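(* Set $$\tilde f(\lambda\,|\,y):=(e^{2\pi i\lambda}-1)^{k/c}f(\lambda\,|\,y),\qquad f(\lambda\,|\,y)=\sum_{j=1}^{2n}I(g_j,W)\,u_j .$$ Then, for any $W\in\mathcal W$ satisfying the degree condition $\mathrm{Re}\,\lambda<\deg P<\mathrm{Re}\,\lambda+2n$, where $P$ is the numerator of $W$, the function $\tilde f$ is a solution of the compatible system with $\alpha=\beta=k/2$ and $x=(e^{2\pi i\lambda},1,\dots,1)$, that is, $$\Delta_m\tilde f=Q_m(x\,|\,y)\tilde f\quad(1\le m\le n),\qquad D_1(x\,|\,y)\tilde f=0 .$$
   Context: Let $n,N$ be positive integers, $c,k$ generic non-zero complex numbers with $\mathrm{Im}\,c>0$ and $\mathrm{Im}\,k>0$, and $\alpha=\beta=k/2$. $V=\bigoplus_{a=1}^N(\mathbb{C}v_a\oplus\mathbb{C}v_{\bar a})$; subscripts on operators and superscripts $u^{(j)}$ give positions in tensor products. $y=(y_1,\dots,y_n)\in\mathbb{C}^n$; $(\Delta_mf)(\lambda\,|\,y)=f(\lambda\,|\,y_1,\dots,y_m-c,\dots,y_n)$. Since $x$ is restricted to $x=(x_1,1,\dots,1)$ with $x_1=e^{2\pi i\lambda}$, only the differential operator $D_1$ enters the system. Operators. $R(z)=\frac{z+k\Pi}{z+k}$ on $V^{\otimes2}$, $\Pi(u\otimes v)=v\otimes u$; $T(x)v_a=x_a^{-1}v_{\bar a}$, $T(x)v_{\bar a}=x_av_a$; $K(z\,|\,x,\beta)=\frac{zT(x)+\beta}{z+\beta}$;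 $\underline1=(1,\dots,1)\in(\mathbb{C}^\times)^N$; $$\begin{aligned}Q_m(x\,|\,y)=\;&R_{m,m-1}(y_m-y_{m-1}-c)\cdots R_{m,1}(y_m-y_1-c)\,K_m(y_m-c/2\,|\,x,\beta)\\&\times R_{1,m}(y_1+y_m)\cdots R_{m-1,m}(y_{m-1}+y_m)\,R_{m,m+1}(y_m+y_{m+1})\cdots R_{m,n}(y_m+y_n)\\&\times K_m(y_m\,|\,\underline1,\alpha)\,R_{m,n}(y_m-y_n)\cdots R_{m,m+1}(y_m-y_{m+1}).\end{aligned}$$ With matrix units $e_{ab}v_p=\delta_{bp}v_a$, $E_{ab}=e_{ab}+e_{\bar a\bar b}$, $\overline E_{ab}=e_{a\bar b}+e_{\bar ab}$, and sums over $1\le i<j\le n$: $\mathbf X_{ab}=\sum(e_{ab}^{(i)}E_{ba}^{(j)}+e_{\bar b\bar a}^{(i)}E_{ab}^{(j)})$, $\mathbf Y_{ab}=\sum(e_{a\bar b}^{(i)}\overline E_{ba}^{(j)}+e_{b\bar a}^{(i)}\overline E_{ab}^{(j)})$, $\mathbf Z_{ab}=\sum(e_{\bar ab}^{(i)}\overline E_{ba}^{(j)}+e_{\bar ba}^{(i)}\overline E_{ab}^{(j)})$. Then $$D_1(x\,|\,y)=c\,x_1\frac{\partial}{\partial x_1}+\sum_{j=1}^ny_j(e_{11}^{(j)}-e_{\bar1\bar1}^{(j)})+2\alpha\sum_{j=1}^ne_{1\bar1}^{(j)}+k\Bigl(\sum_{p=2}^N\mathbf X_{1p}+\sum_{p=1}^N\mathbf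 Y_{1p}\Bigr)+2\frac{\alpha+\beta x_1}{x_1^2-1}\sum_{j=1}^n\overline E_{11}^{(j)}+k\Bigl\{\sum_{p=2}^N\frac{x_p}{x_1-x_p}(\mathbf X_{1p}+\mathbf X_{p1})+\sum_{p=1}^N\frac{1}{x_1x_p-1}(\mathbf Y_{1p}+\mathbf Z_{1p})\Bigr\},$$ where $x_1=e^{2\pi i\lambda}$, so $x_1\partial/\partial x_1=\frac1{2\pi i}\partial/\partial\lambda$, and $x_2=\cdots=x_N=1$. Vectors. $\tilde V=\mathrm{span}\{v_a,v_{\bar a}:2\le a\le N\}$. Fix a non-zero $\tilde v\in\tilde V^{\otimes(n-1)}$ with $\Pi_{i,i+1}\tilde v=\tilde v$ $(1\le i\le n-2)$ and $T_{n-1}(\underline1)\tilde v=\tilde v$. For $1\le j\le n$: $u_j=\Pi_{1,j}(v_1\otimes\tilde v)$, $u_{2n+1-j}=\Pi_{j,n}(\tilde v\otimes v_{\bar1})$, where $\Pi_{i,j}$ exchanges the $i$-th and $j$-th tensor factors and $\Pi_{1,1}=\Pi_{n,n}=\mathrm{id}$. Rational functions. For $1\le j\le n$, $$g_j(t)=\frac1{t-y_j}\prod_{p=1}^{j-1}\frac{t-y_p-k}{t-y_p},\qquad g_{2n+1-j}(t)=\frac1{t+y_j}\prod_{p=j+1}^n\frac{t+y_p-k}{t+y_p}\prod_{p=1}^n\frac{t-y_p-k}{t-y_p}.$$ Cycles. $\mathcal W$ is the $\mathbb{C}$-vector space spanned by the functions of the form $$W(e^{2\pi it/c})=\frac{P(e^{2\pi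 it/c})}{\prod_{p=1}^n(1-e^{2\pi i(t-y_p)/c})(1-e^{2\pi i(t+y_p)/c})},$$ where $P$ is a polynomial whose coefficients are entire and periodic functions in $y_1,\dots,y_n$ with period $c$. Pairing. $$I(g,W)=\int_{C(y)}\varphi(t\,|\,y)\,g(t)\,W(e^{2\pi it/c})\,dt,\qquad \varphi(t\,|\,y)=e^{-\frac{2\pi i\lambda}ct}\prod_{p=1}^n\frac{\Gamma\bigl(\frac{t-y_p-k}{-c}\bigr)\Gamma\bigl(\frac{t+y_p-k}{-c}\bigr)}{\Gamma\bigl(\frac{t-y_p}{-c}\bigr)\Gamma\bigl(\frac{t+y_p}{-c}\bigr)},$$ where $C(y)$ is a deformation of the real line $(-\infty,+\infty)$ such that the poles at $\pm y_p+k+c\mathbb{Z}_{\ge0}$ are above $C(y)$ and the poles at $\pm y_p+c\mathbb{Z}_{\le0}$ are below $C(y)$ $(1\le p\le n)$.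
   Formalization: The degree condition is required of every exponent occurring in P, not only deg P (else the integral diverges, e.g. n=1, P=X+1, λ=1/3); the ends of C(y) may run along a rotated line on which the integrand decays; for D_1 also x_1≠-1 is required. *)

theory Defs
  imports "HOL-Complex_Analysis.Complex_Analysis" "HOL-Computational_Algebra.Polynomial"
begin

section \<open>Tensors\<close>

text \<open>
  \<open>Vec a\<close> and \<open>BarVec a\<close> label the basis vectors $v_a$ and $v_{\bar a}$ of $V$. A tensor is its
  coordinate function on words: the element of $A^{\otimes n}$ whose coefficient at
  $v_{w_1} \otimes \dots \otimes v_{w_n}$ is \<open>f [w1, \<dots>, wn]\<close>, and 0 at all other words. Tensor
  positions, and the indices of \<open>y\<close> and \<open>x\<close>, are 1-based.
\<close>

datatype idx = Vec nat | BarVec nat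

fun bar :: "idx \<Rightarrow> idx" where
  "bar (Vec a) = BarVec a"
| "bar (BarVec a) = Vec a"

definition labels :: "nat set \<Rightarrow> idx set" where
  "labels A = Vec ` A \<union> BarVec ` A"

type_synonym tensor = "idx list \<Rightarrow> complex"

definition tensor_power :: "idx set \<Rightarrow> nat \<Rightarrow> tensor set" where
  "tensor_power A n = {f. \<forall>ws. f ws \<noteq> 0 \<longrightarrow> length ws = n \<and> set ws \<subseteq> A}"

definition basis :: "idx \<Rightarrow> tensor" where
  "basis a = (\<lambda>ws. if ws = [a] then 1 else 0)"

text \<open>\<open>tens p f g\<close> is $f \otimes g$ for \<open>f\<close> of tensor degree \<open>p\<close>.\<close>

definition tens :: "nat \<Rightarrow> tensor \<Rightarrow> tensor \<Rightarrow> tensor" where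
  "tens p f g = (\<lambda>ws. f (take p ws) * g (drop p ws))"

text \<open>
  An endomorphism of $V$ is given by its matrix: \<open>A p q\<close> is the coefficient of $v_p$ in $A v_q$.
  \<open>site N A i\<close> is $A^{(i)}$.
\<close>

type_synonym mat = "idx \<Rightarrow> idx \<Rightarrow> complex"

definition site :: "nat \<Rightarrow> mat \<Rightarrow> nat \<Rightarrow> tensor \<Rightarrow> tensor" where
  "site N A i f = (\<lambda>ws. \<Sum>q\<in>labels {1..N}. A (ws ! (i - 1)) q * f (ws[i - 1 := q]))"

definition Pi_op :: "nat \<Rightarrow> nat \<Rightarrow> tensor \<Rightarrow> tensor" where
  "Pi_op i j f = (\<lambda>ws. f (ws[i - 1 := ws ! (j - 1), j - 1 := ws ! (i - 1)]))"

section \<open>The difference operators\<close>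

definition R_op :: "complex \<Rightarrow> nat \<Rightarrow> nat \<Rightarrow> complex \<Rightarrow> tensor \<Rightarrow> tensor" where
  "R_op k i j z f = (\<lambda>ws. (z * f ws + k * Pi_op i j f ws) / (z + k))"

definition T_mat :: "(nat \<Rightarrow> complex) \<Rightarrow> mat" where
  "T_mat x p q = (if p = bar q then (case q of Vec a \<Rightarrow> inverse (x a) | BarVec a \<Rightarrow> x a) else 0)"

definition K_op :: "nat \<Rightarrow> nat \<Rightarrow> complex \<Rightarrow> (nat \<Rightarrow> complex) \<Rightarrow> complex \<Rightarrow> tensor \<Rightarrow> tensor" where
  "K_op N m z x \<beta> f = (\<lambda>ws. (z * site N (T_mat x) m f ws + \<beta> * f ws) / (z + \<beta>))"

text \<open>\<open>op_prod [A1, \<dots>, Ar]\<close> is the operator product $A_1 \cdots A_r$, so \<open>Ar\<close> acts first.\<close>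

definition op_prod :: "(tensor \<Rightarrow> tensor) list \<Rightarrow> tensor \<Rightarrow> tensor" where
  "op_prod ops = foldr (\<circ>) ops id"

definition Q_op :: "nat \<Rightarrow> nat \<Rightarrow> complex \<Rightarrow> complex \<Rightarrow> complex \<Rightarrow> complex \<Rightarrow> nat
    \<Rightarrow> (nat \<Rightarrow> complex) \<Rightarrow> (nat \<Rightarrow> complex) \<Rightarrow> tensor \<Rightarrow> tensor" where
  "Q_op n N c k \<alpha> \<beta> m x y = op_prod (
      map (\<lambda>j. R_op k m j (y m - y j - c)) (rev [1..<m])
    @ [K_op N m (y m - c / 2) x \<beta>]
    @ map (\<lambda>j. R_op k j m (y j + y m)) [1..<m]
    @ map (\<lambda>j. R_op k m j (y m + y j)) [m + 1..<n + 1]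
    @ [K_op N m (y m) (\<lambda>_. 1) \<alpha>]
    @ map (\<lambda>j. R_op k m j (y m - y j)) (rev [m + 1..<n + 1]))"

definition shift :: "complex \<Rightarrow> nat \<Rightarrow> (nat \<Rightarrow> complex) \<Rightarrow> nat \<Rightarrow> complex" where
  "shift c m y = y(m := y m - c)"

definition Delta :: "complex \<Rightarrow> nat \<Rightarrow> (complex \<Rightarrow> (nat \<Rightarrow> complex) \<Rightarrow> tensor)
    \<Rightarrow> complex \<Rightarrow> (nat \<Rightarrow> complex) \<Rightarrow> tensor" where
  "Delta c m F lam y = F lam (shift c m y)"

section \<open>The differential operator\<close>

definition unit_mat :: "idx \<Rightarrow> idx \<Rightarrow> mat" where
  "unit_mat a b p q = (if p = a \<and> q = b then 1 else 0)"

definition E_mat :: "idx \<Rightarrow> idx \<Rightarrow> mat" where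
  "E_mat a b p q = unit_mat a b p q + unit_mat (bar a) (bar b) p q"

definition Ebar_mat :: "idx \<Rightarrow> idx \<Rightarrow> mat" where
  "Ebar_mat a b p q = unit_mat a (bar b) p q + unit_mat (bar a) b p q"

definition X_op :: "nat \<Rightarrow> nat \<Rightarrow> idx \<Rightarrow> idx \<Rightarrow> tensor \<Rightarrow> tensor" where
  "X_op n N a b f = (\<lambda>ws. \<Sum>i=1..n. \<Sum>j=i+1..n.
      site N (unit_mat a b) i (site N (E_mat b a) j f) ws
    + site N (unit_mat (bar b) (bar a)) i (site N (E_mat a b) j f) ws)"

definition Y_op :: "nat \<Rightarrow> nat \<Rightarrow> idx \<Rightarrow> idx \<Rightarrow> tensor \<Rightarrow> tensor" where
  "Y_op n N a b f = (\<lambda>ws. \<Sum>i=1..n. \<Sum>j=i+1..n.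
      site N (unit_mat a (bar b)) i (site N (Ebar_mat b a) j f) ws
    + site N (unit_mat b (bar a)) i (site N (Ebar_mat a b) j f) ws)"

definition Z_op :: "nat \<Rightarrow> nat \<Rightarrow> idx \<Rightarrow> idx \<Rightarrow> tensor \<Rightarrow> tensor" where
  "Z_op n N a b f = (\<lambda>ws. \<Sum>i=1..n. \<Sum>j=i+1..n.
      site N (unit_mat (bar a) b) i (site N (Ebar_mat b a) j f) ws
    + site N (unit_mat (bar b) a) i (site N (Ebar_mat a b) j f) ws)"

definition xpt :: "complex \<Rightarrow> nat \<Rightarrow> complex" where
  "xpt lam a = (if a = 1 then exp (2 * pi * \<i> * lam) else 1)"

text \<open>
  \<open>D1 n N c k \<alpha> \<beta> F lam y\<close> is $D_1(x\,|\,y)F$ at $x = (e^{2\pi i\lambda},1,\dots,1)$, with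
  $x_1 \partial/\partial x_1 = (2\pi i)^{-1}\partial/\partial\lambda$. It uses \<open>deriv\<close>, so it is
  meaningful only when the coordinates of \<open>F\<close> are differentiable in \<open>lam\<close>.
\<close>

definition D1 :: "nat \<Rightarrow> nat \<Rightarrow> complex \<Rightarrow> complex \<Rightarrow> complex \<Rightarrow> complex
    \<Rightarrow> (complex \<Rightarrow> (nat \<Rightarrow> complex) \<Rightarrow> tensor) \<Rightarrow> complex \<Rightarrow> (nat \<Rightarrow> complex) \<Rightarrow> tensor" where
  "D1 n N c k \<alpha> \<beta> F lam y = (\<lambda>ws. let x = xpt lam; f = F lam y; v = Vec 1; v' = BarVec 1 in
      c * (1 / (2 * pi * \<i>)) * deriv (\<lambda>l. F l y ws) lam
    + (\<Sum>j=1..n. y j * (site N (unit_mat v v) j f ws - site N (unit_mat v' v') j f ws))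
    + 2 * \<alpha> * (\<Sum>j=1..n. site N (unit_mat v v') j f ws)
    + k * ((\<Sum>p=2..N. X_op n N v (Vec p) f ws) + (\<Sum>p=1..N. Y_op n N v (Vec p) f ws))
    + 2 * ((\<alpha> + \<beta> * x 1) / ((x 1)\<^sup>2 - 1)) * (\<Sum>j=1..n. site N (Ebar_mat v v) j f ws)
    + k * ((\<Sum>p=2..N. x p / (x 1 - x p) * (X_op n N v (Vec p) f ws + X_op n N (Vec p) v f ws))
         + (\<Sum>p=1..N. 1 / (x 1 * x p - 1) * (Y_op n N v (Vec p) f ws + Z_op n N v (Vec p) f ws))))"

section \<open>The integrand\<close>

definition u_vec :: "nat \<Rightarrow> tensor \<Rightarrow> nat \<Rightarrow> tensor" where
  "u_vec n vt j = (if j \<le> n then Pi_op 1 j (tens 1 (basis (Vec 1)) vt)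
     else Pi_op (2 * n + 1 - j) n (tens (n - 1) vt (basis (BarVec 1))))"

definition g_fun :: "nat \<Rightarrow> complex \<Rightarrow> (nat \<Rightarrow> complex) \<Rightarrow> nat \<Rightarrow> complex \<Rightarrow> complex" where
  "g_fun n k y j t =
    (if j \<le> n then 1 / (t - y j) * (\<Prod>p=1..<j. (t - y p - k) / (t - y p))
     else let l = 2 * n + 1 - j in
       1 / (t + y l) * (\<Prod>p=l+1..n. (t + y p - k) / (t + y p))
                     * (\<Prod>p=1..n. (t - y p - k) / (t - y p)))"

definition phi :: "nat \<Rightarrow> complex \<Rightarrow> complex \<Rightarrow> complex \<Rightarrow> (nat \<Rightarrow> complex) \<Rightarrow> complex \<Rightarrow> complex" where
  "phi n c k lam y t = exp (- (2 * pi * \<i> * lam / c) * t) *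
    (\<Prod>p=1..n. (Gamma ((t - y p - k) / (- c)) * Gamma ((t + y p - k) / (- c))) /
               (Gamma ((t - y p) / (- c)) * Gamma ((t + y p) / (- c))))"

text \<open>
  Entire functions of $y_1,\dots,y_n$: continuous (the topology on \<open>nat \<Rightarrow> complex\<close> is the product
  topology) and entire in each variable separately.
\<close>

definition entire_in :: "nat \<Rightarrow> ((nat \<Rightarrow> complex) \<Rightarrow> complex) \<Rightarrow> bool" where
  "entire_in n p \<longleftrightarrow> (\<forall>y y'. (\<forall>i\<in>{1..n}. y i = y' i) \<longrightarrow> p y = p y') \<and>
     continuous_on UNIV p \<and> (\<forall>y. \<forall>m\<in>{1..n}. (\<lambda>z. p (y(m := z))) holomorphic_on UNIV)"

definition periodic_in :: "nat \<Rightarrow> complex \<Rightarrow> ((nat \<Rightarrow> complex) \<Rightarrow> complex) \<Rightarrow> bool" where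
  "periodic_in n c p \<longleftrightarrow> (\<forall>y. \<forall>m\<in>{1..n}. p (y(m := y m + c)) = p y)"

text \<open>
  The numerators $P$, as polynomials depending on $y$. They form a vector space and the denominator
  in \<open>cycle\<close> is fixed, so the functions \<open>cycle n c P\<close> are all of $\mathcal W$, not just a spanning set.
\<close>

definition numerators :: "nat \<Rightarrow> complex \<Rightarrow> ((nat \<Rightarrow> complex) \<Rightarrow> complex poly) set" where
  "numerators n c = {P. (\<exists>d. \<forall>y. degree (P y) \<le> d) \<and>
     (\<forall>m. entire_in n (\<lambda>y. coeff (P y) m) \<and> periodic_in n c (\<lambda>y. coeff (P y) m))}"

definition cycle :: "nat \<Rightarrow> complex \<Rightarrow> ((nat \<Rightarrow> complex) \<Rightarrow> complex poly)
    \<Rightarrow> (nat \<Rightarrow> complex) \<Rightarrow> complex \<Rightarrow> complex" where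
  "cycle n c P y t = poly (P y) (exp (2 * pi * \<i> * t / c)) /
    (\<Prod>p=1..n. (1 - exp (2 * pi * \<i> * (t - y p) / c)) * (1 - exp (2 * pi * \<i> * (t + y p) / c)))"

text \<open>
  The exponents occurring in $P$ as a polynomial over the ring of entire functions. The degree
  condition is imposed on every one of them: the top exponent controls the integrand at the right
  end of the contour, the lowest one at the left end.
\<close>

definition exponents :: "((nat \<Rightarrow> complex) \<Rightarrow> complex poly) \<Rightarrow> nat set" where
  "exponents P = {m. \<exists>y. coeff (P y) m \<noteq> 0}"

definition degree_condition :: "nat \<Rightarrow> complex \<Rightarrow> ((nat \<Rightarrow> complex) \<Rightarrow> complex poly) \<Rightarrow> bool" where
  "degree_condition n lam P \<longleftrightarrow> (\<forall>m\<in>exponents P. Re lam < real m \<and> real m < Re lam + 2 * real n)"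

section \<open>Contours\<close>

definition upper_poles :: "nat \<Rightarrow> complex \<Rightarrow> complex \<Rightarrow> (nat \<Rightarrow> complex) \<Rightarrow> complex set" where
  "upper_poles n c k y = {s * y p + k + c * of_nat l | s p l. s \<in> {1, -1} \<and> p \<in> {1..n}}"

definition lower_poles :: "nat \<Rightarrow> complex \<Rightarrow> (nat \<Rightarrow> complex) \<Rightarrow> complex set" where
  "lower_poles n c y = {s * y p - c * of_nat l | s p l. s \<in> {1, -1} \<and> p \<in> {1..n}}"

text \<open>
  The points \<open>y\<close> for which some contour separates the two families. If \<open>y\<close> and \<open>shift c m y\<close> are
  both admissible, no denominator of \<open>Q_op n N c k (k/2) (k/2) m x y\<close> vanishes.
\<close>

definition admissible :: "nat \<Rightarrow> complex \<Rightarrow> complex \<Rightarrow> (nat \<Rightarrow> complex) \<Rightarrow> bool" where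
  "admissible n c k y \<longleftrightarrow> upper_poles n c k y \<inter> lower_poles n c y = {}"

text \<open>
  A contour agrees outside a bounded parameter interval with the line \<open>s \<mapsto> s * w\<close>; \<open>w = 1\<close> is the
  real line. Above it lies the component of the complement containing the far part of the ray
  \<open>\<i> * w * s\<close>, below it the component containing the far part of the opposite ray.
\<close>

definition above :: "complex \<Rightarrow> (real \<Rightarrow> complex) \<Rightarrow> complex \<Rightarrow> bool" where
  "above w \<gamma> p \<longleftrightarrow> (\<forall>\<^sub>F s in at_top. connected_component (- range \<gamma>) p (\<i> * w * of_real s))"

definition below :: "complex \<Rightarrow> (real \<Rightarrow> complex) \<Rightarrow> complex \<Rightarrow> bool" where
  "below w \<gamma> p \<longleftrightarrow> (\<forall>\<^sub>F s in at_top. connected_component (- range \<gamma>) p (- \<i> * w * of_real s))"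

definition separating_contour :: "nat \<Rightarrow> complex \<Rightarrow> complex \<Rightarrow> complex \<Rightarrow> (nat \<Rightarrow> complex)
    \<Rightarrow> (real \<Rightarrow> complex) \<Rightarrow> bool" where
  "separating_contour n c k w y \<gamma> \<longleftrightarrow>
     (\<forall>a b. \<gamma> piecewise_C1_differentiable_on {a..b}) \<and>
     (\<exists>S. \<forall>s. S \<le> \<bar>s\<bar> \<longrightarrow> \<gamma> s = of_real s * w) \<and>
     (\<forall>p\<in>upper_poles n c k y. above w \<gamma> p) \<and> (\<forall>p\<in>lower_poles n c y. below w \<gamma> p)"

text \<open>
  Directions \<open>w\<close> of the two ends of the contour. The first condition says that the line \<open>s * w\<close>
  can be rotated to the real line without passing through the directions \<open>c\<close>, \<open>- c\<close> in which the
  poles accumulate. The others say that $e^{2\pi i(m-\lambda)t/c}$ decays at the left end and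
  $e^{2\pi i(m-\lambda-2n)t/c}$ at the right end. The lemmas below show that the real line is
  allowed if \<open>lam\<close> is real or \<open>c\<close> is purely imaginary, and that the line orthogonal to \<open>c\<close> is
  always allowed. For other \<open>lam\<close> the integral along the real line itself may diverge.
\<close>

definition decay_direction :: "nat \<Rightarrow> complex \<Rightarrow> complex \<Rightarrow> ((nat \<Rightarrow> complex) \<Rightarrow> complex poly)
    \<Rightarrow> complex \<Rightarrow> bool" where
  "decay_direction n c lam P w \<longleftrightarrow> Im (w / c) < 0 \<and>
     (\<forall>m\<in>exponents P. Im ((of_nat m - lam) * (w / c)) < 0 \<and>
                       Im ((of_nat m - lam - 2 * of_nat n) * (w / c)) > 0)"

lemma decay_direction_orthogonal:
  assumes "Im c > 0" "degree_condition n lam P"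
  shows "decay_direction n c lam P (- \<i> * c)"
proof -
  have "c \<noteq> 0" using assms(1) by auto
  hence "- \<i> * c / c = - \<i>" by simp
  thus ?thesis using assms(2)
    unfolding decay_direction_def degree_condition_def by (fastforce simp: algebra_simps)
qed

lemma decay_direction_real_line:
  assumes "Im c > 0" "degree_condition n lam P" "Im lam = 0 \<or> Re c = 0"
  shows "decay_direction n c lam P 1"
proof -
  have pos: "(Re c)\<^sup>2 + (Im c)\<^sup>2 > 0"
    using assms(1) by (simp add: sum_power2_gt_zero_iff)
  have neg: "Im (1 / c) < 0"
    using assms(1) pos by (simp add: Im_divide)
  have mult: "Im (z * (1 / c)) = Re z * Im (1 / c)" if "Im z = 0 \<or> Re c = 0" for z
    using that by (auto simp: Im_divide)
  show ?thesis
    unfolding decay_direction_def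
  proof (intro conjI ballI)
    fix m assume m: "m \<in> exponents P"
    hence b: "Re lam < real m" "real m < Re lam + 2 * real n"
      using assms(2) by (auto simp: degree_condition_def)
    show "Im ((of_nat m - lam) * (1 / c)) < 0"
      using assms(3) b neg by (subst mult) (auto simp: mult_less_0_iff)
    show "Im ((of_nat m - lam - 2 * of_nat n) * (1 / c)) > 0"
      using assms(3) b neg by (subst mult) (auto simp: zero_less_mult_iff)
  qed (use neg in simp)
qed

definition line_integrand :: "(real \<Rightarrow> complex) \<Rightarrow> (complex \<Rightarrow> complex) \<Rightarrow> real \<Rightarrow> complex" where
  "line_integrand \<gamma> h s = h (\<gamma> s) * vector_derivative \<gamma> (at s)"

definition pairing_integrand :: "nat \<Rightarrow> complex \<Rightarrow> complex \<Rightarrow> ((nat \<Rightarrow> complex) \<Rightarrow> complex poly)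
    \<Rightarrow> nat \<Rightarrow> complex \<Rightarrow> (nat \<Rightarrow> complex) \<Rightarrow> complex \<Rightarrow> complex" where
  "pairing_integrand n c k P j lam y t = phi n c k lam y t * g_fun n k y j t * cycle n c P y t"

text \<open>\<open>pairing n c k C P j lam y\<close> is $I(g_j, W)$, computed along the contour \<open>C y\<close>.\<close>

definition pairing :: "nat \<Rightarrow> complex \<Rightarrow> complex \<Rightarrow> ((nat \<Rightarrow> complex) \<Rightarrow> real \<Rightarrow> complex)
    \<Rightarrow> ((nat \<Rightarrow> complex) \<Rightarrow> complex poly) \<Rightarrow> nat \<Rightarrow> complex \<Rightarrow> (nat \<Rightarrow> complex) \<Rightarrow> complex" where
  "pairing n c k C P j lam y = integral UNIV (line_integrand (C y) (pairing_integrand n c k P j lam y))"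

section \<open>The solution\<close>

definition f_sol :: "nat \<Rightarrow> complex \<Rightarrow> complex \<Rightarrow> ((nat \<Rightarrow> complex) \<Rightarrow> real \<Rightarrow> complex)
    \<Rightarrow> ((nat \<Rightarrow> complex) \<Rightarrow> complex poly) \<Rightarrow> tensor \<Rightarrow> complex \<Rightarrow> (nat \<Rightarrow> complex) \<Rightarrow> tensor" where
  "f_sol n c k C P vt lam y = (\<lambda>ws. \<Sum>j=1..2*n. pairing n c k C P j lam y * u_vec n vt j ws)"

text \<open>
  A branch \<open>L\<close> on \<open>U\<close> of $\log(e^{2\pi i\lambda}-1)$, giving a branch of
  $(e^{2\pi i\lambda}-1)^{k/c}$. It exists only if $e^{2\pi i\lambda} \ne 1$ on \<open>U\<close>.
\<close>

definition log_branch :: "complex set \<Rightarrow> (complex \<Rightarrow> complex) \<Rightarrow> bool" where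
  "log_branch U L \<longleftrightarrow> open U \<and> L holomorphic_on U \<and>
     (\<forall>l\<in>U. exp (L l) = exp (2 * pi * \<i> * l) - 1)"

definition f_tilde :: "nat \<Rightarrow> complex \<Rightarrow> complex \<Rightarrow> ((nat \<Rightarrow> complex) \<Rightarrow> real \<Rightarrow> complex)
    \<Rightarrow> ((nat \<Rightarrow> complex) \<Rightarrow> complex poly) \<Rightarrow> tensor \<Rightarrow> (complex \<Rightarrow> complex)
    \<Rightarrow> complex \<Rightarrow> (nat \<Rightarrow> complex) \<Rightarrow> tensor" where
  "f_tilde n c k C P vt L lam y = (\<lambda>ws. exp (k / c * L lam) * f_sol n c k C P vt lam y ws)"

end

theory Submission
  imports Defs
begin

text \<open>
  Since $\tilde v$ is symmetric and invariant under $v_a \leftrightarrow v_{\bar a}$, all operators act by matrices on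
  the coefficients of $u_1,\dots,u_{2n}$, hence on the functions $g_1,\dots,g_{2n}$. There an $R$-matrix exchanges two
  neighbouring positions in the order that underlies the definition of the $g_j$, and $K_m(y_m\,|\,\underline1,k/2)$
  reflects $y_m$ to $-y_m$ when $m$ stands last. So the factors of $Q_m$ move the position $m$ to the end, reflect it,
  move it to the front, shift it, and move it back. The shift by $K_m(y_m - c/2\,|\,x,k/2)$ is the only step that uses the
  integrals: by $\Gamma(z+1) = z\Gamma(z)$ and the quasi-periodicity of $\varphi W$, all terms become integrals of
  rational multiples of one function along contours that separate its poles in the same way, and there the claim is
  an identity of rational functions.

  For $D_1$, the $\lambda$-derivative multiplies the integrand by $-\frac{2\pi i}{c}t$. The products in the $g_j$ telescope,
  $(t-y_i)g_i = 1 - k\sum_{j<i} g_j$, and similarly for the other half, so that $\int\varphi W t g_i\,dt$ is a combination of the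
  $I(g_j,W)$ and $\int\varphi W\,dt$. Translating the contour by $c$ gives
  $(1 - x_1^{-1})\int\varphi W\,dt = k\sum_j I(g_j,W)$.
\<close>

section \<open>Contours with straight ends\<close>

text \<open>The contours \<open>C y\<close> are arbitrary curves, unrelated for different
  \<open>y\<close>, and the pole families are infinite, so no contour is deformed into another.
  Instead each contour is compared with one straight line parallel to \<open>w\<close> that misses
  all poles. The winding number of the resulting loop about a pole depends only on the side on which
  the pole lies, and a strip parallel to \<open>w\<close> contains only finitely many poles. Hence
  integrals of functions with sum zero add up to zero, provided each pole is on one and the same
  side of all contours whose integrand has it.

  Convergence rests on the exponential type of a quotient of Gamma functions. It is read off from
  the logarithmic derivative: two Digamma values whose arguments have a fixed difference approach
  each other far from the real axis, and a bound on the logarithmic derivative integrates to a bound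
  along rays.

  The value k/2 of \<alpha> and \<beta> gives K(z) the weights 2z and k of R(2z), so that a
  reflection becomes an exchange of the points y_m and - y_m. The same value collapses the
  coefficients of D_1 to multiples of k / (x_1 - 1).\<close>

text \<open>The offset \<open>b\<close> admits the translates by \<open>c\<close> of the given
  contours, which themselves have \<open>b = 0\<close>.\<close>

definition line_ended :: "complex \<Rightarrow> complex \<Rightarrow> (real \<Rightarrow> complex) \<Rightarrow> bool" where
  "line_ended w b \<gamma> \<longleftrightarrow> (\<forall>a b. \<gamma> piecewise_C1_differentiable_on {a..b}) \<and>
     (\<exists>S. \<forall>s. S \<le> \<bar>s\<bar> \<longrightarrow> \<gamma> s = of_real s * w + b)"

definition truncate :: "(real \<Rightarrow> complex) \<Rightarrow> real \<Rightarrow> real \<Rightarrow> complex" where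
  "truncate \<gamma> S = (\<lambda>x. \<gamma> (2 * S * x - S))"

lemma truncate_ends [simp]:
  "pathstart (truncate \<gamma> S) = \<gamma> (- S)" "pathfinish (truncate \<gamma> S) = \<gamma> S"
  by (simp_all add: truncate_def pathstart_def pathfinish_def)

lemma affine_image_unit:
  assumes "0 < S"
  shows "(\<lambda>x. 2 * S * x - S) ` {0..1::real} = {-S..S}"
proof -
  have "(\<lambda>x. (2*S) * x + (-S)) ` {0..1::real} = {-S..S}"
    using assms by (subst image_affinity_atLeastAtMost) auto
  thus ?thesis by simp
qed

lemma path_image_truncate: "0 < S \<Longrightarrow> path_image (truncate \<gamma> S) = \<gamma> ` {-S..S}"
  using affine_image_unit[of S] unfolding path_image_def truncate_def
  by (metis (no_types, lifting) image_comp image_cong o_apply)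

lemma valid_path_truncate:
  assumes "line_ended w b \<gamma>" "0 < S"
  shows "valid_path (truncate \<gamma> S)"
proof -
  have eq: "truncate \<gamma> S = \<gamma> \<circ> (\<lambda>x. (2*S) *\<^sub>R x + (-S))"
    by (auto simp: truncate_def)
  have im: "(\<lambda>x. (2*S) *\<^sub>R x + (-S)) ` {0..1} = {-S..S}"
    using affine_image_unit[OF assms(2)] by simp
  show ?thesis unfolding valid_path_def eq
    by (rule piecewise_C1_differentiable_affine) (use assms im in \<open>auto simp: line_ended_def\<close>)
qed

lemma contour_continuous:
  assumes "line_ended w b \<gamma>"
  shows "continuous_on T \<gamma>"
proof -
  have "continuous_on {a..b} \<gamma>" for a b
    using assms unfolding line_ended_def piecewise_C1_differentiable_on_def by blast
  hence "isCont \<gamma> x" for x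
    by (metis continuous_on_interior interior_atLeastAtMost_real greaterThanLessThan_iff
        less_add_one diff_less zero_less_one lt_ex gt_ex)
  thus ?thesis by (simp add: continuous_at_imp_continuous_on)
qed

text \<open>Substitution s = 2 * S * x - S. It connects contour integrals over [0,1], for which the
  residue theorem is stated, with integrals over the parameter line.\<close>

lemma has_integral_truncate:
  assumes \<gamma>: "line_ended w b \<gamma>" and S: "0 < S" and f: "f contour_integrable_on truncate \<gamma> S"
  shows "(line_integrand \<gamma> f has_integral contour_integral (truncate \<gamma> S) f) {-S..S}"
proof -
  have "(f has_contour_integral contour_integral (truncate \<gamma> S) f) (truncate \<gamma> S)"
    using f by (rule has_contour_integral_integral)
  hence 1: "((\<lambda>x. f (truncate \<gamma> S x) * vector_derivative (truncate \<gamma> S) (at x))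
      has_integral contour_integral (truncate \<gamma> S) f) {0..1}"
    by (simp add: has_contour_integral)
  obtain T where T: "finite T" "\<And>x. x \<in> {-S..S} - T \<Longrightarrow> \<gamma> differentiable (at x)"
    using \<gamma> unfolding line_ended_def piecewise_C1_differentiable_on_def C1_differentiable_on_eq
    by blast
  have 2: "((\<lambda>x. (2*S) *\<^sub>R line_integrand \<gamma> f (2*S*x - S)) has_integral contour_integral (truncate \<gamma> S) f) {0..1}"
  proof (rule has_integral_spike_finite[OF _ _ 1])
    \<comment> \<open>The chain rule fails only at the break points of \<gamma>, here pulled back to
      [0,1].\<close>
    show "finite ((\<lambda>s. (s + S) / (2*S)) ` T)" using T by simp
    fix x assume x: "x \<in> {0..1} - (\<lambda>s. (s + S) / (2*S)) ` T"
    have "2*S*x - S \<in> {-S..S}" using x affine_image_unit[OF S] by blast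
    moreover have "2*S*x - S \<notin> T"
    proof
      assume "2*S*x - S \<in> T"
      hence "((2*S*x - S) + S) / (2*S) \<in> (\<lambda>s. (s + S) / (2*S)) ` T" by blast
      thus False using x S by simp
    qed
    ultimately have "\<gamma> differentiable (at (2*S*x - S))" using T by blast
    hence d: "(\<gamma> has_vector_derivative vector_derivative \<gamma> (at (2*S*x - S))) (at (2*S*x - S))"
      by (simp add: vector_derivative_works)
    have "((\<lambda>x. 2*S*x - S) has_vector_derivative 2*S) (at x)"
      by (auto intro!: derivative_eq_intros)
    from vector_diff_chain_at[OF this d]
    have "(truncate \<gamma> S has_vector_derivative (2*S) *\<^sub>R vector_derivative \<gamma> (at (2*S*x - S))) (at x)"
      by (simp add: truncate_def o_def)
    hence "vector_derivative (truncate \<gamma> S) (at x) = (2*S) *\<^sub>R vector_derivative \<gamma> (at (2*S*x - S))"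
      by (rule vector_derivative_at)
    thus "(2*S) *\<^sub>R line_integrand \<gamma> f (2*S*x - S) = f (truncate \<gamma> S x) * vector_derivative (truncate \<gamma> S) (at x)"
      by (simp add: line_integrand_def truncate_def)
  qed
  have "((\<lambda>x. (2*S) *\<^sub>R line_integrand \<gamma> f (2*S*((1/(2*S)) *\<^sub>R x + 1/2) - S)) has_integral
      (1 / \<bar>1/(2*S)\<bar> ^ DIM(real)) *\<^sub>R contour_integral (truncate \<gamma> S) f)
      ((\<lambda>x. (1 / (1/(2*S))) *\<^sub>R x + - ((1 / (1/(2*S))) *\<^sub>R (1/2))) ` cbox 0 1)"
    by (rule has_integral_affinity) (use 2 S in auto)
  also have "(\<lambda>x. (1 / (1/(2*S))) *\<^sub>R x + - ((1 / (1/(2*S))) *\<^sub>R (1/2))) ` cbox 0 1 = {-S..S}"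
    using affine_image_unit[OF S] S by simp
  also have "(\<lambda>x. (2*S) *\<^sub>R line_integrand \<gamma> f (2*S*((1/(2*S)) *\<^sub>R x + 1/2) - S)) =
      (\<lambda>x. (2*S) *\<^sub>R line_integrand \<gamma> f x)"
    using S by (simp add: field_simps)
  finally have "((\<lambda>x. (2*S) *\<^sub>R line_integrand \<gamma> f x) has_integral
      (2*S) *\<^sub>R contour_integral (truncate \<gamma> S) f) {-S..S}"
    using S by simp
  from has_integral_cmul[OF this, of "1/(2*S)"] show ?thesis
    using S by simp
qed

text \<open>A compact middle part and two closed rays. The complement is then open, so points of one
  component can be joined by a path.\<close>

lemma closed_range_contour:
  assumes "line_ended w b \<gamma>" "w \<noteq> 0"
  shows "closed (range \<gamma>)"
proof -
  obtain S where S: "\<And>s. S \<le> \<bar>s\<bar> \<Longrightarrow> \<gamma> s = of_real s * w + b"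
    using assms(1) by (auto simp: line_ended_def)
  have lin: "linear (\<lambda>s::real. of_real s * w)" "inj (\<lambda>s::real. of_real s * w)"
    using assms(2) by (auto intro!: linearI injI simp: algebra_simps scaleR_conv_of_real)
  have "closed ((\<lambda>s::real. of_real s * w) ` {s. S \<le> \<bar>s\<bar>})"
    by (rule closed_injective_linear_image[OF _ lin]) (intro closed_Collect_le continuous_intros)
  hence "closed ((+) b ` (\<lambda>s::real. of_real s * w) ` {s. S \<le> \<bar>s\<bar>})"
    by (rule closed_translation)
  moreover have "compact (\<gamma> ` {-S..S})"
    by (intro compact_continuous_image contour_continuous[OF assms(1)]) auto
  ultimately have "closed (\<gamma> ` {-S..S} \<union> (+) b ` (\<lambda>s::real. of_real s * w) ` {s. S \<le> \<bar>s\<bar>})"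
    by (simp add: closed_Un compact_imp_closed)
  also have "\<gamma> ` {-S..S} \<union> (+) b ` (\<lambda>s::real. of_real s * w) ` {s. S \<le> \<bar>s\<bar>} = range \<gamma>"
  proof (intro equalityI subsetI)
    fix z assume "z \<in> \<gamma> ` {-S..S} \<union> (+) b ` (\<lambda>s::real. of_real s * w) ` {s. S \<le> \<bar>s\<bar>}"
    thus "z \<in> range \<gamma>"
    proof
      assume "z \<in> (+) b ` (\<lambda>s::real. of_real s * w) ` {s. S \<le> \<bar>s\<bar>}"
      then obtain s where "S \<le> \<bar>s\<bar>" "z = b + of_real s * w" by auto
      hence "z = \<gamma> s" using S[of s] by simp
      thus ?thesis by simp
    qed auto
  next
    fix z assume "z \<in> range \<gamma>"
    then obtain s where s: "z = \<gamma> s" by auto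
    show "z \<in> \<gamma> ` {-S..S} \<union> (+) b ` (\<lambda>s::real. of_real s * w) ` {s. S \<le> \<bar>s\<bar>}"
    proof (cases "s \<in> {-S..S}")
      case False
      hence "S \<le> \<bar>s\<bar>" by auto
      moreover have "z = b + of_real s * w" using S[OF \<open>S \<le> \<bar>s\<bar>\<close>] s by simp
      ultimately show ?thesis by blast
    qed (simp add: s)
  qed
  finally show ?thesis .
qed

lemma integrable_exp_minus_abs:
  assumes "0 < (\<delta>::real)"
  shows "(\<lambda>s. exp (- \<delta> * \<bar>s\<bar>)) integrable_on UNIV"
proof -
  have r: "(\<lambda>s. exp (- \<delta> * \<bar>s\<bar>)) integrable_on {0..}"
    using integrable_on_exp_minus_to_infinity[OF assms, of 0]
    by (rule integrable_eq) auto
  have "(\<lambda>s. exp (- \<delta> * \<bar>s\<bar>)) integrable_on {..0}"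
  proof -
    have "(\<lambda>s. exp (- \<delta> * \<bar>s\<bar>)) absolutely_integrable_on {0..}"
      using r by (intro nonnegative_absolutely_integrable_1) auto
    hence "(\<lambda>s. exp (- \<delta> * \<bar>- s\<bar>)) absolutely_integrable_on {..0}"
      by (intro conjunct1[OF iffD2[OF has_absolute_integral_reflect_real conjI[OF _ refl]]]) auto
    thus ?thesis using set_lebesgue_integral_eq_integral(1) by simp
  qed
  with r have "(\<lambda>s. exp (- \<delta> * \<bar>s\<bar>)) integrable_on ({0..} \<union> {..0})"
  proof (intro integrable_Un)
    show "negligible ({0..} \<inter> {..0::real})"
      by (rule negligible_subset[of "{0}"]) auto
  qed
  also have "{0..} \<union> {..0} = (UNIV :: real set)" by auto
  finally show ?thesis .
qed

lemma line_ended_derivative: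
  fixes w b :: complex
  assumes "\<And>s. S \<le> \<bar>s\<bar> \<Longrightarrow> \<gamma> s = of_real s * w + b" "S < \<bar>s\<bar>"
  shows "vector_derivative \<gamma> (at s) = w"
proof (rule vector_derivative_at, rule has_vector_derivative_transform_within_open)
  show "((\<lambda>s. of_real s * w + b) has_vector_derivative w) (at s)"
  proof -
    have "((\<lambda>s. of_real s) has_vector_derivative (1::complex)) (at s)"
      using has_vector_derivative_of_real[OF DERIV_ident] by simp
    hence "((\<lambda>s::real. of_real s * w) has_vector_derivative 1 * w) (at s)"
      by (rule has_vector_derivative_mult_left)
    thus ?thesis by (simp add: has_vector_derivative_add_const)
  qed
  show "open {s. S < \<bar>s\<bar>}" by (intro open_Collect_less continuous_intros)
qed (use assms in auto)

definition decays_along :: "complex \<Rightarrow> complex \<Rightarrow> (complex \<Rightarrow> complex) \<Rightarrow> bool" where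
  "decays_along w b f \<longleftrightarrow> (\<exists>C \<delta> S. \<delta> > 0 \<and>
     (\<forall>s::real. S \<le> \<bar>s\<bar> \<longrightarrow> norm (f (of_real s * w + b)) \<le> C * exp (- \<delta> * \<bar>s\<bar>)))"

lemma contour_integrable_truncate:
  assumes "line_ended w b \<gamma>" "f holomorphic_on - A" "closed A" "range \<gamma> \<inter> A = {}" "0 < S"
  shows "f contour_integrable_on truncate \<gamma> S"
  using assms valid_path_truncate[OF assms(1,5)]
  by (intro contour_integrable_holomorphic_simple[of f "- A"]) (auto simp: path_image_truncate)

lemma
  assumes \<gamma>: "line_ended w b \<gamma>" and f: "f holomorphic_on - A" "closed A" "range \<gamma> \<inter> A = {}"
    and dec: "decays_along w b f"
  shows line_integrable: "line_integrand \<gamma> f integrable_on UNIV"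
    and line_integral_tendsto:
      "((\<lambda>S. contour_integral (truncate \<gamma> S) f) \<longlongrightarrow> integral UNIV (line_integrand \<gamma> f)) at_top"
proof -
  obtain C \<delta> S1 where C: "\<delta> > 0"
    "\<And>s. S1 \<le> \<bar>s\<bar> \<Longrightarrow> norm (f (of_real s * w + b)) \<le> C * exp (- \<delta> * \<bar>s\<bar>)"
    using dec unfolding decays_along_def by metis
  obtain S2 where S2: "\<And>s. S2 \<le> \<bar>s\<bar> \<Longrightarrow> \<gamma> s = of_real s * w + b"
    using \<gamma> by (auto simp: line_ended_def)
  define S0 where "S0 = Max {S1, S2, 1}"
  have S0: "S0 > 0" "S0 \<ge> S1" "S0 \<ge> S2" by (auto simp: S0_def)
  let ?l = "line_integrand \<gamma> f"
  have I: "(?l has_integral contour_integral (truncate \<gamma> S) f) {-S..S}" if "S > 0" for S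
    using has_integral_truncate[OF \<gamma> that contour_integrable_truncate[OF \<gamma> f that]] .
  have int: "?l integrable_on {a..b}" for a b
  proof -
    define S where "S = Max {\<bar>a\<bar>, \<bar>b\<bar>, 1}"
    have "\<bar>a\<bar> \<le> S" "\<bar>b\<bar> \<le> S" "1 \<le> S" by (simp_all add: S_def)
    hence S: "S > 0" "{a..b} \<subseteq> {-S..S}" by auto
    from I[OF S(1)] have "?l integrable_on {-S..S}" by blast
    thus ?thesis using S(2) by (rule integrable_on_subinterval)
  qed
  \<comment> \<open>The derivative of \<gamma> may be unbounded near break points, so the middle
    part is split off as it is; only the two tails are dominated by an exponential.\<close>
  define h where "h s = (if s \<in> {-S0..S0} then ?l s else 0)" for s
  have h: "h integrable_on UNIV"
    unfolding h_def integrable_restrict_UNIV by (rule int)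
  define g where "g s = ?l s - h s" for s
  have bound: "norm (g s) \<le> C * norm w * exp (- \<delta> * \<bar>s\<bar>)" for s
  proof (cases "s \<in> {-S0..S0}")
    case True
    have "0 \<le> C * exp (- \<delta> * \<bar>S0\<bar>)"
      using C(2)[of S0] S0 by (meson abs_ge_self norm_ge_zero order_trans)
    hence "0 \<le> C" by (simp add: zero_le_mult_iff)
    thus ?thesis using True by (simp add: g_def h_def)
  next
    case False
    hence s: "S0 < \<bar>s\<bar>" by auto
    have "vector_derivative \<gamma> (at s) = w"
      using line_ended_derivative[of S2 \<gamma> w b s] S2 s S0 by auto
    have "norm (f (of_real s * w + b)) \<le> C * exp (- \<delta> * \<bar>s\<bar>)"
      using s S0 by (intro C) auto
    have "vector_derivative \<gamma> (at s) = w" by fact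
    moreover have "g s = f (of_real s * w + b) * vector_derivative \<gamma> (at s)"
      using False S2[of s] s S0 by (auto simp: g_def h_def line_integrand_def)
    ultimately have "norm (g s) = norm (f (of_real s * w + b)) * norm w" by (simp add: norm_mult)
    also have "\<dots> \<le> C * exp (- \<delta> * \<bar>s\<bar>) * norm w"
      by (intro mult_right_mono \<open>norm (f (of_real s * w + b)) \<le> C * exp (- \<delta> * \<bar>s\<bar>)\<close>) auto
    finally show ?thesis by (simp only: mult_ac)
  qed
  have "g integrable_on UNIV"
  proof (rule integrable_on_all_intervals_integrable_bound)
    have "g integrable_on cbox a b" for a b
    proof -
      have "h integrable_on {a..b}" by (rule integrable_on_subinterval[OF h]) simp
      hence "(\<lambda>s. ?l s - h s) integrable_on {a..b}" by (intro integrable_diff int)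
      moreover have "(\<lambda>s. ?l s - h s) = g" by (simp add: fun_eq_iff g_def)
      ultimately show ?thesis by simp
    qed
    thus "(\<lambda>x. if x \<in> UNIV then g x else 0) integrable_on cbox a b" for a b by simp
    show "(\<lambda>s. C * norm w * exp (- \<delta> * \<bar>s\<bar>)) integrable_on UNIV"
      using integrable_exp_minus_abs[OF C(1)] by (rule integrable_on_mult_right)
    show "norm (g s) \<le> C * norm w * exp (- \<delta> * \<bar>s\<bar>)" for s by (rule bound)
  qed
  hence "(\<lambda>s. g s + h s) integrable_on UNIV" using h by (rule integrable_add)
  thus 1: "?l integrable_on UNIV" by (simp add: g_def)
  show "((\<lambda>S. contour_integral (truncate \<gamma> S) f) \<longlongrightarrow> integral UNIV ?l) at_top"
  proof (rule tendstoI)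
    fix e :: real assume e: "e > 0"
    have nb: "\<not> (\<exists>a b. UNIV = cbox a (b::real))"
      by (metis bounded_cbox not_bounded_UNIV)
    \<comment> \<open>The integral over an unbounded set is a limit over all intervals containing a
      large ball; here the symmetric ones are used.\<close>
    obtain B where B: "B > 0" "\<And>a b. ball 0 B \<subseteq> cbox a b \<Longrightarrow>
        (\<exists>z. ((\<lambda>x. if x \<in> UNIV then ?l x else 0) has_integral z) (cbox a b) \<and> norm(z - integral UNIV ?l) < e)"
      using has_integral_altD[OF integrable_integral[OF 1] nb e] by metis
    show "\<forall>\<^sub>F S in at_top. dist (contour_integral (truncate \<gamma> S) f) (integral UNIV ?l) < e"
      using eventually_ge_at_top[of B]
    proof eventually_elim
      case (elim S)
      hence "ball 0 B \<subseteq> cbox (-S) S" by (auto simp: dist_norm)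
      from B(2)[OF this] obtain z where z: "(?l has_integral z) {-S..S}" "norm(z - integral UNIV ?l) < e"
        by (auto simp: cbox_interval)
      have "z = contour_integral (truncate \<gamma> S) f"
        using has_integral_unique[OF z(1) I[of S]] elim B(1) by simp
      thus ?case using z(2) by (simp add: dist_norm)
    qed
  qed
qed

section \<open>Sides of a contour and winding numbers\<close>

text \<open>Treats \<open>above\<close> and \<open>below\<close> alike, so that each winding number
  argument is given once, for the direction \<open>v\<close>.\<close>

definition on_side :: "complex \<Rightarrow> (real \<Rightarrow> complex) \<Rightarrow> complex \<Rightarrow> bool" where
  "on_side v \<gamma> p \<longleftrightarrow> (\<forall>\<^sub>F s in at_top. connected_component (- range \<gamma>) p (v * of_real s))"

lemma above_iff_on_side: "above w \<gamma> p \<longleftrightarrow> on_side (\<i> * w) \<gamma> p"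
  and below_iff_on_side: "below w \<gamma> p \<longleftrightarrow> on_side (- \<i> * w) \<gamma> p"
  by (simp_all add: above_def below_def on_side_def)

lemma on_side_notin_range: "on_side v \<gamma> p \<Longrightarrow> p \<notin> range \<gamma>"
proof -
  assume "on_side v \<gamma> p"
  then obtain s where "connected_component (- range \<gamma>) p (v * of_real s)"
    unfolding on_side_def using eventually_happens' trivial_limit_at_top_linorder by blast
  thus ?thesis using connected_component_in by fastforce
qed

lemma convex_Re_halfspace: "convex {z. Re (z / v) \<le> R}"
proof (rule convexI)
  fix x y u t assume A: "x \<in> {z. Re (z / v) \<le> R}" "y \<in> {z. Re (z / v) \<le> R}" "0 \<le> u" "0 \<le> t" "u + t = (1::real)"
  have "Re ((u *\<^sub>R x + t *\<^sub>R y) / v) = u * Re (x / v) + t * Re (y / v)"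
    by (simp add: add_divide_distrib scaleR_conv_of_real flip: times_divide_eq_right)
  also have "\<dots> \<le> R" using A by (intro convex_bound_le) auto
  finally show "u *\<^sub>R x + t *\<^sub>R y \<in> {z. Re (z / v) \<le> R}" by simp
qed

text \<open>In the orthogonal directions \<open>w\<close> and \<open>v\<close> the point has
  coordinates proportional to 1 - u and u, one of which is at least 1/2; the offset \<open>d\<close>
  costs at most its norm.\<close>

lemma norm_segment_orthogonal:
  fixes w d v :: complex and S :: real
  assumes v: "v = \<i> * w \<or> v = - \<i> * w" and S: "S \<ge> 0" and \<eta>: "\<eta> = 1 \<or> \<eta> = -1"
    and z: "z \<in> closed_segment (\<eta> * of_real S * w + d) (- of_real S * v)"
  shows "norm z \<ge> S * norm w / 2 - norm d"
proof -
  obtain u where u: "0 \<le> u" "u \<le> 1" "z = (1 - u) *\<^sub>R (\<eta> * of_real S * w + d) + u *\<^sub>R (- of_real S * v)"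
    using z by (auto simp: in_segment)
  obtain \<sigma> :: real where \<sigma>: "\<sigma> = 1 \<or> \<sigma> = -1" "v = \<sigma> * \<i> * w" using v by force
  obtain \<tau> :: real where \<tau>: "\<tau> = 1 \<or> \<tau> = -1" "\<eta> = of_real \<tau>" using \<eta> by force
  have z_eq: "z = of_real S * w * Complex ((1 - u) * \<tau>) (- u * \<sigma>) + (1 - u) *\<^sub>R d"
    unfolding u(3) \<sigma>(2) \<tau>(2) Complex_eq by (simp add: scaleR_conv_of_real algebra_simps)
  have "1/2 \<le> norm (Complex ((1 - u) * \<tau>) (- u * \<sigma>))"
    using abs_Re_le_cmod[of "Complex ((1 - u) * \<tau>) (- u * \<sigma>)"]
      abs_Im_le_cmod[of "Complex ((1 - u) * \<tau>) (- u * \<sigma>)"] \<sigma>(1) \<tau>(1) u(1,2) by auto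
  hence "S * norm w * (1/2) \<le> norm (of_real S * w * Complex ((1 - u) * \<tau>) (- u * \<sigma>))"
    using S by (simp only: norm_mult norm_of_real abs_of_nonneg) (intro mult_left_mono, auto)
  moreover have "norm ((1 - u) *\<^sub>R d) \<le> norm d" using u by (simp add: mult_left_le_one_le)
  ultimately show ?thesis unfolding z_eq
    using norm_diff_ineq[of "of_real S * w * Complex ((1 - u) * \<tau>) (- u * \<sigma>)" "(1 - u) *\<^sub>R d"] by linarith
qed

lemma norm_segment_offset:
  fixes w b d :: complex and S :: real
  assumes S: "S \<ge> 0" and \<eta>: "\<eta> = 1 \<or> \<eta> = -1"
    and z: "z \<in> closed_segment (\<eta> * of_real S * w + b) (\<eta> * of_real S * w + d)"
  obtains e where "z = \<eta> * of_real S * w + e" "norm e \<le> norm b + norm d" 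
    "norm z \<ge> S * norm w - norm b - norm d"
proof -
  obtain u where u: "0 \<le> u" "u \<le> 1" "z = (1 - u) *\<^sub>R (\<eta> * of_real S * w + b) + u *\<^sub>R (\<eta> * of_real S * w + d)"
    using z by (auto simp: in_segment)
  define e where "e = (1 - u) *\<^sub>R b + u *\<^sub>R d"
  have z_eq: "z = \<eta> * of_real S * w + e"
    unfolding u(3) e_def by (simp add: scaleR_conv_of_real algebra_simps)
  have "norm e \<le> norm ((1 - u) *\<^sub>R b) + norm (u *\<^sub>R d)" unfolding e_def by (rule norm_triangle_ineq)
  also have "\<dots> \<le> norm b + norm d" using u by (intro add_mono) (simp_all add: mult_left_le_one_le)
  finally have e: "norm e \<le> norm b + norm d" .
  have "norm (\<eta> * of_real S * w) = S * norm w" using \<eta> S by (auto simp: norm_mult)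
  hence "norm z \<ge> S * norm w - norm e" unfolding z_eq by (metis norm_diff_ineq)
  thus ?thesis using e z_eq by (intro that) auto
qed

text \<open>Closes a truncated contour on the side opposite to \<open>v\<close>, through the far
  point - S * v. The corners S * w + d and - S * w + d are there so that the first and the last
  segment agree with those of \<open>line_loop\<close>.\<close>

definition closing :: "complex \<Rightarrow> complex \<Rightarrow> complex \<Rightarrow> complex \<Rightarrow> real \<Rightarrow> real \<Rightarrow> complex" where
  "closing w v b d S = linepath (of_real S * w + b) (of_real S * w + d) +++
     linepath (of_real S * w + d) (- of_real S * v) +++
     linepath (- of_real S * v) (- of_real S * w + d) +++
     linepath (- of_real S * w + d) (- of_real S * w + b)"

lemma closing_ends [simp]:
  "pathstart (closing w v b d S) = of_real S * w + b"
  "pathfinish (closing w v b d S) = - of_real S * w + b"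
  by (simp_all add: closing_def)

lemma path_closing [simp]: "path (closing w v b d S)"
  by (simp add: closing_def)

lemma path_image_closing:
  "path_image (closing w v b d S) = 
     closed_segment (of_real S * w + b) (of_real S * w + d) \<union>
     closed_segment (of_real S * w + d) (- of_real S * v) \<union>
     closed_segment (- of_real S * v) (- of_real S * w + d) \<union>
     closed_segment (- of_real S * w + d) (- of_real S * w + b)"
  by (simp add: closing_def path_image_join Un_assoc)

lemma norm_closing:
  assumes v: "v = \<i> * w \<or> v = - \<i> * w" and S: "S \<ge> 0" and z: "z \<in> path_image (closing w v b d S)"
  shows "norm z \<ge> S * norm w / 2 - norm b - norm d"
proof -
  have h: "S * norm w / 2 \<le> S * norm w" using S by simp
  consider "z \<in> closed_segment (1 * of_real S * w + b) (1 * of_real S * w + d)"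
    | "z \<in> closed_segment (1 * of_real S * w + d) (- of_real S * v)"
    | "z \<in> closed_segment (-1 * of_real S * w + d) (- of_real S * v)"
    | "z \<in> closed_segment (-1 * of_real S * w + d) (-1 * of_real S * w + b)"
    using z by (auto simp: path_image_closing closed_segment_commute)
  thus ?thesis
  proof cases
    case 1
    from norm_segment_offset[OF S _ this] show ?thesis using h by fastforce
  next
    case 2
    have "norm z \<ge> S * norm w / 2 - norm d" by (rule norm_segment_orthogonal[OF v S _ 2]) simp
    thus ?thesis using norm_ge_zero[of b] by linarith
  next
    case 3
    have "norm z \<ge> S * norm w / 2 - norm d" by (rule norm_segment_orthogonal[OF v S _ 3]) simp
    thus ?thesis using norm_ge_zero[of b] by linarith
  next
    case 4
    from norm_segment_offset[OF S _ this] show ?thesis using h by fastforce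
  qed
qed

lemma Re_orthogonal:
  assumes "v = \<i> * w \<or> v = - \<i> * w"
  shows "Re (of_real t * w / v) = 0"
proof (cases "w = 0")
  case False
  hence "w / v = - \<i> \<or> w / v = \<i>"
    using assms by auto
  moreover have "Re (of_real t * z) = 0" if "z = - \<i> \<or> z = \<i>" for z using that by auto
  ultimately show ?thesis unfolding times_divide_eq_right[symmetric] by blast
qed simp

lemma line_ended_Re_bound:
  assumes \<gamma>: "line_ended w b \<gamma>" and v: "v = \<i> * w \<or> v = - \<i> * w"
  obtains R where "\<And>s. Re (\<gamma> s / v) \<le> R"
proof -
  obtain S where S: "\<And>s. S \<le> \<bar>s\<bar> \<Longrightarrow> \<gamma> s = of_real s * w + b"
    using \<gamma> by (auto simp: line_ended_def)
  have "compact ((\<lambda>s. Re (\<gamma> s / v)) ` {-S..S})"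
    unfolding divide_inverse
    by (intro compact_continuous_image continuous_intros contour_continuous[OF \<gamma>]) auto
  then obtain R1 where R1: "\<And>s. s \<in> {-S..S} \<Longrightarrow> Re (\<gamma> s / v) \<le> R1"
    by (metis (no_types, lifting) bdd_above_def bounded_imp_bdd_above compact_imp_bounded image_eqI)
  have "Re (\<gamma> s / v) \<le> max R1 (Re (b / v))" for s
  proof (cases "s \<in> {-S..S}")
    case False
    have "Re (\<gamma> s / v) = Re (b / v)"
      using Re_orthogonal[OF v, of s] False S[of s] by (auto simp: add_divide_distrib)
    thus ?thesis by simp
  qed (use R1 in fastforce)
  thus ?thesis by (rule that)
qed

text \<open>A path in the complement joins \<open>p\<close> to a far point in direction
  \<open>v\<close>. For large \<open>S\<close> the closing path runs outside a disc containing that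
  path, so both points have the same winding number; for the far point it is 0, because the loop
  stays in a half-plane that does not contain it.\<close>

lemma winding_number_closing:
  assumes \<gamma>: "line_ended w b \<gamma>" and w: "w \<noteq> 0" and v: "v = \<i> * w \<or> v = - \<i> * w"
    and side: "on_side v \<gamma> p"
  shows "\<forall>\<^sub>F S in at_top. p \<notin> path_image (closing w v b d S) \<and>
           winding_number (truncate \<gamma> S +++ closing w v b d S) p = 0"
proof -
  obtain S0 where S0: "\<And>s. S0 \<le> \<bar>s\<bar> \<Longrightarrow> \<gamma> s = of_real s * w + b"
    using \<gamma> by (auto simp: line_ended_def)
  obtain R1 where R1: "\<And>s. Re (\<gamma> s / v) \<le> R1" using line_ended_Re_bound[OF \<gamma> v] by blast
  have v0: "v \<noteq> 0" using v w by auto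
  \<comment> \<open>The loop stays in the half-plane Re (z / v) \<le> R: \<open>R1\<close> bounds
    the contour, the other terms the corners of the closing path, with 0 for the corner - S *
    v.\<close>
  define R where "R = Max {R1, Re (b / v), Re (d / v), 0}"
  have R: "R1 \<le> R" "Re (b / v) \<le> R" "Re (d / v) \<le> R" "0 \<le> R" by (simp_all add: R_def)
  have "\<forall>\<^sub>F s in at_top. connected_component (- range \<gamma>) p (v * of_real s) \<and> R < s"
    using side eventually_gt_at_top[of R] unfolding on_side_def by (rule eventually_conj)
  then obtain s1 where s1: "connected_component (- range \<gamma>) p (v * of_real s1)" "R < s1"
    using eventually_happens' trivial_limit_at_top_linorder by blast
  have "open (- range \<gamma>)" using closed_range_contour[OF \<gamma> w] by (rule open_Compl)
  hence "path_component (- range \<gamma>) p (v * of_real s1)"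
    using s1(1) open_path_connected_component path_component_eq_connected_component by (metis (no_types))
  then obtain g where g: "path g" "path_image g \<subseteq> - range \<gamma>" "pathstart g = p" "pathfinish g = v * of_real s1"
    unfolding path_component_def by blast
  have "bounded (path_image g)" using g(1) by (simp add: bounded_path_image)
  then obtain \<rho> where \<rho>: "\<And>z. z \<in> path_image g \<Longrightarrow> norm z \<le> \<rho>" unfolding bounded_iff by blast
  \<comment> \<open>By \<open>norm_closing\<close>, for S \<ge> S1 the closing path is outside the
    disc of radius \<rho> containing \<open>g\<close>.\<close>
  define S1 where "S1 = 2 * (\<rho> + norm b + norm d + 1) / norm w"
  show ?thesis
    using eventually_ge_at_top[of "Max {S0, S1, 1}"]
  proof eventually_elim
    case (elim S)
    hence S: "S0 \<le> S" "S1 \<le> S" "1 \<le> S" by auto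
    have "2 * (\<rho> + norm b + norm d + 1) \<le> S * norm w"
      using S(2) w by (simp add: S1_def field_simps)
    hence far: "\<rho> < norm z" if "z \<in> path_image (closing w v b d S)" for z
      using norm_closing[OF v _ that] S(3) by simp
    have end_eq: "\<gamma> S = of_real S * w + b" "\<gamma> (-S) = - of_real S * w + b"
      using S0[of S] S0[of "-S"] S by auto
    let ?L = "truncate \<gamma> S +++ closing w v b d S"
    have pim: "path_image ?L = \<gamma> ` {-S..S} \<union> path_image (closing w v b d S)"
      using S end_eq by (simp add: path_image_join path_image_truncate)
    have disj: "path_image g \<inter> path_image ?L = {}"
      unfolding pim using g(2) far \<rho> by fastforce
    have path: "path ?L"
      using valid_path_imp_path[OF valid_path_truncate[OF \<gamma>]] S end_eq by simp
    have loop: "pathfinish ?L = pathstart ?L" using end_eq by simp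
    have "winding_number ?L p = winding_number ?L (v * of_real s1)"
      by (rule winding_number_eq[OF path loop _ _ _ disj])
         (use g pathstart_in_path_image[of g] pathfinish_in_path_image[of g] connected_path_image[of g] in auto)
    also have "\<dots> = 0"
    proof (rule winding_number_zero_outside[OF path convex_Re_halfspace[of v R] loop])
      show "v * complex_of_real s1 \<notin> {z. Re (z / v) \<le> R}" using s1(2) v0 by simp
      note Re0 = Re_orthogonal[OF v]
      have 1: "of_real t * w + b \<in> {z. Re (z / v) \<le> R}" "of_real t * w + d \<in> {z. Re (z / v) \<le> R}" for t :: real
        using R Re0[of t] by (simp_all add: add_divide_distrib)
      have 2: "- of_real S * v \<in> {z. Re (z / v) \<le> R}" using v0 R S by simp
      have "path_image (closing w v b d S) \<subseteq> {z. Re (z / v) \<le> R}"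
        unfolding path_image_closing using 1[of S] 1[of "-S"] 2
        by (intro Un_least closed_segment_subset convex_Re_halfspace) auto
      thus "path_image ?L \<subseteq> {z. Re (z / v) \<le> R}"
        unfolding pim using R1 R(1) by (auto intro: order_trans)
    qed
    finally have "winding_number ?L p = 0" .
    moreover have "p \<notin> path_image (closing w v b d S)"
      using disj pim g(3) pathstart_in_path_image by blast
    ultimately show ?case by blast
  qed
qed

lemma winding_number_join_linepaths:
  assumes "path g" "p \<notin> path_image g" "pathfinish g = a"
    and "p \<notin> closed_segment a b" "p \<notin> closed_segment b c" "p \<notin> closed_segment c d"
  shows "winding_number (g +++ linepath a b +++ linepath b c +++ linepath c d) p =
     winding_number g p + winding_number (linepath a b) p + winding_number (linepath b c) p
     + winding_number (linepath c d) p"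
    and "p \<notin> closed_segment d e \<Longrightarrow>
     winding_number (g +++ linepath a b +++ linepath b c +++ linepath c d +++ linepath d e) p =
     winding_number g p + winding_number (linepath a b) p + winding_number (linepath b c) p
     + winding_number (linepath c d) p + winding_number (linepath d e) p"
  using assms by (simp_all add: winding_number_join path_image_join)

definition line_loop :: "complex \<Rightarrow> complex \<Rightarrow> complex \<Rightarrow> (real \<Rightarrow> complex) \<Rightarrow> real \<Rightarrow> real \<Rightarrow> complex" where
  "line_loop w b d \<gamma> S = truncate \<gamma> S +++ linepath (of_real S * w + b) (of_real S * w + d) +++
     linepath (of_real S * w + d) (- of_real S * w + d) +++
     linepath (- of_real S * w + d) (- of_real S * w + b)"

text \<open>The loop of \<open>winding_number_closing\<close> winds zero times around
  \<open>p\<close> and shares with this one the contour and the two segments at its ends. What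
  remains is a triangle with corners S * w + d, - S * w + d and - S * v. So the value depends on
  \<open>p\<close> and its side, but not on the contour or its offset.\<close>

lemma winding_number_line_loop:
  assumes \<gamma>: "line_ended w b \<gamma>" and w: "w \<noteq> 0" and v: "v = \<i> * w \<or> v = - \<i> * w"
    and side: "on_side v \<gamma> p" and p: "p \<notin> range (\<lambda>s::real. of_real s * w + d)"
  shows "\<forall>\<^sub>F S in at_top. winding_number (line_loop w b d \<gamma> S) p =
     winding_number (linepath (of_real S * w + d) (- of_real S * w + d)) p
     - winding_number (linepath (of_real S * w + d) (- of_real S * v)) p
     - winding_number (linepath (- of_real S * v) (- of_real S * w + d)) p"
proof -
  obtain S0 where S0: "\<And>s. S0 \<le> \<bar>s\<bar> \<Longrightarrow> \<gamma> s = of_real s * w + b"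
    using \<gamma> by (auto simp: line_ended_def)
  show ?thesis
    using winding_number_closing[OF \<gamma> w v side, of d] eventually_ge_at_top[of "max S0 1"]
  proof eventually_elim
    case (elim S)
    hence S: "S0 \<le> S" "1 \<le> S" by auto
    have end_eq: "\<gamma> S = of_real S * w + b" "\<gamma> (-S) = - of_real S * w + b"
      using S0[of S] S0[of "-S"] S by auto
    have pt: "path (truncate \<gamma> S)" "p \<notin> path_image (truncate \<gamma> S)"
      using valid_path_imp_path[OF valid_path_truncate[OF \<gamma>]] S on_side_notin_range[OF side]
      by (auto simp: path_image_truncate)
    have pc: "p \<notin> closed_segment (of_real S * w + b) (of_real S * w + d)"
       "p \<notin> closed_segment (of_real S * w + d) (- of_real S * v)"
       "p \<notin> closed_segment (- of_real S * v) (- of_real S * w + d)"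
       "p \<notin> closed_segment (- of_real S * w + d) (- of_real S * w + b)"
      using elim(1) by (auto simp: path_image_closing)
    have pd: "p \<notin> closed_segment (of_real S * w + d) (- of_real S * w + d)"
    proof
      assume "p \<in> closed_segment (of_real S * w + d) (- of_real S * w + d)"
      then obtain u where "p = (1 - u) *\<^sub>R (of_real S * w + d) + u *\<^sub>R (- of_real S * w + d)"
        by (auto simp: in_segment)
      hence "p = of_real ((1 - 2 * u) * S) * w + d" by (simp add: scaleR_conv_of_real algebra_simps)
      thus False using p by blast
    qed
    note joins = winding_number_join_linepaths[OF pt(1,2) truncate_ends(2)[of \<gamma> S, unfolded end_eq]]
    have "winding_number (truncate \<gamma> S) p + winding_number (linepath (of_real S * w + b) (of_real S * w + d)) p
       + winding_number (linepath (of_real S * w + d) (- of_real S * v)) p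
       + winding_number (linepath (- of_real S * v) (- of_real S * w + d)) p
       + winding_number (linepath (- of_real S * w + d) (- of_real S * w + b)) p = 0"
      using elim(1) unfolding closing_def by (subst (asm) joins(2)[OF pc]) simp
    moreover have "winding_number (line_loop w b d \<gamma> S) p = winding_number (truncate \<gamma> S) p
       + winding_number (linepath (of_real S * w + b) (of_real S * w + d)) p
       + winding_number (linepath (of_real S * w + d) (- of_real S * w + d)) p
       + winding_number (linepath (- of_real S * w + d) (- of_real S * w + b)) p"
      unfolding line_loop_def by (rule joins(1)[OF pc(1) pd pc(4)])
    ultimately show ?case by (simp add: algebra_simps add_eq_0_iff2)
  qed
qed

section \<open>Cauchy's theorem for several contours\<close>

text \<open>Uniformity in the offset controls the segments that join the ends of a contour to the
  ends of the common line.\<close>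

definition decays_strip :: "complex \<Rightarrow> (complex \<Rightarrow> complex) \<Rightarrow> bool" where
  "decays_strip w f \<longleftrightarrow> (\<forall>B. \<exists>C \<delta> S. \<delta> > 0 \<and>
     (\<forall>(s::real) b. S \<le> \<bar>s\<bar> \<and> norm b \<le> B \<longrightarrow> norm (f (of_real s * w + b)) \<le> C * exp (- \<delta> * \<bar>s\<bar>)))"

lemma decays_strip_imp_along: "decays_strip w f \<Longrightarrow> decays_along w b f"
  unfolding decays_strip_def decays_along_def by (metis order_refl)

text \<open>The form of discreteness used for pole sets: loops around a contour stay in a strip
  parallel to \<open>w\<close>, so they meet only finitely many residues.\<close>

definition strip_finite :: "complex \<Rightarrow> complex set \<Rightarrow> bool" where
  "strip_finite w A \<longleftrightarrow> (\<forall>R. finite {p \<in> A. \<bar>Im (p / w)\<bar> \<le> R})"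

lemma strip_finite_subset: "strip_finite w A \<Longrightarrow> B \<subseteq> A \<Longrightarrow> strip_finite w B"
  unfolding strip_finite_def
proof
  fix R assume "\<forall>R. finite {p \<in> A. \<bar>Im (p / w)\<bar> \<le> R}" "B \<subseteq> A"
  thus "finite {p \<in> B. \<bar>Im (p / w)\<bar> \<le> R}"
    by (intro finite_subset[of "{p \<in> B. \<bar>Im (p / w)\<bar> \<le> R}" "{p \<in> A. \<bar>Im (p / w)\<bar> \<le> R}"]) blast+
qed

lemma strip_finite_UN:
  assumes "finite I" "\<And>i. i \<in> I \<Longrightarrow> strip_finite w (A i)"
  shows "strip_finite w (\<Union>i\<in>I. A i)"
proof -
  have "finite (\<Union>i\<in>I. {p \<in> A i. \<bar>Im (p / w)\<bar> \<le> R})" for R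
    using assms unfolding strip_finite_def by blast
  moreover have "{p \<in> (\<Union>i\<in>I. A i). \<bar>Im (p / w)\<bar> \<le> R} = (\<Union>i\<in>I. {p \<in> A i. \<bar>Im (p / w)\<bar> \<le> R})" for R
    by blast
  ultimately show ?thesis unfolding strip_finite_def by simp
qed

text \<open>Used twice: some line parallel to \<open>w\<close> avoids the set, and its complement is
  path connected.\<close>

lemma strip_finite_countable:
  assumes "strip_finite w A"
  shows "countable A"
proof -
  have "A \<subseteq> (\<Union>n::nat. {p \<in> A. \<bar>Im (p / w)\<bar> \<le> real n})"
  proof
    fix p assume "p \<in> A"
    moreover obtain n :: nat where "\<bar>Im (p / w)\<bar> \<le> real n" using real_arch_simple by blast
    ultimately show "p \<in> (\<Union>n::nat. {p \<in> A. \<bar>Im (p / w)\<bar> \<le> real n})" by blast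
  qed
  moreover have "countable (\<Union>n::nat. {p \<in> A. \<bar>Im (p / w)\<bar> \<le> real n})"
    by (rule countable_UN[OF _ countable_finite]) (use assms in \<open>simp_all add: strip_finite_def\<close>)
  ultimately show ?thesis by (rule countable_subset)
qed

lemma abs_Im_divide_le: "\<bar>Im (z / w)\<bar> \<le> norm z / norm w"
  using abs_Im_le_cmod[of "z / w"] by (simp only: norm_divide)

lemma strip_finite_closed:
  assumes "strip_finite w A"
  shows "closed A"
  unfolding closed_limpt
proof (intro allI impI)
  fix x assume x: "x islimpt A"
  have "A \<inter> ball x 1 \<subseteq> {p \<in> A. \<bar>Im (p / w)\<bar> \<le> (norm x + 1) / norm w}"
  proof safe
    fix p assume "p \<in> ball x 1"
    hence "norm p \<le> norm x + 1"
      using norm_triangle_sub[of p x] by (simp add: dist_norm norm_minus_commute)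
    hence "norm p / norm w \<le> (norm x + 1) / norm w" by (intro divide_right_mono) auto
    thus "\<bar>Im (p / w)\<bar> \<le> (norm x + 1) / norm w" using abs_Im_divide_le order_trans by blast
  qed
  hence "finite (A \<inter> ball x 1)"
    using assms unfolding strip_finite_def by (meson finite_subset)
  thus "x \<in> A" using x unfolding islimpt_eq_infinite_ball by (metis zero_less_one)
qed

text \<open>The functions add up to zero near \<open>p\<close>, although each may be singular there;
  residues are additive.\<close>

lemma residue_sum_eq_0:
  assumes I: "finite I" and U: "open U" "p \<in> U" and f: "\<And>i. i \<in> I \<Longrightarrow> f i holomorphic_on U - {p}"
    and 0: "\<And>t. t \<in> U - {p} \<Longrightarrow> (\<Sum>i\<in>I. f i t) = 0"
  shows "(\<Sum>i\<in>I. residue (f i) p) = 0"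
proof -
  have "residue (\<lambda>t. \<Sum>i\<in>J. f i t) p = (\<Sum>i\<in>J. residue (f i) p)" if "J \<subseteq> I" for J
    using finite_subset[OF that I] that
  proof (induction J rule: finite_induct)
    case (insert j J)
    have "residue (\<lambda>t. f j t + (\<Sum>i\<in>J. f i t)) p = residue (f j) p + residue (\<lambda>t. \<Sum>i\<in>J. f i t) p"
      using insert f by (intro residue_add[OF U]) (auto intro!: holomorphic_on_sum)
    thus ?case using insert by simp
  qed (simp add: residue_const)
  moreover have "residue (\<lambda>t. \<Sum>i\<in>I. f i t) p = residue (\<lambda>_. 0) p"
  proof (rule residue_cong)
    have "eventually (\<lambda>t. t \<in> U - {p}) (at p)" using U by (rule eventually_at_in_open)
    thus "\<forall>\<^sub>F t in at p. (\<Sum>i\<in>I. f i t) = 0" by eventually_elim (rule 0)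
  qed simp
  ultimately show ?thesis by (simp add: residue_const)
qed

text \<open>The length of the segment stays norm (d - b), while the integrand decays exponentially
  on it.\<close>

lemma segment_integral_tendsto_0:
  fixes w b d :: complex
  assumes dec: "decays_strip w f" and f: "f holomorphic_on - A" "closed A"
    and \<eta>: "\<eta> = 1 \<or> \<eta> = -1"
    and disj: "\<forall>\<^sub>F S in at_top. closed_segment (\<eta> * of_real S * w + b) (\<eta> * of_real S * w + d) \<inter> A = {}"
  shows "((\<lambda>S. contour_integral (linepath (\<eta> * of_real S * w + b) (\<eta> * of_real S * w + d)) f) \<longlongrightarrow> 0) at_top"
proof -
  obtain C \<delta> S0 where C: "\<delta> > 0" "\<And>(s::real) e. S0 \<le> \<bar>s\<bar> \<Longrightarrow> norm e \<le> norm b + norm d \<Longrightarrow>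
      norm (f (of_real s * w + e)) \<le> C * exp (- \<delta> * \<bar>s\<bar>)"
    using dec unfolding decays_strip_def by metis
  obtain \<sigma> :: real where \<sigma>: "\<sigma> = 1 \<or> \<sigma> = -1" "\<eta> = of_real \<sigma>" using \<eta> by force
  have "((\<lambda>S. exp (- \<delta> * S)) \<longlongrightarrow> 0) at_top"
    by (rule filterlim_compose[OF exp_at_bot])
       (use C(1) in \<open>intro filterlim_tendsto_neg_mult_at_bot[OF tendsto_const] filterlim_ident, auto\<close>)
  hence lim: "((\<lambda>S. C * exp (- \<delta> * S) * norm (d - b)) \<longlongrightarrow> 0) at_top"
    by (intro tendsto_mult_left_zero tendsto_mult_right_zero)
  show ?thesis
  proof (rule Lim_null_comparison[OF _ lim])
    show "\<forall>\<^sub>F S in at_top. norm (contour_integral (linepath (\<eta> * of_real S * w + b) (\<eta> * of_real S * w + d)) f)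
        \<le> C * exp (- \<delta> * S) * norm (d - b)"
      using disj eventually_ge_at_top[of "max S0 0"]
    proof eventually_elim
      case (elim S)
      hence S: "S \<ge> 0" "S0 \<le> S" by auto
      have bd: "norm (f z) \<le> C * exp (- \<delta> * S)"
        if z: "z \<in> closed_segment (\<eta> * of_real S * w + b) (\<eta> * of_real S * w + d)" for z
      proof -
        obtain e where e: "z = \<eta> * of_real S * w + e" "norm e \<le> norm b + norm d"
          using norm_segment_offset[OF S(1) \<eta> z] by blast
        have "\<bar>\<sigma> * S\<bar> = S" using \<sigma>(1) S by auto
        thus ?thesis using C(2)[of "\<sigma> * S" e] e S by (simp add: \<sigma>(2))
      qed
      have "f contour_integrable_on linepath (\<eta> * of_real S * w + b) (\<eta> * of_real S * w + d)"
        using elim f by (intro contour_integrable_holomorphic_simple[of f "- A"]) auto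
      moreover have "0 \<le> C * exp (- \<delta> * S)" using bd[of "\<eta> * of_real S * w + b"] by (meson ends_in_segment norm_ge_zero order_trans)
      ultimately have "norm (contour_integral (linepath (\<eta> * of_real S * w + b) (\<eta> * of_real S * w + d)) f)
          \<le> C * exp (- \<delta> * S) * norm ((\<eta> * of_real S * w + d) - (\<eta> * of_real S * w + b))"
        by (rule contour_integral_bound_linepath) (rule bd)
      thus ?case by simp
    qed
  qed
qed

lemma contour_integral_join4:
  assumes "valid_path g" "f contour_integrable_on g" "f contour_integrable_on linepath a b"
    "f contour_integrable_on linepath b c" "f contour_integrable_on linepath c d"
  shows "contour_integral (g +++ linepath a b +++ linepath b c +++ linepath c d) f =
    contour_integral g f + contour_integral (linepath a b) f + contour_integral (linepath b c) f
    + contour_integral (linepath c d) f"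
  using assms by (simp add: valid_path_join)

text \<open>Were there one contour for all \<open>i\<close>, integrating \<open>sum0\<close> would
  suffice. Here every contour is moved to a common line, on which the integrands do add up to zero.
  The move costs residues, weighted by winding numbers that are the same for all \<open>i\<close>,
  because \<sigma> prescribes one side for each pole.\<close>

theorem sum_line_integrals_eq_0:
  fixes b :: "'i \<Rightarrow> complex" and \<gamma> :: "'i \<Rightarrow> real \<Rightarrow> complex" and f :: "'i \<Rightarrow> complex \<Rightarrow> complex"
  assumes w: "w \<noteq> 0" and I: "finite I"
    and \<gamma>: "\<And>i. i \<in> I \<Longrightarrow> line_ended w (b i) (\<gamma> i)"
    and A: "\<And>i. i \<in> I \<Longrightarrow> strip_finite w (A i)"
    and hol: "\<And>i. i \<in> I \<Longrightarrow> f i holomorphic_on - A i"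
    and \<sigma>: "\<And>p. \<sigma> p = \<i> * w \<or> \<sigma> p = - \<i> * w"
    and side: "\<And>i p. i \<in> I \<Longrightarrow> p \<in> A i \<Longrightarrow> on_side (\<sigma> p) (\<gamma> i) p"
    and dec: "\<And>i. i \<in> I \<Longrightarrow> decays_strip w (f i)"
    and sum0: "\<And>t. (\<And>i. i \<in> I \<Longrightarrow> t \<notin> A i) \<Longrightarrow> (\<Sum>i\<in>I. f i t) = 0"
  shows "(\<Sum>i\<in>I. integral UNIV (line_integrand (\<gamma> i) (f i))) = 0"
proof -
  let ?U = "\<Union>i\<in>I. A i"
  have UA: "strip_finite w ?U" using I A by (rule strip_finite_UN)
  have closedA: "closed (A i)" if "i \<in> I" for i using A[OF that] by (rule strip_finite_closed)
  have rangeA: "range (\<gamma> i) \<inter> A i = {}" if "i \<in> I" for i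
    using side[OF that] on_side_notin_range by blast
  \<comment> \<open>The heights of the poles are countably many, so some line parallel to
    \<open>w\<close> misses all poles.\<close>
  have "(\<lambda>p. Im (p / w)) ` ?U \<noteq> UNIV"
    using countable_image[OF strip_finite_countable[OF UA], of "\<lambda>p. Im (p / w)"] uncountable_UNIV_real
    by (intro notI) (simp only:)
  then obtain r :: real where r: "r \<notin> (\<lambda>p. Im (p / w)) ` ?U" by blast
  define d where "d = \<i> * w * of_real r"
  have Im_line: "Im ((of_real s * w + d) / w) = r" for s
    using w by (simp add: d_def add_divide_distrib)
  have lineU: "of_real s * w + d \<notin> ?U" for s
    using r Im_line[of s] by blast
  have segU: "closed_segment (of_real S * w + d) (- of_real S * w + d) \<inter> ?U = {}" for S
  proof -
    have "z \<notin> ?U" if z: "z \<in> closed_segment (of_real S * w + d) (- of_real S * w + d)" for z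
    proof -
      obtain u where "z = (1 - u) *\<^sub>R (of_real S * w + d) + u *\<^sub>R (- of_real S * w + d)"
        using z by (auto simp: in_segment)
      hence "z = of_real ((1 - 2 * u) * S) * w + d" by (simp add: scaleR_conv_of_real algebra_simps)
      thus ?thesis using lineU[of "(1 - 2 * u) * S"] by (simp only: simp_thms)
    qed
    thus ?thesis by blast
  qed
  have Re_Im: "Re (z / (\<i> * w)) = Im (z / w)" "Re (z / (- \<i> * w)) = - Im (z / w)" for z
  proof -
    have eq: "z / (\<i> * w) = - \<i> * (z / w)" "z / (- \<i> * w) = \<i> * (z / w)"
      by (simp_all add: divide_inverse)
    have *: "Re (- \<i> * x) = Im x" "Re (\<i> * x) = - Im x" for x by simp_all
    show "Re (z / (\<i> * w)) = Im (z / w)" unfolding eq(1) by (rule *)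
    show "Re (z / (- \<i> * w)) = - Im (z / w)" unfolding eq(2) by (rule *)
  qed
  have "\<exists>R. \<forall>s. \<bar>Im (\<gamma> i s / w)\<bar> \<le> R" if i: "i \<in> I" for i
  proof -
    obtain R1 R2 where R: "\<And>s. Re (\<gamma> i s / (\<i> * w)) \<le> R1" "\<And>s. Re (\<gamma> i s / (- \<i> * w)) \<le> R2"
      using line_ended_Re_bound[OF \<gamma>[OF i]] by metis
    have "\<bar>Im (\<gamma> i s / w)\<bar> \<le> max R1 R2" for s
      using R(1)[of s] R(2)[of s] unfolding Re_Im by linarith
    thus ?thesis by blast
  qed
  then obtain R0 where R0: "\<And>i s. i \<in> I \<Longrightarrow> \<bar>Im (\<gamma> i s / w)\<bar> \<le> R0 i" by metis
  obtain R where R: "\<And>i. i \<in> I \<Longrightarrow> R0 i \<le> R" "\<And>i. i \<in> I \<Longrightarrow> \<bar>Im (b i / w)\<bar> \<le> R" "\<bar>r\<bar> \<le> R"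
  proof -
    let ?M = "insert \<bar>r\<bar> (R0 ` I \<union> (\<lambda>i. \<bar>Im (b i / w)\<bar>) ` I)"
    have "finite ?M" using I by simp
    thus thesis by (intro that[of "Max ?M"] Max_ge) auto
  qed
  \<comment> \<open>This strip contains all contours, the joining segments and the line, so only the
    finitely many poles in it can be encircled.\<close>
  define H where "H = {z. \<bar>Im (z / w)\<bar> \<le> R}"
  have H: "convex H"
  proof -
    have "H = {z. Re (z / (\<i> * w)) \<le> R} \<inter> {z. Re (z / (- \<i> * w)) \<le> R}"
      unfolding H_def Re_Im by auto
    thus ?thesis by (simp only: convex_Int[OF convex_Re_halfspace convex_Re_halfspace])
  qed
  define B where "B i = A i \<inter> H" for i
  have finB: "finite (B i)" if "i \<in> I" for i
    using A[OF that] unfolding B_def H_def strip_finite_def by (simp add: Int_def)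
  \<comment> \<open>By \<open>winding_number_line_loop\<close>, eventually the winding number around
    \<open>p\<close> of the loop of each \<open>i\<close> that has the pole \<open>p\<close>; no
    \<open>i\<close> occurs in it.\<close>
  define N where "N p S = winding_number (linepath (of_real S * w + d) (- of_real S * w + d)) p
     - winding_number (linepath (of_real S * w + d) (- of_real S * \<sigma> p)) p
     - winding_number (linepath (- of_real S * \<sigma> p) (- of_real S * w + d)) p" for p and S :: real
  let ?seg = "\<lambda>\<eta> i S. closed_segment (\<eta> * of_real S * w + b i) (\<eta> * of_real S * w + d)"
  have segA: "\<forall>\<^sub>F S in at_top. ?seg \<eta> i S \<inter> A i = {}"
    and segH: "\<And>S. ?seg \<eta> i S \<subseteq> H" if i: "i \<in> I" and \<eta>: "\<eta> = 1 \<or> \<eta> = -1" for \<eta> i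
  proof -
    have "\<eta> * of_real S * w / w = \<eta> * of_real S" for S using w by simp
    hence "Im ((\<eta> * of_real S * w + e) / w) = Im (e / w)" for S e
      using \<eta> by (auto simp: add_divide_distrib)
    moreover have "Im (d / w) = r" using Im_line[of 0] by simp
    ultimately show segH: "?seg \<eta> i S \<subseteq> H" for S
      using R(2)[OF i] R(3) by (intro closed_segment_subset H) (auto simp: H_def)
    \<comment> \<open>The segments stay in the strip, which holds finitely many poles, and move off
      to infinity.\<close>
    obtain \<rho> where \<rho>: "\<And>z. z \<in> B i \<Longrightarrow> norm z \<le> \<rho>"
      using finite_imp_bounded[OF finB[OF i]] unfolding bounded_iff by blast
    show "\<forall>\<^sub>F S in at_top. ?seg \<eta> i S \<inter> A i = {}"
      using eventually_gt_at_top[of "max 0 ((\<rho> + norm (b i) + norm d) / norm w)"]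
    proof eventually_elim
      case (elim S)
      hence S: "0 \<le> S" "\<rho> + norm (b i) + norm d < S * norm w"
        using w by (simp_all add: divide_less_eq)
      have False if z: "z \<in> ?seg \<eta> i S" "z \<in> A i" for z
      proof -
        have "norm z \<le> \<rho>" using \<rho>[of z] z segH[of S] by (auto simp: B_def)
        moreover have "norm z \<ge> S * norm w - norm (b i) - norm d"
          using norm_segment_offset[OF S(1) \<eta> z(1)] by blast
        ultimately show False using S(2) by linarith
      qed
      thus ?case by blast
    qed
  qed
  define seg where "seg i S = contour_integral (linepath (1 * of_real S * w + b i) (1 * of_real S * w + d)) (f i)
      - contour_integral (linepath (-1 * of_real S * w + b i) (-1 * of_real S * w + d)) (f i)" for i and S :: real
  have loop: "\<forall>\<^sub>F S in at_top. contour_integral (truncate (\<gamma> i) S) (f i) + seg i S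
      + contour_integral (linepath (of_real S * w + d) (- of_real S * w + d)) (f i)
      = 2 * pi * \<i> * (\<Sum>p\<in>B i. N p S * residue (f i) p)" if i: "i \<in> I" for i
  proof -
    obtain S0 where S0: "\<And>s. S0 \<le> \<bar>s\<bar> \<Longrightarrow> \<gamma> i s = of_real s * w + b i"
      using \<gamma>[OF i] by (auto simp: line_ended_def)
    have "\<forall>\<^sub>F S in at_top. \<forall>p\<in>B i. winding_number (line_loop w (b i) d (\<gamma> i) S) p = N p S"
    proof (rule eventually_ball_finite[OF finB[OF i]], rule ballI)
      fix p assume "p \<in> B i"
      hence p: "p \<in> A i" by (simp add: B_def)
      hence "p \<notin> range (\<lambda>s::real. of_real s * w + d)" using lineU i by blast
      from winding_number_line_loop[OF \<gamma>[OF i] w \<sigma> side[OF i p] this]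
      show "\<forall>\<^sub>F S in at_top. winding_number (line_loop w (b i) d (\<gamma> i) S) p = N p S"
        unfolding N_def .
    qed
    thus ?thesis
      using segA[OF i, of 1, simplified] segA[OF i, of "-1", simplified] eventually_ge_at_top[of "max S0 1"]
    proof eventually_elim
      case (elim S)
      hence S: "S0 \<le> S" "1 \<le> S" by auto
      have end_eq: "\<gamma> i S = of_real S * w + b i" "\<gamma> i (-S) = - of_real S * w + b i"
        using S0[of S] S0[of "-S"] S by auto
      let ?L = "line_loop w (b i) d (\<gamma> i) S"
      have vt: "valid_path (truncate (\<gamma> i) S)" using valid_path_truncate[OF \<gamma>[OF i]] S by simp
      have vp: "valid_path ?L"
        unfolding line_loop_def using vt end_eq by (intro valid_path_join) simp_all
      have lp: "pathfinish ?L = pathstart ?L" by (simp add: line_loop_def end_eq)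
      have pim: "path_image ?L \<subseteq> range (\<gamma> i) \<union> ?seg 1 i S \<union> ?seg (-1) i S
          \<union> closed_segment (of_real S * w + d) (- of_real S * w + d)"
        using S end_eq unfolding line_loop_def
        by (auto simp: path_image_join path_image_truncate closed_segment_commute)
      have pimA: "path_image ?L \<subseteq> - A i"
      proof -
        have "closed_segment (of_real S * w + d) (- of_real S * w + d) \<inter> A i = {}" using segU[of S] i by blast
        moreover have "?seg 1 i S \<inter> A i = {}" "?seg (-1) i S \<inter> A i = {}" using elim(2,3) by simp_all
        ultimately show ?thesis using pim rangeA[OF i] by blast
      qed
      have lineH: "of_real s * w + d \<in> H" for s using R(3) by (simp add: H_def Im_line)
      have pimH: "path_image ?L \<subseteq> H"
      proof -
        have "range (\<gamma> i) \<subseteq> H" using R0[OF i] R(1)[OF i] unfolding H_def by (auto intro: order_trans)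
        moreover have "closed_segment (of_real S * w + d) (- of_real S * w + d) \<subseteq> H"
          using lineH[of S] lineH[of "-S"] by (intro closed_segment_subset H) auto
        ultimately show ?thesis using pim segH[OF i, of 1 S] segH[OF i, of "-1" S] by blast
      qed
      \<comment> \<open>Poles off the strip are taken out of the domain rather than counted; the
        loop does not wind around them because the strip is convex.\<close>
      have AB: "- (A i - B i) - B i = - A i" by (auto simp: B_def)
      have "contour_integral ?L (f i) = 2 * pi * \<i> * (\<Sum>p\<in>B i. winding_number ?L p * residue (f i) p)"
      proof (rule Residue_theorem[OF _ _ finB[OF i] _ vp lp])
        have sub: "strip_finite w (A i - B i)" by (rule strip_finite_subset[OF A[OF i]]) blast
        show "open (- (A i - B i))" using strip_finite_closed[OF sub] by (rule open_Compl)
        show "connected (- (A i - B i))"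
          by (intro path_connected_imp_connected path_connected_complement_countable
                strip_finite_countable[OF sub]) simp
        show "f i holomorphic_on - (A i - B i) - B i" unfolding AB by (rule hol[OF i])
        show "path_image ?L \<subseteq> - (A i - B i) - B i" unfolding AB by (rule pimA)
        show "\<forall>z. z \<notin> - (A i - B i) \<longrightarrow> winding_number ?L z = 0"
          using winding_number_zero_outside[OF valid_path_imp_path[OF vp] H lp _ pimH]
          by (auto simp: B_def)
      qed
      also have "\<dots> = 2 * pi * \<i> * (\<Sum>p\<in>B i. N p S * residue (f i) p)"
        using elim(1) by simp
      also have "contour_integral ?L (f i) = contour_integral (truncate (\<gamma> i) S) (f i) 
          + contour_integral (linepath (of_real S * w + b i) (of_real S * w + d)) (f i)
          + contour_integral (linepath (of_real S * w + d) (- of_real S * w + d)) (f i)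
          + contour_integral (linepath (- of_real S * w + d) (- of_real S * w + b i)) (f i)"
        unfolding line_loop_def
      proof (rule contour_integral_join4[OF vt])
        have opn: "open (- A i)" using closedA[OF i] by (rule open_Compl)
        note int = contour_integrable_holomorphic_simple[OF hol[OF i] opn]
        show "f i contour_integrable_on truncate (\<gamma> i) S"
          using contour_integrable_truncate[OF \<gamma>[OF i] hol[OF i] closedA[OF i] rangeA[OF i]] S by simp
        show "f i contour_integrable_on linepath (of_real S * w + b i) (of_real S * w + d)"
          using elim(2) by (intro int) auto
        show "f i contour_integrable_on linepath (of_real S * w + d) (- of_real S * w + d)"
          using segU[of S] i by (intro int) auto
        show "f i contour_integrable_on linepath (- of_real S * w + d) (- of_real S * w + b i)"
          using elim(3) by (intro int) (auto simp: closed_segment_commute)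
      qed
      also have "contour_integral (linepath (- of_real S * w + d) (- of_real S * w + b i)) (f i) =
          - contour_integral (linepath (- of_real S * w + b i) (- of_real S * w + d)) (f i)"
        using contour_integral_reversepath[of "linepath (- of_real S * w + b i) (- of_real S * w + d)" "f i"]
        by simp
      finally show ?case by (simp add: seg_def algebra_simps)
    qed
  qed
  have resid: "(\<Sum>i\<in>I. residue (f i) p) = 0" if "p \<in> ?U" for p
  proof (rule residue_sum_eq_0[OF I])
    have "strip_finite w (?U - {p})" by (rule strip_finite_subset[OF UA]) blast
    thus "open (- (?U - {p}))" by (intro open_Compl strip_finite_closed)
    show "f i holomorphic_on - (?U - {p}) - {p}" if "i \<in> I" for i
      by (rule holomorphic_on_subset[OF hol[OF that]]) (use that in blast)
    show "(\<Sum>i\<in>I. f i t) = 0" if "t \<in> - (?U - {p}) - {p}" for t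
      using that by (intro sum0) blast
  qed simp
  have resid0: "residue (f i) p = 0" if "i \<in> I" "p \<notin> A i" for i p
    using residue_holo[OF open_Compl[OF closedA[OF that(1)]] _ hol[OF that(1)]] that(2) by blast
  have res_total: "(\<Sum>i\<in>I. \<Sum>p\<in>B i. N p S * residue (f i) p) = 0" for S
  proof -
    let ?B = "\<Union>i\<in>I. B i"
    have finUB: "finite ?B" using I finB by simp
    \<comment> \<open>A pole of one integrand may be a regular point of another, with residue 0. So
      all inner sums can run over the same set, and the sums can be exchanged.\<close>
    have "(\<Sum>i\<in>I. \<Sum>p\<in>B i. N p S * residue (f i) p) = (\<Sum>i\<in>I. \<Sum>p\<in>?B. N p S * residue (f i) p)"
    proof (rule sum.cong[OF refl], rule sum.mono_neutral_left[OF finUB])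
      fix i assume i: "i \<in> I"
      show "B i \<subseteq> ?B" using i by blast
      show "\<forall>p\<in>?B - B i. N p S * residue (f i) p = 0"
        using resid0[OF i] by (auto simp: B_def)
    qed
    also have "\<dots> = (\<Sum>p\<in>?B. N p S * (\<Sum>i\<in>I. residue (f i) p))"
      by (subst sum.swap) (simp add: sum_distrib_left)
    also have "\<dots> = 0"
    proof (intro sum.neutral ballI)
      fix p assume "p \<in> ?B"
      hence "p \<in> ?U" by (auto simp: B_def)
      thus "N p S * (\<Sum>i\<in>I. residue (f i) p) = 0" using resid by simp
    qed
    finally show ?thesis .
  qed
  have line_total: "(\<Sum>i\<in>I. contour_integral (linepath (of_real S * w + d) (- of_real S * w + d)) (f i)) = 0" for S
  proof -
    let ?p = "linepath (of_real S * w + d) (- of_real S * w + d)"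
    have "(\<Sum>i\<in>I. contour_integral ?p (f i)) = contour_integral ?p (\<lambda>t. \<Sum>i\<in>I. f i t)"
    proof (rule contour_integral_sum[OF I, symmetric])
      fix i assume i: "i \<in> I"
      show "f i contour_integrable_on ?p"
        using segU[of S] i by (intro contour_integrable_holomorphic_simple[OF hol[OF i] open_Compl[OF closedA[OF i]]]) auto
    qed
    also have "\<dots> = contour_integral ?p (\<lambda>_. 0)"
      using segU[of S] by (intro contour_integral_eq sum0) auto
    finally show ?thesis by simp
  qed
  have seg0: "((\<lambda>S. seg i S) \<longlongrightarrow> 0) at_top" if i: "i \<in> I" for i
    using tendsto_diff[OF segment_integral_tendsto_0[OF dec[OF i] hol[OF i] closedA[OF i] _ segA[OF i, of 1]]
        segment_integral_tendsto_0[OF dec[OF i] hol[OF i] closedA[OF i] _ segA[OF i, of "-1"]]]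
    unfolding seg_def by simp
  have "((\<lambda>S. \<Sum>i\<in>I. contour_integral (truncate (\<gamma> i) S) (f i) + seg i S) \<longlongrightarrow>
      (\<Sum>i\<in>I. integral UNIV (line_integrand (\<gamma> i) (f i)) + 0)) at_top"
    using line_integral_tendsto[OF \<gamma> hol closedA rangeA decays_strip_imp_along[OF dec]] seg0
    by (intro tendsto_sum tendsto_add) auto
  moreover have "\<forall>\<^sub>F S in at_top. (\<Sum>i\<in>I. contour_integral (truncate (\<gamma> i) S) (f i) + seg i S) = 0"
  proof -
    have "\<forall>\<^sub>F S in at_top. \<forall>i\<in>I. contour_integral (truncate (\<gamma> i) S) (f i) + seg i S
        + contour_integral (linepath (of_real S * w + d) (- of_real S * w + d)) (f i)
        = 2 * pi * \<i> * (\<Sum>p\<in>B i. N p S * residue (f i) p)"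
      using I loop by (intro eventually_ball_finite) auto
    thus ?thesis
    proof eventually_elim
      case (elim S)
      hence "(\<Sum>i\<in>I. contour_integral (truncate (\<gamma> i) S) (f i) + seg i S
        + contour_integral (linepath (of_real S * w + d) (- of_real S * w + d)) (f i)) =
        (\<Sum>i\<in>I. 2 * pi * \<i> * (\<Sum>p\<in>B i. N p S * residue (f i) p))"
        by (intro sum.cong) auto
      also have "\<dots> = 0"
        unfolding sum_distrib_left[symmetric] res_total by simp
      finally show ?case using line_total[of S] by (simp add: sum.distrib)
    qed
  qed
  ultimately have "((\<lambda>_. 0) \<longlongrightarrow> (\<Sum>i\<in>I. integral UNIV (line_integrand (\<gamma> i) (f i)) + 0)) (at_top :: real filter)"
    by (rule Lim_transform_eventually)
  hence "(\<Sum>i\<in>I. integral UNIV (line_integrand (\<gamma> i) (f i)) + 0) = 0"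
    by (simp add: tendsto_const_iff)
  thus ?thesis by simp
qed

section \<open>Growth of a quotient of Gamma functions\<close>

text \<open>Comparison of a sum with an integral: r / (r^2 + v^2) is the derivative of arctan (v /
  r), so the bounds telescope over unit steps of v. The factor 3 pays for replacing the intermediate
  point by v, which uses r \<ge> 1.\<close>

lemma inverse_square_le_arctan:
  fixes r v :: real
  assumes "1 \<le> r"
  shows "1 / (v\<^sup>2 + r\<^sup>2) \<le> 3 / r * (arctan ((v + 1) / r) - arctan (v / r))"
proof -
  have r: "r > 0" "r\<^sup>2 \<ge> 1" using assms by (auto simp: one_le_power)
  have "\<exists>z. v < z \<and> z < v + 1 \<and> arctan ((v + 1) / r) - arctan (v / r) = (v + 1 - v) * (r / (r\<^sup>2 + z\<^sup>2))"
  proof (rule MVT2)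
    fix x show "((\<lambda>v. arctan (v / r)) has_real_derivative r / (r\<^sup>2 + x\<^sup>2)) (at x)"
      using r by (auto intro!: derivative_eq_intros simp: field_simps power2_eq_square)
  qed simp
  then obtain z where z: "v < z" "z < v + 1" "arctan ((v + 1) / r) - arctan (v / r) = r / (r\<^sup>2 + z\<^sup>2)"
    by auto
  have "z\<^sup>2 \<le> 2 * v\<^sup>2 + 2 * (z - v)\<^sup>2"
    using zero_le_power2[of "z - 2 * v"] by (simp add: power2_eq_square algebra_simps)
  also have "\<dots> \<le> 2 * v\<^sup>2 + 2 * 1" using z(1,2) by (simp add: power_le_one)
  finally have 1: "z\<^sup>2 \<le> 2 * v\<^sup>2 + 2 * 1" .
  have "R + Z \<le> 3 * (V + R)" if "Z \<le> 2 * V + 2 * 1" "1 \<le> R" "0 \<le> V" for R Z V :: real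
    using that by simp
  from this[OF 1 r(2) zero_le_power2] have "r\<^sup>2 + z\<^sup>2 \<le> 3 * (v\<^sup>2 + r\<^sup>2)" .
  moreover have "0 < r\<^sup>2 + z\<^sup>2" "0 < v\<^sup>2 + r\<^sup>2" using r by (auto intro: add_pos_nonneg add_nonneg_pos)
  ultimately have "1 / (v\<^sup>2 + r\<^sup>2) \<le> 3 / (r\<^sup>2 + z\<^sup>2)" by (simp add: field_simps)
  also have "\<dots> = 3 / r * (r / (r\<^sup>2 + z\<^sup>2))" using r by simp
  finally show ?thesis unfolding z(3) .
qed

lemma
  fixes r x :: real
  assumes "1 \<le> r"
  shows summable_inverse_square_shift: "summable (\<lambda>n. 1 / ((x + real n)\<^sup>2 + r\<^sup>2))"
    and suminf_inverse_square_shift_le: "(\<Sum>n. 1 / ((x + real n)\<^sup>2 + r\<^sup>2)) \<le> 3 * pi / r"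
proof -
  have bound: "(\<Sum>n<N. 1 / ((x + real n)\<^sup>2 + r\<^sup>2)) \<le> 3 * pi / r" for N
  proof -
    have "(\<Sum>n<N. 1 / ((x + real n)\<^sup>2 + r\<^sup>2)) \<le>
        (\<Sum>n<N. 3 / r * (arctan ((x + real (Suc n)) / r) - arctan ((x + real n) / r)))"
    proof (rule sum_mono)
      fix n
      have "x + real (Suc n) = x + real n + 1" by simp
      thus "1 / ((x + real n)\<^sup>2 + r\<^sup>2) \<le> 3 / r * (arctan ((x + real (Suc n)) / r) - arctan ((x + real n) / r))"
        using inverse_square_le_arctan[OF assms, of "x + real n"] by (simp only:)
    qed
    also have "\<dots> = 3 / r * (arctan ((x + real N) / r) - arctan (x / r))"
      by (simp only: sum_distrib_left[symmetric] sum_lessThan_telescope[where f = "\<lambda>n. arctan ((x + real n) / r)"]) simp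
    also have "\<dots> \<le> 3 / r * pi"
      using assms arctan_bounded[of "(x + real N) / r"] arctan_bounded[of "x / r"]
      by (intro mult_left_mono) auto
    finally show ?thesis by simp
  qed
  show 1: "summable (\<lambda>n. 1 / ((x + real n)\<^sup>2 + r\<^sup>2))"
    by (rule summableI_nonneg_bounded[OF _ bound]) simp
  show "(\<Sum>n. 1 / ((x + real n)\<^sup>2 + r\<^sup>2)) \<le> 3 * pi / r"
    by (rule suminf_le_const[OF 1 bound])
qed

text \<open>The difference is the series of a / ((z + n) (z + a + n)), dominated by means of 1 / (p
  q) \<le> 1 / p^2 + 1 / q^2. What matters is that the bound tends to 0 as the imaginary parts grow,
  uniformly in the real parts.\<close>

lemma norm_Digamma_diff_le:
  fixes z a :: complex
  assumes z: "1 \<le> \<bar>Im z\<bar>" and za: "1 \<le> \<bar>Im (z + a)\<bar>"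
  shows "norm (Digamma (z + a) - Digamma z) \<le> norm a * (3 * pi / \<bar>Im z\<bar> + 3 * pi / \<bar>Im (z + a)\<bar>)"
proof -
  define g where "g n = 1 / ((Re z + real n)\<^sup>2 + \<bar>Im z\<bar>\<^sup>2) + 1 / ((Re (z + a) + real n)\<^sup>2 + \<bar>Im (z + a)\<bar>\<^sup>2)" for n
  have nz: "z + of_nat n \<noteq> 0" "z + a + of_nat n \<noteq> 0" for n
    using z za by (auto simp: complex_eq_iff)
  have z0: "z \<noteq> 0" "z + a \<noteq> 0" using nz[of 0] by auto
  have g: "summable g"
    unfolding g_def by (intro summable_add summable_inverse_square_shift z za)
  have sums: "(\<lambda>n. a / ((z + of_nat n) * (z + a + of_nat n))) sums (Digamma (z + a) - Digamma z)"
  proof -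
    have "(\<lambda>n. (inverse (of_nat (Suc n)) - inverse (z + a + of_nat n)) -
              (inverse (of_nat (Suc n)) - inverse (z + of_nat n))) sums
          ((\<Sum>n. inverse (of_nat (Suc n)) - inverse (z + a + of_nat n)) -
           (\<Sum>n. inverse (of_nat (Suc n)) - inverse (z + of_nat n)))"
      by (intro sums_diff summable_sums summable_Digamma z0)
    moreover have "(inverse (of_nat (Suc n)) - inverse (z + a + of_nat n)) -
              (inverse (of_nat (Suc n)) - inverse (z + of_nat n)) = a / ((z + of_nat n) * (z + a + of_nat n))" for n
    proof -
      have "inverse (z + of_nat n) - inverse (z + a + of_nat n) = a / ((z + of_nat n) * (z + a + of_nat n))"
        using nz[of n] by (simp add: field_simps)
      thus ?thesis by simp
    qed
    ultimately show ?thesis by (simp add: Digamma_def)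
  qed
  have bound: "norm (a / ((z + of_nat n) * (z + a + of_nat n))) \<le> norm a * g n" for n
  proof -
    have sq: "norm (x + of_nat n) ^ 2 = (Re x + real n)\<^sup>2 + \<bar>Im x\<bar>\<^sup>2" for x :: complex
      by (simp add: cmod_power2)
    have "1 / (p * q) \<le> 1 / p\<^sup>2 + 1 / q\<^sup>2" if "p > 0" "q > 0" for p q :: real
    proof -
      have "0 \<le> (1 / p - 1 / q)\<^sup>2 + (1 / p\<^sup>2 + 1 / q\<^sup>2)" by simp
      thus ?thesis by (simp add: power2_diff power_divide)
    qed
    from this[of "norm (z + of_nat n)" "norm (z + a + of_nat n)"]
    have "1 / (norm (z + of_nat n) * norm (z + a + of_nat n)) \<le> g n"
      using nz[of n] unfolding g_def sq by simp
    from mult_left_mono[OF this, of "norm a"] show ?thesis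
      by (simp add: norm_divide norm_mult)
  qed
  have "norm (Digamma (z + a) - Digamma z) \<le> (\<Sum>n. norm a * g n)"
    by (rule norm_sums_le[OF sums summable_sums[OF summable_mult[OF g]] bound])
  also have "\<dots> = norm a * (\<Sum>n. g n)" by (rule suminf_mult[OF g])
  also have "(\<Sum>n. g n) \<le> 3 * pi / \<bar>Im z\<bar> + 3 * pi / \<bar>Im (z + a)\<bar>"
    unfolding g_def
    by (subst suminf_add[symmetric])
       (intro summable_inverse_square_shift add_mono suminf_inverse_square_shift_le z za)+
  finally show ?thesis by (simp add: mult_left_mono)
qed

text \<open>Logarithmic derivative of the reflection formula for Gamma.\<close>

lemma Digamma_reflection:
  fixes z :: complex
  assumes "z \<notin> \<int>"
  shows "Digamma (1 - z) - Digamma z = pi * cot (pi * z)"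
proof -
  have nz: "z \<notin> \<int>\<^sub>\<le>\<^sub>0" "1 - z \<notin> \<int>\<^sub>\<le>\<^sub>0"
  proof -
    have "1 - z \<notin> \<int>" using assms Ints_diff[OF Ints_1, of "1 - z"] by auto
    thus "z \<notin> \<int>\<^sub>\<le>\<^sub>0" "1 - z \<notin> \<int>\<^sub>\<le>\<^sub>0" using assms nonpos_Ints_Int by blast+
  qed
  have s: "sin (of_real pi * z) \<noteq> 0"
    using assms by (subst sin_eq_0) (auto simp: Ints_def)
  have 1: "((\<lambda>z. Gamma z * Gamma (1 - z)) has_field_derivative
      Gamma z * Gamma (1 - z) * (Digamma z - Digamma (1 - z))) (at z)"
    using nz by (auto intro!: derivative_eq_intros simp: algebra_simps)
  have 2: "((\<lambda>z. of_real pi / sin (of_real pi * z)) has_field_derivative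
      - (of_real pi / sin (of_real pi * z)) * (pi * cot (pi * z))) (at z)"
    using s by (auto intro!: derivative_eq_intros simp: cot_def field_simps power2_eq_square)
  have "(\<lambda>z::complex. Gamma z * Gamma (1 - z)) = (\<lambda>z. of_real pi / sin (of_real pi * z))"
    using Gamma_reflection_complex by (auto simp: fun_eq_iff)
  with 1 have "((\<lambda>z. of_real pi / sin (of_real pi * z)) has_field_derivative
      Gamma z * Gamma (1 - z) * (Digamma z - Digamma (1 - z))) (at z)" by simp
  from DERIV_unique[OF this 2]
  have "of_real pi / sin (of_real pi * z) * ((Digamma z - Digamma (1 - z)) + pi * cot (pi * z)) = 0"
    by (simp only: Gamma_reflection_complex distrib_left minus_mult_left[symmetric] left_minus)
  moreover have "of_real pi / sin (of_real pi * z) \<noteq> 0" using s by simp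
  ultimately have "(Digamma z - Digamma (1 - z)) + pi * cot (pi * z) = 0"
    by (simp only: mult_eq_0_iff simp_thms)
  thus ?thesis by (simp add: algebra_simps)
qed

lemma cot_exp_eq:
  fixes u :: complex
  assumes "exp (2 * pi * \<i> * u) \<noteq> 1"
  shows "pi * cot (pi * u) = pi * \<i> * (exp (2 * pi * \<i> * u) + 1) / (exp (2 * pi * \<i> * u) - 1)"
proof -
  define e where "e = exp (\<i> * (pi * u))"
  have e0: "e \<noteq> 0" by (simp add: e_def)
  define p where "p = e * e"
  have p: "exp (2 * pi * \<i> * u) = p"
    unfolding e_def p_def exp_add[symmetric] by (simp add: algebra_simps)
  have em: "exp (- (\<i> * (pi * u))) = 1 / e" by (simp add: e_def exp_minus inverse_eq_divide)
  have S: "sin (of_real pi * u) = (p - 1) / (2 * \<i> * e)"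
    unfolding sin_exp_eq em e_def[symmetric] p_def using e0 by (simp add: field_simps)
  have C: "cos (of_real pi * u) = (p + 1) / (2 * e)"
    unfolding cos_exp_eq em e_def[symmetric] p_def using e0 by (simp add: field_simps)
  have "p - 1 \<noteq> 0" using assms p by simp
  thus ?thesis unfolding p cot_def S C using e0 by (simp add: field_simps)
qed

lemma norm_exp_2pi_i: "norm (exp (2 * pi * \<i> * u)) = exp (- (2 * pi) * Im u)"
  by simp

lemma exp_2pi_i_neq_1:
  assumes "Im u \<noteq> 0"
  shows "exp (2 * pi * \<i> * u) \<noteq> 1"
proof
  assume "exp (2 * pi * \<i> * u) = 1"
  hence "exp (- (2 * pi) * Im u) = 1" using norm_exp_2pi_i[of u] by (simp only: norm_one)
  thus False using assms by simp
qed

text \<open>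
  By the reflection formula, \<open>Theta c k x\<close> is $\Gamma(\frac{x-k}{-c}) / \Gamma(\frac{x}{-c})$ divided by
  $1 - e^{2\pi i x/c}$, without the artificial singularities of that quotient at $c\mathbb{Z}$
  (lemma \<open>Theta_eq_Gamma_quotient\<close>). \<open>LTheta\<close> is its logarithmic derivative, which yields its exponential type.
\<close>

definition Theta :: "complex \<Rightarrow> complex \<Rightarrow> complex \<Rightarrow> complex" where
  "Theta c k x = Gamma ((k - x) / c) * exp (- (pi * \<i> * x / c)) * Gamma (1 + x / c) / (2 * pi * \<i>)"

definition LTheta :: "complex \<Rightarrow> complex \<Rightarrow> complex \<Rightarrow> complex" where
  "LTheta c k x = (Digamma (1 + x / c) - Digamma ((k - x) / c) - pi * \<i>) / c"

text \<open>The poles accumulate only in the directions of \<open>c\<close> and - c, along which Im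
  (x / c) stays bounded. The two filters leave every such strip, one on either side.\<close>

abbreviation far_up :: "complex \<Rightarrow> complex filter" where
  "far_up c \<equiv> filtercomap (\<lambda>x. Im (x / c)) at_top"

abbreviation far_down :: "complex \<Rightarrow> complex filter" where
  "far_down c \<equiv> filtercomap (\<lambda>x. Im (x / c)) at_bot"

lemma has_field_derivative_Theta:
  assumes "c \<noteq> 0" "Im ((k - x) / c) \<noteq> 0" "Im (x / c) \<noteq> 0"
  shows "(Theta c k has_field_derivative Theta c k x * LTheta c k x) (at x)"
proof -
  have "(k - x) / c \<notin> \<int>\<^sub>\<le>\<^sub>0" "1 + x / c \<notin> \<int>\<^sub>\<le>\<^sub>0"
  proof -
    have "Im z = 0" if "z \<in> \<int>\<^sub>\<le>\<^sub>0" for z :: complex using that by (auto elim!: nonpos_Ints_cases)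
    from this[of "(k - x) / c"] this[of "1 + x / c"] assms
    show "(k - x) / c \<notin> \<int>\<^sub>\<le>\<^sub>0" "1 + x / c \<notin> \<int>\<^sub>\<le>\<^sub>0" by auto
  qed
  thus ?thesis unfolding Theta_def [abs_def] LTheta_def using assms(1)
    by (auto intro!: derivative_eq_intros simp: divide_simps) (auto simp: algebra_simps)
qed

text \<open>Reflection replaces Digamma (1 + x / c) by Digamma (- x / c), so that the two Digamma
  arguments differ by the constant k / c. The remaining term is a function of \<open>q\<close> alone
  and has a limit on either side.\<close>

lemma LTheta_eq:
  assumes c: "c \<noteq> 0" and u: "Im (x / c) \<noteq> 0"
  defines "q \<equiv> exp (2 * pi * \<i> * (x / c))"
  shows "LTheta c k x = (Digamma (- (x / c)) - Digamma (- (x / c) + k / c) - 2 * pi * \<i> * (q / (q - 1))) / c"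
proof -
  define u where "u = x / c"
  have nI: "- u \<notin> \<int>" using u by (auto simp: u_def elim!: Ints_cases)
  have q1: "exp (2 * pi * \<i> * u) \<noteq> 1"
    using exp_2pi_i_neq_1 u unfolding u_def .
  have "Digamma (1 + u) = Digamma (- u) + pi * cot (pi * (- u))"
    using Digamma_reflection[OF nI] by (simp add: algebra_simps)
  also have "pi * cot (pi * (- u)) = - (pi * cot (pi * u))" by (simp add: cot_def)
  also have "pi * cot (pi * u) = pi * \<i> * (q + 1) / (q - 1)"
    using cot_exp_eq[OF q1] unfolding q_def u_def .
  also have "\<dots> = 2 * pi * \<i> * (q / (q - 1)) - pi * \<i>"
    using q1 unfolding q_def u_def[symmetric] by (simp add: divide_simps) (simp add: algebra_simps)
  finally have "Digamma (1 + u) = Digamma (- u) - (2 * pi * \<i> * (q / (q - 1)) - pi * \<i>)" by simp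
  moreover have "(k - x) / c = - u + k / c" using c by (simp add: u_def diff_divide_distrib)
  ultimately show ?thesis unfolding LTheta_def u_def[symmetric] by simp
qed

lemma eventually_far_up: "eventually P (far_up c) \<longleftrightarrow> (\<exists>M. \<forall>x. Im (x / c) \<ge> M \<longrightarrow> P x)"
  and eventually_far_down: "eventually P (far_down c) \<longleftrightarrow> (\<exists>M. \<forall>x. Im (x / c) \<le> M \<longrightarrow> P x)"
  by (auto simp: eventually_filtercomap_at_top_linorder eventually_filtercomap_at_bot_linorder)

lemma far_filters_shift:
  "filterlim (\<lambda>t. t - a) (far_up c) (far_up c)"
  "filterlim (\<lambda>t. t - a) (far_down c) (far_down c)"
proof -
  have *: "Im ((t - a) / c) = Im (t / c) - Im (a / c)" for t by (simp add: diff_divide_distrib)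
  show "filterlim (\<lambda>t. t - a) (far_up c) (far_up c)"
    unfolding filterlim_iff eventually_far_up
  proof safe
    fix P M assume "\<forall>x. M \<le> Im (x / c) \<longrightarrow> P x"
    thus "\<exists>M. \<forall>x. M \<le> Im (x / c) \<longrightarrow> P (x - a)"
      by (intro exI[of _ "M + Im (a / c)"]) (simp add: *)
  qed
  show "filterlim (\<lambda>t. t - a) (far_down c) (far_down c)"
    unfolding filterlim_iff eventually_far_down
  proof safe
    fix P M assume "\<forall>x. Im (x / c) \<le> M \<longrightarrow> P x"
    thus "\<exists>M. \<forall>x. Im (x / c) \<le> M \<longrightarrow> P (x - a)"
      by (intro exI[of _ "M + Im (a / c)"]) (simp add: *)
  qed
qed

lemma Digamma_diff_tendsto:
  assumes F: "filterlim (\<lambda>x. \<bar>Im (x / c)\<bar>) at_top F"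
  shows "((\<lambda>x. Digamma (- (x / c)) - Digamma (- (x / c) + a)) \<longlongrightarrow> 0) F"
proof (rule Lim_null_comparison)
  have F2: "filterlim (\<lambda>x. \<bar>Im (- (x / c) + a)\<bar>) at_top F"
  proof (rule filterlim_at_top_mono)
    show "filterlim (\<lambda>x. - \<bar>Im a\<bar> + \<bar>Im (x / c)\<bar>) at_top F"
      by (rule filterlim_tendsto_add_at_top[OF tendsto_const F])
    show "\<forall>\<^sub>F x in F. - \<bar>Im a\<bar> + \<bar>Im (x / c)\<bar> \<le> \<bar>Im (- (x / c) + a)\<bar>"
      by (intro always_eventually allI) (simp del: times_divide_eq_right)
  qed
  have lim: "((\<lambda>x. 3 * pi / g x) \<longlongrightarrow> 0) F" if "filterlim g at_top F" for g :: "complex \<Rightarrow> real"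
    by (rule real_tendsto_divide_at_top[OF tendsto_const that])
  have "((\<lambda>x. norm a * (3 * pi / \<bar>Im (x / c)\<bar> + 3 * pi / \<bar>Im (- (x / c) + a)\<bar>)) \<longlongrightarrow> norm a * (0 + 0)) F"
    by (intro tendsto_intros lim F F2)
  thus "((\<lambda>x. norm a * (3 * pi / \<bar>Im (x / c)\<bar> + 3 * pi / \<bar>Im (- (x / c) + a)\<bar>)) \<longlongrightarrow> 0) F" by simp
  have "\<forall>\<^sub>F x in F. 1 \<le> \<bar>Im (x / c)\<bar>" "\<forall>\<^sub>F x in F. 1 \<le> \<bar>Im (- (x / c) + a)\<bar>"
    using F F2 unfolding filterlim_at_top by blast+
  thus "\<forall>\<^sub>F x in F. norm (Digamma (- (x / c)) - Digamma (- (x / c) + a))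
      \<le> norm a * (3 * pi / \<bar>Im (x / c)\<bar> + 3 * pi / \<bar>Im (- (x / c) + a)\<bar>)"
  proof eventually_elim
    case (elim x)
    thus ?case using norm_Digamma_diff_le[of "- (x / c)" a] by (simp only: norm_minus_commute uminus_complex.sel abs_minus_cancel)
  qed
qed

text \<open>Here \<open>q\<close> tends to 0, so a factor \<open>Theta\<close> has exponential type
  0 on this side.\<close>

lemma LTheta_tendsto_up:
  assumes c: "c \<noteq> 0"
  shows "(LTheta c k \<longlongrightarrow> 0) (far_up c)"
proof -
  let ?q = "\<lambda>x. exp (2 * pi * \<i> * (x / c))"
  have Im_top: "filterlim (\<lambda>x. Im (x / c)) at_top (far_up c)" by (rule filterlim_filtercomap)
  have abs_top: "filterlim (\<lambda>x. \<bar>Im (x / c)\<bar>) at_top (far_up c)"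
    by (rule filterlim_compose[OF filterlim_abs_real Im_top])
  have "((\<lambda>x. exp (- (2 * pi) * Im (x / c))) \<longlongrightarrow> 0) (far_up c)"
    by (rule filterlim_compose[OF exp_at_bot filterlim_tendsto_neg_mult_at_bot[OF tendsto_const _ Im_top]]) simp
  hence "((\<lambda>x. norm (?q x)) \<longlongrightarrow> 0) (far_up c)" by (simp only: norm_exp_2pi_i)
  hence q: "(?q \<longlongrightarrow> 0) (far_up c)" by (rule tendsto_norm_zero_cancel)
  have "((\<lambda>x. (Digamma (- (x / c)) - Digamma (- (x / c) + k / c) - 2 * pi * \<i> * (?q x / (?q x - 1))) / c)
      \<longlongrightarrow> (0 - 2 * pi * \<i> * (0 / (0 - 1))) / c) (far_up c)"
    by (intro tendsto_intros Digamma_diff_tendsto[OF abs_top] q) (use c in auto)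
  moreover have "\<forall>\<^sub>F x in far_up c. (Digamma (- (x / c)) - Digamma (- (x / c) + k / c) - 2 * pi * \<i> * (?q x / (?q x - 1))) / c = LTheta c k x"
    unfolding eventually_far_up using LTheta_eq[OF c] by (intro exI[of _ 1]) auto
  ultimately show ?thesis by (auto dest: Lim_transform_eventually)
qed

text \<open>Here \<open>q\<close> tends to infinity and q / (q - 1) to 1. Each of the 2n factors
  \<open>Theta\<close> contributes this limit at one end and nothing at the other, which is the
  origin of 2n in the degree condition.\<close>

lemma LTheta_tendsto_down:
  assumes c: "c \<noteq> 0"
  shows "(LTheta c k \<longlongrightarrow> - (2 * pi * \<i> / c)) (far_down c)"
proof -
  let ?q = "\<lambda>x. exp (2 * pi * \<i> * (x / c))"
  have Im_bot: "filterlim (\<lambda>x. Im (x / c)) at_bot (far_down c)" by (rule filterlim_filtercomap)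
  have abs_top: "filterlim (\<lambda>x. \<bar>Im (x / c)\<bar>) at_top (far_down c)"
    using filterlim_compose[OF filterlim_uminus_at_top_at_bot Im_bot]
    by (rule filterlim_at_top_mono) (auto intro!: always_eventually)
  have "((\<lambda>x. exp ((2 * pi) * Im (x / c))) \<longlongrightarrow> 0) (far_down c)"
    by (rule filterlim_compose[OF exp_at_bot filterlim_tendsto_pos_mult_at_bot[OF tendsto_const _ Im_bot]]) simp
  moreover have "norm (inverse (?q x)) = exp ((2 * pi) * Im (x / c))" for x
    by (subst norm_inverse, subst norm_exp_2pi_i, subst exp_minus[symmetric]) simp
  ultimately have "((\<lambda>x. norm (inverse (?q x))) \<longlongrightarrow> 0) (far_down c)" by (simp only:)
  hence q: "((\<lambda>x. inverse (?q x)) \<longlongrightarrow> 0) (far_down c)" by (rule tendsto_norm_zero_cancel)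
  have "((\<lambda>x. (Digamma (- (x / c)) - Digamma (- (x / c) + k / c) - 2 * pi * \<i> * (1 / (1 - inverse (?q x)))) / c)
      \<longlongrightarrow> (0 - 2 * pi * \<i> * (1 / (1 - 0))) / c) (far_down c)"
    by (intro tendsto_intros Digamma_diff_tendsto[OF abs_top] q) (use c in auto)
  moreover have "\<forall>\<^sub>F x in far_down c. (Digamma (- (x / c)) - Digamma (- (x / c) + k / c) - 2 * pi * \<i> * (1 / (1 - inverse (?q x)))) / c = LTheta c k x"
  proof -
    have "(Digamma (- (x / c)) - Digamma (- (x / c) + k / c) - 2 * pi * \<i> * (1 / (1 - inverse (?q x)))) / c = LTheta c k x"
      if "Im (x / c) \<le> -1" for x
    proof -
      have "1 / (1 - inverse y) = y / (y - 1)" if "y \<noteq> 0" for y :: complex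
        using that by (cases "y = 1") (auto simp: divide_simps)
      from this[of "?q x"] have "1 / (1 - inverse (?q x)) = ?q x / (?q x - 1)" by simp
      thus ?thesis using LTheta_eq[OF c, of x k] that by simp
    qed
    thus ?thesis unfolding eventually_far_down by blast
  qed
  ultimately show ?thesis by (auto dest: Lim_transform_eventually)
qed

section \<open>Exponential decay with explicit rates\<close>

text \<open>The rate is explicit and may be negative, so that growing factors such as exponentials
  and t itself are treated by adding rates.\<close>

definition decays_rate :: "complex \<Rightarrow> real \<Rightarrow> (complex \<Rightarrow> complex) \<Rightarrow> bool" where
  "decays_rate w \<delta> f \<longleftrightarrow> (\<forall>B. \<exists>C S. \<forall>(s::real) b. S \<le> \<bar>s\<bar> \<and> norm b \<le> B \<longrightarrow>
     norm (f (of_real s * w + b)) \<le> C * exp (- \<delta> * \<bar>s\<bar>))"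

lemma decays_rateE:
  assumes "decays_rate w \<delta> f"
  obtains C S where "C \<ge> 0" "S \<ge> 0"
    "\<And>(s::real) b. S \<le> \<bar>s\<bar> \<Longrightarrow> norm b \<le> B \<Longrightarrow> norm (f (of_real s * w + b)) \<le> C * exp (- \<delta> * \<bar>s\<bar>)"
proof -
  obtain C S where *: "\<And>(s::real) b. S \<le> \<bar>s\<bar> \<Longrightarrow> norm b \<le> B \<Longrightarrow>
      norm (f (of_real s * w + b)) \<le> C * exp (- \<delta> * \<bar>s\<bar>)"
    using assms unfolding decays_rate_def by metis
  show ?thesis
  proof (rule that[of "max C 0" "max S 0"])
    fix s :: real and b :: complex assume "max S 0 \<le> \<bar>s\<bar>" "norm b \<le> B"
    hence "norm (f (of_real s * w + b)) \<le> C * exp (- \<delta> * \<bar>s\<bar>)" by (intro *) auto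
    also have "\<dots> \<le> max C 0 * exp (- \<delta> * \<bar>s\<bar>)" by (intro mult_right_mono) auto
    finally show "norm (f (of_real s * w + b)) \<le> max C 0 * exp (- \<delta> * \<bar>s\<bar>)" .
  qed simp_all
qed

lemma decays_rate_mult:
  assumes "decays_rate w \<delta>1 f" "decays_rate w \<delta>2 g"
  shows "decays_rate w (\<delta>1 + \<delta>2) (\<lambda>t. f t * g t)"
  unfolding decays_rate_def
proof
  fix B
  obtain C1 S1 where 1: "C1 \<ge> 0" "S1 \<ge> 0" "\<And>(s::real) b. S1 \<le> \<bar>s\<bar> \<Longrightarrow> norm b \<le> B \<Longrightarrow>
      norm (f (of_real s * w + b)) \<le> C1 * exp (- \<delta>1 * \<bar>s\<bar>)"
    using decays_rateE[OF assms(1)] by metis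
  obtain C2 S2 where 2: "C2 \<ge> 0" "S2 \<ge> 0" "\<And>(s::real) b. S2 \<le> \<bar>s\<bar> \<Longrightarrow> norm b \<le> B \<Longrightarrow>
      norm (g (of_real s * w + b)) \<le> C2 * exp (- \<delta>2 * \<bar>s\<bar>)"
    using decays_rateE[OF assms(2)] by metis
  have "norm (f (of_real s * w + b) * g (of_real s * w + b)) \<le> (C1 * C2) * exp (- (\<delta>1 + \<delta>2) * \<bar>s\<bar>)"
    if "max S1 S2 \<le> \<bar>s\<bar>" "norm b \<le> B" for s :: real and b
  proof -
    have "norm (f (of_real s * w + b) * g (of_real s * w + b)) \<le>
        (C1 * exp (- \<delta>1 * \<bar>s\<bar>)) * (C2 * exp (- \<delta>2 * \<bar>s\<bar>))"
      unfolding norm_mult using 1 2 that by (intro mult_mono) auto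
    also have "\<dots> = (C1 * C2) * exp (- (\<delta>1 + \<delta>2) * \<bar>s\<bar>)"
      by (simp add: algebra_simps flip: exp_add)
    finally show ?thesis .
  qed
  thus "\<exists>C S. \<forall>(s::real) b. S \<le> \<bar>s\<bar> \<and> norm b \<le> B \<longrightarrow>
     norm (f (of_real s * w + b) * g (of_real s * w + b)) \<le> C * exp (- (\<delta>1 + \<delta>2) * \<bar>s\<bar>)"
    by blast
qed

lemma decays_rate_mono:
  assumes "decays_rate w \<delta> f" "\<delta>' \<le> \<delta>"
  shows "decays_rate w \<delta>' f"
  unfolding decays_rate_def
proof
  fix B
  obtain C S where 1: "C \<ge> 0" "S \<ge> 0" "\<And>(s::real) b. S \<le> \<bar>s\<bar> \<Longrightarrow> norm b \<le> B \<Longrightarrow>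
      norm (f (of_real s * w + b)) \<le> C * exp (- \<delta> * \<bar>s\<bar>)"
    using decays_rateE[OF assms(1)] by metis
  have "C * exp (- \<delta> * \<bar>s\<bar>) \<le> C * exp (- \<delta>' * \<bar>s\<bar>)" for s
    using 1(1) assms(2) by (intro mult_left_mono) (auto intro: mult_right_mono)
  thus "\<exists>C S. \<forall>(s::real) b. S \<le> \<bar>s\<bar> \<and> norm b \<le> B \<longrightarrow>
     norm (f (of_real s * w + b)) \<le> C * exp (- \<delta>' * \<bar>s\<bar>)"
    using 1(3) by (meson order_trans)
qed

lemma decays_rate_add:
  assumes "decays_rate w \<delta> f" "decays_rate w \<delta> g"
  shows "decays_rate w \<delta> (\<lambda>t. f t + g t)"
  unfolding decays_rate_def
proof
  fix B
  obtain C1 S1 where 1: "C1 \<ge> 0" "S1 \<ge> 0" "\<And>(s::real) b. S1 \<le> \<bar>s\<bar> \<Longrightarrow> norm b \<le> B \<Longrightarrow>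
      norm (f (of_real s * w + b)) \<le> C1 * exp (- \<delta> * \<bar>s\<bar>)"
    using decays_rateE[OF assms(1)] by metis
  obtain C2 S2 where 2: "C2 \<ge> 0" "S2 \<ge> 0" "\<And>(s::real) b. S2 \<le> \<bar>s\<bar> \<Longrightarrow> norm b \<le> B \<Longrightarrow>
      norm (g (of_real s * w + b)) \<le> C2 * exp (- \<delta> * \<bar>s\<bar>)"
    using decays_rateE[OF assms(2)] by metis
  have "norm (f (of_real s * w + b) + g (of_real s * w + b)) \<le> (C1 + C2) * exp (- \<delta> * \<bar>s\<bar>)"
    if "max S1 S2 \<le> \<bar>s\<bar>" "norm b \<le> B" for s :: real and b
    using 1(3)[of s b] 2(3)[of s b] that norm_triangle_ineq[of "f (of_real s * w + b)" "g (of_real s * w + b)"]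
    by (simp add: distrib_right)
  thus "\<exists>C S. \<forall>(s::real) b. S \<le> \<bar>s\<bar> \<and> norm b \<le> B \<longrightarrow>
     norm (f (of_real s * w + b) + g (of_real s * w + b)) \<le> C * exp (- \<delta> * \<bar>s\<bar>)"
    by blast
qed

lemma decays_rate_0: "decays_rate w \<delta> (\<lambda>_. 0)"
  unfolding decays_rate_def by (intro allI exI[of _ 0]) simp

lemma decays_rate_sum:
  "(\<And>i. i \<in> I \<Longrightarrow> decays_rate w \<delta> (f i)) \<Longrightarrow> decays_rate w \<delta> (\<lambda>t. \<Sum>i\<in>I. f i t)"
  by (induction I rule: infinite_finite_induct) (simp_all add: decays_rate_0 decays_rate_add)

lemma decays_rate_bounded:
  assumes w: "w \<noteq> 0" and "\<forall>\<^sub>F t in at_infinity. norm (f t) \<le> M"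
  shows "decays_rate w 0 f"
  unfolding decays_rate_def
proof
  fix B
  obtain r where r: "\<And>t. r \<le> norm t \<Longrightarrow> norm (f t) \<le> M"
    using assms(2) unfolding eventually_at_infinity by blast
  have "norm (f (of_real s * w + b)) \<le> M * exp (- 0 * \<bar>s\<bar>)"
    if "(r + B) / norm w \<le> \<bar>s\<bar>" "norm b \<le> B" for s :: real and b
  proof -
    have "r + B \<le> norm (of_real s * w)" using that w by (simp add: norm_mult field_simps)
    hence "r \<le> norm (of_real s * w + b)" using norm_diff_ineq[of "of_real s * w" b] that(2) by linarith
    thus ?thesis using r by simp
  qed
  thus "\<exists>C S. \<forall>(s::real) b. S \<le> \<bar>s\<bar> \<and> norm b \<le> B \<longrightarrow>
     norm (f (of_real s * w + b)) \<le> C * exp (- 0 * \<bar>s\<bar>)"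
    by blast
qed

lemma decays_rate_exp: "decays_rate w (- norm (q * w)) (\<lambda>t. exp (q * t))"
  unfolding decays_rate_def
proof
  fix B
  have "norm (exp (q * (of_real s * w + b))) \<le> exp (norm q * B) * exp (- (- norm (q * w)) * \<bar>s\<bar>)"
    if "norm b \<le> B" for s :: real and b
  proof -
    have "Re (q * (of_real s * w + b)) \<le> norm (q * (of_real s * w + b))" by (rule complex_Re_le_cmod)
    also have "\<dots> = norm (q * w * of_real s + q * b)" by (simp add: algebra_simps)
    also have "\<dots> \<le> norm (q * w * of_real s) + norm (q * b)" by (rule norm_triangle_ineq)
    also have "\<dots> \<le> norm (q * w) * \<bar>s\<bar> + norm q * B"
      using that by (simp add: norm_mult mult_left_mono)
    finally show ?thesis by (simp add: add.commute flip: exp_add)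
  qed
  thus "\<exists>C S. \<forall>(s::real) b. S \<le> \<bar>s\<bar> \<and> norm b \<le> B \<longrightarrow>
     norm (exp (q * (of_real s * w + b))) \<le> C * exp (- (- norm (q * w)) * \<bar>s\<bar>)"
    by blast
qed

text \<open>A Gronwall argument: along the ray the squared modulus of T * exp (\<delta> * s) has
  nonpositive derivative, because Re (v * \<Lambda>) + \<delta> \<le> 0. The initial values are
  bounded uniformly in \<open>b\<close>, since \<open>b\<close> ranges over a compact ball.\<close>

lemma decays_rate_ray:
  fixes T \<Lambda> :: "complex \<Rightarrow> complex" and v :: complex
  assumes der: "\<And>(s::real) b. s0 \<le> s \<Longrightarrow> norm b \<le> B \<Longrightarrow>
      (T has_field_derivative T (of_real s * v + b) * \<Lambda> (of_real s * v + b)) (at (of_real s * v + b))"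
    and neg: "\<And>(s::real) b. s0 \<le> s \<Longrightarrow> norm b \<le> B \<Longrightarrow> Re (v * \<Lambda> (of_real s * v + b)) \<le> - \<delta>"
  obtains C where "C \<ge> 0" "\<And>(s::real) b. s0 \<le> s \<Longrightarrow> norm b \<le> B \<Longrightarrow>
      norm (T (of_real s * v + b)) \<le> C * exp (- \<delta> * s)"
proof -
  have "continuous_on (cball 0 B) (\<lambda>b::complex. T (of_real s0 * v + b))"
  proof (intro continuous_at_imp_continuous_on ballI)
    fix b :: complex assume "b \<in> cball 0 B"
    hence "isCont T (of_real s0 * v + b)" using der[of s0 b] by (intro DERIV_isCont) auto
    thus "isCont (\<lambda>b. T (of_real s0 * v + b)) b"
      by (rule isCont_o2[rotated]) (intro continuous_intros)
  qed
  hence "bounded ((\<lambda>b::complex. T (of_real s0 * v + b)) ` cball 0 B)"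
    by (intro compact_imp_bounded compact_continuous_image) auto
  then obtain K where K: "\<And>b::complex. norm b \<le> B \<Longrightarrow> norm (T (of_real s0 * v + b)) \<le> K"
    unfolding bounded_iff by fastforce
  have main: "norm (T (of_real s * v + b)) \<le> (max K 0 * exp (\<delta> * s0)) * exp (- \<delta> * s)"
    if s: "s0 \<le> s" and b: "norm b \<le> B" for s :: real and b :: complex
  proof -
    define h where "h s = T (of_real s * v + b) * exp (of_real (\<delta> * s))" for s
    \<comment> \<open>The squared modulus is differentiable also at zeros of \<open>T\<close>, where
      the logarithm of the modulus is not defined.\<close>
    define N where "N s = (Re (h s))\<^sup>2 + (Im (h s))\<^sup>2" for s
    have hd: "(h has_vector_derivative h s * (v * \<Lambda> (of_real s * v + b) + of_real \<delta>)) (at s)" if "s0 \<le> s" for s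
    proof -
      have 1: "((\<lambda>z. T (z * v + b) * exp (of_real \<delta> * z)) has_field_derivative
          T (of_real s * v + b) * (exp (of_real \<delta> * of_real s) * of_real \<delta>)
          + T (of_real s * v + b) * \<Lambda> (of_real s * v + b) * v * exp (of_real \<delta> * of_real s)) (at (of_real s))"
      proof -
        have "((\<lambda>z. T (z * v + b)) has_field_derivative
            T (of_real s * v + b) * \<Lambda> (of_real s * v + b) * v) (at (of_real s))"
          by (rule DERIV_chain2[where f = T and g = "\<lambda>z. z * v + b", OF der[OF that b]])
             (auto intro!: derivative_eq_intros)
        moreover have "((\<lambda>z. exp (of_real \<delta> * z)) has_field_derivative exp (of_real \<delta> * of_real s) * of_real \<delta>)
            (at (of_real s :: complex))"
          by (auto intro!: derivative_eq_intros)
        ultimately show ?thesis by (rule DERIV_mult')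
      qed
      have 2: "(of_real has_vector_derivative 1) (at s)"
        using has_vector_derivative_of_real[OF DERIV_ident] by simp
      from field_vector_diff_chain_at[OF 2 1] show ?thesis
        unfolding h_def [abs_def] by (simp add: o_def algebra_simps)
    qed
    have Nd: "(N has_real_derivative 2 * N s * (Re (v * \<Lambda> (of_real s * v + b)) + \<delta>)) (at s)" if "s0 \<le> s" for s
    proof -
      let ?d = "h s * (v * \<Lambda> (of_real s * v + b) + of_real \<delta>)"
      have r: "((\<lambda>s. Re (h s)) has_real_derivative Re ?d) (at s)"
        using bounded_linear.has_vector_derivative[OF bounded_linear_Re hd[OF that]]
        by (simp add: has_real_derivative_iff_has_vector_derivative)
      have i: "((\<lambda>s. Im (h s)) has_real_derivative Im ?d) (at s)"
        using bounded_linear.has_vector_derivative[OF bounded_linear_Im hd[OF that]]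
        by (simp add: has_real_derivative_iff_has_vector_derivative)
      have "(N has_real_derivative 2 * Re (h s) * Re ?d + 2 * Im (h s) * Im ?d) (at s)"
        unfolding N_def [abs_def] by (rule derivative_eq_intros r i refl)+ simp
      also have "2 * Re (h s) * Re ?d + 2 * Im (h s) * Im ?d = 2 * N s * (Re (v * \<Lambda> (of_real s * v + b)) + \<delta>)"
        by (simp add: N_def power2_eq_square algebra_simps)
      finally show ?thesis .
    qed
    have "N s \<le> N s0"
    proof (rule DERIV_nonpos_imp_nonincreasing[OF s])
      fix x assume x: "s0 \<le> x"
      have "2 * N x * (Re (v * \<Lambda> (of_real x * v + b)) + \<delta>) \<le> 0"
        using neg[OF x b] by (intro mult_nonneg_nonpos) (auto simp: N_def)
      thus "\<exists>y. (N has_real_derivative y) (at x) \<and> y \<le> 0" using Nd[OF x] by blast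
    qed
    hence "norm (h s) \<le> norm (h s0)" unfolding N_def cmod_def by simp
    moreover have "norm (h x) = norm (T (of_real x * v + b)) * exp (\<delta> * x)" for x
      by (simp add: h_def norm_mult)
    ultimately have "norm (T (of_real s * v + b)) * exp (\<delta> * s) \<le> norm (T (of_real s0 * v + b)) * exp (\<delta> * s0)"
      by simp
    also have "\<dots> \<le> max K 0 * exp (\<delta> * s0)" using K[OF b] by (intro mult_right_mono) auto
    finally have "norm (T (of_real s * v + b)) * exp (\<delta> * s) * exp (- \<delta> * s) \<le> max K 0 * exp (\<delta> * s0) * exp (- \<delta> * s)"
      by (intro mult_right_mono) auto
    moreover have "exp (\<delta> * s) * exp (- \<delta> * s) = 1" by (simp flip: exp_add)
    ultimately show ?thesis by (simp only: mult.assoc mult_1_right)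
  qed
  show ?thesis by (rule that[OF _ main]) simp_all
qed

section \<open>The integrand\<close>

lemma Im_add_of_real_mult: "Im (z + of_real s * z') = Im z + s * Im z'"
  by simp

lemma ray_far_down:
  assumes v: "Im (v / c) < 0" and P: "eventually P (far_down c)"
  obtains s0 where "s0 \<ge> 0" "\<And>(s::real) b. s0 \<le> s \<Longrightarrow> norm b \<le> B \<Longrightarrow> P (of_real s * v + b)"
proof -
  obtain M where M: "\<And>x. Im (x / c) \<le> M \<Longrightarrow> P x" using P unfolding eventually_far_down by blast
  define s0 where "s0 = (M - B / norm c) / Im (v / c)"
  show ?thesis
  proof (rule that[of "max s0 0"])
    fix s :: real and b :: complex assume s: "max s0 0 \<le> s" and b: "norm b \<le> B"
    have "s * Im (v / c) \<le> s0 * Im (v / c)" using s v by (intro mult_right_mono_neg) auto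
    also have "\<dots> = M - B / norm c" using v by (simp add: s0_def)
    finally have "s * Im (v / c) \<le> M - B / norm c" .
    moreover have "Im (b / c) \<le> B / norm c"
    proof -
      have "Im (b / c) \<le> norm (b / c)" using abs_Im_le_cmod[of "b / c"] by linarith
      also have "\<dots> \<le> B / norm c" using b by (simp add: norm_divide divide_right_mono)
      finally show ?thesis .
    qed
    moreover have "Im ((of_real s * v + b) / c) = s * Im (v / c) + Im (b / c)"
    proof -
      have "(of_real s * v + b) / c = b / c + of_real s * (v / c)" by (simp add: add_divide_distrib)
      thus ?thesis by (simp only: Im_add_of_real_mult add.commute)
    qed
    ultimately show "P (of_real s * v + b)" by (intro M) linarith
  qed simp
qed

lemma far_up_uminus: "eventually P (far_up c) \<longleftrightarrow> eventually (\<lambda>x. P x) (far_down (- c))"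
  unfolding eventually_far_up eventually_far_down
proof safe
  fix M assume "\<forall>x. M \<le> Im (x / c) \<longrightarrow> P x"
  thus "\<exists>M. \<forall>x. Im (x / - c) \<le> M \<longrightarrow> P x" by (intro exI[of _ "- M"]) (simp add: minus_divide_right[symmetric])
next
  fix M assume "\<forall>x. Im (x / - c) \<le> M \<longrightarrow> P x"
  thus "\<exists>M. \<forall>x. M \<le> Im (x / c) \<longrightarrow> P x" by (intro exI[of _ "- M"]) (simp add: minus_divide_right[symmetric])
qed

text \<open>For e = m - lam, a = y and b = - y this is the contribution to \<phi> W of one monomial
  of exponent m; the denominator of W is absorbed into \<open>Theta\<close>.\<close>

definition kernel :: "nat \<Rightarrow> complex \<Rightarrow> complex \<Rightarrow> complex \<Rightarrow> (nat \<Rightarrow> complex) \<Rightarrow> (nat \<Rightarrow> complex) \<Rightarrow> complex \<Rightarrow> complex" where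
  "kernel n c k e a b t = exp (2 * pi * \<i> * e / c * t) * (\<Prod>p=1..n. Theta c k (t - a p) * Theta c k (t - b p))"

definition Lkernel :: "nat \<Rightarrow> complex \<Rightarrow> complex \<Rightarrow> complex \<Rightarrow> (nat \<Rightarrow> complex) \<Rightarrow> (nat \<Rightarrow> complex) \<Rightarrow> complex \<Rightarrow> complex" where
  "Lkernel n c k e a b t = 2 * pi * \<i> * e / c + (\<Sum>p=1..n. LTheta c k (t - a p) + LTheta c k (t - b p))"

lemma has_field_derivative_kernel:
  assumes c: "c \<noteq> 0"
    and "\<And>z. z \<in> a ` {1..n} \<union> b ` {1..n} \<Longrightarrow> Im ((k - (t - z)) / c) \<noteq> 0 \<and> Im ((t - z) / c) \<noteq> 0"
  shows "(kernel n c k e a b has_field_derivative kernel n c k e a b t * Lkernel n c k e a b t) (at t)"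
proof -
  have th: "((\<lambda>t. Theta c k (t - z)) has_field_derivative Theta c k (t - z) * LTheta c k (t - z)) (at t)"
    if "z \<in> a ` {1..n} \<union> b ` {1..n}" for z
  proof -
    have "((\<lambda>t. Theta c k (t - z)) has_field_derivative Theta c k (t - z) * LTheta c k (t - z) * 1) (at t)"
      by (rule DERIV_chain2[where f = "Theta c k" and g = "\<lambda>t. t - z"], rule has_field_derivative_Theta[OF c])
         (use assms(2)[OF that] in \<open>auto intro!: derivative_eq_intros\<close>)
    thus ?thesis by simp
  qed
  have pr: "((\<lambda>t. \<Prod>p\<in>S. Theta c k (t - a p) * Theta c k (t - b p)) has_field_derivative
      (\<Prod>p\<in>S. Theta c k (t - a p) * Theta c k (t - b p)) * (\<Sum>p\<in>S. LTheta c k (t - a p) + LTheta c k (t - b p))) (at t)"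
    if "finite S" "S \<subseteq> {1..n}" for S
    using that
  proof (induction S rule: finite_induct)
    case (insert p S)
    have 1: "((\<lambda>t. Theta c k (t - a p)) has_field_derivative Theta c k (t - a p) * LTheta c k (t - a p)) (at t)"
       "((\<lambda>t. Theta c k (t - b p)) has_field_derivative Theta c k (t - b p) * LTheta c k (t - b p)) (at t)"
      using insert.prems by (auto intro!: th)
    have 2: "((\<lambda>t. \<Prod>p\<in>S. Theta c k (t - a p) * Theta c k (t - b p)) has_field_derivative
      (\<Prod>p\<in>S. Theta c k (t - a p) * Theta c k (t - b p)) * (\<Sum>p\<in>S. LTheta c k (t - a p) + LTheta c k (t - b p))) (at t)"
      using insert by simp
    show ?case
      using DERIV_mult'[OF DERIV_mult'[OF 1] 2] insert.hyps by (simp add: algebra_simps)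
  qed simp
  have "((\<lambda>t. exp (2 * pi * \<i> * e / c * t)) has_field_derivative exp (2 * pi * \<i> * e / c * t) * (2 * pi * \<i> * e / c)) (at t)"
    by (rule derivative_eq_intros refl)+ simp
  from DERIV_mult'[OF this pr[of "{1..n}"]] show ?thesis
    unfolding kernel_def [abs_def] Lkernel_def by (simp add: algebra_simps)
qed

lemma eventually_kernel_derivative:
  assumes c: "c \<noteq> 0"
  shows "\<forall>\<^sub>F t in far_up c. (kernel n c k e a b has_field_derivative kernel n c k e a b t * Lkernel n c k e a b t) (at t)"
    and "\<forall>\<^sub>F t in far_down c. (kernel n c k e a b has_field_derivative kernel n c k e a b t * Lkernel n c k e a b t) (at t)"
proof -
  let ?Z = "a ` {1..n} \<union> b ` {1..n}"
  obtain M where M: "\<And>z. z \<in> ?Z \<Longrightarrow> \<bar>Im (z / c)\<bar> + \<bar>Im (k / c)\<bar> \<le> M"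
  proof (rule that)
    fix z assume "z \<in> ?Z"
    thus "\<bar>Im (z / c)\<bar> + \<bar>Im (k / c)\<bar> \<le> Max ((\<lambda>z. \<bar>Im (z / c)\<bar> + \<bar>Im (k / c)\<bar>) ` ?Z)"
      by (intro Max_ge) auto
  qed
  have "(kernel n c k e a b has_field_derivative kernel n c k e a b t * Lkernel n c k e a b t) (at t)"
    if t: "\<bar>Im (t / c)\<bar> > M" for t
  proof (rule has_field_derivative_kernel[OF c])
    fix z assume z: "z \<in> ?Z"
    have "Im ((k - (t - z)) / c) = Im (k / c) - Im (t / c) + Im (z / c)" "Im ((t - z) / c) = Im (t / c) - Im (z / c)"
      by (simp_all add: diff_divide_distrib)
    thus "Im ((k - (t - z)) / c) \<noteq> 0 \<and> Im ((t - z) / c) \<noteq> 0" using M[OF z] t by linarith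
  qed
  thus "\<forall>\<^sub>F t in far_up c. (kernel n c k e a b has_field_derivative kernel n c k e a b t * Lkernel n c k e a b t) (at t)"
    "\<forall>\<^sub>F t in far_down c. (kernel n c k e a b has_field_derivative kernel n c k e a b t * Lkernel n c k e a b t) (at t)"
    unfolding eventually_far_up eventually_far_down
    by (intro exI[of _ "\<bar>M\<bar> + 1"] exI[of _ "- \<bar>M\<bar> - 1"], auto)+
qed

lemma Lkernel_tendsto:
  assumes c: "c \<noteq> 0"
  shows "(Lkernel n c k e a b \<longlongrightarrow> 2 * pi * \<i> * e / c) (far_up c)"
    and "(Lkernel n c k e a b \<longlongrightarrow> 2 * pi * \<i> * (e - 2 * of_nat n) / c) (far_down c)"
proof -
  have "((\<lambda>t. LTheta c k (t - z)) \<longlongrightarrow> 0) (far_up c)"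
       "((\<lambda>t. LTheta c k (t - z)) \<longlongrightarrow> - (2 * pi * \<i> / c)) (far_down c)" for z
    by (rule filterlim_compose[OF LTheta_tendsto_up[OF c] far_filters_shift(1)]
             filterlim_compose[OF LTheta_tendsto_down[OF c] far_filters_shift(2)])+
  note * = this
  have "((\<lambda>t. 2 * pi * \<i> * e / c + (\<Sum>p=1..n. LTheta c k (t - a p) + LTheta c k (t - b p))) \<longlongrightarrow>
      2 * pi * \<i> * e / c + (\<Sum>p=1..n. 0 + 0)) (far_up c)"
    by (intro tendsto_intros *)
  thus "(Lkernel n c k e a b \<longlongrightarrow> 2 * pi * \<i> * e / c) (far_up c)"
    by (simp add: Lkernel_def [abs_def])
  have "((\<lambda>t. 2 * pi * \<i> * e / c + (\<Sum>p=1..n. LTheta c k (t - a p) + LTheta c k (t - b p))) \<longlongrightarrow>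
      2 * pi * \<i> * e / c + (\<Sum>p=1..n. - (2 * pi * \<i> / c) + - (2 * pi * \<i> / c))) (far_down c)"
    by (intro tendsto_intros *)
  moreover have "2 * pi * \<i> * e / c + (\<Sum>p=1..n. - (2 * pi * \<i> / c) + - (2 * pi * \<i> / c)) =
      2 * pi * \<i> * (e - 2 * of_nat n) / c"
    using c by (simp add: field_simps)
  ultimately show "(Lkernel n c k e a b \<longlongrightarrow> 2 * pi * \<i> * (e - 2 * of_nat n) / c) (far_down c)"
    by (simp add: Lkernel_def [abs_def])
qed

lemma kernel_ray:
  assumes F: "\<forall>\<^sub>F t in far_down d. (K has_field_derivative K t * \<Lambda> t) (at t)"
    and L: "(\<Lambda> \<longlongrightarrow> l) (far_down d)" and v: "Im (v / d) < 0" and \<delta>: "Re (v * l) < - \<delta>"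
  shows "\<exists>C S. \<forall>(s::real) b. S \<le> s \<and> norm b \<le> B \<longrightarrow> norm (K (of_real s * v + b)) \<le> C * exp (- \<delta> * s)"
proof -
  have "((\<lambda>t. Re (v * \<Lambda> t)) \<longlongrightarrow> Re (v * l)) (far_down d)" by (intro tendsto_intros L)
  hence "\<forall>\<^sub>F t in far_down d. Re (v * \<Lambda> t) < - \<delta>" using \<delta> by (rule order_tendstoD(2))
  with F have ev: "\<forall>\<^sub>F t in far_down d. (K has_field_derivative K t * \<Lambda> t) (at t) \<and> Re (v * \<Lambda> t) < - \<delta>"
    by (rule eventually_conj)
  obtain s0 where s0: "\<And>(s::real) b. s0 \<le> s \<Longrightarrow> norm b \<le> B \<Longrightarrow>
      (K has_field_derivative K (of_real s * v + b) * \<Lambda> (of_real s * v + b)) (at (of_real s * v + b))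
        \<and> Re (v * \<Lambda> (of_real s * v + b)) < - \<delta>"
    by (rule ray_far_down[OF v ev, of B]) blast
  have der: "(K has_field_derivative K (of_real s * v + b) * \<Lambda> (of_real s * v + b)) (at (of_real s * v + b))"
    and neg: "Re (v * \<Lambda> (of_real s * v + b)) \<le> - \<delta>" if "s0 \<le> s" "norm b \<le> B" for s :: real and b :: complex
    using s0[OF that] by auto
  obtain C where "C \<ge> 0" "\<And>(s::real) b. s0 \<le> s \<Longrightarrow> norm b \<le> B \<Longrightarrow> norm (K (of_real s * v + b)) \<le> C * exp (- \<delta> * s)"
    using decays_rate_ray[OF der neg] by blast
  thus ?thesis by blast
qed

text \<open>The right end runs into the half-plane where each \<open>Theta\<close> has type - 2 pi i
  / c, the left end into the one where it has type 0. So the two hypotheses on \<open>e\<close> say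
  that exp (2 pi i (e - 2n) t / c) decays on the right and exp (2 pi i e t / c) on the left.\<close>

lemma kernel_decays:
  assumes wc: "Im (w / c) < 0" and e: "Im (e * (w / c)) < 0" "Im ((e - 2 * of_nat n) * (w / c)) > 0"
  shows "\<exists>\<delta>>0. decays_rate w \<delta> (kernel n c k e a b)"
proof -
  have c: "c \<noteq> 0" using wc by auto
  define \<delta> where "\<delta> = min (- Im (e * (w / c))) (Im ((e - 2 * of_nat n) * (w / c)))"
  have \<delta>: "\<delta> > 0" "Im (e * (w / c)) \<le> - \<delta>" "Im ((e - 2 * of_nat n) * (w / c)) \<ge> \<delta>" using e by (auto simp: \<delta>_def)
  \<comment> \<open>The limits of the logarithmic derivative give the rate 2 pi \<delta>; the gap to
    \<delta> leaves room for the approach to the limit.\<close>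
  have pi1: "\<delta> < 2 * pi * \<delta>" using \<delta>(1) pi_gt3 by simp
  have ReIm: "Re (2 * pi * \<i> * x) = - 2 * pi * Im x" for x by simp
  have "decays_rate w \<delta> (kernel n c k e a b)"
    unfolding decays_rate_def
  proof
    fix B
    have "\<exists>C S. \<forall>(s::real) b'. S \<le> s \<and> norm b' \<le> B \<longrightarrow> norm (kernel n c k e a b (of_real s * w + b')) \<le> C * exp (- \<delta> * s)"
    proof (rule kernel_ray[OF eventually_kernel_derivative(2)[OF c] Lkernel_tendsto(2)[OF c] wc])
      have "w * (2 * pi * \<i> * (e - 2 * of_nat n) / c) = 2 * pi * \<i> * ((e - 2 * of_nat n) * (w / c))" by simp
      hence "Re (w * (2 * pi * \<i> * (e - 2 * of_nat n) / c)) = - 2 * pi * Im ((e - 2 * of_nat n) * (w / c))"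
        by (simp only: ReIm)
      moreover have "2 * pi * \<delta> \<le> 2 * pi * Im ((e - 2 * of_nat n) * (w / c))"
        using \<delta>(3) by (intro mult_left_mono) auto
      ultimately show "Re (w * (2 * pi * \<i> * (e - 2 * of_nat n) / c)) < - \<delta>" using pi1 by linarith
    qed
    then obtain C1 S1 where 1: "\<And>(s::real) b'. S1 \<le> s \<Longrightarrow> norm b' \<le> B \<Longrightarrow>
        norm (kernel n c k e a b (of_real s * w + b')) \<le> C1 * exp (- \<delta> * s)" by metis
    \<comment> \<open>The left end is a ray in direction - w, and the far upper side with respect to
      \<open>c\<close> is the far lower side with respect to - c.\<close>
    have "\<exists>C S. \<forall>(s::real) b'. S \<le> s \<and> norm b' \<le> B \<longrightarrow> norm (kernel n c k e a b (of_real s * (- w) + b')) \<le> C * exp (- \<delta> * s)"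
    proof (rule kernel_ray[where d = "- c"])
      show "\<forall>\<^sub>F t in far_down (- c). (kernel n c k e a b has_field_derivative kernel n c k e a b t * Lkernel n c k e a b t) (at t)"
        using eventually_kernel_derivative(1)[OF c] unfolding far_up_uminus .
      have "far_up c = far_down (- c)" by (rule filter_eq_iff[THEN iffD2]) (simp add: far_up_uminus)
      thus "(Lkernel n c k e a b \<longlongrightarrow> 2 * pi * \<i> * e / c) (far_down (- c))"
        using Lkernel_tendsto(1)[OF c] by simp
      show "Im (- w / - c) < 0" using wc by simp
      have "- w * (2 * pi * \<i> * e / c) = - (2 * pi * \<i> * (e * (w / c)))" by simp
      hence "Re (- w * (2 * pi * \<i> * e / c)) = 2 * pi * Im (e * (w / c))"
        by (simp only: ReIm uminus_complex.sel minus_mult_left[symmetric] minus_minus)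
      moreover have "2 * pi * Im (e * (w / c)) \<le> 2 * pi * (- \<delta>)"
        using \<delta>(2) by (intro mult_left_mono) auto
      ultimately show "Re (- w * (2 * pi * \<i> * e / c)) < - \<delta>" using pi1 by linarith
    qed
    then obtain C2 S2 where 2: "\<And>(s::real) b'. S2 \<le> s \<Longrightarrow> norm b' \<le> B \<Longrightarrow>
        norm (kernel n c k e a b (of_real s * (- w) + b')) \<le> C2 * exp (- \<delta> * s)" by metis
    have "norm (kernel n c k e a b (of_real s * w + b')) \<le> max C1 C2 * exp (- \<delta> * \<bar>s\<bar>)"
      if s: "max S1 S2 \<le> \<bar>s\<bar>" and b': "norm b' \<le> B" for s :: real and b'
    proof (cases "s \<ge> 0")
      case True
      hence "norm (kernel n c k e a b (of_real s * w + b')) \<le> C1 * exp (- \<delta> * \<bar>s\<bar>)" using 1[of s b'] s b' by simp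
      also have "\<dots> \<le> max C1 C2 * exp (- \<delta> * \<bar>s\<bar>)" by (intro mult_right_mono) auto
      finally show ?thesis .
    next
      case False
      hence "norm (kernel n c k e a b (of_real s * w + b')) \<le> C2 * exp (- \<delta> * \<bar>s\<bar>)" using 2[of "- s" b'] s b' by simp
      also have "\<dots> \<le> max C1 C2 * exp (- \<delta> * \<bar>s\<bar>)" by (intro mult_right_mono) auto
      finally show ?thesis .
    qed
    thus "\<exists>C S. \<forall>(s::real) b'. S \<le> \<bar>s\<bar> \<and> norm b' \<le> B \<longrightarrow>
       norm (kernel n c k e a b (of_real s * w + b')) \<le> C * exp (- \<delta> * \<bar>s\<bar>)" by blast
  qed
  thus ?thesis using \<delta>(1) by blast
qed

text \<open>
  The product $\varphi W$, where the exponents and the coefficients of $P$ are \<open>D\<close> and \<open>cf\<close>, with two independent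
  families \<open>a\<close>, \<open>b\<close> in place of $y$ and $-y$: a shift $y_m \mapsto y_m - c$ moves only one of them at a time.
\<close>

definition psi :: "nat \<Rightarrow> complex \<Rightarrow> complex \<Rightarrow> complex \<Rightarrow> nat set \<Rightarrow> (nat \<Rightarrow> complex)
    \<Rightarrow> (nat \<Rightarrow> complex) \<Rightarrow> (nat \<Rightarrow> complex) \<Rightarrow> complex \<Rightarrow> complex" where
  "psi n c k lam D cf a b t = (\<Sum>m\<in>D. cf m * kernel n c k (of_nat m - lam) a b t)"

lemma psi_decays:
  assumes wc: "Im (w / c) < 0" and D: "finite D"
    and e: "\<And>m. m \<in> D \<Longrightarrow> Im ((of_nat m - lam) * (w / c)) < 0"
      "\<And>m. m \<in> D \<Longrightarrow> Im ((of_nat m - lam - 2 * of_nat n) * (w / c)) > 0"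
  shows "\<exists>\<delta>>0. decays_rate w \<delta> (psi n c k lam D cf a b)"
proof -
  have "w \<noteq> 0" using wc by auto
  have "\<forall>m\<in>D. \<exists>\<delta>>0. decays_rate w \<delta> (kernel n c k (of_nat m - lam) a b)"
    using kernel_decays[OF wc e] by blast
  then obtain \<delta> where \<delta>: "\<And>m. m \<in> D \<Longrightarrow> \<delta> m > 0" "\<And>m. m \<in> D \<Longrightarrow> decays_rate w (\<delta> m) (kernel n c k (of_nat m - lam) a b)"
    by metis
  \<comment> \<open>The 1 keeps the minimum defined when \<open>D\<close> is empty.\<close>
  define d where "d = Min (insert 1 (\<delta> ` D))"
  have d: "d > 0" "\<And>m. m \<in> D \<Longrightarrow> d \<le> \<delta> m" unfolding d_def using D \<delta>(1) by auto
  have "decays_rate w d (psi n c k lam D cf a b)"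
    unfolding psi_def [abs_def]
  proof (rule decays_rate_sum)
    fix m assume m: "m \<in> D"
    have "decays_rate w 0 (\<lambda>_. cf m)"
      by (rule decays_rate_bounded[OF \<open>w \<noteq> 0\<close>, of _ "norm (cf m)"]) simp
    from decays_rate_mult[OF this decays_rate_mono[OF \<delta>(2)[OF m] d(2)[OF m]]]
    show "decays_rate w d (\<lambda>t. cf m * kernel n c k (of_nat m - lam) a b t)" by simp
  qed
  thus ?thesis using d(1) by blast
qed

section \<open>Pole sets and the functional equation of Theta\<close>

definition up_set :: "complex \<Rightarrow> complex \<Rightarrow> complex set \<Rightarrow> complex set" where
  "up_set c k Z = {z + k + c * of_nat l | z l. z \<in> Z}"

text \<open>
  The progression starts at \<open>z - c\<close>: the poles of $\varphi W g_j$ at \<open>z\<close> itself come only from $g_j$.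
\<close>

definition low_set :: "complex \<Rightarrow> complex set \<Rightarrow> complex set" where
  "low_set c Z = {z - c - c * of_nat l | z l. z \<in> Z}"

text \<open>As \<open>e\<close> is not parallel to \<open>w\<close>, the absolute height of the l-th
  term grows linearly in l, so each strip contains finitely many terms.\<close>

lemma strip_finite_progression:
  assumes "finite Z" "Im (e / w) \<noteq> 0"
  shows "strip_finite w {z + e * of_nat l | z l. z \<in> Z}"
proof -
  have "strip_finite w {z + e * of_nat l | l. True}" for z
    unfolding strip_finite_def
  proof
    fix R
    have "l \<le> nat \<lceil>(R + \<bar>Im (z / w)\<bar>) / \<bar>Im (e / w)\<bar>\<rceil>" if "\<bar>Im ((z + e * of_nat l) / w)\<bar> \<le> R" for l :: nat
    proof -
      have "(z + e * of_nat l) / w = z / w + of_real (real l) * (e / w)" by (simp add: add_divide_distrib)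
      hence "Im ((z + e * of_nat l) / w) = Im (z / w) + real l * Im (e / w)"
        by (simp only: Im_add_of_real_mult)
      hence "\<bar>real l * Im (e / w)\<bar> \<le> R + \<bar>Im (z / w)\<bar>" using that by linarith
      hence "real l * \<bar>Im (e / w)\<bar> \<le> R + \<bar>Im (z / w)\<bar>" by (simp add: abs_mult)
      moreover have "0 < \<bar>Im (e / w)\<bar>" using assms(2) by simp
      ultimately have "real l \<le> (R + \<bar>Im (z / w)\<bar>) / \<bar>Im (e / w)\<bar>" by (simp only: pos_le_divide_eq)
      thus ?thesis by linarith
    qed
    hence "{p \<in> {z + e * of_nat l | l. True}. \<bar>Im (p / w)\<bar> \<le> R} \<subseteq>
        (\<lambda>l. z + e * of_nat l) ` {..nat \<lceil>(R + \<bar>Im (z / w)\<bar>) / \<bar>Im (e / w)\<bar>\<rceil>}"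
      by blast
    thus "finite {p \<in> {z + e * of_nat l | l. True}. \<bar>Im (p / w)\<bar> \<le> R}" by (rule finite_subset) simp
  qed
  hence "strip_finite w (\<Union>z\<in>Z. {z + e * of_nat l | l. True})" using assms(1) by (intro strip_finite_UN)
  also have "(\<Union>z\<in>Z. {z + e * of_nat l | l. True}) = {z + e * of_nat l | z l. z \<in> Z}" by blast
  finally show ?thesis .
qed

lemma strip_finite_Un: "strip_finite w A \<Longrightarrow> strip_finite w B \<Longrightarrow> strip_finite w (A \<union> B)"
proof -
  assume A: "strip_finite w A" and B: "strip_finite w B"
  have "{p \<in> A \<union> B. \<bar>Im (p / w)\<bar> \<le> R} = {p \<in> A. \<bar>Im (p / w)\<bar> \<le> R} \<union> {p \<in> B. \<bar>Im (p / w)\<bar> \<le> R}" for R by blast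
  thus ?thesis using A B unfolding strip_finite_def by simp
qed

lemma strip_finite_finite: "finite A \<Longrightarrow> strip_finite w A"
  by (simp add: strip_finite_def)

lemma Im_inverse_sign:
  assumes "Im (w / c) < 0"
  shows "Im (c / w) > 0"
proof -
  have "c / w = inverse (w / c)" by simp
  hence "Im (c / w) = - Im (w / c) / ((Re (w / c))\<^sup>2 + (Im (w / c))\<^sup>2)" by (simp only: inverse_complex.sel)
  moreover have "(Re (w / c))\<^sup>2 + (Im (w / c))\<^sup>2 > 0" using assms by (simp add: sum_power2_gt_zero_iff)
  ultimately show ?thesis using assms by (simp add: divide_neg_pos)
qed

lemma strip_finite_up_low:
  assumes "Im (w / c) < 0" "finite Z"
  shows "strip_finite w (up_set c k Z)" "strip_finite w (low_set c Z)"
proof -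
  note pos = Im_inverse_sign[OF assms(1)]
  have "strip_finite w {z + c * of_nat l | z l. z \<in> (\<lambda>z. z + k) ` Z}"
    by (rule strip_finite_progression) (use pos assms(2) in auto)
  moreover have "up_set c k Z = {z + c * of_nat l | z l. z \<in> (\<lambda>z. z + k) ` Z}"
    unfolding up_set_def by blast
  ultimately show "strip_finite w (up_set c k Z)" by (simp only:)
  have "strip_finite w {z + (- c) * of_nat l | z l. z \<in> (\<lambda>z. z - c) ` Z}"
    by (rule strip_finite_progression) (use pos assms(2) in \<open>auto simp flip: minus_divide_left\<close>)
  moreover have "low_set c Z = {z + (- c) * of_nat l | z l. z \<in> (\<lambda>z. z - c) ` Z}"
    unfolding low_set_def by auto
  ultimately show "strip_finite w (low_set c Z)" by (simp only:)
qed

text \<open>The poles of the two Gamma factors of \<open>Theta\<close>. Gamma (1 + x / c) is regular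
  at x = 0, whence the lower family begins at z - c.\<close>

lemma Theta_args:
  assumes c: "c \<noteq> 0"
  shows "(k - (t - z)) / c \<in> \<int>\<^sub>\<le>\<^sub>0 \<longleftrightarrow> t \<in> up_set c k {z}"
    and "1 + (t - z) / c \<in> \<int>\<^sub>\<le>\<^sub>0 \<longleftrightarrow> t \<in> low_set c {z}"
proof -
  have 1: "x \<in> \<int>\<^sub>\<le>\<^sub>0 \<longleftrightarrow> (\<exists>l::nat. x = - of_nat l)" for x :: complex
    by (auto elim!: nonpos_Ints_cases')
  have "(k - (t - z)) / c = - of_nat l \<longleftrightarrow> t = z + k + c * of_nat l" for l :: nat
    using c by (auto simp: field_simps)
  thus "(k - (t - z)) / c \<in> \<int>\<^sub>\<le>\<^sub>0 \<longleftrightarrow> t \<in> up_set c k {z}"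
    unfolding 1 up_set_def by auto
  have "1 + (t - z) / c = - of_nat l \<longleftrightarrow> t = z - c - c * of_nat l" for l :: nat
    using c by (auto simp: field_simps)
  thus "1 + (t - z) / c \<in> \<int>\<^sub>\<le>\<^sub>0 \<longleftrightarrow> t \<in> low_set c {z}"
    unfolding 1 low_set_def by auto
qed

text \<open>Functional equation of both Gamma factors. The sign in t + c - z - k = - c * u is
  compensated by exp (- pi i x / c), which changes sign when x is increased by c.\<close>

lemma Theta_shift:
  assumes c: "c \<noteq> 0" and t: "t + c \<notin> up_set c k {z}" "t \<notin> low_set c {z}"
  shows "Theta c k (t + c - z) * (t + c - z - k) = Theta c k (t - z) * (t + c - z)"
proof -
  define u where "u = (k - (t + c - z)) / c"
  define v where "v = 1 + (t - z) / c"
  have u: "u \<notin> \<int>\<^sub>\<le>\<^sub>0" using t(1) unfolding u_def Theta_args(1)[OF c] .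
  have v: "v \<notin> \<int>\<^sub>\<le>\<^sub>0" using t(2) unfolding v_def Theta_args(2)[OF c] .
  have eqs: "(k - (t - z)) / c = u + 1" "1 + (t + c - z) / c = v + 1" "t + c - z - k = - c * u" "t + c - z = c * v"
    using c by (simp_all add: u_def v_def field_simps)
  have ex: "exp (- (pi * \<i> * (t + c - z) / c)) = - exp (- (pi * \<i> * (t - z) / c))"
  proof -
    have "- (pi * \<i> * (t + c - z) / c) = - (pi * \<i> * (t - z) / c) + - (pi * \<i>)" using c by (simp add: field_simps)
    thus ?thesis by (simp only: exp_add exp_minus[of "pi * \<i>"] exp_pi_i') simp
  qed
  have "Theta c k (t + c - z) * (t + c - z - k) =
      Gamma u * (- exp (- (pi * \<i> * (t - z) / c))) * Gamma (v + 1) / (2 * pi * \<i>) * (- c * u)"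
    unfolding Theta_def u_def[symmetric] eqs(2) ex eqs(3) ..
  also have "\<dots> = (u * Gamma u) * exp (- (pi * \<i> * (t - z) / c)) * Gamma v / (2 * pi * \<i>) * (c * v)"
    unfolding Gamma_plus1[OF v] by simp
  also have "\<dots> = Theta c k (t - z) * (t + c - z)"
    unfolding Theta_def Gamma_plus1[OF u, symmetric] eqs(1)[symmetric] v_def[symmetric] eqs(4) ..
  finally show ?thesis .
qed

lemma holomorphic_Theta:
  assumes "c \<noteq> 0"
  shows "(\<lambda>t. Theta c k (t - z)) holomorphic_on - (up_set c k {z} \<union> low_set c {z})"
  unfolding Theta_def
  by (intro holomorphic_intros) (use assms Theta_args[OF assms] in \<open>auto\<close>)

lemma holomorphic_psi:
  assumes c: "c \<noteq> 0" and Z: "a ` {1..n} \<union> b ` {1..n} \<subseteq> Z"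
  shows "psi n c k lam D cf a b holomorphic_on - (up_set c k Z \<union> low_set c Z)"
  unfolding psi_def [abs_def] kernel_def
proof (intro holomorphic_intros)
  have "(\<lambda>t. Theta c k (t - z)) holomorphic_on - (up_set c k Z \<union> low_set c Z)" if "z \<in> Z" for z
    by (rule holomorphic_on_subset[OF holomorphic_Theta[OF c]])
       (use that in \<open>auto simp: up_set_def low_set_def\<close>)
  thus "(\<lambda>t. Theta c k (t - a p)) holomorphic_on - (up_set c k Z \<union> low_set c Z)"
    "(\<lambda>t. Theta c k (t - b p)) holomorphic_on - (up_set c k Z \<union> low_set c Z)" if "p \<in> {1..n}" for p
    using that Z by blast+
qed

section \<open>Tensors with one distinguished factor\<close>

text \<open>A multiset suffices, since the tensor in the remaining positions is symmetric. The set
  \<open>I\<close> has one element for a single distinguished letter and two for the pair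
  operators.\<close>

definition rest :: "nat \<Rightarrow> idx list \<Rightarrow> nat set \<Rightarrow> idx multiset" where
  "rest n ws I = image_mset (\<lambda>j. ws ! (j - 1)) (mset_set ({1..n} - I))"

definition coef :: "complex \<Rightarrow> complex \<Rightarrow> idx \<Rightarrow> complex" where
  "coef x y l = (if l = Vec 1 then x else 0) + (if l = BarVec 1 then y else 0)"

text \<open>
  \<open>slots n \<tau> a b\<close> has coefficient \<open>a i\<close> at the vector with $v_1$ in position \<open>i\<close> and
  \<open>b i\<close> at the vector with $v_{\bar 1}$ there; \<open>\<tau>\<close> encodes the symmetric tensor in the other positions.
\<close>

definition slots :: "nat \<Rightarrow> (idx multiset \<Rightarrow> complex) \<Rightarrow> (nat \<Rightarrow> complex) \<Rightarrow> (nat \<Rightarrow> complex) \<Rightarrow> tensor" where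
  "slots n \<tau> a b ws = (if length ws = n then
     \<Sum>i=1..n. coef (a i) (b i) (ws ! (i - 1)) * \<tau> (rest n ws {i}) else 0)"

definition swp :: "nat \<Rightarrow> nat \<Rightarrow> nat \<Rightarrow> nat" where
  "swp i j l = (if l = i then j else if l = j then i else l)"

lemma bar_bar [simp]: "bar (bar p) = p" by (cases p) auto

lemma bar_in_labels [simp]: "bar p \<in> labels A \<longleftrightarrow> p \<in> labels A"
  by (cases p) (auto simp: labels_def)

lemma finite_labels [simp]: "finite A \<Longrightarrow> finite (labels A)" by (simp add: labels_def)

lemma nth_update_slot [simp]: "m \<in> {1..n} \<Longrightarrow> length ws = n \<Longrightarrow> ws[m - 1 := q] ! (m - 1) = q"
  by (rule nth_list_update_eq) auto

lemma rest_update_in: "m \<in> I \<Longrightarrow> m \<ge> 1 \<Longrightarrow> rest n (ws[m - 1 := q]) I = rest n ws I"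
  unfolding rest_def
proof (intro image_mset_cong nth_list_update_neq notI)
  fix j assume "m \<in> I" "m \<ge> 1" "j \<in># mset_set ({1..n} - I)" "m - 1 = j - 1"
  moreover from this have "j = m" by auto
  ultimately show False by auto
qed

lemma rest_split: "m \<in> {1..n} \<Longrightarrow> m \<notin> I \<Longrightarrow> rest n ws I = add_mset (ws ! (m - 1)) (rest n ws (insert m I))"
proof -
  assume m: "m \<in> {1..n}" "m \<notin> I"
  have "mset_set ({1..n} - I) = add_mset m (mset_set ({1..n} - I - {m}))"
    using m by (intro mset_set.remove) auto
  moreover have "{1..n} - I - {m} = {1..n} - insert m I" by blast
  ultimately show ?thesis by (simp add: rest_def)
qed

lemma mset_eq_rest: "length ws = n \<Longrightarrow> mset ws = rest n ws {}"
proof -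
  assume n: "length ws = n"
  have "mset ws = mset (map (\<lambda>j. ws ! (j - 1)) [1..<Suc n])"
    by (rule arg_cong[of _ _ mset], rule nth_equalityI) (use n in \<open>auto simp del: upt_Suc\<close>)
  also have "\<dots> = image_mset (\<lambda>j. ws ! (j - 1)) (mset_set {1..<Suc n})"
    by (simp only: mset_map mset_upt)
  also have "{1..<Suc n} = {1..n} - {}" by auto
  finally show ?thesis by (simp only: rest_def)
qed

text \<open>A transposition keeps the multiset of the whole word and carries the letter at
  \<open>swp i j l\<close> to \<open>l\<close>; cancelling this letter gives the second
  equation.\<close>

lemma rest_swap:
  assumes "i \<in> {1..n}" "j \<in> {1..n}" "length ws = n" "l \<in> {1..n}"
  defines "ws' \<equiv> ws[i - 1 := ws ! (j - 1), j - 1 := ws ! (i - 1)]"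
  shows "ws' ! (l - 1) = ws ! (swp i j l - 1)" "rest n ws' {l} = rest n ws {swp i j l}"
proof -
  have nth: "ws' ! (l - 1) = ws ! (swp i j l - 1)" if "l \<in> {1..n}" for l
    using assms that by (auto simp: ws'_def nth_list_update swp_def)
  show "ws' ! (l - 1) = ws ! (swp i j l - 1)" using nth assms by blast
  have len: "length ws' = n" using assms by (simp add: ws'_def)
  have "mset ws' = mset ws" unfolding ws'_def using assms by (intro mset_swap) auto
  hence "rest n ws' {} = rest n ws {}" using mset_eq_rest[OF len] mset_eq_rest[OF assms(3)] by simp
  moreover have "swp i j l \<in> {1..n}" using assms by (auto simp: swp_def)
  ultimately show "rest n ws' {l} = rest n ws {swp i j l}"
    using rest_split[of l n "{}" ws'] rest_split[of "swp i j l" n "{}" ws] nth[OF assms(4)] assms(4) by simp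
qed

lemma slots_cong:
  "(\<And>i. i \<in> {1..n} \<Longrightarrow> a i = a' i) \<Longrightarrow> (\<And>i. i \<in> {1..n} \<Longrightarrow> b i = b' i) \<Longrightarrow> slots n \<tau> a b = slots n \<tau> a' b'"
  unfolding slots_def by (intro ext if_cong sum.cong refl) auto

lemma slots_linear:
  "x * slots n \<tau> a b ws + y * slots n \<tau> a' b' ws = slots n \<tau> (\<lambda>i. x * a i + y * a' i) (\<lambda>i. x * b i + y * b' i) ws"
  by (simp add: slots_def sum_distrib_left sum.distrib[symmetric] coef_def algebra_simps
        cong: sum.cong if_cong) (intro impI sum.cong, auto simp: algebra_simps)

lemma slots_scale: "slots n \<tau> a b ws * x = slots n \<tau> (\<lambda>i. a i * x) (\<lambda>i. b i * x) ws"
  using slots_linear[of x n \<tau> a b ws 0 a b] by (simp add: mult.commute)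

lemma slots_divide: "slots n \<tau> a b ws / x = slots n \<tau> (\<lambda>i. a i / x) (\<lambda>i. b i / x) ws"
  using slots_scale[of n \<tau> a b ws "inverse x"] by (simp add: divide_inverse)

lemma Pi_op_slots:
  assumes "i \<in> {1..n}" "j \<in> {1..n}"
  shows "Pi_op i j (slots n \<tau> a b) = slots n \<tau> (\<lambda>l. a (swp i j l)) (\<lambda>l. b (swp i j l))"
proof
  fix ws
  show "Pi_op i j (slots n \<tau> a b) ws = slots n \<tau> (\<lambda>l. a (swp i j l)) (\<lambda>l. b (swp i j l)) ws"
  proof (cases "length ws = n")
    case True
    let ?ws = "ws[i - 1 := ws ! (j - 1), j - 1 := ws ! (i - 1)]"
    have "Pi_op i j (slots n \<tau> a b) ws =
        (\<Sum>l=1..n. coef (a l) (b l) (ws ! (swp i j l - 1)) * \<tau> (rest n ws {swp i j l}))"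
    proof -
      have "(\<Sum>l=1..n. coef (a l) (b l) (?ws ! (l - 1)) * \<tau> (rest n ?ws {l})) =
         (\<Sum>l=1..n. coef (a l) (b l) (ws ! (swp i j l - 1)) * \<tau> (rest n ws {swp i j l}))"
        by (intro sum.cong refl) (simp only: rest_swap[OF assms True])
      thus ?thesis using True by (simp add: Pi_op_def slots_def)
    qed
    also have "\<dots> = (\<Sum>l=1..n. coef (a (swp i j l)) (b (swp i j l)) (ws ! (l - 1)) * \<tau> (rest n ws {l}))"
      by (rule sum.reindex_bij_witness[of _ "swp i j" "swp i j"]) (use assms in \<open>auto simp: swp_def\<close>)
    finally show ?thesis using True by (simp add: slots_def)
  qed (simp add: Pi_op_def slots_def)
qed

lemma R_op_slots:
  assumes "i \<in> {1..n}" "j \<in> {1..n}"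
  shows "R_op k i j z (slots n \<tau> a b) = slots n \<tau> (\<lambda>l. (z * a l + k * a (swp i j l)) / (z + k))
     (\<lambda>l. (z * b l + k * b (swp i j l)) / (z + k))"
  unfolding R_op_def Pi_op_slots[OF assms] slots_linear slots_divide ..

section \<open>The operators on coefficients of slots\<close>

text \<open>\<tau> stands for the fixed tensor: its symmetry is contained in the multiset argument,
  and the invariance under T, required in the last position only, becomes \<open>bar_inv\<close> for
  every letter.\<close>

locale symmetric_part =
  fixes n N :: nat and \<tau> :: "idx multiset \<Rightarrow> complex"
  assumes N: "1 \<le> N"
    and supp: "\<And>M. \<tau> M \<noteq> 0 \<Longrightarrow> set_mset M \<subseteq> labels {2..N}"
    and bar_inv: "\<And>l M. \<tau> (add_mset (bar l) M) = \<tau> (add_mset l M)"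
begin

lemma Vec1_notin: "Vec 1 \<notin> labels {2..N}" "BarVec 1 \<notin> labels {2..N}"
  by (auto simp: labels_def)

lemma labels_Suc: "labels {1..N} = insert (Vec 1) (insert (BarVec 1) (labels {2..N}))"
proof -
  have "{1..N} = insert 1 {2..N}" using N by auto
  thus ?thesis by (auto simp: labels_def)
qed

lemma tau_rest_eq_0:
  "j \<in> {1..n} \<Longrightarrow> j \<notin> I \<Longrightarrow> ws ! (j - 1) \<notin> labels {2..N} \<Longrightarrow> \<tau> (rest n ws I) = 0"
  using supp[of "rest n ws I"] rest_split[of j n I ws] by auto

text \<open>Every summand with i \<noteq> m has the letter at \<open>m\<close> in the argument of
  \<tau>, which vanishes on letters outside \<open>labels {2..N}\<close>.\<close>

lemma slots_special:
  assumes "length ws = n" "m \<in> {1..n}" "ws ! (m - 1) \<notin> labels {2..N}"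
  shows "slots n \<tau> a b ws = coef (a m) (b m) (ws ! (m - 1)) * \<tau> (rest n ws {m})"
proof -
  have "(\<Sum>i=1..n. coef (a i) (b i) (ws ! (i - 1)) * \<tau> (rest n ws {i})) =
      (\<Sum>i\<in>{m}. coef (a i) (b i) (ws ! (i - 1)) * \<tau> (rest n ws {i}))"
    using assms tau_rest_eq_0[of m "{_}" ws] by (intro sum.mono_neutral_right) auto
  thus ?thesis using assms by (simp add: slots_def)
qed

lemma slots_update2:
  assumes ws: "length ws = n" and ij: "i \<in> {1..n}" "j \<in> {1..n}" "i \<noteq> j" and x: "x \<notin> labels {2..N}"
  shows "slots n \<tau> a b (ws[i - 1 := x, j - 1 := y]) = coef (a i) (b i) x * \<tau> (add_mset y (rest n ws {i, j}))"
    and "slots n \<tau> a b (ws[j - 1 := y, i - 1 := x]) = coef (a i) (b i) x * \<tau> (add_mset y (rest n ws {i, j}))"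
proof -
  let ?ws = "ws[i - 1 := x, j - 1 := y]"
  have "i - 1 \<noteq> j - 1" using ij by auto
  hence eq: "ws[j - 1 := y, i - 1 := x] = ?ws" by (simp add: list_update_swap)
  have nth: "?ws ! (i - 1) = x" "?ws ! (j - 1) = y" using ij ws by (auto simp: nth_list_update)
  have "rest n ?ws {i} = add_mset y (rest n ?ws {j, i})" using rest_split[of j n "{i}" ?ws] ij nth by simp
  also have "rest n ?ws {j, i} = rest n ws {i, j}"
    using ij rest_update_in[of j "{j, i}" n "ws[i - 1 := x]" y] rest_update_in[of i "{j, i}" n ws x]
    by (simp add: insert_commute)
  finally have "rest n ?ws {i} = add_mset y (rest n ws {i, j})" .
  thus "slots n \<tau> a b ?ws = coef (a i) (b i) x * \<tau> (add_mset y (rest n ws {i, j}))"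
    using slots_special[of ?ws i a b] ij nth ws x by simp
  thus "slots n \<tau> a b (ws[j - 1 := y, i - 1 := x]) = coef (a i) (b i) x * \<tau> (add_mset y (rest n ws {i, j}))"
    unfolding eq .
qed

text \<open>On an ordinary letter T only applies \<open>bar\<close>, because x_p = 1 for p \<ge> 2,
  and \<tau> does not notice this. So T exchanges the two coefficients at \<open>m\<close>, up to
  powers of x_1, and fixes all others.\<close>

lemma site_T_slots:
  assumes m: "m \<in> {1..n}" and x: "\<And>p. 2 \<le> p \<Longrightarrow> x p = 1"
  shows "site N (T_mat x) m (slots n \<tau> a b) = slots n \<tau> (a(m := x 1 * b m)) (b(m := inverse (x 1) * a m))"
proof
  fix ws
  let ?a = "a(m := x 1 * b m)" and ?b = "b(m := inverse (x 1) * a m)"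
  show "site N (T_mat x) m (slots n \<tau> a b) ws = slots n \<tau> ?a ?b ws"
  proof (cases "length ws = n")
    case ws: True
    define p where "p = ws ! (m - 1)"
    have "site N (T_mat x) m (slots n \<tau> a b) ws =
        (\<Sum>q\<in>labels {1..N}. if q = bar p then T_mat x p (bar p) * slots n \<tau> a b (ws[m - 1 := bar p]) else 0)"
      unfolding site_def p_def[symmetric] by (intro sum.cong refl) (auto simp: T_mat_def)
    hence L: "site N (T_mat x) m (slots n \<tau> a b) ws =
        (if p \<in> labels {1..N} then T_mat x p (bar p) * slots n \<tau> a b (ws[m - 1 := bar p]) else 0)"
      by (simp add: sum.delta')
    consider "p = Vec 1" | "p = BarVec 1" | "p \<notin> labels {1..N}" | "p \<in> labels {2..N}"
      using labels_Suc by auto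
    thus ?thesis
    proof cases
      case 1
      hence "slots n \<tau> ?a ?b ws = x 1 * b m * \<tau> (rest n ws {m})"
        using slots_special[OF ws m, of ?a ?b] Vec1_notin by (simp add: p_def coef_def)
      moreover have "slots n \<tau> a b (ws[m - 1 := BarVec 1]) = b m * \<tau> (rest n ws {m})"
        using slots_special[of "ws[m - 1 := BarVec 1]" m a b] Vec1_notin m ws
          rest_update_in[of m "{m}" n ws "BarVec 1"] nth_update_slot[OF m ws, of "BarVec 1"]
        by (simp add: coef_def)
      ultimately show ?thesis using 1 L labels_Suc by (simp add: T_mat_def)
    next
      case 2
      hence "slots n \<tau> ?a ?b ws = inverse (x 1) * a m * \<tau> (rest n ws {m})"
        using slots_special[OF ws m, of ?a ?b] Vec1_notin by (simp add: p_def coef_def)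
      moreover have "slots n \<tau> a b (ws[m - 1 := Vec 1]) = a m * \<tau> (rest n ws {m})"
        using slots_special[of "ws[m - 1 := Vec 1]" m a b] Vec1_notin m ws
          rest_update_in[of m "{m}" n ws "Vec 1"] nth_update_slot[OF m ws, of "Vec 1"]
        by (simp add: coef_def)
      ultimately show ?thesis using 2 L labels_Suc by (simp add: T_mat_def)
    next
      case 3
      hence "slots n \<tau> ?a ?b ws = 0"
        using slots_special[OF ws m, of ?a ?b] labels_Suc by (auto simp: p_def coef_def)
      thus ?thesis using 3 L by simp
    next
      case 4
      hence T: "T_mat x p (bar p) = 1" using x by (cases p) (auto simp: T_mat_def labels_def)
      have p1: "p \<noteq> Vec 1" "p \<noteq> BarVec 1" using 4 Vec1_notin by auto
      hence bp1: "bar p \<noteq> Vec 1" "bar p \<noteq> BarVec 1" by (cases p; simp)+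
      have "coef (a i) (b i) (ws[m - 1 := bar p] ! (i - 1)) * \<tau> (rest n (ws[m - 1 := bar p]) {i}) =
          coef (?a i) (?b i) (ws ! (i - 1)) * \<tau> (rest n ws {i})" if i: "i \<in> {1..n}" for i
      proof (cases "i = m")
        case True
        thus ?thesis using p1 bp1 nth_update_slot[OF m ws, of "bar p"] by (simp add: coef_def p_def)
      next
        case False
        hence "i - 1 \<noteq> m - 1" using i m by auto
        hence nth: "ws[m - 1 := bar p] ! (i - 1) = ws ! (i - 1)" by simp
        have "rest n (ws[m - 1 := bar p]) {i} = add_mset (bar p) (rest n ws {m, i})"
          using rest_split[of m n "{i}" "ws[m - 1 := bar p]"] False m nth_update_slot[OF m ws, of "bar p"]
            rest_update_in[of m "{m, i}" n ws "bar p"] by simp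
        moreover have "rest n ws {i} = add_mset p (rest n ws {m, i})"
          using rest_split[of m n "{i}" ws] False m by (simp add: p_def)
        ultimately show ?thesis using False nth bar_inv by simp
      qed
      hence "slots n \<tau> a b (ws[m - 1 := bar p]) = slots n \<tau> ?a ?b ws"
        using ws by (simp add: slots_def)
      thus ?thesis using L T 4 labels_Suc by simp
    qed
  qed (simp add: site_def slots_def)
qed

text \<open>At the positions other than \<open>m\<close> the operator T is the identity, so K
  multiplies by (z + \<beta>) / (z + \<beta>).\<close>

lemma K_op_slots:
  assumes m: "m \<in> {1..n}" and x: "\<And>p. 2 \<le> p \<Longrightarrow> x p = 1" and z: "z + \<beta> \<noteq> 0"
  shows "K_op N m z x \<beta> (slots n \<tau> a b) =
    slots n \<tau> (a(m := (z * (x 1 * b m) + \<beta> * a m) / (z + \<beta>)))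
       (b(m := (z * (inverse (x 1) * a m) + \<beta> * b m) / (z + \<beta>)))"
proof -
  have eq: "K_op N m z x \<beta> (slots n \<tau> a b) = slots n \<tau> (\<lambda>i. (z * (a(m := x 1 * b m)) i + \<beta> * a i) / (z + \<beta>))
     (\<lambda>i. (z * (b(m := inverse (x 1) * a m)) i + \<beta> * b i) / (z + \<beta>))"
    unfolding K_op_def by (rule ext) (simp only: site_T_slots[where x = x, OF m x] slots_linear slots_divide)
  show ?thesis unfolding eq
  proof (rule slots_cong)
  have "(z * u + \<beta> * u) / (z + \<beta>) = u" for u using z by (simp add: distrib_right[symmetric])
  thus "(z * (a(m := x 1 * b m)) i + \<beta> * a i) / (z + \<beta>) = (a(m := (z * (x 1 * b m) + \<beta> * a m) / (z + \<beta>))) i"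
    "(z * (b(m := inverse (x 1) * a m)) i + \<beta> * b i) / (z + \<beta>) =
      (b(m := (z * (inverse (x 1) * a m) + \<beta> * b m) / (z + \<beta>))) i" for i
    by auto
  qed
qed

lemma site_unit: "site N (unit_mat p q) i f ws =
    (if ws ! (i - 1) = p \<and> q \<in> labels {1..N} then f (ws[i - 1 := q]) else 0)"
proof -
  have "site N (unit_mat p q) i f ws =
      (\<Sum>r\<in>labels {1..N}. if r = q then (if ws ! (i - 1) = p then f (ws[i - 1 := q]) else 0) else 0)"
    unfolding site_def by (intro sum.cong refl) (auto simp: unit_mat_def)
  thus ?thesis by (simp add: sum.delta')
qed

lemma site_add: "site N (\<lambda>p q. A p q + B p q) i f ws = site N A i f ws + site N B i f ws"
  by (simp add: site_def distrib_right sum.distrib)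

lemma site_E: "site N (E_mat p q) j f ws = site N (unit_mat p q) j f ws + site N (unit_mat (bar p) (bar q)) j f ws"
  using site_add[of "unit_mat p q" "unit_mat (bar p) (bar q)"] by (simp add: E_mat_def [abs_def])

lemma site_Ebar: "site N (Ebar_mat p q) j f ws = site N (unit_mat p (bar q)) j f ws + site N (unit_mat (bar p) q) j f ws"
  using site_add[of "unit_mat p (bar q)" "unit_mat (bar p) q"] by (simp add: Ebar_mat_def [abs_def])

lemma sum_letters:
  fixes f :: "nat \<Rightarrow> complex"
  shows "(\<Sum>p=2..N. (if l = Vec p then f p else 0) + (if l = BarVec p then f p else 0)) =
    (if l \<in> labels {2..N} then (case l of Vec p \<Rightarrow> f p | BarVec p \<Rightarrow> f p) else 0)"
proof (cases l)
  case (Vec r)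
  have "(\<Sum>p=2..N. if r = p then f p else 0) = (if r \<in> {2..N} then f r else 0)"
    by (rule sum.delta') simp
  thus ?thesis using Vec by (auto simp: labels_def image_iff)
next
  case (BarVec r)
  have "(\<Sum>p=2..N. if r = p then f p else 0) = (if r \<in> {2..N} then f r else 0)"
    by (rule sum.delta') simp
  thus ?thesis using BarVec by (auto simp: labels_def image_iff)
qed

text \<open>X and Y become simple only when added: with v_1 at position \<open>i\<close>, an
  ordinary letter at \<open>j\<close> receives the contribution of \<open>a j\<close> from one of
  them and that of \<open>b j\<close> from the other. Together, and by \<open>bar_inv\<close>, they
  give a j + b j for every ordinary letter. In the second half of the terms the distinguished letter
  moves from \<open>i\<close> to \<open>j\<close>, and only \<open>b i\<close> occurs.\<close>

lemma sum_hop_left: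
  fixes a b :: "nat \<Rightarrow> complex"
  assumes ws: "length ws = n" and ij: "i \<in> {1..n}" "j \<in> {1..n}" "i \<noteq> j"
  defines "f \<equiv> slots n \<tau> a b"
  shows "(\<Sum>p=2..N. (site N (unit_mat (Vec 1) (Vec p)) i (site N (E_mat (Vec p) (Vec 1)) j f) ws
      + site N (unit_mat (bar (Vec p)) (bar (Vec 1))) i (site N (E_mat (Vec 1) (Vec p)) j f) ws)
      + (site N (unit_mat (Vec 1) (bar (Vec p))) i (site N (Ebar_mat (Vec p) (Vec 1)) j f) ws
      + site N (unit_mat (Vec p) (bar (Vec 1))) i (site N (Ebar_mat (Vec 1) (Vec p)) j f) ws))
    = (if ws ! (i - 1) = Vec 1 then (a j + b j) * \<tau> (rest n ws {i}) else 0)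
      + (if ws ! (j - 1) = Vec 1 \<or> ws ! (j - 1) = BarVec 1 then b i * \<tau> (rest n ws {j}) else 0)"
    (is "(\<Sum>p=2..N. ?t p) = ?R")
proof -
  define x where "x = ws ! (i - 1)"
  define y where "y = ws ! (j - 1)"
  define M where "M = rest n ws {i, j}"
  have idx: "i - 1 \<noteq> j - 1" using ij by auto
  have lab: "Vec 1 \<in> labels {1..N}" "BarVec 1 \<in> labels {1..N}" using labels_Suc by auto
  have lab2: "Vec p \<in> labels {1..N}" "BarVec p \<in> labels {1..N}" if "p \<in> {2..N}" for p
    using that by (auto simp: labels_def)
  have ri: "rest n ws {i} = add_mset y M" and rj: "rest n ws {j} = add_mset x M"
    using rest_split[of j n "{i}" ws] rest_split[of i n "{j}" ws] ij
    by (simp_all add: x_def y_def M_def insert_commute)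
  have \<tau>bar: "\<tau> (add_mset (BarVec p) M) = \<tau> (add_mset (Vec p) M)" for p
    using bar_inv[of "Vec p" M] by simp
  note upd = slots_update2[OF ws ij Vec1_notin(1), of a b, folded f_def M_def]
    slots_update2[OF ws ij Vec1_notin(2), of a b, folded f_def M_def]
    slots_update2[OF ws ij(2,1) ij(3)[symmetric] Vec1_notin(1), of a b, folded f_def, unfolded insert_commute[of j i] , folded M_def]
    slots_update2[OF ws ij(2,1) ij(3)[symmetric] Vec1_notin(2), of a b, folded f_def, unfolded insert_commute[of j i], folded M_def]
  have zero: "\<tau> (add_mset l M) = 0" if "l \<notin> labels {2..N}" for l using supp[of "add_mset l M"] that by auto
  have "?t p = (if y = Vec p then (if x = Vec 1 then (a j + b j) * \<tau> (add_mset (Vec p) M) else 0) else 0)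
      + (if y = BarVec p then (if x = Vec 1 then (a j + b j) * \<tau> (add_mset (Vec p) M) else 0) else 0)
      + ((if x = Vec p then (if y = Vec 1 \<or> y = BarVec 1 then b i * \<tau> (add_mset (Vec p) M) else 0) else 0)
      + (if x = BarVec p then (if y = Vec 1 \<or> y = BarVec 1 then b i * \<tau> (add_mset (Vec p) M) else 0) else 0))"
    if p: "p \<in> {2..N}" for p
    using p idx lab lab2[OF p]
    by (simp add: site_unit site_E site_Ebar nth_list_update_neq upd x_def[symmetric] y_def[symmetric] coef_def \<tau>bar distrib_right
        del: One_nat_def)
  hence "(\<Sum>p=2..N. ?t p) = (\<Sum>p=2..N. (if y = Vec p then (if x = Vec 1 then (a j + b j) * \<tau> (add_mset (Vec p) M) else 0) else 0)
      + (if y = BarVec p then (if x = Vec 1 then (a j + b j) * \<tau> (add_mset (Vec p) M) else 0) else 0)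
      + ((if x = Vec p then (if y = Vec 1 \<or> y = BarVec 1 then b i * \<tau> (add_mset (Vec p) M) else 0) else 0)
      + (if x = BarVec p then (if y = Vec 1 \<or> y = BarVec 1 then b i * \<tau> (add_mset (Vec p) M) else 0) else 0)))"
    by (rule sum.cong[OF refl])
  also have "\<dots> = (if x = Vec 1 then (a j + b j) * \<tau> (add_mset y M) else 0)
      + (if y = Vec 1 \<or> y = BarVec 1 then b i * \<tau> (add_mset x M) else 0)"
    unfolding sum.distrib
    using sum_letters[of y "\<lambda>p. if x = Vec 1 then (a j + b j) * \<tau> (add_mset (Vec p) M) else 0"]
      sum_letters[of x "\<lambda>p. if y = Vec 1 \<or> y = BarVec 1 then b i * \<tau> (add_mset (Vec p) M) else 0"]
      zero[of x] zero[of y] zero[OF Vec1_notin(1)] zero[OF Vec1_notin(2)] Vec1_notin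
    unfolding sum.distrib by (cases x; cases y) (simp_all add: \<tau>bar)
  finally show ?thesis unfolding ri rj x_def y_def .
qed

text \<open>The opposite terms X_p1 and Z_1p: the computation of \<open>sum_hop_left\<close> with
  v_1 and its bar partner exchanged at position \<open>i\<close>.\<close>

lemma sum_hop_all:
  fixes a b :: "nat \<Rightarrow> complex"
  assumes ws: "length ws = n" and ij: "i \<in> {1..n}" "j \<in> {1..n}" "i \<noteq> j"
  defines "f \<equiv> slots n \<tau> a b"
  shows "(\<Sum>p=2..N. (site N (unit_mat (Vec p) (Vec 1)) i (site N (E_mat (Vec 1) (Vec p)) j f) ws
      + site N (unit_mat (bar (Vec 1)) (bar (Vec p))) i (site N (E_mat (Vec p) (Vec 1)) j f) ws)
      + (site N (unit_mat (bar (Vec 1)) (Vec p)) i (site N (Ebar_mat (Vec p) (Vec 1)) j f) ws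
      + site N (unit_mat (bar (Vec p)) (Vec 1)) i (site N (Ebar_mat (Vec 1) (Vec p)) j f) ws))
    = (if ws ! (i - 1) = BarVec 1 then (a j + b j) * \<tau> (rest n ws {i}) else 0)
      + (if ws ! (j - 1) = Vec 1 \<or> ws ! (j - 1) = BarVec 1 then a i * \<tau> (rest n ws {j}) else 0)"
    (is "(\<Sum>p=2..N. ?t p) = ?R")
proof -
  define x where "x = ws ! (i - 1)"
  define y where "y = ws ! (j - 1)"
  define M where "M = rest n ws {i, j}"
  have idx: "i - 1 \<noteq> j - 1" using ij by auto
  have lab: "Vec 1 \<in> labels {1..N}" "BarVec 1 \<in> labels {1..N}" using labels_Suc by auto
  have lab2: "Vec p \<in> labels {1..N}" "BarVec p \<in> labels {1..N}" if "p \<in> {2..N}" for p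
    using that by (auto simp: labels_def)
  have ri: "rest n ws {i} = add_mset y M" and rj: "rest n ws {j} = add_mset x M"
    using rest_split[of j n "{i}" ws] rest_split[of i n "{j}" ws] ij
    by (simp_all add: x_def y_def M_def insert_commute)
  have \<tau>bar: "\<tau> (add_mset (BarVec p) M) = \<tau> (add_mset (Vec p) M)" for p
    using bar_inv[of "Vec p" M] by simp
  note upd = slots_update2[OF ws ij Vec1_notin(1), of a b, folded f_def M_def]
    slots_update2[OF ws ij Vec1_notin(2), of a b, folded f_def M_def]
    slots_update2[OF ws ij(2,1) ij(3)[symmetric] Vec1_notin(1), of a b, folded f_def, unfolded insert_commute[of j i] , folded M_def]
    slots_update2[OF ws ij(2,1) ij(3)[symmetric] Vec1_notin(2), of a b, folded f_def, unfolded insert_commute[of j i], folded M_def]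
  have zero: "\<tau> (add_mset l M) = 0" if "l \<notin> labels {2..N}" for l using supp[of "add_mset l M"] that by auto
  have "?t p = (if y = Vec p then (if x = BarVec 1 then (a j + b j) * \<tau> (add_mset (Vec p) M) else 0) else 0)
      + (if y = BarVec p then (if x = BarVec 1 then (a j + b j) * \<tau> (add_mset (Vec p) M) else 0) else 0)
      + ((if x = Vec p then (if y = Vec 1 \<or> y = BarVec 1 then a i * \<tau> (add_mset (Vec p) M) else 0) else 0)
      + (if x = BarVec p then (if y = Vec 1 \<or> y = BarVec 1 then a i * \<tau> (add_mset (Vec p) M) else 0) else 0))"
    if p: "p \<in> {2..N}" for p
    using p idx lab lab2[OF p]
    by (simp add: site_unit site_E site_Ebar nth_list_update_neq upd x_def[symmetric] y_def[symmetric] coef_def \<tau>bar distrib_right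
        del: One_nat_def)
  hence "(\<Sum>p=2..N. ?t p) = (\<Sum>p=2..N. (if y = Vec p then (if x = BarVec 1 then (a j + b j) * \<tau> (add_mset (Vec p) M) else 0) else 0)
      + (if y = BarVec p then (if x = BarVec 1 then (a j + b j) * \<tau> (add_mset (Vec p) M) else 0) else 0)
      + ((if x = Vec p then (if y = Vec 1 \<or> y = BarVec 1 then a i * \<tau> (add_mset (Vec p) M) else 0) else 0)
      + (if x = BarVec p then (if y = Vec 1 \<or> y = BarVec 1 then a i * \<tau> (add_mset (Vec p) M) else 0) else 0)))"
    by (rule sum.cong[OF refl])
  also have "\<dots> = (if x = BarVec 1 then (a j + b j) * \<tau> (add_mset y M) else 0)
      + (if y = Vec 1 \<or> y = BarVec 1 then a i * \<tau> (add_mset x M) else 0)"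
    unfolding sum.distrib
    using sum_letters[of y "\<lambda>p. if x = BarVec 1 then (a j + b j) * \<tau> (add_mset (Vec p) M) else 0"]
      sum_letters[of x "\<lambda>p. if y = Vec 1 \<or> y = BarVec 1 then a i * \<tau> (add_mset (Vec p) M) else 0"]
      zero[of x] zero[of y] zero[OF Vec1_notin(1)] zero[OF Vec1_notin(2)] Vec1_notin
    unfolding sum.distrib by (cases x; cases y) (simp_all add: \<tau>bar)
  finally show ?thesis unfolding ri rj x_def y_def .
qed

text \<open>These operators evaluate the tensor at words with v_1 or its bar partner in two
  positions, where \<tau> vanishes.\<close>

lemma Y_op_diag:
  fixes a b :: "nat \<Rightarrow> complex"
  shows "Y_op n N (Vec 1) (Vec 1) (slots n \<tau> a b) ws = 0" "Z_op n N (Vec 1) (Vec 1) (slots n \<tau> a b) ws = 0"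
proof -
  have *: "(ws[i - 1 := p, j - 1 := q]) = ws' \<Longrightarrow> slots n \<tau> a b ws' = 0"
    if "i \<in> {1..n}" "j \<in> {1..n}" "i \<noteq> j" "p \<notin> labels {2..N}" "q \<notin> labels {2..N}" for i j p q ws'
  proof (cases "length ws = n")
    case True
    assume "(ws[i - 1 := p, j - 1 := q]) = ws'"
    moreover have "\<tau> (add_mset q (rest n ws {i, j})) = 0"
      using supp[of "add_mset q (rest n ws {i, j})"] that(5) by auto
    ultimately show ?thesis using slots_update2(1)[OF True that(1-4), of a b q] by simp
  next
    case False
    assume "(ws[i - 1 := p, j - 1 := q]) = ws'"
    thus ?thesis using False by (auto simp: slots_def)
  qed
  have **: "slots n \<tau> a b (ws[i - 1 := p, j - 1 := q]) = 0"
    if "i \<in> {1..n}" "j \<in> {i+1..n}" "p \<notin> labels {2..N}" "q \<notin> labels {2..N}" for i j p q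
    using that by (intro *[of i j p q]) auto
  show "Y_op n N (Vec 1) (Vec 1) (slots n \<tau> a b) ws = 0" "Z_op n N (Vec 1) (Vec 1) (slots n \<tau> a b) ws = 0"
    unfolding Y_op_def Z_op_def
    by (intro sum.neutral ballI; simp add: site_unit site_Ebar ** Vec1_notin del: One_nat_def)+
qed

lemma sum_triangle_swap:
  fixes g :: "nat \<Rightarrow> nat \<Rightarrow> complex"
  shows "(\<Sum>i=1..n. \<Sum>j=i+1..n. g i j) = (\<Sum>j=1..n. \<Sum>i=1..<j. g i j)"
proof -
  have "(\<Sum>i=1..n. \<Sum>j=i+1..n. g i j) = (\<Sum>i=1..n. \<Sum>j=1..n. if i < j then g i j else 0)"
    by (rule sum.cong[OF refl], rule sum.mono_neutral_cong_left) auto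
  also have "\<dots> = (\<Sum>j=1..n. \<Sum>i=1..n. if i < j then g i j else 0)" by (rule sum.swap)
  also have "\<dots> = (\<Sum>j=1..n. \<Sum>i=1..<j. g i j)"
    by (rule sum.cong[OF refl], rule sum.mono_neutral_cong_right) auto
  finally show ?thesis .
qed

text \<open>The contributions are regrouped by the position of the distinguished letter after the
  move; in the second kind this is the larger index \<open>j\<close>, whence the exchange of
  summations.\<close>

lemma slots_of_pair_sum:
  fixes A B d e :: "nat \<Rightarrow> complex"
  assumes "length ws = n"
  shows "(\<Sum>i=1..n. \<Sum>j=i+1..n. (if ws ! (i - 1) = l then d j * \<tau> (rest n ws {i}) else 0)
      + (if ws ! (j - 1) = Vec 1 \<or> ws ! (j - 1) = BarVec 1 then e i * \<tau> (rest n ws {j}) else 0))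
    = (\<Sum>i=1..n. ((if ws ! (i - 1) = l then \<Sum>j=i+1..n. d j else 0)
      + (if ws ! (i - 1) = Vec 1 \<or> ws ! (i - 1) = BarVec 1 then \<Sum>j=1..<i. e j else 0)) * \<tau> (rest n ws {i}))"
proof -
  have "(\<Sum>i=1..n. \<Sum>j=i+1..n. if ws ! (j - 1) = Vec 1 \<or> ws ! (j - 1) = BarVec 1 then e i * \<tau> (rest n ws {j}) else 0)
     = (\<Sum>j=1..n. \<Sum>i=1..<j. if ws ! (j - 1) = Vec 1 \<or> ws ! (j - 1) = BarVec 1 then e i * \<tau> (rest n ws {j}) else 0)"
    by (rule sum_triangle_swap)
  also have "\<dots> = (\<Sum>j=1..n. (if ws ! (j - 1) = Vec 1 \<or> ws ! (j - 1) = BarVec 1 then \<Sum>i=1..<j. e i else 0) * \<tau> (rest n ws {j}))"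
    by (intro sum.cong refl) (simp add: sum_distrib_right)
  finally have 2: "(\<Sum>i=1..n. \<Sum>j=i+1..n. if ws ! (j - 1) = Vec 1 \<or> ws ! (j - 1) = BarVec 1 then e i * \<tau> (rest n ws {j}) else 0)
     = (\<Sum>j=1..n. (if ws ! (j - 1) = Vec 1 \<or> ws ! (j - 1) = BarVec 1 then \<Sum>i=1..<j. e i else 0) * \<tau> (rest n ws {j}))" .
  have 1: "(\<Sum>i=1..n. \<Sum>j=i+1..n. if ws ! (i - 1) = l then d j * \<tau> (rest n ws {i}) else 0)
     = (\<Sum>i=1..n. (if ws ! (i - 1) = l then \<Sum>j=i+1..n. d j else 0) * \<tau> (rest n ws {i}))"
    by (rule sum.cong[OF refl]) (simp add: sum_distrib_right)
  show ?thesis unfolding sum.distrib distrib_right 1 2 ..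
qed

lemma site_length: "(\<And>ws. length ws \<noteq> n \<Longrightarrow> f ws = 0) \<Longrightarrow> length ws \<noteq> n \<Longrightarrow> site N A i f ws = 0"
  by (simp add: site_def)

lemma hop_left_op:
  fixes a b :: "nat \<Rightarrow> complex"
  defines "f \<equiv> slots n \<tau> a b"
  shows "(\<Sum>p=2..N. X_op n N (Vec 1) (Vec p) f ws) + (\<Sum>p=1..N. Y_op n N (Vec 1) (Vec p) f ws) =
    slots n \<tau> (\<lambda>i. (\<Sum>j=i+1..n. a j + b j) + (\<Sum>j=1..<i. b j)) (\<lambda>i. \<Sum>j=1..<i. b j) ws"
proof -
  have Y: "(\<Sum>p=1..N. Y_op n N (Vec 1) (Vec p) f ws) = (\<Sum>p=2..N. Y_op n N (Vec 1) (Vec p) f ws)"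
    using N Y_op_diag(1)[of a b ws] by (simp add: sum.atLeast_Suc_atMost f_def numeral_2_eq_2)
  have f0: "f ws = 0" if "length ws \<noteq> n" for ws using that by (simp add: f_def slots_def)
  show ?thesis
  proof (cases "length ws = n")
    case True
    have "(\<Sum>p=2..N. X_op n N (Vec 1) (Vec p) f ws) + (\<Sum>p=2..N. Y_op n N (Vec 1) (Vec p) f ws) =
       (\<Sum>i=1..n. \<Sum>j=i+1..n. \<Sum>p=2..N. (site N (unit_mat (Vec 1) (Vec p)) i (site N (E_mat (Vec p) (Vec 1)) j f) ws
      + site N (unit_mat (bar (Vec p)) (bar (Vec 1))) i (site N (E_mat (Vec 1) (Vec p)) j f) ws)
      + (site N (unit_mat (Vec 1) (bar (Vec p))) i (site N (Ebar_mat (Vec p) (Vec 1)) j f) ws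
      + site N (unit_mat (Vec p) (bar (Vec 1))) i (site N (Ebar_mat (Vec 1) (Vec p)) j f) ws))"
      unfolding X_op_def Y_op_def sum.distrib[symmetric]
      by (subst sum.swap, rule sum.cong[OF refl], subst sum.swap, rule refl)
    also have "\<dots> = (\<Sum>i=1..n. \<Sum>j=i+1..n. (if ws ! (i - 1) = Vec 1 then (a j + b j) * \<tau> (rest n ws {i}) else 0)
      + (if ws ! (j - 1) = Vec 1 \<or> ws ! (j - 1) = BarVec 1 then b i * \<tau> (rest n ws {j}) else 0))"
    proof (intro sum.cong refl)
      fix i j assume "i \<in> {1..n}" "j \<in> {i+1..n}"
      hence ij: "i \<in> {1..n}" "j \<in> {1..n}" "i \<noteq> j" by auto
      show "(\<Sum>p=2..N. (site N (unit_mat (Vec 1) (Vec p)) i (site N (E_mat (Vec p) (Vec 1)) j f) ws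
      + site N (unit_mat (bar (Vec p)) (bar (Vec 1))) i (site N (E_mat (Vec 1) (Vec p)) j f) ws)
      + (site N (unit_mat (Vec 1) (bar (Vec p))) i (site N (Ebar_mat (Vec p) (Vec 1)) j f) ws
      + site N (unit_mat (Vec p) (bar (Vec 1))) i (site N (Ebar_mat (Vec 1) (Vec p)) j f) ws)) =
      (if ws ! (i - 1) = Vec 1 then (a j + b j) * \<tau> (rest n ws {i}) else 0)
      + (if ws ! (j - 1) = Vec 1 \<or> ws ! (j - 1) = BarVec 1 then b i * \<tau> (rest n ws {j}) else 0)"
        unfolding f_def by (rule sum_hop_left[OF True ij])
    qed
    also have "\<dots> = slots n \<tau> (\<lambda>i. (\<Sum>j=i+1..n. a j + b j) + (\<Sum>j=1..<i. b j)) (\<lambda>i. \<Sum>j=1..<i. b j) ws"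
      unfolding slots_of_pair_sum[OF True] slots_def coef_def using True by (auto intro!: sum.cong)
    finally show ?thesis unfolding Y .
  next
    case False
    have "X_op n N (Vec 1) (Vec p) f ws = 0" "Y_op n N (Vec 1) (Vec p) f ws = 0" for p
      using False by (simp_all add: X_op_def Y_op_def site_length f0)
    thus ?thesis using False by (simp add: slots_def)
  qed
qed

text \<open>The two halves depend on the order of the positions in complementary ways. In their sum
  the order disappears, and all j \<noteq> i contribute equally.\<close>

lemma hop_all_op:
  fixes a b :: "nat \<Rightarrow> complex"
  defines "f \<equiv> slots n \<tau> a b"
  shows "(\<Sum>p=2..N. X_op n N (Vec 1) (Vec p) f ws + X_op n N (Vec p) (Vec 1) f ws)
      + (\<Sum>p=2..N. Y_op n N (Vec 1) (Vec p) f ws + Z_op n N (Vec 1) (Vec p) f ws) =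
    slots n \<tau> (\<lambda>i. \<Sum>j\<in>{1..n}-{i}. a j + b j) (\<lambda>i. \<Sum>j\<in>{1..n}-{i}. a j + b j) ws"
proof -
  have Y: "(\<Sum>p=1..N. Y_op n N (Vec 1) (Vec p) f ws) = (\<Sum>p=2..N. Y_op n N (Vec 1) (Vec p) f ws)"
    using N Y_op_diag(1)[of a b ws] by (simp add: sum.atLeast_Suc_atMost f_def numeral_2_eq_2)
  have f0: "f ws = 0" if "length ws \<noteq> n" for ws using that by (simp add: f_def slots_def)
  show ?thesis
  proof (cases "length ws = n")
    case True
    have "(\<Sum>p=2..N. X_op n N (Vec p) (Vec 1) f ws) + (\<Sum>p=2..N. Z_op n N (Vec 1) (Vec p) f ws) =
       (\<Sum>i=1..n. \<Sum>j=i+1..n. \<Sum>p=2..N. (site N (unit_mat (Vec p) (Vec 1)) i (site N (E_mat (Vec 1) (Vec p)) j f) ws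
      + site N (unit_mat (bar (Vec 1)) (bar (Vec p))) i (site N (E_mat (Vec p) (Vec 1)) j f) ws)
      + (site N (unit_mat (bar (Vec 1)) (Vec p)) i (site N (Ebar_mat (Vec p) (Vec 1)) j f) ws
      + site N (unit_mat (bar (Vec p)) (Vec 1)) i (site N (Ebar_mat (Vec 1) (Vec p)) j f) ws))"
      unfolding X_op_def Z_op_def sum.distrib[symmetric]
      by (subst sum.swap, rule sum.cong[OF refl], subst sum.swap, rule refl)
    also have "\<dots> = (\<Sum>i=1..n. \<Sum>j=i+1..n. (if ws ! (i - 1) = BarVec 1 then (a j + b j) * \<tau> (rest n ws {i}) else 0)
      + (if ws ! (j - 1) = Vec 1 \<or> ws ! (j - 1) = BarVec 1 then a i * \<tau> (rest n ws {j}) else 0))"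
    proof (intro sum.cong refl)
      fix i j assume "i \<in> {1..n}" "j \<in> {i+1..n}"
      hence ij: "i \<in> {1..n}" "j \<in> {1..n}" "i \<noteq> j" by auto
      show "(\<Sum>p=2..N. (site N (unit_mat (Vec p) (Vec 1)) i (site N (E_mat (Vec 1) (Vec p)) j f) ws
      + site N (unit_mat (bar (Vec 1)) (bar (Vec p))) i (site N (E_mat (Vec p) (Vec 1)) j f) ws)
      + (site N (unit_mat (bar (Vec 1)) (Vec p)) i (site N (Ebar_mat (Vec p) (Vec 1)) j f) ws
      + site N (unit_mat (bar (Vec p)) (Vec 1)) i (site N (Ebar_mat (Vec 1) (Vec p)) j f) ws)) =
      (if ws ! (i - 1) = BarVec 1 then (a j + b j) * \<tau> (rest n ws {i}) else 0)
      + (if ws ! (j - 1) = Vec 1 \<or> ws ! (j - 1) = BarVec 1 then a i * \<tau> (rest n ws {j}) else 0)"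
        unfolding f_def by (rule sum_hop_all[OF True ij])
    qed
    also have "\<dots> = slots n \<tau> (\<lambda>i. \<Sum>j=1..<i. a j) (\<lambda>i. (\<Sum>j=i+1..n. a j + b j) + (\<Sum>j=1..<i. a j)) ws"
      unfolding slots_of_pair_sum[OF True] slots_def coef_def using True by (auto intro!: sum.cong)
    finally have XZ: "(\<Sum>p=2..N. X_op n N (Vec p) (Vec 1) f ws) + (\<Sum>p=2..N. Z_op n N (Vec 1) (Vec p) f ws) =
      slots n \<tau> (\<lambda>i. \<Sum>j=1..<i. a j) (\<lambda>i. (\<Sum>j=i+1..n. a j + b j) + (\<Sum>j=1..<i. a j)) ws" .
    have split: "(\<Sum>j\<in>{1..n}-{i}. a j + b j) = (\<Sum>j=i+1..n. a j + b j) + ((\<Sum>j=1..<i. b j) + (\<Sum>j=1..<i. a j))"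
      if "i \<in> {1..n}" for i
    proof -
      have "{1..n} - {i} = {i+1..n} \<union> {1..<i}" using that by auto
      moreover have "(\<Sum>j\<in>{i+1..n} \<union> {1..<i}. a j + b j) = (\<Sum>j=i+1..n. a j + b j) + (\<Sum>j=1..<i. a j + b j)"
        by (rule sum.union_disjoint) auto
      ultimately have "(\<Sum>j\<in>{1..n}-{i}. a j + b j) = (\<Sum>j=i+1..n. a j + b j) + (\<Sum>j=1..<i. a j + b j)"
        by simp
      thus ?thesis by (simp add: sum.distrib)
    qed
    have "(\<Sum>p=2..N. X_op n N (Vec 1) (Vec p) f ws + X_op n N (Vec p) (Vec 1) f ws)
        + (\<Sum>p=2..N. Y_op n N (Vec 1) (Vec p) f ws + Z_op n N (Vec 1) (Vec p) f ws) =
        1 * ((\<Sum>p=2..N. X_op n N (Vec 1) (Vec p) f ws) + (\<Sum>p=1..N. Y_op n N (Vec 1) (Vec p) f ws))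
        + 1 * ((\<Sum>p=2..N. X_op n N (Vec p) (Vec 1) f ws) + (\<Sum>p=2..N. Z_op n N (Vec 1) (Vec p) f ws))"
      unfolding Y sum.distrib by simp
    also have "\<dots> = slots n \<tau> (\<lambda>i. 1 * ((\<Sum>j=i+1..n. a j + b j) + (\<Sum>j=1..<i. b j)) + 1 * (\<Sum>j=1..<i. a j))
        (\<lambda>i. 1 * (\<Sum>j=1..<i. b j) + 1 * ((\<Sum>j=i+1..n. a j + b j) + (\<Sum>j=1..<i. a j))) ws"
      unfolding XZ hop_left_op[of a b ws, folded f_def] slots_linear ..
    also have "\<dots> = slots n \<tau> (\<lambda>i. \<Sum>j\<in>{1..n}-{i}. a j + b j) (\<lambda>i. \<Sum>j\<in>{1..n}-{i}. a j + b j) ws"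
      by (rule arg_cong[of _ _ "\<lambda>f. f ws"], rule slots_cong) (simp_all only: mult_1 split ac_simps)
    finally show ?thesis .
  next
    case False
    have "X_op n N l l' f ws = 0" "Y_op n N l l' f ws = 0" "Z_op n N l l' f ws = 0" for l l'
      using False by (simp_all add: X_op_def Y_op_def Z_op_def site_length f0)
    thus ?thesis using False by (simp add: slots_def)
  qed
qed

lemma site_diag_slots:
  fixes a b :: "nat \<Rightarrow> complex"
  assumes j: "j \<in> {1..n}"
  defines "f \<equiv> slots n \<tau> a b"
  shows "site N (unit_mat (Vec 1) (Vec 1)) j f ws = slots n \<tau> (\<lambda>i. if i = j then a i else 0) (\<lambda>_. 0) ws"
    and "site N (unit_mat (BarVec 1) (BarVec 1)) j f ws = slots n \<tau> (\<lambda>_. 0) (\<lambda>i. if i = j then b i else 0) ws"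
    and "site N (unit_mat (Vec 1) (BarVec 1)) j f ws = slots n \<tau> (\<lambda>i. if i = j then b i else 0) (\<lambda>_. 0) ws"
    and "site N (unit_mat (BarVec 1) (Vec 1)) j f ws = slots n \<tau> (\<lambda>_. 0) (\<lambda>i. if i = j then a i else 0) ws"
proof -
  have lab: "Vec 1 \<in> labels {1..N}" "BarVec 1 \<in> labels {1..N}" using labels_Suc by auto
  have main: "site N (unit_mat p q) j f ws = (if length ws = n \<and> ws ! (j - 1) = p then coef (a j) (b j) q * \<tau> (rest n ws {j}) else 0)"
    if "q \<in> labels {1..N}" "q \<notin> labels {2..N}" for p q
  proof (cases "length ws = n")
    case True
    have "f (ws[j - 1 := q]) = coef (a j) (b j) q * \<tau> (rest n ws {j})"
      unfolding f_def using slots_special[of "ws[j - 1 := q]" j a b] nth_update_slot[OF j True, of q] that(2) True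
        rest_update_in[of j "{j}" n ws q] j by simp
    thus ?thesis using True that by (simp add: site_unit)
  next
    case False
    thus ?thesis by (simp add: site_def f_def slots_def)
  qed
  have rhs: "slots n \<tau> (\<lambda>i. if i = j then u else 0) (\<lambda>i. if i = j then v else 0) ws =
     (if length ws = n then coef u v (ws ! (j - 1)) * \<tau> (rest n ws {j}) else 0)" for u v
  proof -
    have "(\<Sum>i=1..n. coef (if i = j then u else 0) (if i = j then v else 0) (ws ! (i - 1)) * \<tau> (rest n ws {i})) =
      (\<Sum>i=1..n. if i = j then coef u v (ws ! (i - 1)) * \<tau> (rest n ws {i}) else 0)"
      by (intro sum.cong refl) (auto simp: coef_def)
    thus ?thesis using j by (simp add: slots_def sum.delta)
  qed
  have if0: "(\<lambda>_. 0) = (\<lambda>i. if i = j then 0 else 0 :: complex)" by auto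
  have ifj: "(\<lambda>i. if i = j then h i else 0) = (\<lambda>i. if i = j then h j else 0)" for h :: "nat \<Rightarrow> complex" by auto
  show "site N (unit_mat (Vec 1) (Vec 1)) j f ws = slots n \<tau> (\<lambda>i. if i = j then a i else 0) (\<lambda>_. 0) ws"
    unfolding main[OF lab(1) Vec1_notin(1)] if0 ifj[of a] rhs by (simp add: coef_def)
  show "site N (unit_mat (BarVec 1) (BarVec 1)) j f ws = slots n \<tau> (\<lambda>_. 0) (\<lambda>i. if i = j then b i else 0) ws"
    unfolding main[OF lab(2) Vec1_notin(2)] if0 ifj[of b] rhs by (simp add: coef_def)
  show "site N (unit_mat (Vec 1) (BarVec 1)) j f ws = slots n \<tau> (\<lambda>i. if i = j then b i else 0) (\<lambda>_. 0) ws"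
    unfolding main[OF lab(2) Vec1_notin(2)] if0 ifj[of b] rhs by (simp add: coef_def)
  show "site N (unit_mat (BarVec 1) (Vec 1)) j f ws = slots n \<tau> (\<lambda>_. 0) (\<lambda>i. if i = j then a i else 0) ws"
    unfolding main[OF lab(1) Vec1_notin(1)] if0 ifj[of a] rhs by (simp add: coef_def)
qed

lemma sum_slots:
  "finite J \<Longrightarrow> (\<Sum>j\<in>J. y j * slots n \<tau> (a j) (b j) ws) = slots n \<tau> (\<lambda>i. \<Sum>j\<in>J. y j * a j i) (\<lambda>i. \<Sum>j\<in>J. y j * b j i) ws"
proof (induction J rule: finite_induct)
  case empty
  thus ?case by (simp add: slots_def coef_def)
next
  case (insert j J)
  thus ?case using slots_linear[of "y j" n \<tau> "a j" "b j" ws 1] by simp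
qed

text \<open>The coefficient 2 (\<alpha> + \<beta> x) / (x^2 - 1) collapses to k / (x - 1), which is
  also the coefficient of the last bracket of D_1. So the term with the swap of v_1 and its bar
  partner completes the sum over j \<noteq> i to the full sum minus one term. Likewise 2 \<alpha> =
  k supplies the summand \<open>b i\<close> missing from the sum of all \<open>b j\<close>.\<close>

lemma D1_slots:
  fixes a b a' b' :: "nat \<Rightarrow> complex"
  assumes F: "F lam y = slots n \<tau> a b" and dF: "\<And>ws. deriv (\<lambda>l. F l y ws) lam = slots n \<tau> a' b' ws"
    and x: "x = xpt lam 1" "x \<noteq> 1" "x \<noteq> -1"
  shows "D1 n N c k (k / 2) (k / 2) F lam y = slots n \<tau>
     (\<lambda>i. c * (1 / (2 * pi * \<i>)) * a' i + y i * a i + k * ((\<Sum>j=i+1..n. a j) + (\<Sum>j=1..n. b j))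
        + k / (x - 1) * ((\<Sum>j=1..n. a j + b j) - a i))
     (\<lambda>i. c * (1 / (2 * pi * \<i>)) * b' i - y i * b i + k * (\<Sum>j=1..<i. b j)
        + k / (x - 1) * ((\<Sum>j=1..n. a j + b j) - b i))"
proof
  fix ws
  let ?f = "slots n \<tau> a b"
  have xp: "xpt lam p = 1" if "p \<in> {2..N}" for p using that by (simp add: xpt_def)
  have d1: "(\<Sum>j=1..n. y j * (site N (unit_mat (Vec 1) (Vec 1)) j ?f ws - site N (unit_mat (BarVec 1) (BarVec 1)) j ?f ws))
      = slots n \<tau> (\<lambda>i. y i * a i) (\<lambda>i. - (y i * b i)) ws"
  proof -
    have "(\<Sum>j=1..n. y j * (site N (unit_mat (Vec 1) (Vec 1)) j ?f ws - site N (unit_mat (BarVec 1) (BarVec 1)) j ?f ws))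
       = (\<Sum>j=1..n. y j * slots n \<tau> (\<lambda>i. if i = j then a i else 0) (\<lambda>i. - (if i = j then b i else 0)) ws)"
    proof (intro sum.cong refl)
      fix j assume j: "j \<in> {1..n}"
      show "y j * (site N (unit_mat (Vec 1) (Vec 1)) j ?f ws - site N (unit_mat (BarVec 1) (BarVec 1)) j ?f ws) =
        y j * slots n \<tau> (\<lambda>i. if i = j then a i else 0) (\<lambda>i. - (if i = j then b i else 0)) ws"
        unfolding site_diag_slots[OF j] using slots_linear[of 1 n \<tau> _ _ ws "-1"] by simp
    qed
    also have "\<dots> = slots n \<tau> (\<lambda>i. y i * a i) (\<lambda>i. - (y i * b i)) ws"
      unfolding sum_slots[OF finite_atLeastAtMost]
      by (rule arg_cong[of _ _ "\<lambda>f. f ws"], rule slots_cong) (simp_all add: if_distrib[of "(*) _"] sum.delta' sum_negf cong: if_cong)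
    finally show ?thesis .
  qed
  have d2: "(\<Sum>j=1..n. site N (unit_mat (Vec 1) (BarVec 1)) j ?f ws) = slots n \<tau> b (\<lambda>_. 0) ws"
  proof -
    have "(\<Sum>j=1..n. site N (unit_mat (Vec 1) (BarVec 1)) j ?f ws)
       = (\<Sum>j=1..n. 1 * slots n \<tau> (\<lambda>i. if i = j then b i else 0) (\<lambda>_. 0) ws)"
      by (intro sum.cong refl) (simp only: site_diag_slots mult_1)
    also have "\<dots> = slots n \<tau> b (\<lambda>_. 0) ws"
      unfolding sum_slots[OF finite_atLeastAtMost]
      by (rule arg_cong[of _ _ "\<lambda>f. f ws"], rule slots_cong) (simp_all add: sum.delta')
    finally show ?thesis .
  qed
  have d3: "(\<Sum>j=1..n. site N (Ebar_mat (Vec 1) (Vec 1)) j ?f ws) = slots n \<tau> b a ws"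
  proof -
    have "(\<Sum>j=1..n. site N (Ebar_mat (Vec 1) (Vec 1)) j ?f ws)
       = (\<Sum>j=1..n. 1 * slots n \<tau> (\<lambda>i. if i = j then b i else 0) (\<lambda>i. if i = j then a i else 0) ws)"
    proof (intro sum.cong refl)
      fix j assume j: "j \<in> {1..n}"
      show "site N (Ebar_mat (Vec 1) (Vec 1)) j ?f ws =
        1 * slots n \<tau> (\<lambda>i. if i = j then b i else 0) (\<lambda>i. if i = j then a i else 0) ws"
        unfolding site_Ebar bar.simps site_diag_slots[OF j] using slots_linear[of 1 n \<tau> _ _ ws 1] by simp
    qed
    also have "\<dots> = slots n \<tau> b a ws"
      unfolding sum_slots[OF finite_atLeastAtMost]
      by (rule arg_cong[of _ _ "\<lambda>f. f ws"], rule slots_cong) (simp_all add: sum.delta')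
    finally show ?thesis .
  qed
  have co: "2 * ((k / 2 + k / 2 * x) / (x\<^sup>2 - 1)) = k / (x - 1)"
  proof -
    have 1: "x\<^sup>2 - 1 = (x - 1) * (x + 1)" by (simp add: power2_eq_square algebra_simps)
    have 2: "x + 1 \<noteq> 0" using x(3) by (metis add.inverse_inverse add_eq_0_iff)
    have 3: "2 * (k / 2 + k / 2 * x) = k * (x + 1)" by (simp add: algebra_simps)
    show ?thesis unfolding 1 times_divide_eq_right 3 using 2 by simp
  qed
  have d4: "(\<Sum>p=2..N. xpt lam p / (x - xpt lam p) * (X_op n N (Vec 1) (Vec p) ?f ws + X_op n N (Vec p) (Vec 1) ?f ws))
      + (\<Sum>p=1..N. 1 / (x * xpt lam p - 1) * (Y_op n N (Vec 1) (Vec p) ?f ws + Z_op n N (Vec 1) (Vec p) ?f ws))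
      = 1 / (x - 1) * slots n \<tau> (\<lambda>i. \<Sum>j\<in>{1..n}-{i}. a j + b j) (\<lambda>i. \<Sum>j\<in>{1..n}-{i}. a j + b j) ws"
  proof -
    have "(\<Sum>p=1..N. 1 / (x * xpt lam p - 1) * (Y_op n N (Vec 1) (Vec p) ?f ws + Z_op n N (Vec 1) (Vec p) ?f ws))
       = (\<Sum>p=2..N. 1 / (x * xpt lam p - 1) * (Y_op n N (Vec 1) (Vec p) ?f ws + Z_op n N (Vec 1) (Vec p) ?f ws))"
      using N Y_op_diag[of a b ws] by (simp add: sum.atLeast_Suc_atMost numeral_2_eq_2)
    also have "\<dots> = 1 / (x - 1) * (\<Sum>p=2..N. Y_op n N (Vec 1) (Vec p) ?f ws + Z_op n N (Vec 1) (Vec p) ?f ws)"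
      unfolding sum_distrib_left by (intro sum.cong refl) (simp add: xp)
    finally have 1: "(\<Sum>p=1..N. 1 / (x * xpt lam p - 1) * (Y_op n N (Vec 1) (Vec p) ?f ws + Z_op n N (Vec 1) (Vec p) ?f ws))
       = 1 / (x - 1) * (\<Sum>p=2..N. Y_op n N (Vec 1) (Vec p) ?f ws + Z_op n N (Vec 1) (Vec p) ?f ws)" .
    have 2: "(\<Sum>p=2..N. xpt lam p / (x - xpt lam p) * (X_op n N (Vec 1) (Vec p) ?f ws + X_op n N (Vec p) (Vec 1) ?f ws))
      = 1 / (x - 1) * (\<Sum>p=2..N. X_op n N (Vec 1) (Vec p) ?f ws + X_op n N (Vec p) (Vec 1) ?f ws)"
      unfolding sum_distrib_left by (intro sum.cong refl) (simp add: xp)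
    show ?thesis unfolding 1 2 distrib_left[symmetric] hop_all_op ..
  qed
  have "D1 n N c k (k / 2) (k / 2) F lam y ws =
      1 * (1 * (1 * (1 * (c * (1 / (2 * pi * \<i>)) * slots n \<tau> a' b' ws + 1 * slots n \<tau> (\<lambda>i. y i * a i) (\<lambda>i. - (y i * b i)) ws)
      + k * slots n \<tau> b (\<lambda>_. 0) ws)
      + k * slots n \<tau> (\<lambda>i. (\<Sum>j=i+1..n. a j + b j) + (\<Sum>j=1..<i. b j)) (\<lambda>i. \<Sum>j=1..<i. b j) ws)
      + k / (x - 1) * slots n \<tau> b a ws)
      + k / (x - 1) * slots n \<tau> (\<lambda>i. \<Sum>j\<in>{1..n}-{i}. a j + b j) (\<lambda>i. \<Sum>j\<in>{1..n}-{i}. a j + b j) ws"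
    unfolding D1_def Let_def F dF x(1)[symmetric] d1 d2 d3 d4 co hop_left_op by simp
  also have "\<dots> = slots n \<tau>
     (\<lambda>i. c * (1 / (2 * pi * \<i>)) * a' i + y i * a i + k * ((\<Sum>j=i+1..n. a j) + (\<Sum>j=1..n. b j))
        + k / (x - 1) * ((\<Sum>j=1..n. a j + b j) - a i))
     (\<lambda>i. c * (1 / (2 * pi * \<i>)) * b' i - y i * b i + k * (\<Sum>j=1..<i. b j)
        + k / (x - 1) * ((\<Sum>j=1..n. a j + b j) - b i)) ws"
    unfolding slots_linear
  proof (rule arg_cong[of _ _ "\<lambda>f. f ws"], rule slots_cong)
    fix i assume i: "i \<in> {1..n}"
    have e1: "(\<Sum>j\<in>{1..n}-{i}. a j + b j) = (\<Sum>j=1..n. a j + b j) - (a i + b i)"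
      using i by (simp add: sum_diff1)
    have "{1..n} = {1..<i} \<union> ({i} \<union> {i+1..n})" using i by auto
    hence "(\<Sum>j=1..n. b j) = sum b ({1..<i} \<union> ({i} \<union> {i+1..n}))" by simp
    also have "\<dots> = sum b {1..<i} + (b i + sum b {i+1..n})"
      by (subst sum.union_disjoint) (auto simp: sum.union_disjoint)
    finally have e2: "(\<Sum>j=1..n. b j) = sum b {1..<i} + (b i + sum b {i+1..n})" .
    show "1 * (1 * (1 * (1 * (c * (1 / (2 * pi * \<i>)) * a' i + 1 * (y i * a i)) + k * b i)
        + k * ((\<Sum>j=i+1..n. a j + b j) + (\<Sum>j=1..<i. b j))) + k / (x - 1) * b i)
        + k / (x - 1) * (\<Sum>j\<in>{1..n}-{i}. a j + b j) =
       c * (1 / (2 * pi * \<i>)) * a' i + y i * a i + k * ((\<Sum>j=i+1..n. a j) + (\<Sum>j=1..n. b j))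
        + k / (x - 1) * ((\<Sum>j=1..n. a j + b j) - a i)"
      unfolding e1 unfolding e2 sum.distrib by (simp only: mult_1 distrib_left right_diff_distrib) simp
    show "1 * (1 * (1 * (1 * (c * (1 / (2 * pi * \<i>)) * b' i + 1 * - (y i * b i)) + k * 0)
        + k * (\<Sum>j=1..<i. b j)) + k / (x - 1) * a i)
        + k / (x - 1) * (\<Sum>j\<in>{1..n}-{i}. a j + b j) =
       c * (1 / (2 * pi * \<i>)) * b' i - y i * b i + k * (\<Sum>j=1..<i. b j)
        + k / (x - 1) * ((\<Sum>j=1..n. a j + b j) - b i)"
      unfolding e1 by (simp only: mult_1 distrib_left right_diff_distrib) simp
  qed
  finally show "D1 n N c k (k / 2) (k / 2) F lam y ws = slots n \<tau>
     (\<lambda>i. c * (1 / (2 * pi * \<i>)) * a' i + y i * a i + k * ((\<Sum>j=i+1..n. a j) + (\<Sum>j=1..n. b j))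
        + k / (x - 1) * ((\<Sum>j=1..n. a j + b j) - a i))
     (\<lambda>i. c * (1 / (2 * pi * \<i>)) * b' i - y i * b i + k * (\<Sum>j=1..<i. b j)
        + k / (x - 1) * ((\<Sum>j=1..n. a j + b j) - b i)) ws" .
qed

end

section \<open>Orders of the positions\<close>

text \<open>Induction on \<open>xs\<close>: its first letter is brought to the front of
  \<open>ys\<close> by adjacent exchanges, and the prefix \<open>us\<close> makes the hypothesis
  applicable to the tails.\<close>

lemma adjacent_swap_imp_mset_invariant:
  fixes v :: "'a list \<Rightarrow> 'b"
  assumes swap: "\<And>us a b vs. v (us @ [a, b] @ vs) = v (us @ [b, a] @ vs)" and eq: "mset xs = mset ys"
  shows "v xs = v ys"
proof -
  have move: "v (us @ x # vs @ ws) = v (us @ vs @ x # ws)" for us x vs ws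
  proof (induction vs arbitrary: us)
    case (Cons b vs)
    have "v (us @ x # (b # vs) @ ws) = v (us @ [b, x] @ (vs @ ws))" using swap[of us x b "vs @ ws"] by simp
    also have "\<dots> = v ((us @ [b]) @ x # vs @ ws)" by simp
    also have "\<dots> = v ((us @ [b]) @ vs @ x # ws)" by (rule Cons.IH)
    finally show ?case by simp
  qed simp
  have "\<forall>us ys. mset xs = mset ys \<longrightarrow> v (us @ xs) = v (us @ ys)"
  proof (induction xs)
    case (Cons x xs)
    show ?case
    proof (intro allI impI)
      fix us ys assume m: "mset (x # xs) = mset ys"
      hence "x \<in> set ys" by (metis list.set_intros(1) set_mset_mset)
      then obtain p q where ys: "ys = p @ x # q" by (meson split_list)
      hence "mset xs = mset (p @ q)" using m by simp
      hence "v ((us @ [x]) @ xs) = v ((us @ [x]) @ (p @ q))" using Cons.IH by blast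
      also have "\<dots> = v (us @ x # p @ q)" by simp
      also have "\<dots> = v (us @ p @ x # q)" by (rule move)
      finally show "v (us @ x # xs) = v (us @ ys)" unfolding ys by simp
    qed
  qed simp
  thus ?thesis using eq by (metis append_Nil)
qed

text \<open>T acts on the last factor only, but by symmetry any letter may be put last.\<close>

lemma symmetric_tensor:
  fixes vt :: tensor
  assumes n: "1 \<le> n" and N: "1 \<le> N"
    and vt: "vt \<in> tensor_power (labels {2..N}) (n - 1)"
    and sym: "\<And>i. 1 \<le> i \<Longrightarrow> i + 2 \<le> n \<Longrightarrow> Pi_op i (i + 1) vt = vt"
    and T: "2 \<le> n \<Longrightarrow> site N (T_mat (\<lambda>_. 1)) (n - 1) vt = vt"
  obtains \<tau> where "symmetric_part N \<tau>" "\<And>xs. vt xs = \<tau> (mset xs)"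
proof -
  have supp: "length xs = n - 1 \<and> set xs \<subseteq> labels {2..N}" if "vt xs \<noteq> 0" for xs
    using vt that by (auto simp: tensor_power_def)
  have swap: "vt (us @ [a, b] @ vs) = vt (us @ [b, a] @ vs)" for us a b vs
  proof (cases "length us + 2 + length vs = n - 1")
    case True
    let ?ws = "us @ [b, a] @ vs"
    have "Pi_op (length us + 1) (length us + 1 + 1) vt = vt" using True by (intro sym) auto
    moreover have "Pi_op (length us + 1) (length us + 1 + 1) vt ?ws = vt (us @ [a, b] @ vs)"
      by (simp add: Pi_op_def nth_append list_update_append)
    ultimately show ?thesis by simp
  next
    case False
    hence "vt (us @ [a, b] @ vs) = 0" "vt (us @ [b, a] @ vs) = 0" using supp by fastforce+
    thus ?thesis by simp
  qed
  \<comment> \<open>The list chosen for a multiset is irrelevant by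
    \<open>adjacent_swap_imp_mset_invariant\<close>.\<close>
  define \<tau> where "\<tau> M = vt (SOME xs. mset xs = M)" for M
  have \<tau>: "vt xs = \<tau> (mset xs)" for xs
    unfolding \<tau>_def
    by (rule adjacent_swap_imp_mset_invariant[where v = vt, OF swap]) (metis (mono_tags) someI)
  have "\<tau> (add_mset (bar l) M) = \<tau> (add_mset l M)" for l M
  proof -
    obtain xs where xs: "mset xs = M" using ex_mset by blast
    have eq: "\<tau> (add_mset p M) = vt (xs @ [p])" for p using \<tau>[of "xs @ [p]"] xs by simp
    show ?thesis
    proof (cases "length xs + 1 = n - 1")
      case True
      let ?a = "bar l"
      have len: "n - 1 - 1 = length xs" using True by simp
      have "vt (xs @ [?a]) = site N (T_mat (\<lambda>_. 1)) (n - 1) vt (xs @ [?a])" using T True by simp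
      also have "\<dots> = (\<Sum>q\<in>labels {1..N}. if q = bar ?a then vt (xs @ [bar ?a]) else 0)"
        unfolding site_def len
        by (intro sum.cong refl) (auto simp: T_mat_def list_update_append split: idx.splits)
      also have "\<dots> = (if bar ?a \<in> labels {1..N} then vt (xs @ [bar ?a]) else 0)" by (simp add: sum.delta)
      also have "\<dots> = vt (xs @ [l])"
      proof -
        have "vt (xs @ [l]) = 0" if "l \<notin> labels {1..N}"
        proof (rule ccontr)
          assume "vt (xs @ [l]) \<noteq> 0"
          hence "l \<in> labels {2..N}" using supp by fastforce
          thus False using that by (auto simp: labels_def)
        qed
        thus ?thesis by simp
      qed
      finally show ?thesis by (simp add: eq)
    next
      case False
      hence "vt (xs @ [p]) = 0" for p using supp[of "xs @ [p]"] by auto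
      thus ?thesis by (simp add: eq)
    qed
  qed
  moreover have "set_mset M \<subseteq> labels {2..N}" if "\<tau> M \<noteq> 0" for M
  proof -
    obtain xs where xs: "mset xs = M" using ex_mset by blast
    thus ?thesis using supp[of xs] that \<tau>[of xs] by auto
  qed
  ultimately have "symmetric_part N \<tau>" using N by unfold_locales auto
  thus thesis using \<tau> by (rule that)
qed

lemma drop_last: "length xs = n \<Longrightarrow> 1 \<le> n \<Longrightarrow> drop (n - 1) xs = [xs ! (n - 1)]"
  by (cases xs rule: rev_cases) auto

text \<open>The exchange in the definition of u_j keeps the multiset of letters, so only the place
  of the distinguished letter matters.\<close>

lemma u_vec_slots:
  fixes vt :: tensor
  assumes n: "1 \<le> n" and len: "\<And>xs. vt xs \<noteq> 0 \<Longrightarrow> length xs = n - 1" and \<tau>: "\<And>xs. vt xs = \<tau> (mset xs)"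
    and i: "i \<in> {1..n}"
  shows "u_vec n vt i ws = (if length ws = n \<and> ws ! (i - 1) = Vec 1 then \<tau> (rest n ws {i}) else 0)"
    and "u_vec n vt (2 * n + 1 - i) ws = (if length ws = n \<and> ws ! (i - 1) = BarVec 1 then \<tau> (rest n ws {i}) else 0)"
proof -
  have rest: "mset ws = add_mset (ws ! (i - 1)) (rest n ws {i})" if "length ws = n"
    using mset_eq_rest[OF that] rest_split[of i n "{}" ws] i by simp
  let ?ws1 = "ws[1 - 1 := ws ! (i - 1), i - 1 := ws ! (1 - 1)]"
  have u1: "u_vec n vt i ws = basis (Vec 1) (take 1 ?ws1) * vt (drop 1 ?ws1)"
    unfolding u_vec_def Pi_op_def tens_def using i by simp
  show "u_vec n vt i ws = (if length ws = n \<and> ws ! (i - 1) = Vec 1 then \<tau> (rest n ws {i}) else 0)"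
  proof (cases "length ws = n")
    case True
    let ?ws = "ws[1 - 1 := ws ! (i - 1), i - 1 := ws ! (1 - 1)]"
    have hd: "?ws ! 0 = ws ! (i - 1)"
    proof (cases "i = 1")
      case False
      hence "i - 1 \<noteq> 0" using i by auto
      thus ?thesis using n True by simp
    qed simp
    have "length ?ws = n" using True by simp
    then obtain r where r: "?ws = ws ! (i - 1) # r" using hd n by (cases ?ws) auto
    have "mset ?ws = mset ws" using i n True by (intro mset_swap) auto
    hence "mset r = rest n ws {i}" unfolding r using rest[OF True] by simp
    thus ?thesis using True unfolding u1 basis_def r by (simp add: \<tau>)
  next
    case False
    let ?ws = "ws[1 - 1 := ws ! (i - 1), i - 1 := ws ! (1 - 1)]"
    have "basis (Vec 1) (take 1 ?ws) * vt (drop 1 ?ws) = 0"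
    proof (rule ccontr)
      assume "basis (Vec 1) (take 1 ?ws) * vt (drop 1 ?ws) \<noteq> 0"
      hence "take 1 ?ws = [Vec 1]" "vt (drop 1 ?ws) \<noteq> 0" unfolding basis_def mult_eq_0_iff by argo+
      hence "take 1 ?ws = [Vec 1]" "length (drop 1 ?ws) = n - 1" using len[of "drop 1 ?ws"] by blast+
      hence "length (take 1 ?ws @ drop 1 ?ws) = n" using n by (simp only: length_append) simp
      thus False using False by (simp only: append_take_drop_id length_list_update)
    qed
    thus ?thesis using False u1 by simp
  qed
  show "u_vec n vt (2 * n + 1 - i) ws = (if length ws = n \<and> ws ! (i - 1) = BarVec 1 then \<tau> (rest n ws {i}) else 0)"
  proof -
    have ni: "\<not> 2 * n + 1 - i \<le> n" "2 * n + 1 - (2 * n + 1 - i) = i" using i by auto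
    let ?ws = "ws[i - 1 := ws ! (n - 1), n - 1 := ws ! (i - 1)]"
    have u: "u_vec n vt (2 * n + 1 - i) ws = vt (take (n - 1) ?ws) * basis (BarVec 1) (drop (n - 1) ?ws)"
      unfolding u_vec_def Pi_op_def tens_def ni(2) using ni(1) by simp
    show ?thesis
    proof (cases "length ws = n")
      case True
      have lst: "?ws ! (n - 1) = ws ! (i - 1)" using i True by (simp add: nth_list_update)
      have "length ?ws = n" using True by simp
      hence dr: "drop (n - 1) ?ws = [ws ! (i - 1)]"
        using lst n drop_last[of ?ws n] by simp
      have "mset ?ws = mset ws" using i n True by (intro mset_swap) auto
      also have "mset ?ws = mset (take (n - 1) ?ws @ drop (n - 1) ?ws)" by (simp only: append_take_drop_id)
      finally have "mset (take (n - 1) ?ws) = rest n ws {i}" unfolding dr using rest[OF True] by simp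
      thus ?thesis unfolding u dr using True by (simp add: \<tau> basis_def)
    next
      case False
      have "vt (take (n - 1) ?ws) * basis (BarVec 1) (drop (n - 1) ?ws) = 0"
      proof (rule ccontr)
        assume "vt (take (n - 1) ?ws) * basis (BarVec 1) (drop (n - 1) ?ws) \<noteq> 0"
        hence "drop (n - 1) ?ws = [BarVec 1]" "vt (take (n - 1) ?ws) \<noteq> 0" unfolding basis_def mult_eq_0_iff by argo+
        hence "drop (n - 1) ?ws = [BarVec 1]" "length (take (n - 1) ?ws) = n - 1"
          using len[of "take (n - 1) ?ws"] by blast+
        hence "length (take (n - 1) ?ws @ drop (n - 1) ?ws) = n" using n by (simp only: length_append) simp
        thus False using False by (simp only: append_take_drop_id length_list_update)
      qed
      thus ?thesis using False u by simp
    qed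
  qed
qed

lemma sum_u_vec:
  fixes vt :: tensor
  assumes n: "1 \<le> n" and len: "\<And>xs. vt xs \<noteq> 0 \<Longrightarrow> length xs = n - 1" and \<tau>: "\<And>xs. vt xs = \<tau> (mset xs)"
  shows "(\<Sum>j=1..2*n. I j * u_vec n vt j ws) = slots n \<tau> I (\<lambda>i. I (2 * n + 1 - i)) ws"
proof -
  have "{1..2*n} = {1..n} \<union> {n+1..2*n}" using n by auto
  hence "(\<Sum>j=1..2*n. I j * u_vec n vt j ws) = (\<Sum>j\<in>{1..n} \<union> {n+1..2*n}. I j * u_vec n vt j ws)" by (simp only:)
  also have "\<dots> = (\<Sum>j=1..n. I j * u_vec n vt j ws) + (\<Sum>j=n+1..2*n. I j * u_vec n vt j ws)"
    by (rule sum.union_disjoint) auto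
  also have "(\<Sum>j=n+1..2*n. I j * u_vec n vt j ws) = (\<Sum>i=1..n. I (2*n+1-i) * u_vec n vt (2*n+1-i) ws)"
    by (rule sum.reindex_bij_witness[of _ "\<lambda>i. 2*n+1-i" "\<lambda>j. 2*n+1-j"]) auto
  finally have "(\<Sum>j=1..2*n. I j * u_vec n vt j ws) =
      (\<Sum>i=1..n. I i * u_vec n vt i ws + I (2*n+1-i) * u_vec n vt (2*n+1-i) ws)"
    by (simp add: sum.distrib)
  also have "\<dots> = (\<Sum>i=1..n. if length ws = n then coef (I i) (I (2*n+1-i)) (ws ! (i - 1)) * \<tau> (rest n ws {i}) else 0)"
  proof (rule sum.cong[OF refl])
    fix i assume i: "i \<in> {1..n}"
    show "I i * u_vec n vt i ws + I (2*n+1-i) * u_vec n vt (2*n+1-i) ws =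
        (if length ws = n then coef (I i) (I (2*n+1-i)) (ws ! (i - 1)) * \<tau> (rest n ws {i}) else 0)"
    proof -
      have 1: "u_vec n vt i ws = (if length ws = n \<and> ws ! (i - 1) = Vec 1 then \<tau> (rest n ws {i}) else 0)"
        by (rule u_vec_slots(1)[where \<tau> = \<tau>, OF n _ _ i], (rule len, assumption), rule \<tau>)
      have 2: "u_vec n vt (2*n+1-i) ws = (if length ws = n \<and> ws ! (i - 1) = BarVec 1 then \<tau> (rest n ws {i}) else 0)"
        by (rule u_vec_slots(2)[where \<tau> = \<tau>, OF n _ _ i], (rule len, assumption), rule \<tau>)
      show ?thesis unfolding 1 2 coef_def by (simp add: distrib_right)
    qed
  qed
  finally show ?thesis by (simp add: slots_def)
qed

text \<open>
  \<open>before m j i\<close> is the set of positions preceding \<open>i\<close> when \<open>m\<close> is inserted directly before the others that are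
  at least \<open>j\<close>. The functions \<open>ga\<close> and \<open>gb\<close> are $g_i$ and $g_{2n+1-i}$ for this order of the positions;
  the natural order is \<open>j = m\<close>, or equivalently \<open>j = m + 1\<close>.
\<close>

definition before :: "nat \<Rightarrow> nat \<Rightarrow> nat \<Rightarrow> nat set" where
  "before m j i = (if i = m then {1..<j} - {m} else ({1..<i} - {m}) \<union> (if j \<le> i then {m} else {}))"

definition fct :: "complex \<Rightarrow> complex \<Rightarrow> complex \<Rightarrow> complex" where
  "fct k z t = (t - z - k) / (t - z)"

definition ga :: "complex \<Rightarrow> nat \<Rightarrow> nat \<Rightarrow> (nat \<Rightarrow> complex) \<Rightarrow> nat \<Rightarrow> complex \<Rightarrow> complex" where
  "ga k m j y i t = 1 / (t - y i) * (\<Prod>p\<in>before m j i. fct k (y p) t)"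

definition gb :: "nat \<Rightarrow> complex \<Rightarrow> nat \<Rightarrow> nat \<Rightarrow> (nat \<Rightarrow> complex) \<Rightarrow> nat \<Rightarrow> complex \<Rightarrow> complex" where
  "gb n k m j y i t = 1 / (t + y i) * (\<Prod>p\<in>{1..n} - before m j i - {i}. fct k (- y p) t) * (\<Prod>p=1..n. fct k (y p) t)"

lemma finite_before [simp]: "finite (before m j i)" by (auto simp: before_def)

lemma before_natural: "m \<ge> 1 \<Longrightarrow> before m m i = {1..<i}" "m \<ge> 1 \<Longrightarrow> before m (m + 1) i = {1..<i}"
  by (auto simp: before_def)

lemma g_fun_eq:
  assumes i: "i \<in> {1..n}" and m: "m \<in> {1..n}"
  shows "g_fun n k y i t = ga k m m y i t" "g_fun n k y (2 * n + 1 - i) t = gb n k m m y i t"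
proof -
  show "g_fun n k y i t = ga k m m y i t"
    using i m by (simp add: g_fun_def ga_def before_natural fct_def)
  have ni: "\<not> 2 * n + 1 - i \<le> n" "2 * n + 1 - (2 * n + 1 - i) = i" using i by auto
  have "{1..n} - {1..<i} - {i} = {i+1..n}" using i by auto
  thus "g_fun n k y (2 * n + 1 - i) t = gb n k m m y i t"
    using m ni unfolding g_fun_def Let_def ni(2) gb_def fct_def by (simp add: before_natural)
qed

section \<open>Exchange and reflection of points\<close>

text \<open>The two rows of R on a pair of neighbouring functions, with common factors removed. No
  other identity is behind the R-matrices.\<close>

lemma exchange_identities:
  fixes t a b k :: complex
  assumes t: "t \<noteq> a" "t \<noteq> b" and z: "a - b + k \<noteq> 0"
  shows "((a - b) * (1 / (t - a)) + k * (1 / (t - b) * fct k a t)) / (a - b + k) = 1 / (t - a) * fct k b t"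
    and "((a - b) * (1 / (t - b) * fct k a t) + k * (1 / (t - a))) / (a - b + k) = 1 / (t - b)"
proof -
  define s where "s = t - a"
  define r where "r = t - b"
  have sr: "s \<noteq> 0" "r \<noteq> 0" "a - b = r - s" "r - s + k \<noteq> 0" using t z by (auto simp: s_def r_def)
  show "((a - b) * (1 / (t - a)) + k * (1 / (t - b) * fct k a t)) / (a - b + k) = 1 / (t - a) * fct k b t"
    unfolding fct_def s_def[symmetric] r_def[symmetric] sr(3) using sr(1,2,4)
    by (simp add: divide_simps) (simp add: algebra_simps)
  show "((a - b) * (1 / (t - b) * fct k a t) + k * (1 / (t - a))) / (a - b + k) = 1 / (t - b)"
    unfolding fct_def s_def[symmetric] r_def[symmetric] sr(3) using sr(1,2,4)
    by (simp add: divide_simps) (simp add: algebra_simps)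
qed

lemma before_step:
  assumes "j \<noteq> m"
  defines "B \<equiv> {1..<j} - {m}"
  shows "before m j m = B" "before m j j = insert m B" "before m (j + 1) j = B"
    and "j \<ge> 1 \<Longrightarrow> before m (j + 1) m = insert j B"
    and "i \<noteq> m \<Longrightarrow> i \<noteq> j \<Longrightarrow> before m (j + 1) i = before m j i"
    and "m \<notin> B" "j \<notin> B" "finite B"
  using assms(1) by (auto simp: before_def B_def)

text \<open>When \<open>m\<close> passes \<open>j\<close>, only the functions of these two positions
  change, by \<open>exchange_identities\<close>; for the others the combination consists of equal
  terms. The second claim is the passage in the opposite direction.\<close>

lemma exchange_ga:
  assumes j: "j \<in> {1..n}" "m \<in> {1..n}" "j \<noteq> m"
    and t: "t \<noteq> y m" "t \<noteq> y j"
  shows "y m - y j + k \<noteq> 0 \<Longrightarrow>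
      ((y m - y j) * ga k m j y i t + k * ga k m j y (swp m j i) t) / (y m - y j + k) = ga k m (j + 1) y i t"
    and "y j - y m + k \<noteq> 0 \<Longrightarrow>
      ((y j - y m) * ga k m (j + 1) y i t + k * ga k m (j + 1) y (swp m j i) t) / (y j - y m + k) = ga k m j y i t"
proof -
  define B where "B = {1..<j} - {m}"
  define X where "X = (\<Prod>p\<in>B. fct k (y p) t)"
  note bs = before_step[OF j(3), folded B_def]
  have v: "ga k m j y m t = 1 / (t - y m) * X" "ga k m j y j t = 1 / (t - y j) * fct k (y m) t * X"
     "ga k m (j + 1) y m t = 1 / (t - y m) * fct k (y j) t * X" "ga k m (j + 1) y j t = 1 / (t - y j) * X"
    using bs j by (simp_all add: ga_def X_def)
  have eq: "ga k m (j + 1) y i t = ga k m j y i t" if "i \<noteq> m" "i \<noteq> j" for i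
    using bs(5)[OF that] by (simp add: ga_def)
  have triv: "(u * x + k * x) / (u + k) = x" if "u + k \<noteq> 0" for u x :: complex
    using that by (simp add: distrib_right[symmetric])
  have fac: "(u * (p * X) + k * (q * X)) / w = (u * p + k * q) / w * X" for u p q w by (simp add: algebra_simps add_divide_distrib)
  have sw: "swp m j m = j" "swp m j j = m" using j by (auto simp: swp_def)
  {
    assume z: "y m - y j + k \<noteq> 0"
    show "((y m - y j) * ga k m j y i t + k * ga k m j y (swp m j i) t) / (y m - y j + k) = ga k m (j + 1) y i t"
    proof (cases "i = m \<or> i = j")
      case True
      thus ?thesis using exchange_identities[OF t z]
        by (elim disjE; simp only: sw v fac)
    next
      case False
      thus ?thesis using eq triv[OF z] by (simp add: swp_def)
    qed
  }
  {
    assume z: "y j - y m + k \<noteq> 0"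
    show "((y j - y m) * ga k m (j + 1) y i t + k * ga k m (j + 1) y (swp m j i) t) / (y j - y m + k) = ga k m j y i t"
    proof (cases "i = m \<or> i = j")
      case True
      thus ?thesis using exchange_identities[OF t(2,1) z]
        by (elim disjE; simp only: sw v fac)
    next
      case False
      thus ?thesis using eq triv[OF z] by (simp add: swp_def)
    qed
  }
qed

text \<open>In \<open>gb\<close> the factors at - y come from the positions after \<open>i\<close>.
  So the identities are applied to the points - y j and - y m in the opposite order, which leaves
  the difference y m - y j unchanged.\<close>

lemma exchange_gb:
  assumes j: "j \<in> {1..n}" "m \<in> {1..n}" "j \<noteq> m"
    and t: "t \<noteq> - y m" "t \<noteq> - y j" and i: "i \<in> {1..n}"
  shows "y m - y j + k \<noteq> 0 \<Longrightarrow>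
      ((y m - y j) * gb n k m j y i t + k * gb n k m j y (swp m j i) t) / (y m - y j + k) = gb n k m (j + 1) y i t"
    and "y j - y m + k \<noteq> 0 \<Longrightarrow>
      ((y j - y m) * gb n k m (j + 1) y i t + k * gb n k m (j + 1) y (swp m j i) t) / (y j - y m + k) = gb n k m j y i t"
proof -
  define B where "B = {1..<j} - {m}"
  define A where "A = {1..n} - B - {m} - {j}"
  define X where "X = (\<Prod>p\<in>A. fct k (- y p) t) * (\<Prod>p=1..n. fct k (y p) t)"
  note bs = before_step[OF j(3), folded B_def]
  have A: "finite A" "m \<notin> A" "j \<notin> A" by (auto simp: A_def)
  have sets: "{1..n} - before m j m - {m} = insert j A" "{1..n} - before m j j - {j} = A"
     "{1..n} - before m (j + 1) m - {m} = A" "{1..n} - before m (j + 1) j - {j} = insert m A"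
    using bs j by (auto simp: A_def)
  have v: "gb n k m j y m t = 1 / (t - (- y m)) * fct k (- y j) t * X" "gb n k m j y j t = 1 / (t - (- y j)) * X"
     "gb n k m (j + 1) y m t = 1 / (t - (- y m)) * X" "gb n k m (j + 1) y j t = 1 / (t - (- y j)) * fct k (- y m) t * X"
    unfolding gb_def sets X_def using A by simp_all
  have eq: "gb n k m (j + 1) y i t = gb n k m j y i t" if "i \<noteq> m" "i \<noteq> j" for i
    using bs(5)[OF that] by (simp add: gb_def)
  have triv: "(u * x + k * x) / (u + k) = x" if "u + k \<noteq> 0" for u x :: complex
    using that by (simp add: distrib_right[symmetric])
  have fac: "(u * (p * X) + k * (q * X)) / w = (u * p + k * q) / w * X" for u p q w by (simp add: algebra_simps add_divide_distrib)
  have sw: "swp m j m = j" "swp m j j = m" using j by (auto simp: swp_def)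
  {
    assume z: "y m - y j + k \<noteq> 0"
    have d: "y m - y j = - y j - (- y m)" by simp
    have z': "- y j - (- y m) + k \<noteq> 0" using z by (simp add: algebra_simps)
    show "((y m - y j) * gb n k m j y i t + k * gb n k m j y (swp m j i) t) / (y m - y j + k) = gb n k m (j + 1) y i t"
    proof (cases "i = m \<or> i = j")
      case True
      thus ?thesis using exchange_identities[OF t(2,1) z'] unfolding d
        by (elim disjE; simp only: sw v fac)
    next
      case False
      thus ?thesis using eq triv[OF z] by (simp add: swp_def)
    qed
  }
  {
    assume z: "y j - y m + k \<noteq> 0"
    have d: "y j - y m = - y m - (- y j)" by simp
    have z': "- y m - (- y j) + k \<noteq> 0" using z by (simp add: algebra_simps)
    show "((y j - y m) * gb n k m (j + 1) y i t + k * gb n k m (j + 1) y (swp m j i) t) / (y j - y m + k) = gb n k m j y i t"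
    proof (cases "i = m \<or> i = j")
      case True
      thus ?thesis using exchange_identities[OF t z'] unfolding d
        by (elim disjE; simp only: sw v fac)
    next
      case False
      thus ?thesis using eq triv[OF z] by (simp add: swp_def)
    qed
  }
qed

lemma before_last: "m \<in> {1..n} \<Longrightarrow> i \<in> {1..n} \<Longrightarrow> before m (n + 1) i = (if i = m then {1..n} - {m} else {1..<i} - {m})"
  by (auto simp: before_def)

text \<open>With \<open>m\<close> last, its two functions are neighbours in the order of all 2n
  functions, with points y m and - y m, and K exchanges them. Every other function contains both or
  neither of the factors at these two points, so the reflection does not change it.\<close>

lemma reflect_ga_gb:
  assumes m: "m \<in> {1..n}" and i: "i \<in> {1..n}"
    and t: "t \<noteq> y m" "t \<noteq> - y m" and z: "y m + k / 2 \<noteq> 0"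
  defines "y' \<equiv> y(m := - y m)"
  shows "i \<noteq> m \<Longrightarrow> ga k m (n + 1) y i t = ga k m (n + 1) y' i t"
    and "i \<noteq> m \<Longrightarrow> gb n k m (n + 1) y i t = gb n k m (n + 1) y' i t"
    and "(y m * gb n k m (n + 1) y m t + k / 2 * ga k m (n + 1) y m t) / (y m + k / 2) = ga k m (n + 1) y' m t"
    and "(y m * ga k m (n + 1) y m t + k / 2 * gb n k m (n + 1) y m t) / (y m + k / 2) = gb n k m (n + 1) y' m t"
proof -
  have same: "(\<Prod>p\<in>S. fct k (y' p) t) = (\<Prod>p\<in>S. fct k (y p) t)" "(\<Prod>p\<in>S. fct k (- y' p) t) = (\<Prod>p\<in>S. fct k (- y p) t)"
    if "m \<notin> S" for S
    using that by (intro prod.cong refl, auto simp: y'_def)+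
  define X where "X = (\<Prod>p\<in>{1..n} - {m}. fct k (y p) t)"
  have y'm: "y' m = - y m" by (simp add: y'_def)
  have all: "(\<Prod>p=1..n. fct k (y p) t) = fct k (y m) t * X"
    unfolding X_def using m by (intro prod.remove) auto
  have "(\<Prod>p=1..n. fct k (y' p) t) = fct k (y' m) t * (\<Prod>p\<in>{1..n} - {m}. fct k (y' p) t)"
    using m by (intro prod.remove) auto
  hence all': "(\<Prod>p=1..n. fct k (y' p) t) = fct k (- y m) t * X"
    using same(1)[of "{1..n} - {m}"] by (simp add: X_def y'm)
  {
    assume im: "i \<noteq> m"
    hence y'i: "y' i = y i" by (simp add: y'_def)
    show "ga k m (n + 1) y i t = ga k m (n + 1) y' i t"
      unfolding ga_def before_last[OF m i] y'i using im same(1)[of "{1..<i} - {m}"] by simp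
    let ?A = "{1..n} - ({1..<i} - {m}) - {i}"
    have mA: "m \<in> ?A" "finite ?A" using m im by auto
    have e1: "(\<Prod>p\<in>?A. fct k (- y p) t) = fct k (- y m) t * (\<Prod>p\<in>?A - {m}. fct k (- y p) t)"
      using mA by (intro prod.remove) auto
    have "(\<Prod>p\<in>?A. fct k (- y' p) t) = fct k (- y' m) t * (\<Prod>p\<in>?A - {m}. fct k (- y' p) t)"
      using mA by (intro prod.remove) auto
    hence e2: "(\<Prod>p\<in>?A. fct k (- y' p) t) = fct k (y m) t * (\<Prod>p\<in>?A - {m}. fct k (- y p) t)"
      using same(2)[of "?A - {m}"] by (simp add: y'm)
    show "gb n k m (n + 1) y i t = gb n k m (n + 1) y' i t"
      unfolding gb_def before_last[OF m i] if_not_P[OF im] y'i all all' e1 e2 by (simp only: ac_simps)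
  }
  have none: "{1..n} - ({1..n} - {m}) - {m} = {}" by blast
  have v: "ga k m (n + 1) y m t = 1 / (t - y m) * X" "ga k m (n + 1) y' m t = 1 / (t + y m) * X"
    "gb n k m (n + 1) y m t = (1 / (t + y m) * fct k (y m) t) * X"
    "gb n k m (n + 1) y' m t = (1 / (t - y m) * fct k (- y m) t) * X"
    using same(1)[of "{1..n} - {m}"] unfolding ga_def gb_def before_last[OF m m] if_P[OF refl] all all' none y'm
    by (simp_all add: X_def)
  define r where "r = t - y m"
  define s where "s = t + y m"
  have ym: "y m = (s - r) / 2" by (simp add: s_def r_def)
  have sr: "s \<noteq> 0" "r \<noteq> 0" "s - r + k \<noteq> 0"
    using t z by (auto simp: s_def r_def add_eq_0_iff field_simps)
  have fs: "fct k (y m) t = (r - k) / r" "fct k (- y m) t = (s - k) / s"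
    by (simp_all add: fct_def r_def s_def)
  \<comment> \<open>Doubling numerator and denominator gives the weights 2z and k of R(2z); here u =
    s - r is twice \<open>y m\<close>.\<close>
  have half: "(u / 2 * A + k / 2 * B) / (u / 2 + k / 2) = (u * A + k * B) / (u + k)" for u A B :: complex
  proof -
    have 1: "u / 2 * A + k / 2 * B = (u * A + k * B) / 2" "u / 2 + k / 2 = (u + k) / 2"
      by (simp_all add: add_divide_distrib)
    have 2: "(v / 2) / (w / 2) = v / w" for v w :: complex by simp
    show ?thesis unfolding 1 2 ..
  qed
  have id: "((s - r) * (1 / s * ((r - k) / r)) + k * (1 / r)) / (s - r + k) = 1 / s"
    "((s - r) * (1 / r) + k * (1 / s * ((r - k) / r))) / (s - r + k) = 1 / r * ((s - k) / s)"
    using sr by (simp add: divide_simps, simp add: algebra_simps)+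
  have fac: "(u * (p * X) + k / 2 * (q * X)) / w = (u * p + k / 2 * q) / w * X" for u p q w
    by (simp add: algebra_simps add_divide_distrib)
  show "(y m * gb n k m (n + 1) y m t + k / 2 * ga k m (n + 1) y m t) / (y m + k / 2) = ga k m (n + 1) y' m t"
    unfolding v fac unfolding fs r_def[symmetric] s_def[symmetric] unfolding ym half id ..
  show "(y m * ga k m (n + 1) y m t + k / 2 * gb n k m (n + 1) y m t) / (y m + k / 2) = gb n k m (n + 1) y' m t"
    unfolding v fac unfolding fs r_def[symmetric] s_def[symmetric] unfolding ym half id ..
qed

section \<open>The pairing\<close>

text \<open>The class of admissible rational factors: they preserve the decay of \<open>psi\<close>
  and add poles in \<open>Z\<close> only.\<close>

definition tempered :: "complex set \<Rightarrow> (complex \<Rightarrow> complex) \<Rightarrow> bool" where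
  "tempered Z h \<longleftrightarrow> h holomorphic_on - Z \<and> (\<exists>M. \<forall>\<^sub>F t in at_infinity. norm (h t) \<le> M)"

lemma tempered_const [simp, intro]: "tempered Z (\<lambda>_. a)"
  unfolding tempered_def by (auto intro!: holomorphic_intros exI[of _ "norm a"])

lemma tempered_add: "tempered Z f \<Longrightarrow> tempered Z g \<Longrightarrow> tempered Z (\<lambda>t. f t + g t)"
proof -
  assume "tempered Z f" "tempered Z g"
  then obtain M1 M2 where M: "\<forall>\<^sub>F t in at_infinity. norm (f t) \<le> M1" "\<forall>\<^sub>F t in at_infinity. norm (g t) \<le> M2"
    and h: "f holomorphic_on - Z" "g holomorphic_on - Z" unfolding tempered_def by blast
  have "\<forall>\<^sub>F t in at_infinity. norm (f t + g t) \<le> M1 + M2"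
    using M by eventually_elim (rule norm_triangle_mono)
  thus ?thesis unfolding tempered_def using h by (auto intro!: holomorphic_intros)
qed

lemma tempered_mult: "tempered Z f \<Longrightarrow> tempered Z g \<Longrightarrow> tempered Z (\<lambda>t. f t * g t)"
proof -
  assume "tempered Z f" "tempered Z g"
  then obtain M1 M2 where M: "\<forall>\<^sub>F t in at_infinity. norm (f t) \<le> M1" "\<forall>\<^sub>F t in at_infinity. norm (g t) \<le> M2"
    and h: "f holomorphic_on - Z" "g holomorphic_on - Z" unfolding tempered_def by blast
  have "\<forall>\<^sub>F t in at_infinity. norm (f t * g t) \<le> M1 * M2"
    using M by eventually_elim (simp add: norm_mult mult_mono')
  thus ?thesis unfolding tempered_def using h by (auto intro!: holomorphic_intros)
qed

lemma tempered_prod: "(\<And>i. i \<in> I \<Longrightarrow> tempered Z (f i)) \<Longrightarrow> tempered Z (\<lambda>t. \<Prod>i\<in>I. f i t)"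
  by (induction I rule: infinite_finite_induct) (auto intro: tempered_mult)

lemma tempered_sum: "(\<And>i. i \<in> I \<Longrightarrow> tempered Z (f i)) \<Longrightarrow> tempered Z (\<lambda>t. \<Sum>i\<in>I. f i t)"
  by (induction I rule: infinite_finite_induct) (auto intro: tempered_add)

lemma tempered_pole:
  assumes "z \<in> Z" shows "tempered Z (\<lambda>t. 1 / (t - z))"
  unfolding tempered_def
proof (intro conjI exI)
  show "(\<lambda>t. 1 / (t - z)) holomorphic_on - Z" using assms by (intro holomorphic_intros) auto
  have "norm (1 / (t - z)) \<le> 1" if "norm z + 1 \<le> norm t" for t
  proof -
    have "1 \<le> norm (t - z)" using norm_triangle_sub[of t z] that by linarith
    thus ?thesis by (simp add: norm_divide divide_le_eq_1)
  qed
  thus "\<forall>\<^sub>F t in at_infinity. norm (1 / (t - z)) \<le> 1" unfolding eventually_at_infinity by blast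
qed

lemma tempered_cong:
  assumes "tempered Z f" "\<And>t. t \<notin> Z \<Longrightarrow> g t = f t" "bounded Z"
  shows "tempered Z g"
proof -
  obtain M where M: "\<forall>\<^sub>F t in at_infinity. norm (f t) \<le> M" using assms(1) unfolding tempered_def by blast
  obtain R where R: "\<And>z. z \<in> Z \<Longrightarrow> norm z \<le> R" using assms(3) unfolding bounded_iff by blast
  have "\<forall>\<^sub>F t in at_infinity. R + 1 \<le> norm t" unfolding eventually_at_infinity by blast
  with M have "\<forall>\<^sub>F t in at_infinity. norm (g t) \<le> M"
  proof eventually_elim
    case (elim t)
    hence "t \<notin> Z" using R[of t] by auto
    thus ?case using elim(1) assms(2) by simp
  qed
  moreover have "g holomorphic_on - Z"
    using assms(1,2) unfolding tempered_def by (metis (no_types, lifting) ComplD holomorphic_transform)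
  ultimately show ?thesis unfolding tempered_def by blast
qed

section \<open>Integrands that agree off a countable set\<close>

lemma isolated_imp_countable:
  fixes E :: "real set"
  assumes "\<And>s. s \<in> E \<Longrightarrow> \<exists>d>0. \<forall>r\<in>E. \<bar>r - s\<bar> < d \<longrightarrow> r = s"
  shows "countable E"
proof -
  have "E \<subseteq> (\<lambda>(a, b). THE s. s \<in> E \<and> a < s \<and> s < b) ` (\<rat> \<times> \<rat>)"
  proof
    fix s assume s: "s \<in> E"
    then obtain d where d: "d > 0" "\<And>r. r \<in> E \<Longrightarrow> \<bar>r - s\<bar> < d \<Longrightarrow> r = s" using assms by blast
    obtain a where a: "a \<in> \<rat>" "s - d < a" "a < s" using Rats_dense_in_real[of "s - d" s] d(1) by auto
    obtain b where b: "b \<in> \<rat>" "s < b" "b < s + d" using Rats_dense_in_real[of s "s + d"] d(1) by auto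
    have "(THE s. s \<in> E \<and> a < s \<and> s < b) = s"
    proof (rule the_equality)
      fix r assume "r \<in> E \<and> a < r \<and> r < b"
      thus "r = s" using d(2)[of r] a b by auto
    qed (use s a b in auto)
    thus "s \<in> (\<lambda>(a, b). THE s. s \<in> E \<and> a < s \<and> s < b) ` (\<rat> \<times> \<rat>)"
      using a(1) b(1) by (intro image_eqI[of _ _ "(a, b)"]) auto
  qed
  moreover have "countable ((\<rat> :: real set) \<times> (\<rat> :: real set))" by (intro countable_SIGMA countable_rat)
  ultimately show ?thesis by (meson countable_image countable_subset)
qed

text \<open>Where the derivative is nonzero the curve leaves \<open>p\<close> at once, so these
  parameters are isolated. Parameters with derivative zero may be uncountably many, but the line
  integrand vanishes there.\<close>

lemma countable_preimage_nonstationary: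
  fixes \<gamma> :: "real \<Rightarrow> complex"
  shows "countable {s. \<gamma> s = p \<and> \<gamma> differentiable (at s) \<and> vector_derivative \<gamma> (at s) \<noteq> 0}" (is "countable ?E")
proof (rule isolated_imp_countable)
  fix s assume "s \<in> ?E"
  hence s: "\<gamma> s = p" "\<gamma> differentiable (at s)" "vector_derivative \<gamma> (at s) \<noteq> 0" by auto
  let ?v = "vector_derivative \<gamma> (at s)"
  have "(\<gamma> has_derivative (\<lambda>x. x *\<^sub>R ?v)) (at s)"
    using s(2) by (simp add: vector_derivative_works has_vector_derivative_def)
  moreover have "norm ?v / 2 > 0" using s(3) by simp
  ultimately obtain d where d: "d > 0" "\<And>r. norm (r - s) < d \<Longrightarrow> norm (\<gamma> r - \<gamma> s - (r - s) *\<^sub>R ?v) \<le> norm ?v / 2 * norm (r - s)"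
    unfolding has_derivative_at_alt by blast
  have "r = s" if "r \<in> ?E" "\<bar>r - s\<bar> < d" for r
  proof -
    have "norm ((r - s) *\<^sub>R ?v) \<le> norm ?v / 2 * norm (r - s)" using d(2)[of r] that s(1) by (simp add: norm_minus_commute)
    hence "\<bar>r - s\<bar> * norm ?v \<le> norm ?v / 2 * \<bar>r - s\<bar>" by (simp only: norm_scaleR real_norm_def)
    hence "\<bar>r - s\<bar> * (norm ?v / 2) \<le> 0" by (simp add: field_simps)
    thus ?thesis using s(3) by (simp add: mult_le_0_iff)
  qed
  thus "\<exists>d>0. \<forall>r\<in>?E. \<bar>r - s\<bar> < d \<longrightarrow> r = s" using d(1) by blast
qed

text \<open>A contour may pass through points of \<open>Q\<close> or rest there for a while. The
  values at these points have no effect: apart from countably many parameters the derivative is zero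
  there.\<close>

lemma
  assumes \<gamma>: "line_ended w b \<gamma>" and Q: "countable Q" and eq: "\<And>t. t \<in> range \<gamma> \<Longrightarrow> t \<notin> Q \<Longrightarrow> F t = G t"
  shows line_integrand_integrable_cong:
      "line_integrand \<gamma> F integrable_on UNIV \<longleftrightarrow> line_integrand \<gamma> G integrable_on UNIV"
    and line_integral_cong: "integral UNIV (line_integrand \<gamma> F) = integral UNIV (line_integrand \<gamma> G)"
proof -
  let ?D = "{s. \<not> \<gamma> differentiable (at s)}"
  let ?E = "\<lambda>p. {s. \<gamma> s = p \<and> \<gamma> differentiable (at s) \<and> vector_derivative \<gamma> (at s) \<noteq> 0}"
  have "countable ?D"
  proof -
    have "finite ({s. \<not> \<gamma> differentiable (at s)} \<inter> {-real n..real n})" for n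
    proof -
      obtain T where "finite T" "\<And>x. x \<in> {-real n..real n} - T \<Longrightarrow> \<gamma> differentiable (at x)"
        using \<gamma> unfolding line_ended_def piecewise_C1_differentiable_on_def C1_differentiable_on_eq by blast
      thus ?thesis by (elim finite_subset[rotated]) blast
    qed
    hence "countable (\<Union>n. {s. \<not> \<gamma> differentiable (at s)} \<inter> {-real n..real n})"
      by (intro countable_UN[OF _ countable_finite]) simp_all
    moreover have "?D \<subseteq> (\<Union>n. {s. \<not> \<gamma> differentiable (at s)} \<inter> {-real n..real n})"
    proof
      fix s assume "s \<in> ?D"
      moreover obtain n :: nat where "\<bar>s\<bar> \<le> real n" using real_arch_simple by blast
      ultimately show "s \<in> (\<Union>n. {s. \<not> \<gamma> differentiable (at s)} \<inter> {-real n..real n})" by (auto intro!: exI[of _ n])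
    qed
    ultimately show ?thesis using countable_subset by blast
  qed
  moreover have "countable (\<Union>p\<in>Q. ?E p)" using Q countable_preimage_nonstationary by (intro countable_UN) auto
  ultimately have N: "negligible (?D \<union> (\<Union>p\<in>Q. ?E p))" by (simp add: negligible_iff_null_sets null_sets_completionI countable_imp_null_set_lborel)
  have FG: "line_integrand \<gamma> F s = line_integrand \<gamma> G s" if "s \<in> UNIV - (?D \<union> (\<Union>p\<in>Q. ?E p))" for s
    using that eq[of "\<gamma> s", OF rangeI] by (cases "\<gamma> s \<in> Q") (auto simp: line_integrand_def)
  show "integral UNIV (line_integrand \<gamma> F) = integral UNIV (line_integrand \<gamma> G)"
    by (rule integral_spike[OF N FG[symmetric]])
  show "line_integrand \<gamma> F integrable_on UNIV \<longleftrightarrow> line_integrand \<gamma> G integrable_on UNIV"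
  proof
    assume "line_integrand \<gamma> F integrable_on UNIV"
    thus "line_integrand \<gamma> G integrable_on UNIV" by (rule integrable_spike[OF _ N FG[symmetric]])
  next
    assume "line_integrand \<gamma> G integrable_on UNIV"
    thus "line_integrand \<gamma> F integrable_on UNIV" by (rule integrable_spike[OF _ N FG])
  qed
qed

text \<open>By reflection 1 / Gamma (- u) is a multiple of Gamma (1 + u) sin (pi u), and sin (pi u)
  is an exponential times 1 - exp (2 pi i u), the factor in the denominator of
  \<open>cycle\<close>.\<close>

lemma Theta_eq_Gamma_quotient:
  assumes c: "c \<noteq> 0" and x: "x / c \<notin> \<int>"
  shows "Theta c k x = Gamma ((x - k) / (- c)) / Gamma (x / (- c)) / (1 - exp (2 * pi * \<i> * x / c))"
proof -
  define u where "u = x / c"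
  define e where "e = exp (\<i> * (pi * u))"
  define G where "G = Gamma (- u)"
  have nu: "- u \<notin> \<int>" using x by (simp add: u_def)
  have G0: "G \<noteq> 0" using nu nonpos_Ints_Int by (auto simp: G_def Gamma_eq_zero_iff)
  have e0: "e \<noteq> 0" by (simp add: e_def)
  have s: "sin (of_real pi * u) = (e - 1 / e) / (2 * \<i>)"
    unfolding sin_exp_eq by (simp add: e_def exp_minus inverse_eq_divide)
  have "u \<notin> \<int>" using x by (simp add: u_def)
  hence s0: "sin (of_real pi * u) \<noteq> 0" by (subst sin_eq_0) (auto simp: Ints_def)
  have ee: "e * e \<noteq> 1"
  proof
    assume "e * e = 1"
    hence "e - 1 / e = 0" using e0 by (simp add: field_simps)
    thus False using s s0 by simp
  qed
  have "G * Gamma (1 + u) = - (pi / sin (of_real pi * u))"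
    using Gamma_reflection_complex[of "- u"] by (simp add: G_def)
  hence G1: "Gamma (1 + u) = - (pi / sin (of_real pi * u)) / G"
    using G0 by (metis nonzero_mult_div_cancel_left)
  have ex: "exp (- (pi * \<i> * x / c)) = 1 / e" "exp (2 * pi * \<i> * x / c) = e * e"
  proof -
    have "- (pi * \<i> * x / c) = - (\<i> * (pi * u))" by (simp add: u_def)
    thus "exp (- (pi * \<i> * x / c)) = 1 / e" by (simp add: e_def exp_minus inverse_eq_divide)
    have "2 * pi * \<i> * x / c = \<i> * (pi * u) + \<i> * (pi * u)" by (simp add: u_def)
    thus "exp (2 * pi * \<i> * x / c) = e * e" by (simp only: e_def exp_add)
  qed
  have arg: "(x - k) / (- c) = (k - x) / c" "x / (- c) = - u" using c by (simp_all add: u_def field_simps)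
  have "Theta c k x = Gamma ((k - x) / c) * (1 / e * (- (pi / ((e - 1 / e) / (2 * \<i>))) / G) / (2 * pi * \<i>))"
    unfolding Theta_def ex u_def[symmetric] G1 s by simp
  also have "1 / e * (- (pi / ((e - 1 / e) / (2 * \<i>))) / G) / (2 * pi * \<i>) = 1 / G / (1 - e * e)"
  proof -
    have "e - 1 / e = (e * e - 1) / e" using e0 by (simp add: field_simps)
    moreover have "e * e - 1 \<noteq> 0" "1 - e * e \<noteq> 0" using ee by auto
    ultimately show ?thesis using e0 G0 by (simp add: divide_simps) (simp add: algebra_simps)
  qed
  finally show ?thesis unfolding arg ex G_def by simp
qed

text \<open>At the excluded points a denominator of \<open>cycle\<close> vanishes, and division by
  zero makes the left-hand side 0, whereas the right-hand side need not vanish there.\<close>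

lemma pairing_integrand_eq_psi:
  assumes c: "c \<noteq> 0" and D: "finite (exponents P)"
    and t: "\<And>p. p \<in> {1..n} \<Longrightarrow> (t - y p) / c \<notin> \<int> \<and> (t + y p) / c \<notin> \<int>"
  shows "pairing_integrand n c k P j lam y t =
    psi n c k lam (exponents P) (coeff (P y)) y (\<lambda>p. - y p) t * g_fun n k y j t"
proof -
  define q where "q = exp (2 * pi * \<i> * t / c)"
  have P: "poly (P y) q = (\<Sum>m\<in>exponents P. coeff (P y) m * q ^ m)"
  proof -
    have "poly (P y) q = (\<Sum>m\<le>degree (P y). coeff (P y) m * q ^ m)" by (rule poly_altdef)
    also have "\<dots> = (\<Sum>m\<in>exponents P. coeff (P y) m * q ^ m)"
    proof (rule sum.mono_neutral_cong[OF D])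
      fix m assume "m \<in> {..degree (P y)} - exponents P"
      thus "coeff (P y) m * q ^ m = 0" by (auto simp: exponents_def)
    next
      fix m assume "m \<in> exponents P - {..degree (P y)}"
      thus "coeff (P y) m * q ^ m = 0" by (auto simp: coeff_eq_0)
    qed auto
    finally show ?thesis .
  qed
  have ex: "exp (- (2 * pi * \<i> * lam / c) * t) * q ^ m = exp (2 * pi * \<i> * (of_nat m - lam) / c * t)" for m
    using c by (simp add: q_def exp_of_nat_mult[symmetric] exp_add[symmetric] field_simps)
  have th: "Theta c k (t - y p) * Theta c k (t - - y p) =
      (Gamma ((t - y p - k) / (- c)) * Gamma ((t + y p - k) / (- c))) / (Gamma ((t - y p) / (- c)) * Gamma ((t + y p) / (- c)))
      / ((1 - exp (2 * pi * \<i> * (t - y p) / c)) * (1 - exp (2 * pi * \<i> * (t + y p) / c)))" if "p \<in> {1..n}" for p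
    using t[OF that] by (simp add: Theta_eq_Gamma_quotient[OF c])
  have "(\<Prod>p=1..n. Theta c k (t - y p) * Theta c k (t - - y p)) =
      (\<Prod>p=1..n. (Gamma ((t - y p - k) / (- c)) * Gamma ((t + y p - k) / (- c))) / (Gamma ((t - y p) / (- c)) * Gamma ((t + y p) / (- c))))
      / (\<Prod>p=1..n. (1 - exp (2 * pi * \<i> * (t - y p) / c)) * (1 - exp (2 * pi * \<i> * (t + y p) / c)))"
    unfolding prod_dividef[symmetric] by (rule prod.cong[OF refl]) (rule th)
  moreover have "psi n c k lam (exponents P) (coeff (P y)) y (\<lambda>p. - y p) t =
     exp (- (2 * pi * \<i> * lam / c) * t) * poly (P y) q * (\<Prod>p=1..n. Theta c k (t - y p) * Theta c k (t - - y p))"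
    unfolding psi_def kernel_def P sum_distrib_left sum_distrib_right
  proof (rule sum.cong[OF refl])
    fix m assume "m \<in> exponents P"
    let ?K = "\<Prod>p=1..n. Theta c k (t - y p) * Theta c k (t - - y p)"
    show "coeff (P y) m * (exp (2 * pi * \<i> * (of_nat m - lam) / c * t) * ?K) =
        exp (- (2 * pi * \<i> * lam / c) * t) * (coeff (P y) m * q ^ m) * ?K"
      unfolding ex[symmetric] by simp
  qed
  ultimately show ?thesis
    unfolding pairing_integrand_def phi_def cycle_def q_def[symmetric] by (simp add: field_simps)
qed

lemma psi_shift_lam:
  "psi n c k (lam + h) D cf a b t = psi n c k lam D cf a b t * exp (- (2 * pi * \<i> / c) * h * t)"
proof -
  have "exp (2 * pi * \<i> * (of_nat m - (lam + h)) / c * t) = exp (2 * pi * \<i> * (of_nat m - lam) / c * t) * exp (- (2 * pi * \<i> / c) * h * t)" for m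
    unfolding exp_add[symmetric] by (rule arg_cong[of _ _ exp]) (simp add: algebra_simps diff_divide_distrib add_divide_distrib)
  thus ?thesis unfolding psi_def kernel_def sum_distrib_right by (intro sum.cong refl) (simp only: ac_simps)
qed

section \<open>Comparison of contours and differentiation under the integral\<close>

lemma decays_rate_imp_strip: "0 < \<delta> \<Longrightarrow> decays_rate w \<delta> f \<Longrightarrow> decays_strip w f"
  unfolding decays_rate_def decays_strip_def by blast

lemma decays_rate_id:
  assumes "0 < \<epsilon>"
  shows "decays_rate w (- \<epsilon>) (\<lambda>t. t)"
  unfolding decays_rate_def
proof
  fix B
  have "norm (of_real s * w + b) \<le> (norm w / \<epsilon> + \<bar>B\<bar>) * exp (- (- \<epsilon>) * \<bar>s\<bar>)" if "norm b \<le> B" for s :: real and b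
  proof -
    have e1: "\<epsilon> * \<bar>s\<bar> \<le> exp (\<epsilon> * \<bar>s\<bar>)" using exp_ge_add_one_self[of "\<epsilon> * \<bar>s\<bar>"] by linarith
    have "norm (of_real s * w) = norm w / \<epsilon> * (\<epsilon> * \<bar>s\<bar>)" using assms by (simp add: norm_mult)
    also have "\<dots> \<le> norm w / \<epsilon> * exp (\<epsilon> * \<bar>s\<bar>)" using assms e1 by (intro mult_left_mono) auto
    finally have 1: "norm (of_real s * w) \<le> norm w / \<epsilon> * exp (\<epsilon> * \<bar>s\<bar>)" .
    have "norm b \<le> \<bar>B\<bar> * 1" using that by simp
    also have "\<dots> \<le> \<bar>B\<bar> * exp (\<epsilon> * \<bar>s\<bar>)" using assms by (intro mult_left_mono) auto
    finally have "norm b \<le> \<bar>B\<bar> * exp (\<epsilon> * \<bar>s\<bar>)" .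
    with 1 have "norm (of_real s * w) + norm b \<le> norm w / \<epsilon> * exp (\<epsilon> * \<bar>s\<bar>) + \<bar>B\<bar> * exp (\<epsilon> * \<bar>s\<bar>)" by (rule add_mono)
    moreover have "norm (of_real s * w + b) \<le> norm (of_real s * w) + norm b" by (rule norm_triangle_ineq)
    ultimately show ?thesis by (simp add: distrib_right)
  qed
  thus "\<exists>C S. \<forall>(s::real) b. S \<le> \<bar>s\<bar> \<and> norm b \<le> B \<longrightarrow> norm (of_real s * w + b) \<le> C * exp (- (- \<epsilon>) * \<bar>s\<bar>)"
    by blast
qed

text \<open>
  The piecewise continuous derivative of a contour may be unbounded near its break points, so the
  bounded part of the contour is estimated by \<open>contour_integral_bound_exists\<close>.
\<close>

lemma line_integral_bound:
  assumes \<gamma>: "line_ended w b \<gamma>" and A: "closed A" "range \<gamma> \<inter> A = {}"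
    and S: "0 < S" "\<And>s. S \<le> \<bar>s\<bar> \<Longrightarrow> \<gamma> s = of_real s * w + b" and \<delta>: "0 < \<delta>"
  obtains N K where "compact N" "N \<inter> A = {}" "K > 0"
    "\<And>f B. f holomorphic_on - A \<Longrightarrow> (\<And>z. z \<in> N \<Longrightarrow> norm (f z) \<le> B) \<Longrightarrow>
       (\<And>s. S \<le> \<bar>s\<bar> \<Longrightarrow> norm (f (of_real s * w + b)) \<le> B * exp (- \<delta> * \<bar>s\<bar>)) \<Longrightarrow>
       norm (integral UNIV (line_integrand \<gamma> f)) \<le> K * B"
proof -
  let ?p = "truncate \<gamma> S"
  have vp: "valid_path ?p" by (rule valid_path_truncate[OF \<gamma> S(1)])
  have cp: "compact (path_image ?p)" by (rule compact_valid_path_image[OF vp])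
  have ne: "path_image ?p \<noteq> {}" by simp
  have "path_image ?p \<subseteq> - A" using A(2) S(1) by (auto simp: path_image_truncate)
  then obtain e where e: "e > 0" "(\<Union>x\<in>path_image ?p. ball x e) \<subseteq> - A"
    using compact_subset_open_imp_ball_epsilon_subset[OF cp open_Compl[OF A(1)]] by metis
  define N where "N = {z. infdist z (path_image ?p) \<le> e / 2}"
  define O' where "O' = {z. infdist z (path_image ?p) < e / 2}"
  have N: "compact N" unfolding N_def by (rule compact_infdist_le) (use ne cp e in auto)
  have NA: "N \<inter> A = {}"
  proof -
    have "z \<in> - A" if "z \<in> N" for z
    proof -
      have "infdist z (path_image ?p) < e" using that e(1) by (simp add: N_def)
      then obtain x where "x \<in> path_image ?p" "dist z x < e"
        using infdist_attains_inf[OF compact_imp_closed[OF cp] ne, of z] by metis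
      hence "z \<in> (\<Union>x\<in>path_image ?p. ball x e)" by (auto simp: dist_commute)
      thus ?thesis using e(2) by blast
    qed
    thus ?thesis by blast
  qed
  have "continuous_on UNIV (\<lambda>z. infdist z (path_image ?p))" by (intro continuous_intros)
  hence opO: "open O'" unfolding O'_def by (intro open_Collect_less continuous_intros) auto
  have pO: "path_image ?p \<subseteq> O'" using e(1) by (auto simp: O'_def)
  have ON: "O' \<subseteq> N" by (auto simp: O'_def N_def)
  obtain L where L: "L > 0" "\<And>f B. f holomorphic_on O' \<Longrightarrow> (\<And>z. z \<in> O' \<Longrightarrow> norm (f z) \<le> B) \<Longrightarrow> norm (contour_integral ?p f) \<le> L * B"
    using contour_integral_bound_exists[OF opO vp pO] by blast
  define I where "I = integral UNIV (\<lambda>s. exp (- \<delta> * \<bar>s\<bar>))"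
  have I0: "0 \<le> I" unfolding I_def by (intro integral_nonneg integrable_exp_minus_abs \<delta>) auto
  show thesis
  proof (rule that[OF N NA])
    show "L + norm w * I > 0" using L(1) I0 by (simp add: add_pos_nonneg)
    fix f B assume f: "f holomorphic_on - A" and fN: "\<And>z. z \<in> N \<Longrightarrow> norm (f z) \<le> B"
      and tail: "\<And>s. S \<le> \<bar>s\<bar> \<Longrightarrow> norm (f (of_real s * w + b)) \<le> B * exp (- \<delta> * \<bar>s\<bar>)"
    have "pathstart ?p \<in> N" using pO ON by blast
    hence B0: "0 \<le> B" using fN norm_ge_zero order_trans by blast
    let ?l = "line_integrand \<gamma> f"
    have dec: "decays_along w b f" unfolding decays_along_def using tail \<delta> by blast
    have int: "?l integrable_on UNIV" by (rule line_integrable[OF \<gamma> f A dec])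
    have mid: "(?l has_integral contour_integral ?p f) {-S..S}"
      by (rule has_integral_truncate[OF \<gamma> S(1) contour_integrable_truncate[OF \<gamma> f A S(1)]])
    define h where "h s = (if s \<in> {-S..S} then ?l s else 0)" for s
    have h: "(h has_integral contour_integral ?p f) UNIV"
      unfolding h_def has_integral_restrict_UNIV by (rule mid)
    define g where "g s = ?l s - h s" for s
    have g: "(g has_integral integral UNIV ?l - contour_integral ?p f) UNIV"
      unfolding g_def by (intro has_integral_diff h integrable_integral int)
    have gb: "norm (g s) \<le> B * norm w * exp (- \<delta> * \<bar>s\<bar>)" for s
    proof (cases "s \<in> {-S..S}")
      case True
      thus ?thesis using B0 by (simp add: g_def h_def)
    next
      case False
      hence s: "S < \<bar>s\<bar>" by auto
      have "g s = f (of_real s * w + b) * w"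
        using False S(2)[of s] s line_ended_derivative[of S \<gamma> w b s] S(2)
        by (auto simp: g_def h_def line_integrand_def)
      moreover have "norm (f (of_real s * w + b)) \<le> B * exp (- \<delta> * \<bar>s\<bar>)" using s by (intro tail) simp
      ultimately have "norm (g s) \<le> B * exp (- \<delta> * \<bar>s\<bar>) * norm w"
        by (simp only: norm_mult) (intro mult_right_mono, auto)
      thus ?thesis by (simp only: mult_ac)
    qed
    have "norm (integral UNIV g) \<le> integral UNIV (\<lambda>s. B * norm w * exp (- \<delta> * \<bar>s\<bar>))"
      by (rule integral_norm_bound_integral) (use g gb integrable_exp_minus_abs[OF \<delta>] in \<open>auto intro!: integrable_on_mult_right\<close>)
    also have "\<dots> = B * norm w * I" unfolding I_def by simp
    finally have 1: "norm (integral UNIV ?l - contour_integral ?p f) \<le> B * norm w * I"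
      using integral_unique[OF g] by simp
    have 2: "norm (contour_integral ?p f) \<le> L * B"
    proof (rule L(2))
      show "f holomorphic_on O'" by (rule holomorphic_on_subset[OF f]) (use ON NA in blast)
    qed (use fN ON in blast)
    have "norm (integral UNIV ?l) \<le> B * norm w * I + L * B"
      using norm_triangle_sub[of "integral UNIV ?l" "contour_integral ?p f"] 1 2 by linarith
    thus "norm (integral UNIV ?l) \<le> (L + norm w * I) * B" by (simp add: algebra_simps)
  qed
qed

lemma norm_exp_remainder_le: "norm (exp z - 1 - z) \<le> exp (norm z) * (norm z)\<^sup>2" for z :: complex
proof -
  have "norm (exp z - (\<Sum>k\<le>1. z ^ k / fact k)) \<le> exp \<bar>Re z\<bar> * norm z ^ Suc 1 / fact 1"
    by (rule Taylor_exp)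
  also have "\<dots> \<le> exp (norm z) * norm z ^ Suc 1 / fact 1"
    using abs_Re_le_cmod[of z] by (intro divide_right_mono mult_right_mono) auto
  finally show ?thesis by (simp add: power2_eq_square algebra_simps)
qed

lemma square_le_exp: "0 \<le> (u::real) \<Longrightarrow> u\<^sup>2 \<le> 2 * exp u"
  using exp_lower_Taylor_quadratic[of u] by (simp add: field_simps)

text \<open>The parameter enters only through an exponential, so the difference quotient is
  estimated by the second-order remainder of exp, which is O(\<eta>^2) against the weaker rate
  \<delta>/2.\<close>

lemma line_integral_exp_derivative:
  assumes \<gamma>: "line_ended w b \<gamma>" and A: "closed A" "range \<gamma> \<inter> A = {}" and F: "F holomorphic_on - A"
    and dec: "decays_rate w \<delta> F" and \<delta>: "0 < \<delta>" and b: "b = 0"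
  shows "((\<lambda>\<eta>. integral UNIV (line_integrand \<gamma> (\<lambda>t. F t * exp (q * \<eta> * t)))) has_field_derivative
    integral UNIV (line_integrand \<gamma> (\<lambda>t. F t * (q * t)))) (at 0)"
proof -
  obtain C S1 where C: "C \<ge> 0" "S1 \<ge> 0" "\<And>(s::real) b. S1 \<le> \<bar>s\<bar> \<Longrightarrow> norm b \<le> 0 \<Longrightarrow> norm (F (of_real s * w + b)) \<le> C * exp (- \<delta> * \<bar>s\<bar>)"
    using decays_rateE[OF dec, of 0] by blast
  obtain S2 where S2: "\<And>s. S2 \<le> \<bar>s\<bar> \<Longrightarrow> \<gamma> s = of_real s * w + b"
    using \<gamma> by (auto simp: line_ended_def)
  define S where "S = Max {S1, S2, 1}"
  have S: "S > 0" "S \<ge> S1" "S \<ge> S2" by (auto simp: S_def)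
  have gS: "\<And>s. S \<le> \<bar>s\<bar> \<Longrightarrow> \<gamma> s = of_real s * w + b" using S2 S(3) by auto
  define \<delta>2 where "\<delta>2 = \<delta> / 2"
  have \<delta>2: "0 < \<delta>2" using \<delta> by (simp add: \<delta>2_def)
  obtain N K where N: "compact N" "N \<inter> A = {}" "K > 0"
    and K: "\<And>f B. f holomorphic_on - A \<Longrightarrow> (\<And>z. z \<in> N \<Longrightarrow> norm (f z) \<le> B) \<Longrightarrow>
       (\<And>s. S \<le> \<bar>s\<bar> \<Longrightarrow> norm (f (of_real s * w + b)) \<le> B * exp (- \<delta>2 * \<bar>s\<bar>)) \<Longrightarrow>
       norm (integral UNIV (line_integrand \<gamma> f)) \<le> K * B"
    using line_integral_bound[OF \<gamma> A S(1) gS \<delta>2] by metis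
  have "continuous_on N F"
    by (rule continuous_on_subset[OF holomorphic_on_imp_continuous_on[OF F]]) (use N(2) in blast)
  hence "bounded (F ` N)" using N(1) by (intro compact_imp_bounded compact_continuous_image)
  then obtain M where M: "\<And>z. z \<in> N \<Longrightarrow> norm (F z) \<le> M" unfolding bounded_iff by blast
  obtain T where T: "\<And>z. z \<in> N \<Longrightarrow> norm z \<le> T" using compact_imp_bounded[OF N(1)] unfolding bounded_iff by blast
  \<comment> \<open>Makes |q \<eta> w| \<le> \<delta>/4. One quarter of the rate is spent on the
    exponential in the remainder, another on the factor s^2; the 1 avoids division by zero.\<close>
  define \<eta>0 where "\<eta>0 = min 1 (\<delta> / 4 / (norm q * norm w + 1))"
  have \<eta>0: "\<eta>0 > 0" using \<delta> by (auto simp: \<eta>0_def intro!: divide_pos_pos add_nonneg_pos)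
  have \<eta>0w: "norm q * \<eta> * norm w \<le> \<delta> / 4" if "0 \<le> \<eta>" "\<eta> \<le> \<eta>0" for \<eta>
  proof -
    have "norm q * \<eta> * norm w \<le> (norm q * norm w + 1) * \<eta>0"
    proof -
      have "norm q * \<eta> * norm w = (norm q * norm w) * \<eta>" by simp
      also have "\<dots> \<le> (norm q * norm w + 1) * \<eta>0" using that \<eta>0 by (intro mult_mono) auto
      finally show ?thesis .
    qed
    also have "\<dots> \<le> (norm q * norm w + 1) * (\<delta> / 4 / (norm q * norm w + 1))"
      by (intro mult_left_mono) (auto simp: \<eta>0_def)
    also have "\<dots> = \<delta> / 4"
    proof -
      have "norm q * norm w + 1 > 0" by (intro add_nonneg_pos) auto
      moreover have "x * (\<delta> / 4 / x) = \<delta> / 4" if "x > 0" for x using that by simp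
      ultimately show ?thesis by blast
    qed
    finally show ?thesis .
  qed
  define B1 where "B1 = \<bar>M\<bar> * (exp (norm q * \<bar>T\<bar>) * (norm q * \<bar>T\<bar>)\<^sup>2)"
  \<comment> \<open>The constant of s^2 \<le> 2 (4/\<delta>)^2 exp (\<delta> |s| / 4), used on the
    tails.\<close>
  define B2 where "B2 = C * ((norm q * norm w)\<^sup>2 * (2 * (4 / \<delta>)\<^sup>2))"
  define B where "B = max B1 B2"
  have B0: "0 \<le> B1" "0 \<le> B2" using C(1) by (auto simp: B1_def B2_def)
  let ?R = "\<lambda>\<eta> t. F t * (exp (q * \<eta> * t) - 1 - q * \<eta> * t)"
  have est: "norm (integral UNIV (line_integrand \<gamma> (?R \<eta>))) \<le> K * (B * (norm \<eta>)\<^sup>2)" if \<eta>: "norm \<eta> \<le> \<eta>0" for \<eta>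
  proof (rule K)
    show "?R \<eta> holomorphic_on - A" by (intro holomorphic_intros F)
  next
    fix z assume z: "z \<in> N"
    have "norm (q * \<eta> * z) \<le> norm q * norm \<eta> * \<bar>T\<bar>"
      unfolding norm_mult using T[OF z] by (intro mult_left_mono) auto
    moreover have "norm \<eta> \<le> 1" using \<eta> by (simp add: \<eta>0_def)
    hence "norm q * norm \<eta> * \<bar>T\<bar> \<le> norm q * 1 * \<bar>T\<bar>" by (intro mult_mono) auto
    ultimately have 1: "norm (q * \<eta> * z) \<le> norm \<eta> * (norm q * \<bar>T\<bar>)" "norm (q * \<eta> * z) \<le> norm q * \<bar>T\<bar>" by (simp_all add: mult_ac)
    have "norm (?R \<eta> z) \<le> \<bar>M\<bar> * (exp (norm (q * \<eta> * z)) * (norm (q * \<eta> * z))\<^sup>2)"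
      unfolding norm_mult[of "F z"]
      by (rule mult_mono) (use M[OF z] in simp, rule norm_exp_remainder_le, simp_all)
    also have "\<dots> \<le> \<bar>M\<bar> * (exp (norm q * \<bar>T\<bar>) * (norm \<eta> * (norm q * \<bar>T\<bar>))\<^sup>2)"
      using 1 by (intro mult_left_mono mult_mono power_mono) auto
    also have "\<dots> = B1 * (norm \<eta>)\<^sup>2" by (simp add: B1_def power_mult_distrib)
    also have "\<dots> \<le> B * (norm \<eta>)\<^sup>2" by (intro mult_right_mono) (auto simp: B_def)
    finally show "norm (?R \<eta> z) \<le> B * (norm \<eta>)\<^sup>2" .
  next
    fix s :: real assume s: "S \<le> \<bar>s\<bar>"
    let ?z = "of_real s * w + b"
    have nz: "norm (q * \<eta> * ?z) = norm q * norm \<eta> * norm w * \<bar>s\<bar>" by (simp add: b norm_mult)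
    have "norm (q * \<eta> * ?z) \<le> \<delta> / 4 * \<bar>s\<bar>"
      unfolding nz using \<eta>0w[of "norm \<eta>"] \<eta> by (intro mult_right_mono) auto
    hence e1: "exp (norm (q * \<eta> * ?z)) \<le> exp (\<delta> / 4 * \<bar>s\<bar>)" by simp
    have "(\<delta> / 4 * \<bar>s\<bar>)\<^sup>2 \<le> 2 * exp (\<delta> / 4 * \<bar>s\<bar>)" using \<delta> by (intro square_le_exp) simp
    hence "(4 / \<delta>)\<^sup>2 * (\<delta> / 4 * \<bar>s\<bar>)\<^sup>2 \<le> (4 / \<delta>)\<^sup>2 * (2 * exp (\<delta> / 4 * \<bar>s\<bar>))" by (intro mult_left_mono) auto
    moreover have "(4 / \<delta>)\<^sup>2 * (\<delta> / 4 * \<bar>s\<bar>)\<^sup>2 = \<bar>s\<bar>\<^sup>2" using \<delta> by (simp add: power_mult_distrib[symmetric])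
    ultimately have e2: "\<bar>s\<bar>\<^sup>2 \<le> (4 / \<delta>)\<^sup>2 * (2 * exp (\<delta> / 4 * \<bar>s\<bar>))" by simp
    have "norm (?R \<eta> ?z) \<le> (C * exp (- \<delta> * \<bar>s\<bar>)) * (exp (norm (q * \<eta> * ?z)) * (norm (q * \<eta> * ?z))\<^sup>2)"
      unfolding norm_mult[of "F ?z"]
      by (rule mult_mono) (use C(3)[of s b] s S(2) b in simp, rule norm_exp_remainder_le, use C(1) in simp_all)
    also have "\<dots> \<le> (C * exp (- \<delta> * \<bar>s\<bar>)) * (exp (\<delta> / 4 * \<bar>s\<bar>) * ((norm q * norm \<eta> * norm w)\<^sup>2 * ((4 / \<delta>)\<^sup>2 * (2 * exp (\<delta> / 4 * \<bar>s\<bar>)))))"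
      unfolding nz power_mult_distrib[of _ "\<bar>s\<bar>"] using C(1) e1 e2 unfolding nz by (intro mult_left_mono mult_mono) auto
    also have "\<dots> = B2 * (norm \<eta>)\<^sup>2 * (exp (- \<delta> * \<bar>s\<bar>) * (exp (\<delta> / 4 * \<bar>s\<bar>) * exp (\<delta> / 4 * \<bar>s\<bar>)))"
      by (simp add: B2_def power_mult_distrib mult_ac)
    also have "exp (- \<delta> * \<bar>s\<bar>) * (exp (\<delta> / 4 * \<bar>s\<bar>) * exp (\<delta> / 4 * \<bar>s\<bar>)) = exp (- \<delta>2 * \<bar>s\<bar>)"
      unfolding exp_add[symmetric] \<delta>2_def by (simp add: algebra_simps)
    also have "B2 * (norm \<eta>)\<^sup>2 * exp (- \<delta>2 * \<bar>s\<bar>) \<le> B * (norm \<eta>)\<^sup>2 * exp (- \<delta>2 * \<bar>s\<bar>)"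
      by (intro mult_right_mono) (auto simp: B_def)
    finally show "norm (?R \<eta> ?z) \<le> B * (norm \<eta>)\<^sup>2 * exp (- \<delta>2 * \<bar>s\<bar>)" .
  qed
  let ?G = "\<lambda>\<eta>. integral UNIV (line_integrand \<gamma> (\<lambda>t. F t * exp (q * \<eta> * t)))"
  let ?D = "integral UNIV (line_integrand \<gamma> (\<lambda>t. F t * (q * t)))"
  have intg: "line_integrand \<gamma> f integrable_on UNIV"
    if "f holomorphic_on - A" "decays_rate w d f" "0 < d" for f d
    by (rule line_integrable[OF \<gamma> that(1) A decays_strip_imp_along[OF decays_rate_imp_strip[OF that(3,2)]]])
  have iD: "line_integrand \<gamma> (\<lambda>t. F t * (q * t)) integrable_on UNIV"
  proof (rule intg)
    show "(\<lambda>t. F t * (q * t)) holomorphic_on - A" by (intro holomorphic_intros F)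
    have "decays_rate w 0 (\<lambda>_. q)" by (cases "w = 0") (auto simp: decays_rate_def intro!: exI[of _ "norm q"])
    from decays_rate_mult[OF dec decays_rate_mult[OF this decays_rate_id[OF \<delta>2]]]
    show "decays_rate w (\<delta> + (0 + - \<delta>2)) (\<lambda>t. F t * (q * t))" .
  qed (use \<delta> in \<open>simp add: \<delta>2_def\<close>)
  have i0: "line_integrand \<gamma> F integrable_on UNIV" by (rule intg[OF F dec \<delta>])
  have iG: "line_integrand \<gamma> (\<lambda>t. F t * exp (q * \<eta> * t)) integrable_on UNIV" if \<eta>: "norm \<eta> \<le> \<eta>0" for \<eta>
  proof (rule intg)
    show "(\<lambda>t. F t * exp (q * \<eta> * t)) holomorphic_on - A" by (intro holomorphic_intros F)
    show "decays_rate w (\<delta> + - norm (q * \<eta> * w)) (\<lambda>t. F t * exp (q * \<eta> * t))"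
      by (rule decays_rate_mult[OF dec decays_rate_exp])
    show "0 < \<delta> + - norm (q * \<eta> * w)" using \<eta>0w[of "norm \<eta>"] \<eta> \<delta> by (simp add: norm_mult)
  qed
  have g0: "(\<lambda>t. F t * exp (q * 0 * t)) = F" by simp
  have eq: "integral UNIV (line_integrand \<gamma> (?R \<eta>)) = ?G \<eta> - ?G 0 - \<eta> * ?D" if "norm \<eta> \<le> \<eta>0" for \<eta>
  proof -
    let ?g = "line_integrand \<gamma> (\<lambda>t. F t * exp (q * \<eta> * t))" and ?h = "line_integrand \<gamma> (\<lambda>t. F t * (q * t))"
    have 1: "line_integrand \<gamma> (?R \<eta>) = (\<lambda>s. ?g s - line_integrand \<gamma> F s - \<eta> * ?h s)"
      by (simp add: line_integrand_def fun_eq_iff algebra_simps)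
    have 2: "integral UNIV (\<lambda>s. ?g s - line_integrand \<gamma> F s - \<eta> * ?h s) =
        integral UNIV ?g - integral UNIV (line_integrand \<gamma> F) - \<eta> * integral UNIV ?h"
      using iG[OF that] i0 iD by (simp add: integral_diff integrable_diff integrable_on_mult_right)
    show ?thesis unfolding 1 2 g0 ..
  qed
  show ?thesis
    unfolding has_field_derivative_iff
  proof (rule LIM_zero_cancel, rule Lim_null_comparison)
    show "((\<lambda>\<eta>. K * B * norm \<eta>) \<longlongrightarrow> 0) (at 0)"
      by (rule tendsto_eq_intros refl tendsto_norm_zero tendsto_ident_at | simp)+
    have "\<forall>\<^sub>F \<eta> in at 0. \<eta> \<in> ball 0 \<eta>0 - {0}" using \<eta>0 by (intro eventually_at_in_open) auto
    thus "\<forall>\<^sub>F \<eta> in at 0. norm ((?G \<eta> - ?G 0) / (\<eta> - 0) - ?D) \<le> K * B * norm \<eta>"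
    proof eventually_elim
      case (elim \<eta>)
      hence \<eta>: "norm \<eta> \<le> \<eta>0" "\<eta> \<noteq> 0" by auto
      have "(?G \<eta> - ?G 0) / (\<eta> - 0) - ?D = (?G \<eta> - ?G 0 - \<eta> * ?D) / \<eta>" using \<eta>(2) by (simp add: diff_divide_distrib)
      hence "norm ((?G \<eta> - ?G 0) / (\<eta> - 0) - ?D) = norm (integral UNIV (line_integrand \<gamma> (?R \<eta>))) / norm \<eta>"
        unfolding eq[OF \<eta>(1)] by (simp only: norm_divide)
      also have "\<dots> \<le> K * (B * (norm \<eta>)\<^sup>2) / norm \<eta>" by (intro divide_right_mono est \<eta>(1)) auto
      also have "\<dots> = K * B * norm \<eta>" using \<eta>(2) by (simp add: power2_eq_square)
      finally show ?case .
    qed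
  qed
qed

section \<open>Translation by c and comparison of few contours\<close>

lemma line_ended_shift:
  assumes "line_ended w b \<gamma>"
  shows "line_ended w (b - e) (\<lambda>s. \<gamma> s - e)"
  unfolding line_ended_def
proof (intro conjI allI)
  fix x y :: real
  have "(\<lambda>s::real. e) piecewise_C1_differentiable_on {x..y}"
    by (rule C1_differentiable_imp_piecewise) (auto simp: C1_differentiable_on_def intro!: exI[of _ "\<lambda>_. 0"])
  thus "(\<lambda>s. \<gamma> s - e) piecewise_C1_differentiable_on {x..y}"
    using assms unfolding line_ended_def by (intro piecewise_C1_differentiable_diff) auto
next
  obtain S where "\<And>s. S \<le> \<bar>s\<bar> \<Longrightarrow> \<gamma> s = of_real s * w + b" using assms unfolding line_ended_def by blast
  thus "\<exists>S. \<forall>s. S \<le> \<bar>s\<bar> \<longrightarrow> \<gamma> s - e = of_real s * w + (b - e)" by (intro exI[of _ S]) auto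
qed

lemma line_integrand_shift: "line_integrand (\<lambda>s. \<gamma> s - e) (\<lambda>t. F (t + e)) = line_integrand \<gamma> F"
proof -
  have "vector_derivative (\<lambda>s. \<gamma> s - e) (at s) = vector_derivative \<gamma> (at s)" for s
    unfolding vector_derivative_def using has_vector_derivative_add_const[of \<gamma> "- e"] by simp
  thus ?thesis by (intro ext) (simp add: line_integrand_def)
qed

text \<open>Translation carries the connecting set along. Its far end and the far point of the
  original ray both lie in a half-plane that the translated contour does not meet.\<close>

lemma on_side_shift:
  assumes \<gamma>: "line_ended w b \<gamma>" and w: "w \<noteq> 0" and v: "v = \<i> * w \<or> v = - \<i> * w" and p: "on_side v \<gamma> (p + e)"
  shows "on_side v (\<lambda>s. \<gamma> s - e) p"
proof -
  let ?\<gamma> = "\<lambda>s. \<gamma> s - e"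
  obtain R where R: "\<And>s. Re (?\<gamma> s / v) \<le> R" using line_ended_Re_bound[OF line_ended_shift[OF \<gamma>] v] by blast
  have v0: "v \<noteq> 0" using v w by auto
  define H where "H = {z. R < Re (z / v)}"
  have H: "connected H"
  proof -
    have "H = (\<lambda>z. Re (z / v)) -` {R<..}" by (auto simp: H_def)
    moreover have "convex ((\<lambda>z. Re (z / v)) -` {R<..})"
      by (intro convex_linear_vimage linearI) (auto simp: add_divide_distrib scaleR_conv_of_real simp flip: times_divide_eq_right)
    ultimately show ?thesis using convex_connected by metis
  qed
  have HR: "H \<subseteq> - range ?\<gamma>"
  proof
    fix z assume "z \<in> H"
    hence "R < Re (z / v)" by (simp add: H_def)
    hence "z \<noteq> ?\<gamma> s" for s using R[of s] by auto
    thus "z \<in> - range ?\<gamma>" by blast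
  qed
  show ?thesis
    using p eventually_gt_at_top[of "max R (R + Re (e / v))"] unfolding on_side_def
  proof eventually_elim
    case (elim s)
    then obtain T where T: "connected T" "T \<subseteq> - range \<gamma>" "p + e \<in> T" "v * of_real s \<in> T"
      unfolding connected_component_def by blast
    let ?T = "(\<lambda>z. z - e) ` T"
    have "connected ?T" using T(1) by (intro connected_continuous_image continuous_intros)
    moreover have "?T \<subseteq> - range ?\<gamma>" using T(2) by auto
    moreover have "p \<in> ?T" "v * of_real s - e \<in> ?T" using T(3,4) by (auto simp: image_iff intro!: bexI[of _ "p + e"])
    ultimately have 1: "connected_component (- range ?\<gamma>) p (v * of_real s - e)"
      unfolding connected_component_def by blast
    have "v * of_real s - e \<in> H" "v * of_real s \<in> H"
      using elim(2) v0 by (simp_all add: H_def diff_divide_distrib)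
    hence "connected_component (- range ?\<gamma>) (v * of_real s - e) (v * of_real s)"
      unfolding connected_component_def using H HR by blast
    with 1 show ?case by (rule connected_component_trans)
  qed
qed

text \<open>\<open>Theta_shift\<close> read backwards: a factor \<open>fct\<close> moves the centre
  \<open>z\<close> to z + c. This is how rational factors are traded for moved centres.\<close>

lemma Theta_fct:
  assumes c: "c \<noteq> 0" and t: "t \<notin> up_set c k {z}" "\<And>l. t \<noteq> z - c * of_nat l"
  shows "Theta c k (t - z) * fct k z t = Theta c k (t - (z + c))"
proof -
  have "t - c \<notin> low_set c {z}" using t(2) by (auto simp: low_set_def algebra_simps)
  from Theta_shift[OF c _ this, of k] t(1)
  have "Theta c k (t - z) * (t - z - k) = Theta c k (t - c - z) * (t - z)" by simp
  moreover have "t - z \<noteq> 0" using t(2)[of 0] by simp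
  ultimately show ?thesis unfolding fct_def by (simp add: field_simps)
qed

lemma psi_mult:
  assumes "\<And>p. p \<in> {1..n} \<Longrightarrow> Theta c k (t - a p) * fa p = Theta c k (t - a' p)"
    and "\<And>p. p \<in> {1..n} \<Longrightarrow> Theta c k (t - b p) * fb p = Theta c k (t - b' p)"
  shows "psi n c k lam D cf a b t * (\<Prod>p=1..n. fa p * fb p) = psi n c k lam D cf a' b' t"
proof -
  have "(\<Prod>p=1..n. Theta c k (t - a' p) * Theta c k (t - b' p)) =
      (\<Prod>p=1..n. (Theta c k (t - a p) * Theta c k (t - b p)) * (fa p * fb p))"
  proof (rule prod.cong[OF refl])
    fix p assume p: "p \<in> {1..n}"
    have "(Theta c k (t - a p) * Theta c k (t - b p)) * (fa p * fb p) =
        (Theta c k (t - a p) * fa p) * (Theta c k (t - b p) * fb p)" by simp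
    thus "Theta c k (t - a' p) * Theta c k (t - b' p) = (Theta c k (t - a p) * Theta c k (t - b p)) * (fa p * fb p)"
      unfolding assms(1)[OF p] assms(2)[OF p] ..
  qed
  thus ?thesis
    unfolding psi_def kernel_def sum_distrib_right by (simp add: prod.distrib mult_ac)
qed

text \<open>The exponents m are integers, so exp (2 pi i m) = 1 and the multiplier depends on
  \<open>lam\<close> alone, the same for all monomials of P.\<close>

lemma psi_translate:
  assumes c: "c \<noteq> 0" and a: "\<And>p. p \<in> {1..n} \<Longrightarrow> a' p = a p - c" and b: "\<And>p. p \<in> {1..n} \<Longrightarrow> b' p = b p - c"
  shows "psi n c k lam D cf a b (t + c) = exp (- (2 * pi * \<i> * lam)) * psi n c k lam D cf a' b' t"
proof -
  have e: "exp (2 * pi * \<i> * (of_nat m - lam) / c * (t + c)) = exp (- (2 * pi * \<i> * lam)) * exp (2 * pi * \<i> * (of_nat m - lam) / c * t)" for m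
  proof -
    have "2 * pi * \<i> * (of_nat m - lam) / c * (t + c) =
        - (2 * pi * \<i> * lam) + 2 * pi * \<i> * (of_nat m - lam) / c * t + \<i> * (of_nat m * (of_real pi * 2))"
      using c by (simp add: field_simps)
    moreover have "exp (\<i> * (of_nat m * (of_real pi * 2))) = 1"
      using exp_2pi_1_int[of "int m"] by (simp add: mult_ac)
    ultimately show ?thesis by (simp only: exp_add mult_1_right)
  qed
  have "(\<Prod>p=1..n. Theta c k (t + c - a p) * Theta c k (t + c - b p)) = (\<Prod>p=1..n. Theta c k (t - a' p) * Theta c k (t - b' p))"
  proof (rule prod.cong[OF refl])
    fix p assume p: "p \<in> {1..n}"
    have "t + c - a p = t - a' p" "t + c - b p = t - b' p" using a[OF p] b[OF p] by simp_all
    thus "Theta c k (t + c - a p) * Theta c k (t + c - b p) = Theta c k (t - a' p) * Theta c k (t - b' p)" by (simp only:)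
  qed
  thus ?thesis unfolding psi_def kernel_def sum_distrib_left e by (intro sum.cong refl) simp
qed

text \<open>Each row of K relates three integrals. A pole must lie on the proper side only of those
  contours whose integrand has it; disjointness of all upper from all lower poles makes the side a
  function of the pole.\<close>

lemma three_contours:
  assumes w: "w \<noteq> 0" and \<gamma>: "line_ended w b1 \<gamma>1" "line_ended w b2 \<gamma>2" "line_ended w b3 \<gamma>3"
    and A: "strip_finite w (U1 \<union> L1)" "strip_finite w (U2 \<union> L2)" "strip_finite w (U3 \<union> L3)"
    and hol: "f1 holomorphic_on - (U1 \<union> L1)" "f2 holomorphic_on - (U2 \<union> L2)" "f3 holomorphic_on - (U3 \<union> L3)"
    and dec: "decays_strip w f1" "decays_strip w f2" "decays_strip w f3"
    and up: "\<And>p. p \<in> U1 \<Longrightarrow> above w \<gamma>1 p" "\<And>p. p \<in> U2 \<Longrightarrow> above w \<gamma>2 p" "\<And>p. p \<in> U3 \<Longrightarrow> above w \<gamma>3 p"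
    and low: "\<And>p. p \<in> L1 \<Longrightarrow> below w \<gamma>1 p" "\<And>p. p \<in> L2 \<Longrightarrow> below w \<gamma>2 p" "\<And>p. p \<in> L3 \<Longrightarrow> below w \<gamma>3 p"
    and disj: "(U1 \<union> U2 \<union> U3) \<inter> (L1 \<union> L2 \<union> L3) = {}"
    and sum: "\<And>t. t \<notin> U1 \<union> L1 \<union> U2 \<union> L2 \<union> U3 \<union> L3 \<Longrightarrow> x1 * f1 t + x2 * f2 t + x3 * f3 t = 0"
  shows "x1 * integral UNIV (line_integrand \<gamma>1 f1) + x2 * integral UNIV (line_integrand \<gamma>2 f2)
      + x3 * integral UNIV (line_integrand \<gamma>3 f3) = 0"
proof -
  define \<sigma> where "\<sigma> p = (if p \<in> U1 \<union> U2 \<union> U3 then \<i> * w else - \<i> * w)" for p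
  define f where "f i = [\<lambda>t. x1 * f1 t, \<lambda>t. x2 * f2 t, \<lambda>t. x3 * f3 t] ! i" for i
  define A' where "A' i = [U1 \<union> L1, U2 \<union> L2, U3 \<union> L3] ! i" for i
  define \<gamma>' where "\<gamma>' i = [\<gamma>1, \<gamma>2, \<gamma>3] ! i" for i
  define b' where "b' i = [b1, b2, b3] ! i" for i
  have I: "i = 0 \<or> i = 1 \<or> i = 2" if "i \<in> {0, 1, 2}" for i :: nat using that by auto
  have scale: "decays_strip w (\<lambda>t. x * f t)" if f: "decays_strip w f" for x f
    unfolding decays_strip_def
  proof
    fix B
    obtain C \<delta> S where C: "\<delta> > 0" "\<And>(s::real) b. S \<le> \<bar>s\<bar> \<Longrightarrow> norm b \<le> B \<Longrightarrow> norm (f (of_real s * w + b)) \<le> C * exp (- \<delta> * \<bar>s\<bar>)"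
      using f unfolding decays_strip_def by metis
    have "norm (x * f (of_real s * w + b)) \<le> (norm x * C) * exp (- \<delta> * \<bar>s\<bar>)" if "S \<le> \<bar>s\<bar>" "norm b \<le> B" for s :: real and b
      using mult_left_mono[OF C(2)[OF that], of "norm x"] by (simp add: norm_mult mult.assoc)
    thus "\<exists>C \<delta> S. \<delta> > 0 \<and> (\<forall>(s::real) b. S \<le> \<bar>s\<bar> \<and> norm b \<le> B \<longrightarrow> norm (x * f (of_real s * w + b)) \<le> C * exp (- \<delta> * \<bar>s\<bar>))"
      using C(1) by blast
  qed
  have "(\<Sum>i\<in>{0, 1, 2::nat}. integral UNIV (line_integrand (\<gamma>' i) (f i))) = 0"
  proof (rule sum_line_integrals_eq_0[OF w, where A = A' and b = b' and \<sigma> = \<sigma>])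
    show "\<sigma> p = \<i> * w \<or> \<sigma> p = - \<i> * w" for p by (simp add: \<sigma>_def)
    fix i :: nat assume i: "i \<in> {0, 1, 2}"
    show "line_ended w (b' i) (\<gamma>' i)" using I[OF i] \<gamma> by (auto simp: b'_def \<gamma>'_def)
    show "strip_finite w (A' i)" using I[OF i] A by (auto simp: A'_def)
    show "f i holomorphic_on - A' i" using I[OF i] hol by (auto simp: A'_def f_def intro!: holomorphic_intros)
    show "decays_strip w (f i)" using I[OF i] dec scale by (auto simp: f_def)
    fix p assume p: "p \<in> A' i"
    show "on_side (\<sigma> p) (\<gamma>' i) p"
      using I[OF i] p up low disj unfolding \<sigma>_def A'_def \<gamma>'_def above_iff_on_side below_iff_on_side
      by (elim disjE; simp; blast)
  next
    fix t assume t: "\<And>i. i \<in> {0, 1, 2::nat} \<Longrightarrow> t \<notin> A' i"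
    have "t \<notin> U1 \<union> L1 \<union> U2 \<union> L2 \<union> U3 \<union> L3" using t[of 0] t[of 1] t[of 2] by (simp add: A'_def)
    from sum[OF this] show "(\<Sum>i\<in>{0, 1, 2}. f i t) = 0" by (simp add: f_def add.assoc)
  qed simp
  moreover have "integral UNIV (line_integrand \<gamma> (\<lambda>t. x * g t)) = x * integral UNIV (line_integrand \<gamma> g)" for x g \<gamma>
    unfolding line_integrand_def [abs_def] by (simp add: mult.assoc)
  ultimately show ?thesis by (simp add: f_def \<gamma>'_def add.assoc)
qed

lemma two_contours:
  assumes w: "w \<noteq> 0" and \<gamma>: "line_ended w b1 \<gamma>1" "line_ended w b2 \<gamma>2"
    and A: "strip_finite w (U \<union> L)" and hol: "f holomorphic_on - (U \<union> L)" and dec: "decays_strip w f"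
    and up: "\<And>p. p \<in> U \<Longrightarrow> above w \<gamma>1 p \<and> above w \<gamma>2 p" and low: "\<And>p. p \<in> L \<Longrightarrow> below w \<gamma>1 p \<and> below w \<gamma>2 p"
    and disj: "U \<inter> L = {}"
  shows "integral UNIV (line_integrand \<gamma>1 f) = integral UNIV (line_integrand \<gamma>2 f)"
proof -
  \<comment> \<open>The third integral is a copy with coefficient 0.\<close>
  have "1 * integral UNIV (line_integrand \<gamma>1 f) + (- 1) * integral UNIV (line_integrand \<gamma>2 f)
      + 0 * integral UNIV (line_integrand \<gamma>2 f) = 0"
    by (rule three_contours[OF w \<gamma>(1,2,2) A A A hol hol hol dec dec dec]) (use up low disj in auto)
  thus ?thesis by simp
qed

section \<open>The shift of a variable\<close>

locale solution_data =
  fixes n :: nat and c k lam w :: complex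
    and P :: "(nat \<Rightarrow> complex) \<Rightarrow> complex poly" and C :: "(nat \<Rightarrow> complex) \<Rightarrow> real \<Rightarrow> complex"
  assumes n: "1 \<le> n" and Im_c: "Im c > 0" and Im_k: "Im k > 0"
    and P: "P \<in> numerators n c"
    and dir: "decay_direction n c lam P w"
    and C: "\<And>y. admissible n c k y \<Longrightarrow> separating_contour n c k w y (C y)"
begin

lemma c0: "c \<noteq> 0" using Im_c by auto

lemma wc: "Im (w / c) < 0" using dir by (simp add: decay_direction_def)

lemma w0: "w \<noteq> 0" using wc by auto

lemma finite_exponents: "finite (exponents P)"
proof -
  obtain d where "\<And>y. degree (P y) \<le> d" using P by (auto simp: numerators_def)
  hence "exponents P \<subseteq> {..d}" by (auto simp: exponents_def) (metis le_degree le_trans)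
  thus ?thesis by (rule finite_subset) simp
qed

definition centers :: "(nat \<Rightarrow> complex) \<Rightarrow> complex set" where
  "centers y = y ` {1..n} \<union> (\<lambda>p. - y p) ` {1..n}"

text \<open>Unlike \<open>low_set\<close>, this begins at the centres themselves, where the
  functions g_j have poles.\<close>

definition lows :: "complex set \<Rightarrow> complex set" where
  "lows Z = {z - c * of_nat l | z l. z \<in> Z}"

lemma finite_centers [simp]: "finite (centers y)" by (simp add: centers_def)

lemma in_centers: "p \<in> {1..n} \<Longrightarrow> y p \<in> centers y" "p \<in> {1..n} \<Longrightarrow> - y p \<in> centers y"
  by (auto simp: centers_def)

lemma upper_poles_eq: "upper_poles n c k y = up_set c k (centers y)"
proof (intro equalityI subsetI)
  fix t assume "t \<in> upper_poles n c k y"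
  then obtain s p l where "t = s * y p + k + c * of_nat l" "s = 1 \<or> s = - 1" "p \<in> {1..n}"
    unfolding upper_poles_def by blast
  thus "t \<in> up_set c k (centers y)" unfolding up_set_def using in_centers[of p y] by auto
next
  fix t assume "t \<in> up_set c k (centers y)"
  then obtain z l where "t = z + k + c * of_nat l" "z \<in> centers y" unfolding up_set_def by blast
  then obtain p where "p \<in> {1..n}" "t = 1 * y p + k + c * of_nat l \<or> t = (- 1) * y p + k + c * of_nat l"
    unfolding centers_def by auto
  thus "t \<in> upper_poles n c k y" unfolding upper_poles_def by blast
qed

lemma lower_poles_eq: "lower_poles n c y = lows (centers y)"
proof (intro equalityI subsetI)
  fix t assume "t \<in> lower_poles n c y"
  then obtain s p l where "t = s * y p - c * of_nat l" "s = 1 \<or> s = - 1" "p \<in> {1..n}"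
    unfolding lower_poles_def by blast
  thus "t \<in> lows (centers y)" unfolding lows_def using in_centers[of p y] by auto
next
  fix t assume "t \<in> lows (centers y)"
  then obtain z l where "t = z - c * of_nat l" "z \<in> centers y" unfolding lows_def by blast
  then obtain p where "p \<in> {1..n}" "t = 1 * y p - c * of_nat l \<or> t = (- 1) * y p - c * of_nat l"
    unfolding centers_def by auto
  thus "t \<in> lower_poles n c y" unfolding lower_poles_def by blast
qed

lemma admissible_iff: "admissible n c k y \<longleftrightarrow> up_set c k (centers y) \<inter> lows (centers y) = {}"
  by (simp add: admissible_def upper_poles_eq lower_poles_eq)

lemma lows_self: "Z \<subseteq> lows Z"
proof
  fix z assume "z \<in> Z"
  moreover have "z = z - c * of_nat 0" by simp
  ultimately show "z \<in> lows Z" unfolding lows_def by blast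
qed

lemma low_set_lows: "low_set c Z \<subseteq> lows Z"
proof
  fix t assume "t \<in> low_set c Z"
  then obtain z l where "t = z - c - c * of_nat l" "z \<in> Z" by (auto simp: low_set_def)
  hence "t = z - c * of_nat (Suc l)" by (simp add: algebra_simps)
  thus "t \<in> lows Z" unfolding lows_def using \<open>z \<in> Z\<close> by blast
qed

text \<open>Keeps the denominators away from zero: y m + k \<noteq> y j for the R-matrices, and y m
  + k \<noteq> - y m for the reflection.\<close>

lemma admissible_neq:
  assumes "admissible n c k y" "z \<in> centers y" "z' \<in> centers y"
  shows "z + k \<noteq> z'"
proof
  assume "z + k = z'"
  hence "z' = z + k + c * of_nat 0" by simp
  hence "z' \<in> up_set c k (centers y)" unfolding up_set_def using assms(2) by blast
  moreover have "z' \<in> lows (centers y)" using lows_self assms(3) by blast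
  ultimately show False using assms(1) by (auto simp: admissible_iff)
qed

lemma contour:
  assumes "admissible n c k y"
  shows "line_ended w 0 (C y)"
    and "p \<in> up_set c k (centers y) \<Longrightarrow> above w (C y) p"
    and "p \<in> lows (centers y) \<Longrightarrow> below w (C y) p"
  using C[OF assms] by (auto simp: separating_contour_def line_ended_def upper_poles_eq lower_poles_eq)

lemma range_contour:
  assumes "admissible n c k y" "t \<in> range (C y)"
  shows "t \<notin> up_set c k (centers y)" "t \<notin> lows (centers y)"
  using contour(2,3)[OF assms(1)] assms(2) on_side_notin_range above_iff_on_side below_iff_on_side by blast+

abbreviation psiP :: "(nat \<Rightarrow> complex) \<Rightarrow> (nat \<Rightarrow> complex) \<Rightarrow> (nat \<Rightarrow> complex) \<Rightarrow> complex \<Rightarrow> complex" where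
  "psiP y a b \<equiv> psi n c k lam (exponents P) (coeff (P y)) a b"

lemma psi_tempered:
  assumes Z: "a ` {1..n} \<union> b ` {1..n} \<subseteq> Z" "finite Z" and R: "finite R" "tempered R h"
  shows "(\<lambda>t. psiP y a b t * h t) holomorphic_on - (up_set c k Z \<union> (low_set c Z \<union> R))"
    and "strip_finite w (up_set c k Z \<union> (low_set c Z \<union> R))"
    and "\<exists>\<delta>>0. decays_rate w \<delta> (\<lambda>t. psiP y a b t * h t)"
    and "decays_strip w (\<lambda>t. psiP y a b t * h t)"
proof -
  show "(\<lambda>t. psiP y a b t * h t) holomorphic_on - (up_set c k Z \<union> (low_set c Z \<union> R))"
  proof (intro holomorphic_on_mult)
    show "psiP y a b holomorphic_on - (up_set c k Z \<union> (low_set c Z \<union> R))"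
      by (rule holomorphic_on_subset[OF holomorphic_psi[OF c0 Z(1)]]) blast
    show "h holomorphic_on - (up_set c k Z \<union> (low_set c Z \<union> R))"
      using R(2) unfolding tempered_def by (elim conjE holomorphic_on_subset) blast
  qed
  show "strip_finite w (up_set c k Z \<union> (low_set c Z \<union> R))"
    by (intro strip_finite_Un strip_finite_up_low[OF wc Z(2)] strip_finite_finite R(1))
  show 1: "\<exists>\<delta>>0. decays_rate w \<delta> (\<lambda>t. psiP y a b t * h t)"
  proof -
    obtain \<delta> where \<delta>: "\<delta> > 0" "decays_rate w \<delta> (psiP y a b)"
      using psi_decays[OF wc finite_exponents, of lam n k "coeff (P y)" a b] dir
      unfolding decay_direction_def by blast
    obtain M where M: "\<forall>\<^sub>F t in at_infinity. norm (h t) \<le> M" using R(2) by (auto simp: tempered_def)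
    have "decays_rate w (\<delta> + 0) (\<lambda>t. psiP y a b t * h t)"
      by (rule decays_rate_mult[OF \<delta>(2) decays_rate_bounded[OF w0 M]])
    thus ?thesis using \<delta>(1) by auto
  qed
  show "decays_strip w (\<lambda>t. psiP y a b t * h t)"
    using 1 decays_rate_imp_strip by blast
qed

text \<open>The pairing as a functional on all tempered functions, with \<phi> W in its regular
  form; it makes the action of the operators a matter of linearity.\<close>

definition J :: "(nat \<Rightarrow> complex) \<Rightarrow> (complex \<Rightarrow> complex) \<Rightarrow> complex" where
  "J y h = integral UNIV (line_integrand (C y) (\<lambda>t. psiP y y (\<lambda>p. - y p) t * h t))"

lemma J_sets:
  assumes "tempered (centers y) h"
  shows "(\<lambda>t. psiP y y (\<lambda>p. - y p) t * h t) holomorphic_on - (up_set c k (centers y) \<union> (low_set c (centers y) \<union> centers y))"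
    and "closed (up_set c k (centers y) \<union> (low_set c (centers y) \<union> centers y))"
    and "\<exists>\<delta>>0. decays_rate w \<delta> (\<lambda>t. psiP y y (\<lambda>p. - y p) t * h t)"
proof -
  have Z: "y ` {1..n} \<union> (\<lambda>p. - y p) ` {1..n} \<subseteq> centers y" by (simp add: centers_def)
  note ph = psi_tempered[OF Z finite_centers finite_centers assms]
  show "(\<lambda>t. psiP y y (\<lambda>p. - y p) t * h t) holomorphic_on - (up_set c k (centers y) \<union> (low_set c (centers y) \<union> centers y))"
    "closed (up_set c k (centers y) \<union> (low_set c (centers y) \<union> centers y))"
    "\<exists>\<delta>>0. decays_rate w \<delta> (\<lambda>t. psiP y y (\<lambda>p. - y p) t * h t)"
    by (rule ph(1), rule strip_finite_closed[OF ph(2)], rule ph(3))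
qed

lemma range_sets:
  assumes "admissible n c k y"
  shows "range (C y) \<inter> (up_set c k (centers y) \<union> (low_set c (centers y) \<union> centers y)) = {}"
  using range_contour[OF assms] low_set_lows lows_self by blast

lemma J_integrable:
  assumes y: "admissible n c k y" and h: "tempered (centers y) h"
  shows "line_integrand (C y) (\<lambda>t. psiP y y (\<lambda>p. - y p) t * h t) integrable_on UNIV"
  using J_sets(3)[OF h]
  by (auto intro: line_integrable[OF contour(1)[OF y] J_sets(1,2)[OF h] range_sets[OF y]]
     decays_strip_imp_along decays_rate_imp_strip)

lemma J_linear:
  assumes y: "admissible n c k y" and h: "tempered (centers y) h1" "tempered (centers y) h2"
  shows "J y (\<lambda>t. x1 * h1 t + x2 * h2 t) = x1 * J y h1 + x2 * J y h2"
proof -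
  let ?l = "\<lambda>h. line_integrand (C y) (\<lambda>t. psiP y y (\<lambda>p. - y p) t * h t)"
  have 1: "?l (\<lambda>t. x1 * h1 t + x2 * h2 t) = (\<lambda>s. x1 * ?l h1 s + x2 * ?l h2 s)"
    by (simp add: line_integrand_def fun_eq_iff algebra_simps)
  have 2: "integral UNIV (\<lambda>s. x1 * ?l h1 s + x2 * ?l h2 s) = x1 * integral UNIV (?l h1) + x2 * integral UNIV (?l h2)"
    using J_integrable[OF y h(1)] J_integrable[OF y h(2)]
    by (simp add: integral_add integrable_on_mult_right)
  show ?thesis unfolding J_def 1 2 ..
qed

lemma J_cong:
  assumes y: "admissible n c k y" and eq: "\<And>t. t \<notin> centers y \<Longrightarrow> h t = h' t"
  shows "J y h = J y h'"
proof -
  have "line_integrand (C y) (\<lambda>t. psiP y y (\<lambda>p. - y p) t * h t) = line_integrand (C y) (\<lambda>t. psiP y y (\<lambda>p. - y p) t * h' t)"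
  proof
    fix s
    have "C y s \<notin> centers y" using range_sets[OF y] by blast
    thus "line_integrand (C y) (\<lambda>t. psiP y y (\<lambda>p. - y p) t * h t) s = line_integrand (C y) (\<lambda>t. psiP y y (\<lambda>p. - y p) t * h' t) s"
      by (simp add: line_integrand_def eq)
  qed
  thus ?thesis by (simp only: J_def)
qed

lemma tempered_fct: "z \<in> Z \<Longrightarrow> finite Z \<Longrightarrow> tempered Z (fct k z)"
proof (rule tempered_cong)
  assume z: "z \<in> Z" "finite Z"
  show "tempered Z (\<lambda>t. 1 + (- k) * (1 / (t - z)))"
    by (intro tempered_add tempered_mult tempered_const tempered_pole z)
  show "fct k z t = 1 + - k * (1 / (t - z))" if "t \<notin> Z" for t
  proof -
    have "t - z \<noteq> 0" using that z by auto
    thus ?thesis by (simp add: fct_def field_simps)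
  qed
qed (rule finite_imp_bounded)

lemma tempered_ga_gb:
  assumes Z: "finite Z" "\<And>p. p \<in> {1..n} \<Longrightarrow> y p \<in> Z \<and> - y p \<in> Z" and m: "m \<in> {1..n}" "i \<in> {1..n}" "j \<le> n + 1"
  shows "tempered Z (ga k m j y i)" "tempered Z (gb n k m j y i)"
proof -
  have sub: "before m j i \<subseteq> {1..n}" using m by (auto simp: before_def)
  show "tempered Z (ga k m j y i)"
    unfolding ga_def [abs_def] using Z m sub
    by (intro tempered_mult tempered_prod tempered_pole tempered_fct) auto
  have "tempered Z (\<lambda>t. 1 / (t - (- y i)))" using Z m by (intro tempered_pole) auto
  thus "tempered Z (gb n k m j y i)"
    unfolding gb_def [abs_def] using Z m
    by (intro tempered_mult tempered_prod tempered_fct) auto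
qed

lemma tempered_state:
  assumes "m \<in> {1..n}" "i \<in> {1..n}" "j \<le> n + 1" "\<zeta> = y m \<or> \<zeta> = - y m"
  shows "tempered (centers y) (ga k m j (y(m := \<zeta>)) i)" "tempered (centers y) (gb n k m j (y(m := \<zeta>)) i)"
  by (rule tempered_ga_gb; use assms in_centers[of _ y] in auto)+

text \<open>The contour has to avoid only the true poles. It may meet other points congruent to y p
  or - y p modulo \<open>c\<close>, where the written integrand takes default values; all such
  points form a countable set.\<close>

lemma pairing_psi:
  assumes y: "admissible n c k y"
  shows "pairing n c k C P j l y =
      integral UNIV (line_integrand (C y) (\<lambda>t. psi n c k l (exponents P) (coeff (P y)) y (\<lambda>p. - y p) t * g_fun n k y j t))"
    and "line_integrand (C y) (pairing_integrand n c k P j l y) integrable_on UNIV \<longleftrightarrow>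
      line_integrand (C y) (\<lambda>t. psi n c k l (exponents P) (coeff (P y)) y (\<lambda>p. - y p) t * g_fun n k y j t) integrable_on UNIV"
proof -
  define Q where "Q = (\<Union>p\<in>{1..n}. {t. (t - y p) / c \<in> \<int>} \<union> {t. (t + y p) / c \<in> \<int>})"
  have "countable {t. (t - z) / c \<in> \<int>}" for z
  proof -
    have "{t. (t - z) / c \<in> \<int>} \<subseteq> (\<lambda>u. z + c * u) ` \<int>"
      using c0 by (auto simp: image_iff intro!: bexI[of _ "(_ - z) / c"])
    moreover have "countable ((\<lambda>u. z + c * u) ` \<int>)" by (intro countable_image countable_int)
    ultimately show ?thesis by (rule countable_subset)
  qed
  from this[of "y _"] this[of "- y _"] have Q: "countable Q" unfolding Q_def by (intro countable_UN countable_Un) auto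
  have eq: "pairing_integrand n c k P j l y t =
      psi n c k l (exponents P) (coeff (P y)) y (\<lambda>p. - y p) t * g_fun n k y j t" if "t \<notin> Q" for t
    using that by (intro pairing_integrand_eq_psi c0 finite_exponents) (auto simp: Q_def)
  show "pairing n c k C P j l y =
      integral UNIV (line_integrand (C y) (\<lambda>t. psi n c k l (exponents P) (coeff (P y)) y (\<lambda>p. - y p) t * g_fun n k y j t))"
    unfolding pairing_def by (rule line_integral_cong[OF contour(1)[OF y] Q eq])
  show "line_integrand (C y) (pairing_integrand n c k P j l y) integrable_on UNIV \<longleftrightarrow>
      line_integrand (C y) (\<lambda>t. psi n c k l (exponents P) (coeff (P y)) y (\<lambda>p. - y p) t * g_fun n k y j t) integrable_on UNIV"
    by (rule line_integrand_integrable_cong[OF contour(1)[OF y] Q eq])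
qed

lemma pairing_eq_J:
  assumes y: "admissible n c k y" and m: "m \<in> {1..n}" and i: "i \<in> {1..n}"
  shows "pairing n c k C P i lam y = J y (ga k m m y i)"
    and "pairing n c k C P (2 * n + 1 - i) lam y = J y (gb n k m m y i)"
    and "line_integrand (C y) (pairing_integrand n c k P i lam y) integrable_on UNIV"
    and "line_integrand (C y) (pairing_integrand n c k P (2 * n + 1 - i) lam y) integrable_on UNIV"
proof -
  have ga: "g_fun n k y i = ga k m m y i" "g_fun n k y (2 * n + 1 - i) = gb n k m m y i"
    using g_fun_eq[OF i m] by auto
  have temp: "tempered (centers y) (ga k m m y i)" "tempered (centers y) (gb n k m m y i)"
    using tempered_state[OF m i, of m "y m" y] m by auto
  show "pairing n c k C P i lam y = J y (ga k m m y i)" "pairing n c k C P (2 * n + 1 - i) lam y = J y (gb n k m m y i)"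
    unfolding pairing_psi(1)[OF y] J_def ga by (rule refl)+
  show "line_integrand (C y) (pairing_integrand n c k P i lam y) integrable_on UNIV"
    "line_integrand (C y) (pairing_integrand n c k P (2 * n + 1 - i) lam y) integrable_on UNIV"
    unfolding pairing_psi(2)[OF y] ga by (rule J_integrable[OF y temp(1)], rule J_integrable[OF y temp(2)])
qed

lemma above_shift: "line_ended w b \<gamma> \<Longrightarrow> above w \<gamma> (p + c) \<Longrightarrow> above w (\<lambda>s. \<gamma> s - c) p"
  and below_shift: "line_ended w b \<gamma> \<Longrightarrow> below w \<gamma> (p + c) \<Longrightarrow> below w (\<lambda>s. \<gamma> s - c) p"
  unfolding above_iff_on_side below_iff_on_side using on_side_shift w0 by blast+

lemma up_set_add_c: "p \<in> up_set c k Z \<Longrightarrow> (\<And>z. z \<in> Z \<Longrightarrow> z \<in> Z' \<or> z + c \<in> Z') \<Longrightarrow> p + c \<in> up_set c k Z'"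
proof -
  assume "p \<in> up_set c k Z" and Z: "\<And>z. z \<in> Z \<Longrightarrow> z \<in> Z' \<or> z + c \<in> Z'"
  then obtain z l where p: "p = z + k + c * of_nat l" "z \<in> Z" by (auto simp: up_set_def)
  have "p + c = z + k + c * of_nat (Suc l)" "p + c = (z + c) + k + c * of_nat l" using p by (simp_all add: algebra_simps)
  thus "p + c \<in> up_set c k Z'" unfolding up_set_def using Z[OF p(2)] by blast
qed

text \<open>The progressions in \<open>low_set\<close> begin at z - c, so after translation by
  \<open>c\<close> they still lie in \<open>lows\<close>, where the first term is the
  centre.\<close>

lemma low_set_add_c: "p \<in> low_set c Z \<Longrightarrow> (\<And>z. z \<in> Z \<Longrightarrow> z \<in> Z' \<or> z + c \<in> Z') \<Longrightarrow> p + c \<in> lows Z'"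
proof -
  assume "p \<in> low_set c Z" and Z: "\<And>z. z \<in> Z \<Longrightarrow> z \<in> Z' \<or> z + c \<in> Z'"
  then obtain z l where p: "p = z - c - c * of_nat l" "z \<in> Z" by (auto simp: low_set_def)
  have "p + c = z - c * of_nat l" "p + c = (z + c) - c * of_nat (Suc l)" using p by (simp_all add: algebra_simps)
  thus "p + c \<in> lows Z'" unfolding lows_def using Z[OF p(2)] by blast
qed

lemma line_integral_cong_range:
  "(\<And>t. t \<in> range \<gamma> \<Longrightarrow> f t = g t) \<Longrightarrow> integral UNIV (line_integrand \<gamma> f) = integral UNIV (line_integrand \<gamma> g)"
  by (rule arg_cong[of _ _ "integral UNIV"]) (auto simp: line_integrand_def)

lemma line_integral_cmult: "integral UNIV (line_integrand \<gamma> (\<lambda>t. x * g t)) = x * integral UNIV (line_integrand \<gamma> g)"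
  unfolding line_integrand_def [abs_def] by (simp add: mult.assoc)

text \<open>The periodicity of the coefficients of P: the numerator of W is the same at both
  points.\<close>

lemma coeff_shift:
  assumes "m \<in> {1..n}"
  shows "coeff (P (y(m := y m - c))) = coeff (P y)"
proof
  fix i
  have "coeff (P ((y(m := y m - c))(m := (y(m := y m - c)) m + c))) i = coeff (P (y(m := y m - c))) i"
    using P assms unfolding numerators_def periodic_in_def by blast
  thus "coeff (P (y(m := y m - c))) i = coeff (P y) i" by simp
qed

lemma fct_transfer:
  assumes "t \<notin> up_set c k Z" "t \<notin> lows Z" "z \<in> Z" "z' = z + c"
  shows "Theta c k (t - z) * fct k z t = Theta c k (t - z')"
  unfolding assms(4)
  by (rule Theta_fct[OF c0]) (use assms in \<open>auto simp: up_set_def lows_def\<close>)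

end

section \<open>Replacing y_m by y_m - c\<close>

locale shift_data = solution_data +
  fixes y :: "nat \<Rightarrow> complex" and m :: nat
  assumes m: "m \<in> {1..n}" and y: "admissible n c k y" and y': "admissible n c k (y(m := y m - c))"
begin

abbreviation "ym \<equiv> y m"
abbreviation "y2 \<equiv> y(m := y m - c)"

definition others :: "complex set" where
  "others = y ` ({1..n} - {m}) \<union> (\<lambda>p. - y p) ` ({1..n} - {m})"

lemma finite_others [simp]: "finite others" by (simp add: others_def)

lemma centers_y: "centers y = insert ym (insert (- ym) others)"
  using m by (auto simp: centers_def others_def)

lemma centers_y2: "centers y2 = insert (ym - c) (insert (c - ym) others)"
proof -
  have "{1..n} = insert m ({1..n} - {m})" using m by auto
  hence "centers y2 = y2 ` insert m ({1..n} - {m}) \<union> (\<lambda>p. - y2 p) ` insert m ({1..n} - {m})" by (simp only: centers_def)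
  thus ?thesis by (auto simp: others_def)
qed

text \<open>The centres kept are the lower members of the pairs ym - c, ym and - ym, c - ym. Thus
  \<open>Up\<close> is the union of the upper families of \<open>y\<close> and \<open>y2\<close>,
  while \<open>Lo\<close> is contained in both lower families. This gives disjointness, although
  admissibility says nothing about upper poles of one point and lower poles of the other.\<close>

definition Up where "Up = up_set c k (insert (ym - c) (insert (- ym) others))"
definition Lo where "Lo = lows (insert (ym - c) (insert (- ym) others))"

lemma up_insert: "up_set c k (insert z Z) = up_set c k {z} \<union> up_set c k Z"
  by (auto simp: up_set_def)

lemma lows_insert: "lows (insert z Z) = lows {z} \<union> lows Z"
  by (auto simp: lows_def)

lemma up_plus: "up_set c k {z + c} \<subseteq> up_set c k {z}"
proof
  fix t assume "t \<in> up_set c k {z + c}"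
  then obtain l where "t = z + c + k + c * of_nat l" by (auto simp: up_set_def)
  hence "t = z + k + c * of_nat (Suc l)" by (simp add: algebra_simps)
  thus "t \<in> up_set c k {z}" unfolding up_set_def by blast
qed

lemma lows_minus: "lows {z - c} \<subseteq> lows {z}"
proof
  fix t assume "t \<in> lows {z - c}"
  then obtain l where "t = z - c - c * of_nat l" by (auto simp: lows_def)
  hence "t = z - c * of_nat (Suc l)" by (simp add: algebra_simps)
  thus "t \<in> lows {z}" unfolding lows_def by blast
qed

lemma Up_subset: "Up \<subseteq> up_set c k (centers y) \<union> up_set c k (centers y2)"
  unfolding Up_def centers_y centers_y2 up_insert[of _ "insert _ _"] up_insert[of _ others] by blast

lemma Lo_subset: "Lo \<subseteq> lows (centers y)" "Lo \<subseteq> lows (centers y2)"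
  unfolding Lo_def centers_y centers_y2 lows_insert[of _ "insert _ _"] lows_insert[of _ others]
  using lows_minus[of ym] lows_minus[of "c - ym"] by auto

lemma Up_Lo_disjoint: "Up \<inter> Lo = {}"
  using Up_subset Lo_subset y y' unfolding admissible_iff by blast

lemma up_y: "up_set c k (centers y) \<subseteq> Up" and up_y2: "up_set c k (centers y2) \<subseteq> Up"
  unfolding Up_def centers_y centers_y2 up_insert[of _ "insert _ _"] up_insert[of _ others]
  using up_plus[of "ym - c"] up_plus[of "- ym"] by auto

lemma lows_eq: "lows Z = Z \<union> low_set c Z"
proof -
  have "lows Z \<subseteq> Z \<union> low_set c Z"
  proof
    fix t assume "t \<in> lows Z"
    then obtain z l where t: "t = z - c * of_nat l" "z \<in> Z" by (auto simp: lows_def)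
    show "t \<in> Z \<union> low_set c Z"
    proof (cases l)
      case (Suc l')
      hence "t = z - c - c * of_nat l'" using t by (simp add: algebra_simps)
      thus ?thesis unfolding low_set_def using t(2) by blast
    qed (use t in simp)
  qed
  thus ?thesis using lows_self low_set_lows by blast
qed

text \<open>
  \<open>Q\<close> is a common divisor of the integrands for \<open>y\<close> and for the shifted point: only \<open>a m\<close> has been moved.
  After translation of two of the contours by \<open>c\<close>, all four integrals in \<open>J_first\<close> are integrals of \<open>Q\<close>
  times a rational function.
\<close>

definition Q :: "complex \<Rightarrow> complex" where
  "Q = psiP y y2 (\<lambda>p. - y p)"

lemma psi_y_eq:
  assumes "t \<notin> up_set c k {ym - c}" "t \<notin> lows {ym - c}"
  shows "psiP y y (\<lambda>p. - y p) t = Q t * fct k (ym - c) t"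
proof -
  have "Q t * (\<Prod>p=1..n. (if p = m then fct k (ym - c) t else 1) * 1) = psiP y y (\<lambda>p. - y p) t"
    unfolding Q_def
  proof (rule psi_mult)
    fix p assume "p \<in> {1..n}"
    show "Theta c k (t - y2 p) * (if p = m then fct k (ym - c) t else 1) = Theta c k (t - y p)"
      using fct_transfer[OF assms, of "ym - c" ym] by auto
  qed simp
  thus ?thesis using m by (simp add: prod.delta)
qed

lemma psi_y2_eq:
  assumes "t \<notin> up_set c k {- ym}" "t \<notin> lows {- ym}"
  shows "psiP y y2 (\<lambda>p. - y2 p) t = Q t * fct k (- ym) t"
proof -
  have "Q t * (\<Prod>p=1..n. 1 * (if p = m then fct k (- ym) t else 1)) = psiP y y2 (\<lambda>p. - y2 p) t"
    unfolding Q_def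
  proof (rule psi_mult)
    fix p assume "p \<in> {1..n}"
    show "Theta c k (t - - y p) * (if p = m then fct k (- ym) t else 1) = Theta c k (t - - y2 p)"
    proof (cases "p = m")
      case True
      have "Theta c k (t - - ym) * fct k (- ym) t = Theta c k (t - - y2 m)"
        by (rule fct_transfer[OF assms]) simp_all
      thus ?thesis unfolding True by (simp only: if_True simp_thms)
    qed simp
  qed simp
  thus ?thesis using m by (simp add: prod.delta)
qed

lemma coeff_y2: "coeff (P y2) = coeff (P y)"
  by (rule coeff_shift[OF m])

definition X :: "complex \<Rightarrow> complex" where
  "X t = (\<Prod>p\<in>{1..n} - {m}. fct k (y p) t * fct k (- y p) t)"

lemma ga_first: "ga k m 1 (y(m := \<zeta>)) m t = 1 / (t - \<zeta>)"
  by (simp add: ga_def before_def)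

lemma gb_first: "gb n k m 1 (y(m := \<zeta>)) m t = 1 / (t + \<zeta>) * (fct k \<zeta> t * X t)"
proof -
  have "(\<Prod>p=1..n. fct k ((y(m := \<zeta>)) p) t) = fct k \<zeta> t * (\<Prod>p\<in>{1..n} - {m}. fct k ((y(m := \<zeta>)) p) t)"
    using m prod.remove[of "{1..n}" m "\<lambda>p. fct k ((y(m := \<zeta>)) p) t"] by simp
  also have "(\<Prod>p\<in>{1..n} - {m}. fct k ((y(m := \<zeta>)) p) t) = (\<Prod>p\<in>{1..n} - {m}. fct k (y p) t)"
    by (intro prod.cong) auto
  finally have 1: "(\<Prod>p=1..n. fct k ((y(m := \<zeta>)) p) t) = fct k \<zeta> t * (\<Prod>p\<in>{1..n} - {m}. fct k (y p) t)" .
  have "before m 1 m = {}" by (simp add: before_def)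
  hence 2: "(\<Prod>p\<in>{1..n} - before m 1 m - {m}. fct k (- (y(m := \<zeta>)) p) t) = (\<Prod>p\<in>{1..n} - {m}. fct k (- y p) t)"
    by (intro prod.cong) auto
  show ?thesis unfolding gb_def 1 2 X_def prod.distrib by simp
qed

definition a1 where "a1 = (\<lambda>p. y p + c)(m := ym)"
definition b1 where "b1 = (\<lambda>p. c - y p)"

lemma prod_X: "(\<And>p. p \<in> {1..n} - {m} \<Longrightarrow> fa p * fb p = fct k (y p) t * fct k (- y p) t) \<Longrightarrow>
   (\<Prod>p=1..n. fa p * fb p) = fa m * fb m * X t"
  unfolding X_def prod.remove[OF finite_atLeastAtMost m] by (rule arg_cong[OF prod.cong[OF refl]]) blast

lemma psi_X_y:
  assumes "t \<notin> up_set c k (centers y)" "t \<notin> lows (centers y)"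
  shows "psiP y y (\<lambda>p. - y p) t * (fct k (- ym) t * X t) = psiP y a1 b1 t"
proof -
  let ?fa = "\<lambda>p. if p = m then 1 else fct k (y p) t" and ?fb = "\<lambda>p. fct k (- y p) t"
  have "psiP y y (\<lambda>p. - y p) t * (\<Prod>p=1..n. ?fa p * ?fb p) = psiP y a1 b1 t"
  proof (rule psi_mult)
    fix p assume p: "p \<in> {1..n}"
    show "Theta c k (t - y p) * ?fa p = Theta c k (t - a1 p)"
      using fct_transfer[OF assms in_centers(1)[OF p] refl] by (simp add: a1_def)
    show "Theta c k (t - - y p) * ?fb p = Theta c k (t - b1 p)"
      using fct_transfer[OF assms in_centers(2)[OF p], of "b1 p"] by (simp add: b1_def)
  qed
  moreover have "(\<Prod>p=1..n. ?fa p * ?fb p) = ?fa m * ?fb m * X t" by (rule prod_X) simp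
  ultimately show ?thesis by simp
qed

lemma psi_X_y2:
  assumes "t \<notin> up_set c k (centers y2)" "t \<notin> lows (centers y2)"
  shows "psiP y y2 (\<lambda>p. - y2 p) t * (fct k (ym - c) t * X t) = psiP y a1 b1 t"
proof -
  let ?fa = "\<lambda>p. fct k (y2 p) t" and ?fb = "\<lambda>p. if p = m then 1 else fct k (- y p) t"
  have "psiP y y2 (\<lambda>p. - y2 p) t * (\<Prod>p=1..n. ?fa p * ?fb p) = psiP y a1 b1 t"
  proof (rule psi_mult)
    fix p assume p: "p \<in> {1..n}"
    have "a1 p = y2 p + c" by (simp add: a1_def)
    thus "Theta c k (t - y2 p) * ?fa p = Theta c k (t - a1 p)"
      by (rule fct_transfer[OF assms in_centers(1)[OF p]])
    show "Theta c k (t - - y2 p) * ?fb p = Theta c k (t - b1 p)"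
    proof (cases "p = m")
      case True
      have "- y2 m = b1 m" by (simp add: b1_def)
      thus ?thesis using True by simp
    next
      case False
      thus ?thesis using fct_transfer[OF assms in_centers(2)[OF p], of "b1 p"] by (simp add: b1_def)
    qed
  qed
  moreover have "(\<Prod>p=1..n. ?fa p * ?fb p) = ?fa m * ?fb m * X t" by (rule prod_X) simp
  ultimately show ?thesis by simp
qed

lemma psi_a1_b1_translate: "psiP y a1 b1 (t + c) = exp (- (2 * pi * \<i> * lam)) * Q t"
  unfolding Q_def by (rule psi_translate[OF c0]) (auto simp: a1_def b1_def)

definition fA where "fA t = psiP y y (\<lambda>p. - y p) t * (1 / (t - (- ym)))" for t
definition fA2 where "fA2 t = psiP y y2 (\<lambda>p. - y2 p) t * (1 / (t - (ym - c)))" for t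
definition S1 where "S1 t = Q t * (1 / (t - (ym - c)))" for t
definition S2 where "S2 t = Q t * (1 / (t - (- ym)))" for t

abbreviation "Iy \<equiv> \<lambda>f. integral UNIV (line_integrand (C y) f)"
abbreviation "Iy2 \<equiv> \<lambda>f. integral UNIV (line_integrand (C y2) f)"
abbreviation "Jy \<equiv> \<lambda>f. integral UNIV (line_integrand (\<lambda>s. C y s - c) f)"
abbreviation "Jy2 \<equiv> \<lambda>f. integral UNIV (line_integrand (\<lambda>s. C y2 s - c) f)"

text \<open>For \<open>ga\<close> the rational factor is a simple pole. For \<open>gb\<close> the
  factor \<open>X\<close> and one more \<open>fct\<close> move all 2n centres but one, to
  \<open>a1\<close> and \<open>b1\<close>; translation by \<open>c\<close> then produces
  \<open>Q\<close> and the multiplier in lam.\<close>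

lemma J_first:
  shows "J y (ga k m 1 (y(m := - ym)) m) = Iy fA"
    and "J y2 (ga k m 1 y2 m) = Iy2 fA2"
    and "J y (gb n k m 1 (y(m := - ym)) m) = exp (- (2 * pi * \<i> * lam)) * Jy S1"
    and "J y2 (gb n k m 1 y2 m) = exp (- (2 * pi * \<i> * lam)) * Jy2 S2"
proof -
  show "J y (ga k m 1 (y(m := - ym)) m) = Iy fA"
    unfolding J_def by (rule line_integral_cong_range) (simp add: fA_def ga_first del: One_nat_def)
  show "J y2 (ga k m 1 y2 m) = Iy2 fA2"
    unfolding J_def coeff_y2 by (rule line_integral_cong_range) (simp add: fA2_def ga_first del: One_nat_def)
  let ?B = "\<lambda>t. psiP y a1 b1 t * (1 / (t - ym))"
  have "J y (gb n k m 1 (y(m := - ym)) m) = Iy ?B"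
    unfolding J_def
  proof (rule line_integral_cong_range)
    fix t assume "t \<in> range (C y)"
    note t = range_contour[OF y this]
    show "psiP y y (\<lambda>p. - y p) t * gb n k m 1 (y(m := - ym)) m t = ?B t"
      unfolding gb_first psi_X_y[OF t, symmetric] by simp
  qed
  also have "Iy ?B = Jy (\<lambda>t. ?B (t + c))" by (simp only: line_integrand_shift[of "C y" c ?B])
  also have "(\<lambda>t. ?B (t + c)) = (\<lambda>t. exp (- (2 * pi * \<i> * lam)) * S1 t)"
    unfolding psi_a1_b1_translate S1_def by (simp add: fun_eq_iff algebra_simps)
  finally show "J y (gb n k m 1 (y(m := - ym)) m) = exp (- (2 * pi * \<i> * lam)) * Jy S1"
    unfolding line_integral_cmult .
  let ?B2 = "\<lambda>t. psiP y a1 b1 t * (1 / (t + (ym - c)))"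
  have "J y2 (gb n k m 1 y2 m) = Iy2 ?B2"
    unfolding J_def coeff_y2
  proof (rule line_integral_cong_range)
    fix t assume "t \<in> range (C y2)"
    note t = range_contour[OF y' this]
    show "psiP y y2 (\<lambda>p. - y2 p) t * gb n k m 1 y2 m t = ?B2 t"
      unfolding gb_first psi_X_y2[OF t, symmetric] by simp
  qed
  also have "Iy2 ?B2 = Jy2 (\<lambda>t. ?B2 (t + c))" by (simp only: line_integrand_shift[of "C y2" c ?B2])
  also have "(\<lambda>t. ?B2 (t + c)) = (\<lambda>t. exp (- (2 * pi * \<i> * lam)) * S2 t)"
    unfolding psi_a1_b1_translate S2_def by (simp add: fun_eq_iff algebra_simps)
  finally show "J y2 (gb n k m 1 y2 m) = exp (- (2 * pi * \<i> * lam)) * Jy2 S2"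
    unfolding line_integral_cmult .
qed

abbreviation "ZS \<equiv> insert (ym - c) (insert (- ym) others)"

lemma integrand_sets:
  shows "fA holomorphic_on - (up_set c k (centers y) \<union> (low_set c (centers y) \<union> {- ym}))"
    and "strip_finite w (up_set c k (centers y) \<union> (low_set c (centers y) \<union> {- ym}))" and "decays_strip w fA"
    and "fA2 holomorphic_on - (up_set c k (centers y2) \<union> (low_set c (centers y2) \<union> {ym - c}))"
    and "strip_finite w (up_set c k (centers y2) \<union> (low_set c (centers y2) \<union> {ym - c}))" and "decays_strip w fA2"
    and "S1 holomorphic_on - (up_set c k ZS \<union> (low_set c ZS \<union> {ym - c}))"
    and "strip_finite w (up_set c k ZS \<union> (low_set c ZS \<union> {ym - c}))" and "decays_strip w S1"
    and "S2 holomorphic_on - (up_set c k ZS \<union> (low_set c ZS \<union> {- ym}))"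
    and "strip_finite w (up_set c k ZS \<union> (low_set c ZS \<union> {- ym}))" and "decays_strip w S2"
proof -
  have Z: "y ` {1..n} \<union> (\<lambda>p. - y p) ` {1..n} \<subseteq> centers y" "y2 ` {1..n} \<union> (\<lambda>p. - y2 p) ` {1..n} \<subseteq> centers y2"
    by (simp_all add: centers_def)
  have ZS: "y2 ` {1..n} \<union> (\<lambda>p. - y p) ` {1..n} \<subseteq> ZS" by (auto simp: others_def)
  have fin: "finite ZS" "finite {- ym}" "finite {ym - c}" by simp_all
  have tp: "tempered {z} (\<lambda>t. 1 / (t - z))" for z by (rule tempered_pole) simp
  note ph = psi_tempered[OF Z(1) finite_centers fin(2) tp] psi_tempered[OF Z(2) finite_centers fin(3) tp]
    psi_tempered[OF ZS fin(1) fin(3) tp] psi_tempered[OF ZS fin(1) fin(2) tp]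
  show "fA holomorphic_on - (up_set c k (centers y) \<union> (low_set c (centers y) \<union> {- ym}))"
    "strip_finite w (up_set c k (centers y) \<union> (low_set c (centers y) \<union> {- ym}))" "decays_strip w fA"
    "fA2 holomorphic_on - (up_set c k (centers y2) \<union> (low_set c (centers y2) \<union> {ym - c}))"
    "strip_finite w (up_set c k (centers y2) \<union> (low_set c (centers y2) \<union> {ym - c}))" "decays_strip w fA2"
    "S1 holomorphic_on - (up_set c k ZS \<union> (low_set c ZS \<union> {ym - c}))"
    "strip_finite w (up_set c k ZS \<union> (low_set c ZS \<union> {ym - c}))" "decays_strip w S1"
    "S2 holomorphic_on - (up_set c k ZS \<union> (low_set c ZS \<union> {- ym}))"
    "strip_finite w (up_set c k ZS \<union> (low_set c ZS \<union> {- ym}))" "decays_strip w S2"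
    unfolding fA_def [abs_def] fA2_def [abs_def] S1_def [abs_def] S2_def [abs_def] Q_def
    by (rule ph)+
qed

lemma shifted_contours:
  "line_ended w (0 - c) (\<lambda>s. C y s - c)" "line_ended w (0 - c) (\<lambda>s. C y2 s - c)"
  using line_ended_shift contour(1)[OF y] contour(1)[OF y'] by blast+

text \<open>A translated contour has \<open>p\<close> on the side on which the original has p + c,
  so the poles of \<open>S1\<close> and \<open>S2\<close>, increased by \<open>c\<close>, have to be
  found in the families of \<open>y\<close> or of \<open>y2\<close>.\<close>

lemma integrand_sides:
  shows "p \<in> up_set c k (centers y) \<Longrightarrow> above w (C y) p"
    and "p \<in> low_set c (centers y) \<union> {- ym} \<Longrightarrow> below w (C y) p"
    and "p \<in> up_set c k (centers y2) \<Longrightarrow> above w (C y2) p"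
    and "p \<in> low_set c (centers y2) \<union> {ym - c} \<Longrightarrow> below w (C y2) p"
    and "p \<in> up_set c k ZS \<Longrightarrow> above w (\<lambda>s. C y s - c) p"
    and "p \<in> low_set c ZS \<union> {ym - c} \<Longrightarrow> below w (\<lambda>s. C y s - c) p"
    and "p \<in> up_set c k ZS \<Longrightarrow> above w (\<lambda>s. C y2 s - c) p"
    and "p \<in> low_set c ZS \<union> {- ym} \<Longrightarrow> below w (\<lambda>s. C y2 s - c) p"
proof -
  have in_y: "- ym \<in> lows (centers y)" "ym \<in> lows (centers y)" using lows_self[of "centers y"] by (auto simp: centers_y)
  have in_y2: "ym - c \<in> lows (centers y2)" "c - ym \<in> lows (centers y2)"
    using lows_self[of "centers y2"] by (auto simp: centers_y2)
  show "p \<in> up_set c k (centers y) \<Longrightarrow> above w (C y) p" by (rule contour(2)[OF y])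
  show "p \<in> low_set c (centers y) \<union> {- ym} \<Longrightarrow> below w (C y) p"
    using contour(3)[OF y] low_set_lows in_y by blast
  show "p \<in> up_set c k (centers y2) \<Longrightarrow> above w (C y2) p" by (rule contour(2)[OF y'])
  show "p \<in> low_set c (centers y2) \<union> {ym - c} \<Longrightarrow> below w (C y2) p"
    using contour(3)[OF y'] low_set_lows in_y2 by blast
  have Z1: "z \<in> centers y \<or> z + c \<in> centers y" "z \<in> centers y2 \<or> z + c \<in> centers y2" if "z \<in> ZS" for z
    using that by (auto simp: centers_y centers_y2)
  have L1: "p + c \<in> lows (centers y)" if "p \<in> low_set c ZS"
    by (rule low_set_add_c[OF that Z1(1)])
  have L2: "p + c \<in> lows (centers y2)" if "p \<in> low_set c ZS"
    by (rule low_set_add_c[OF that Z1(2)])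
  show "p \<in> up_set c k ZS \<Longrightarrow> above w (\<lambda>s. C y s - c) p"
    by (intro above_shift[OF contour(1)[OF y]] contour(2)[OF y] up_set_add_c[of p ZS] Z1(1))
  show "p \<in> up_set c k ZS \<Longrightarrow> above w (\<lambda>s. C y2 s - c) p"
    by (intro above_shift[OF contour(1)[OF y']] contour(2)[OF y'] up_set_add_c[of p ZS] Z1(2))
  show "p \<in> low_set c ZS \<union> {ym - c} \<Longrightarrow> below w (\<lambda>s. C y s - c) p"
  proof (intro below_shift[OF contour(1)[OF y]] contour(3)[OF y])
    assume "p \<in> low_set c ZS \<union> {ym - c}"
    hence "p \<in> low_set c ZS \<or> p = ym - c" by (simp only: Un_iff singleton_iff)
    thus "p + c \<in> lows (centers y)"
    proof
      assume "p = ym - c"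
      hence "p + c = ym" by (simp only: diff_add_cancel)
      thus ?thesis using in_y(2) by (simp only:)
    qed (rule L1)
  qed
  show "p \<in> low_set c ZS \<union> {- ym} \<Longrightarrow> below w (\<lambda>s. C y2 s - c) p"
  proof (intro below_shift[OF contour(1)[OF y']] contour(3)[OF y'])
    assume "p \<in> low_set c ZS \<union> {- ym}"
    hence "p \<in> low_set c ZS \<or> p = - ym" by (simp only: Un_iff singleton_iff)
    thus "p + c \<in> lows (centers y2)"
    proof
      assume "p = - ym"
      hence "p + c = c - ym" by (simp only: add.commute diff_conv_add_uminus)
      thus ?thesis using in_y2(2) by (simp only:)
    qed (rule L2)
  qed
qed

lemma lower_sets:
  "low_set c (centers y) \<union> {- ym} \<subseteq> Lo" "low_set c (centers y2) \<union> {ym - c} \<subseteq> Lo"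
  "low_set c ZS \<union> {ym - c} \<subseteq> Lo" "low_set c ZS \<union> {- ym} \<subseteq> Lo"
proof -
  have ZS: "ZS \<subseteq> Lo" "low_set c ZS \<subseteq> Lo" unfolding Lo_def by (rule lows_self, rule low_set_lows)
  thus "low_set c ZS \<union> {ym - c} \<subseteq> Lo" "low_set c ZS \<union> {- ym} \<subseteq> Lo" by auto
  have "z - c - c * of_nat l \<in> Lo" if z: "z \<in> centers y \<or> z \<in> centers y2" for z and l :: nat
  proof -
    have "z \<in> ZS \<or> z - c \<in> ZS" using z unfolding centers_y centers_y2 by auto
    moreover have "z - c - c * of_nat l = z - c * of_nat (Suc l)" by (simp add: algebra_simps)
    ultimately show ?thesis unfolding Lo_def lows_def by blast
  qed
  hence "low_set c (centers y) \<subseteq> Lo" "low_set c (centers y2) \<subseteq> Lo" unfolding low_set_def by auto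
  thus "low_set c (centers y) \<union> {- ym} \<subseteq> Lo" "low_set c (centers y2) \<union> {ym - c} \<subseteq> Lo" using ZS(1) by (simp_all only: Un_subset_iff insert_subset empty_subsetI simp_thms)
qed

text \<open>Twice these equations are \<open>exchange_identities\<close> for the points ym - c and -
  ym, with denominators cleared: the difference of the points is 2 (ym - c/2).\<close>

lemma shift_identities:
  fixes s r z q :: complex
  assumes "s \<noteq> 0" "r \<noteq> 0" "r - s = 2 * z"
  shows "(z + k / 2) * (q * ((r - k) / r) * (1 / s)) + (- (k / 2)) * (q * ((s - k) / s) * (1 / r)) + (- z) * (q * (1 / s)) = 0"
    and "(z + k / 2) * (q * (1 / r)) + (- z) * (q * ((s - k) / s) * (1 / r)) + (- (k / 2)) * (q * (1 / s)) = 0"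
proof -
  have z: "z = (r - s) / 2" using assms(3) by simp
  show "(z + k / 2) * (q * ((r - k) / r) * (1 / s)) + (- (k / 2)) * (q * ((s - k) / s) * (1 / r)) + (- z) * (q * (1 / s)) = 0"
    unfolding z using assms(1,2) by (simp add: divide_simps) (simp add: algebra_simps)
  show "(z + k / 2) * (q * (1 / r)) + (- z) * (q * ((s - k) / s) * (1 / r)) + (- (k / 2)) * (q * (1 / s)) = 0"
    unfolding z using assms(1,2) by (simp add: divide_simps) (simp add: algebra_simps)
qed

text \<open>
  The two rows of $K(y_m - c/2\,|\,x,k/2)$: by Cauchy's theorem they hold for the integrals because they hold
  for the integrands, although the three contours differ.
\<close>

lemma pointwise:
  assumes "t \<notin> Up" "t \<notin> low_set c ZS" "t \<noteq> ym - c" "t \<noteq> - ym"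
  shows "(ym - c / 2 + k / 2) * fA2 t + (- (k / 2)) * fA t + (- (ym - c / 2)) * S1 t = 0"
    and "(ym - c / 2 + k / 2) * S2 t + (- (ym - c / 2)) * fA t + (- (k / 2)) * S1 t = 0"
proof -
  have "t \<notin> up_set c k {ym - c}" "t \<notin> up_set c k {- ym}"
    using assms(1) unfolding Up_def up_insert[of _ "insert _ _"] up_insert[of _ others] by blast+
  moreover have "t \<notin> lows {ym - c}" "t \<notin> lows {- ym}"
  proof -
    have "low_set c {ym - c} \<subseteq> low_set c ZS" "low_set c {- ym} \<subseteq> low_set c ZS" unfolding low_set_def by blast+
    thus "t \<notin> lows {ym - c}" "t \<notin> lows {- ym}" using assms(2-4) unfolding lows_eq by blast+
  qed
  ultimately have e: "psiP y y (\<lambda>p. - y p) t = Q t * fct k (ym - c) t" "psiP y y2 (\<lambda>p. - y2 p) t = Q t * fct k (- ym) t"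
    using psi_y_eq psi_y2_eq by blast+
  let ?s = "t - (ym - c)" and ?r = "t - (- ym)"
  have sr: "?s \<noteq> 0" "?r \<noteq> 0" using assms(3,4) by (simp_all only: right_minus_eq simp_thms) 
  have d: "?r - ?s = 2 * (ym - c / 2)" by simp
  show "(ym - c / 2 + k / 2) * fA2 t + (- (k / 2)) * fA t + (- (ym - c / 2)) * S1 t = 0"
    "(ym - c / 2 + k / 2) * S2 t + (- (ym - c / 2)) * fA t + (- (k / 2)) * S1 t = 0"
    unfolding fA2_def fA_def S1_def S2_def e fct_def by (rule shift_identities[OF sr d])+
qed

lemma shift_first:
  shows "(ym - c / 2 + k / 2) * Iy2 fA2 = k / 2 * Iy fA + (ym - c / 2) * Jy S1"
    and "(ym - c / 2 + k / 2) * Jy2 S2 = (ym - c / 2) * Iy fA + k / 2 * Jy S1"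
proof -
  have "(ym - c / 2 + k / 2) * Iy2 fA2 + (- (k / 2)) * Iy fA + (- (ym - c / 2)) * Jy S1 = 0"
  proof (rule three_contours[OF w0 contour(1)[OF y'] contour(1)[OF y] shifted_contours(1) integrand_sets(5,2,8) integrand_sets(4,1,7) integrand_sets(6,3,9)
        integrand_sides(3,1,5) integrand_sides(4,2,6)])
    show "(up_set c k (centers y2) \<union> up_set c k (centers y) \<union> up_set c k ZS) \<inter>
        (low_set c (centers y2) \<union> {ym - c} \<union> (low_set c (centers y) \<union> {- ym}) \<union> (low_set c ZS \<union> {ym - c})) = {}"
      using up_y up_y2 lower_sets Up_Lo_disjoint unfolding Up_def by blast
    fix t assume "t \<notin> up_set c k (centers y2) \<union> (low_set c (centers y2) \<union> {ym - c}) \<union> up_set c k (centers y)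
      \<union> (low_set c (centers y) \<union> {- ym}) \<union> up_set c k ZS \<union> (low_set c ZS \<union> {ym - c})"
    thus "(ym - c / 2 + k / 2) * fA2 t + (- (k / 2)) * fA t + (- (ym - c / 2)) * S1 t = 0"
      by (intro pointwise(1)) (auto simp: Up_def)
  qed
  thus "(ym - c / 2 + k / 2) * Iy2 fA2 = k / 2 * Iy fA + (ym - c / 2) * Jy S1" by (simp add: algebra_simps)
  have "(ym - c / 2 + k / 2) * Jy2 S2 + (- (ym - c / 2)) * Iy fA + (- (k / 2)) * Jy S1 = 0"
  proof (rule three_contours[OF w0 shifted_contours(2) contour(1)[OF y] shifted_contours(1) integrand_sets(11,2,8) integrand_sets(10,1,7) integrand_sets(12,3,9)
        integrand_sides(7,1,5) integrand_sides(8,2,6)])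
    show "(up_set c k ZS \<union> up_set c k (centers y) \<union> up_set c k ZS) \<inter>
        (low_set c ZS \<union> {- ym} \<union> (low_set c (centers y) \<union> {- ym}) \<union> (low_set c ZS \<union> {ym - c})) = {}"
      using up_y lower_sets Up_Lo_disjoint unfolding Up_def by blast
    fix t assume "t \<notin> up_set c k ZS \<union> (low_set c ZS \<union> {- ym}) \<union> up_set c k (centers y)
      \<union> (low_set c (centers y) \<union> {- ym}) \<union> up_set c k ZS \<union> (low_set c ZS \<union> {ym - c})"
    thus "(ym - c / 2 + k / 2) * S2 t + (- (ym - c / 2)) * fA t + (- (k / 2)) * S1 t = 0"
      by (intro pointwise(2)) (auto simp: Up_def)
  qed
  thus "(ym - c / 2 + k / 2) * Jy2 S2 = (ym - c / 2) * Iy fA + k / 2 * Jy S1" by (simp add: algebra_simps)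
qed

text \<open>A zero would make - ym = (ym - c) + k an upper pole for \<open>y2\<close>, while - ym =
  (c - ym) - c is a lower one.\<close>

lemma shift_denominator: "ym - c / 2 + k / 2 \<noteq> 0"
proof
  assume "ym - c / 2 + k / 2 = 0"
  hence "(ym - c) + k = - ym" by (simp add: field_simps)
  hence "- ym \<in> up_set c k (centers y2)" unfolding up_set_def centers_y2
    by (intro CollectI exI[of _ "ym - c"] exI[of _ 0]) simp
  moreover have "- ym = (c - ym) - c * of_nat 1" by simp
  hence "- ym \<in> lows (centers y2)" unfolding lows_def centers_y2 by blast
  ultimately show False using y' unfolding admissible_iff by blast
qed

text \<open>When \<open>m\<close> stands first, every function of another position contains y m in
  exactly one factor \<open>fct\<close>; \<open>ra\<close> and \<open>rb\<close> are what is
  left.\<close>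

definition ra where "ra i t = 1 / (t - y i) * (\<Prod>p\<in>{1..<i} - {m}. fct k (y p) t)"
definition rb where "rb i t = 1 / (t + y i) * (\<Prod>p\<in>{1..n} - before m 1 i - {i}. fct k (- y p) t) * (\<Prod>p\<in>{1..n} - {m}. fct k (y p) t)"

lemma ga_other:
  assumes "i \<in> {1..n}" "i \<noteq> m"
  shows "ga k m 1 (y(m := \<zeta>)) i t = fct k \<zeta> t * ra i t" "gb n k m 1 (y(m := \<zeta>)) i t = fct k \<zeta> t * rb i t"
proof -
  have b: "before m 1 i = insert m ({1..<i} - {m})" using assms by (auto simp: before_def)
  have same: "(\<Prod>p\<in>A. fct k ((y(m := \<zeta>)) p) t) = (\<Prod>p\<in>A. fct k (y p) t)"
    "(\<Prod>p\<in>A. fct k (- (y(m := \<zeta>)) p) t) = (\<Prod>p\<in>A. fct k (- y p) t)" if "m \<notin> A" for A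
    by (intro prod.cong refl; use that in auto)+
  have "(\<Prod>p\<in>before m 1 i. fct k ((y(m := \<zeta>)) p) t) = fct k \<zeta> t * (\<Prod>p\<in>{1..<i} - {m}. fct k ((y(m := \<zeta>)) p) t)"
    unfolding b by (subst prod.insert) auto
  thus "ga k m 1 (y(m := \<zeta>)) i t = fct k \<zeta> t * ra i t"
    unfolding ga_def ra_def using assms(2) same(1)[of "{1..<i} - {m}"] by simp
  have "(\<Prod>p=1..n. fct k ((y(m := \<zeta>)) p) t) = fct k \<zeta> t * (\<Prod>p\<in>{1..n} - {m}. fct k ((y(m := \<zeta>)) p) t)"
    using m prod.remove[of "{1..n}" m "\<lambda>p. fct k ((y(m := \<zeta>)) p) t"] by simp
  hence all: "(\<Prod>p=1..n. fct k ((y(m := \<zeta>)) p) t) = fct k \<zeta> t * (\<Prod>p\<in>{1..n} - {m}. fct k (y p) t)"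
    using same(1)[of "{1..n} - {m}"] by simp
  have mb: "m \<notin> {1..n} - before m 1 i - {i}" using b by blast
  have yi: "(y(m := \<zeta>)) i = y i" using assms(2) by simp
  show "gb n k m 1 (y(m := \<zeta>)) i t = fct k \<zeta> t * rb i t"
    unfolding gb_def rb_def all same(2)[OF mb] yi by simp
qed

lemma tempered_others:
  assumes i: "i \<in> {1..n}" "i \<noteq> m"
  shows "tempered others (ra i)" "tempered others (rb i)"
proof -
  have o: "y p \<in> others" "- y p \<in> others" if "p \<in> {1..n}" "p \<noteq> m" for p using that by (auto simp: others_def)
  show "tempered others (ra i)"
    unfolding ra_def [abs_def] using i o
    by (intro tempered_mult tempered_prod tempered_pole tempered_fct finite_others) auto
  have "tempered others (\<lambda>t. 1 / (t - (- y i)))" using i o by (intro tempered_pole) auto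
  moreover have "m \<in> before m 1 i" using i by (auto simp: before_def)
  ultimately show "tempered others (rb i)"
    unfolding rb_def [abs_def] using o
    by (intro tempered_mult tempered_prod tempered_fct finite_others) auto
qed

text \<open>K does not act on the positions other than \<open>m\<close>, yet the two integrals
  belong to different points. One factor moves the centre - ym to c - ym, the other ym - c to ym.
  The products are the same function, and its poles lie on the same sides of both contours.\<close>

lemma J_other:
  assumes h: "tempered others h"
  shows "J y (\<lambda>t. fct k (- ym) t * h t) = J y2 (\<lambda>t. fct k (ym - c) t * h t)"
proof -
  let ?g = "\<lambda>t. psiP y y (\<lambda>p. - y2 p) t * h t"
  let ?Z = "insert ym (insert (c - ym) others)"
  have 1: "J y (\<lambda>t. fct k (- ym) t * h t) = Iy ?g"
    unfolding J_def
  proof (rule line_integral_cong_range)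
    fix t assume "t \<in> range (C y)"
    note t = range_contour[OF y this]
    have "psiP y y (\<lambda>p. - y p) t * (\<Prod>p=1..n. 1 * (if p = m then fct k (- ym) t else 1)) = psiP y y (\<lambda>p. - y2 p) t"
    proof (rule psi_mult)
      fix p assume p: "p \<in> {1..n}"
      show "Theta c k (t - - y p) * (if p = m then fct k (- ym) t else 1) = Theta c k (t - - y2 p)"
      proof (cases "p = m")
        case True
        have "Theta c k (t - - ym) * fct k (- ym) t = Theta c k (t - - y2 m)"
          by (rule fct_transfer[OF t in_centers(2)[OF m]]) simp
        thus ?thesis unfolding True by (simp only: if_True simp_thms)
      qed simp
    qed simp
    hence "psiP y y (\<lambda>p. - y p) t * fct k (- ym) t = psiP y y (\<lambda>p. - y2 p) t" using m by (simp add: prod.delta)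
    thus "psiP y y (\<lambda>p. - y p) t * (fct k (- ym) t * h t) = ?g t" by (simp only: mult.assoc[symmetric])
  qed
  have 2: "J y2 (\<lambda>t. fct k (ym - c) t * h t) = Iy2 ?g"
    unfolding J_def coeff_y2
  proof (rule line_integral_cong_range)
    fix t assume "t \<in> range (C y2)"
    note t = range_contour[OF y' this]
    have "psiP y y2 (\<lambda>p. - y2 p) t * (\<Prod>p=1..n. (if p = m then fct k (ym - c) t else 1) * 1) = psiP y y (\<lambda>p. - y2 p) t"
    proof (rule psi_mult)
      fix p assume p: "p \<in> {1..n}"
      have "ym - c \<in> centers y2" by (simp add: centers_y2)
      thus "Theta c k (t - y2 p) * (if p = m then fct k (ym - c) t else 1) = Theta c k (t - y p)"
        using fct_transfer[OF t, of "ym - c" ym] by auto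
    qed simp
    hence "psiP y y2 (\<lambda>p. - y2 p) t * fct k (ym - c) t = psiP y y (\<lambda>p. - y2 p) t" using m by (simp add: prod.delta)
    thus "psiP y y2 (\<lambda>p. - y2 p) t * (fct k (ym - c) t * h t) = ?g t" by (simp only: mult.assoc[symmetric])
  qed
  have Z: "y ` {1..n} \<union> (\<lambda>p. - y2 p) ` {1..n} \<subseteq> ?Z" by (auto simp: others_def)
  have fin: "finite ?Z" by simp
  note ph = psi_tempered[OF Z fin finite_others h]
  have up: "up_set c k ?Z \<subseteq> up_set c k (centers y)" "up_set c k ?Z \<subseteq> up_set c k (centers y2)"
    unfolding centers_y centers_y2 up_insert[of _ "insert _ _"] up_insert[of _ others]
    using up_plus[of "ym - c"] up_plus[of "- ym"] by auto
  have low: "low_set c ?Z \<subseteq> lows (centers y)" "low_set c ?Z \<subseteq> lows (centers y2)"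
  proof -
    have "z - c - c * of_nat l \<in> lows (centers y) \<and> z - c - c * of_nat l \<in> lows (centers y2)" if z: "z \<in> ?Z" for z and l :: nat
    proof -
      have 1: "z \<in> centers y \<or> z - c \<in> centers y" "z \<in> centers y2 \<or> z - c \<in> centers y2"
        using z unfolding centers_y centers_y2 by auto
      have "z - c - c * of_nat l = z - c * of_nat (Suc l)" "z - c - c * of_nat l = (z - c) - c * of_nat l" by (simp_all add: algebra_simps)
      thus ?thesis unfolding lows_def using 1 by blast
    qed
    thus "low_set c ?Z \<subseteq> lows (centers y)" "low_set c ?Z \<subseteq> lows (centers y2)" unfolding low_set_def by blast+
  qed
  have oth: "others \<subseteq> lows (centers y)" "others \<subseteq> lows (centers y2)"
    using lows_self[of "centers y"] lows_self[of "centers y2"] by (auto simp: centers_y centers_y2)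
  have "Iy ?g = Iy2 ?g"
  proof (rule two_contours[OF w0 contour(1)[OF y] contour(1)[OF y'] ph(2,1,4)])
    show "above w (C y) p \<and> above w (C y2) p" if "p \<in> up_set c k ?Z" for p
      using that up contour(2)[OF y] contour(2)[OF y'] by blast
    show "below w (C y) p \<and> below w (C y2) p" if "p \<in> low_set c ?Z \<union> others" for p
      using that low oth contour(3)[OF y] contour(3)[OF y'] by blast
    show "up_set c k ?Z \<inter> (low_set c ?Z \<union> others) = {}"
      using up(1) low(1) oth(1) y unfolding admissible_iff by blast
  qed
  thus ?thesis unfolding 1 2 .
qed

end

section \<open>The difference equations\<close>

lemma op_prod_simps [simp]:
  "op_prod (xs @ ys) v = op_prod xs (op_prod ys v)" "op_prod [f] v = f v" "op_prod (f # xs) v = f (op_prod xs v)"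
  "op_prod [] v = v"
proof -
  show "op_prod (xs @ ys) v = op_prod xs (op_prod ys v)" by (induction xs) (simp_all add: op_prod_def)
qed (simp_all add: op_prod_def)

text \<open>The last operator of the list acts first, so \<open>X j\<close> is the vector on which
  \<open>F j\<close> acts.\<close>

lemma op_prod_downto:
  "a \<le> b \<Longrightarrow> (\<And>j. a \<le> j \<Longrightarrow> j < b \<Longrightarrow> F j (X j) = X (j + 1)) \<Longrightarrow> op_prod (map F (rev [a..<b])) (X a) = X b"
proof (induction b rule: dec_induct)
  case (step b)
  thus ?case by simp
qed simp

lemma op_prod_upto:
  assumes "a \<le> b" "\<And>j. a \<le> j \<Longrightarrow> j < b \<Longrightarrow> F j (X (j + 1)) = X j"
  shows "op_prod (map F [a..<b]) (X b) = X a"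
  using assms
proof (induction b rule: dec_induct)
  case (step b)
  have "F b (X (b + 1)) = X b" using step by simp
  hence "op_prod (map F [a..<Suc b]) (X (Suc b)) = op_prod (map F [a..<b]) (X b)" using step(1) by simp
  thus ?case using step by simp
qed simp

lemma R_op_slots_commute:
  "i \<in> {1..n} \<Longrightarrow> j \<in> {1..n} \<Longrightarrow> R_op k i j z (slots n \<tau> a b) = R_op k j i z (slots n \<tau> a b)"
proof -
  assume ij: "i \<in> {1..n}" "j \<in> {1..n}"
  have "swp i j = swp j i" by (auto simp: swp_def fun_eq_iff)
  thus ?thesis by (simp only: R_op_slots[OF ij] R_op_slots[OF ij(2,1)])
qed

context solution_data
begin

text \<open>The vector in the course of Q_m: \<open>m\<close> stands before \<open>j\<close> and its
  variable has become \<zeta>. Only the rational functions follow these moves; contour and kernel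
  remain those of \<open>y\<close>.\<close>

definition state :: "(idx multiset \<Rightarrow> complex) \<Rightarrow> complex \<Rightarrow> nat \<Rightarrow> (nat \<Rightarrow> complex) \<Rightarrow> complex \<Rightarrow> nat \<Rightarrow> tensor" where
  "state \<tau> E m y \<zeta> j = slots n \<tau> (\<lambda>i. E * J y (ga k m j (y(m := \<zeta>)) i)) (\<lambda>i. E * J y (gb n k m j (y(m := \<zeta>)) i))"

lemma J_combine:
  assumes y: "admissible n c k y" and h: "tempered (centers y) h1" "tempered (centers y) h2"
    and eq: "\<And>t. t \<notin> centers y \<Longrightarrow> (x1 * h1 t + x2 * h2 t) / d = h t"
  shows "(x1 * (E * J y h1) + x2 * (E * J y h2)) / d = E * J y h"
proof -
  have "J y h = J y (\<lambda>t. x1 / d * h1 t + x2 / d * h2 t)"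
    by (rule J_cong[OF y]) (simp add: eq[symmetric] add_divide_distrib)
  also have "\<dots> = x1 / d * J y h1 + x2 / d * J y h2" by (rule J_linear[OF y h])
  finally have "J y h = x1 / d * J y h1 + x2 / d * J y h2" .
  thus ?thesis by (simp add: distrib_left add_divide_distrib mult_ac)
qed

text \<open>The exchange identities hold pointwise off the centres and pass to the integrals by
  linearity, since both sides have the same contour and kernel.\<close>

lemma R_step:
  assumes y: "admissible n c k y" and m: "m \<in> {1..n}" and j: "j \<in> {1..n}" "j \<noteq> m" and \<zeta>: "\<zeta> = y m \<or> \<zeta> = - y m"
  shows "R_op k m j (\<zeta> - y j) (state \<tau> E m y \<zeta> j) = state \<tau> E m y \<zeta> (j + 1)"
    and "R_op k m j (y j - \<zeta>) (state \<tau> E m y \<zeta> (j + 1)) = state \<tau> E m y \<zeta> j"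
proof -
  let ?Y = "y(m := \<zeta>)"
  have Y: "?Y m = \<zeta>" "?Y j = y j" using j by auto
  have cen: "\<zeta> \<in> centers y" "- \<zeta> \<in> centers y" "y j \<in> centers y" "- y j \<in> centers y"
    using \<zeta> in_centers[OF m, of y] in_centers[OF j(1), of y] by auto
  have nz: "?Y m - ?Y j + k \<noteq> 0" "?Y j - ?Y m + k \<noteq> 0"
    using admissible_neq[OF y cen(1,3)] admissible_neq[OF y cen(3,1)] unfolding Y
    by (simp_all add: eq_diff_eq[symmetric] eq_neg_iff_add_eq_0 diff_add_eq)
  have swp: "swp m j i \<in> {1..n}" if "i \<in> {1..n}" for i using that m j by (auto simp: swp_def)
  have jn: "j \<le> n + 1" "j + 1 \<le> n + 1" using j by auto
  have t: "t \<noteq> ?Y m" "t \<noteq> ?Y j" "t \<noteq> - ?Y m" "t \<noteq> - ?Y j" if "t \<notin> centers y" for t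
    using that cen unfolding Y by auto
  have temp: "tempered (centers y) (ga k m j' ?Y i)" "tempered (centers y) (gb n k m j' ?Y i)" if "i \<in> {1..n}" "j' \<le> n + 1" for i j'
    by (rule tempered_state[where m = m and y = y and \<zeta> = \<zeta>, OF m that \<zeta>])+
  note exa = exchange_ga[where y = ?Y, OF j(1) m j(2) t(1,2), unfolded Y]
    and exb = exchange_gb[where y = ?Y, OF j(1) m j(2) t(3,4), unfolded Y]
  show "R_op k m j (\<zeta> - y j) (state \<tau> E m y \<zeta> j) = state \<tau> E m y \<zeta> (j + 1)"
    unfolding state_def R_op_slots[OF m j(1)]
  proof (rule slots_cong)
    fix i assume i: "i \<in> {1..n}"
    show "((\<zeta> - y j) * (E * J y (ga k m j ?Y i)) + k * (E * J y (ga k m j ?Y (swp m j i)))) / (\<zeta> - y j + k) = E * J y (ga k m (j + 1) ?Y i)"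
      by (rule J_combine[OF y temp(1)[OF i jn(1)] temp(1)[OF swp[OF i] jn(1)]])
        (rule exa(1), assumption, assumption, rule nz[unfolded Y])
    show "((\<zeta> - y j) * (E * J y (gb n k m j ?Y i)) + k * (E * J y (gb n k m j ?Y (swp m j i)))) / (\<zeta> - y j + k) = E * J y (gb n k m (j + 1) ?Y i)"
      by (rule J_combine[OF y temp(2)[OF i jn(1)] temp(2)[OF swp[OF i] jn(1)]])
        (rule exb(1), assumption, assumption, rule i, rule nz[unfolded Y])
  qed
  show "R_op k m j (y j - \<zeta>) (state \<tau> E m y \<zeta> (j + 1)) = state \<tau> E m y \<zeta> j"
    unfolding state_def R_op_slots[OF m j(1)]
  proof (rule slots_cong)
    fix i assume i: "i \<in> {1..n}"
    show "((y j - \<zeta>) * (E * J y (ga k m (j + 1) ?Y i)) + k * (E * J y (ga k m (j + 1) ?Y (swp m j i)))) / (y j - \<zeta> + k) = E * J y (ga k m j ?Y i)"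
      by (rule J_combine[OF y temp(1)[OF i jn(2)] temp(1)[OF swp[OF i] jn(2)]])
        (rule exa(2), assumption, assumption, rule nz[unfolded Y])
    show "((y j - \<zeta>) * (E * J y (gb n k m (j + 1) ?Y i)) + k * (E * J y (gb n k m (j + 1) ?Y (swp m j i)))) / (y j - \<zeta> + k) = E * J y (gb n k m j ?Y i)"
      by (rule J_combine[OF y temp(2)[OF i jn(2)] temp(2)[OF swp[OF i] jn(2)]])
        (rule exb(2), assumption, assumption, rule i, rule nz[unfolded Y])
  qed
qed

lemma K_step:
  assumes \<tau>: "symmetric_part N \<tau>" and y: "admissible n c k y" and m: "m \<in> {1..n}"
  shows "K_op N m (y m) (\<lambda>_. 1) (k / 2) (state \<tau> E m y (y m) (n + 1)) = state \<tau> E m y (- y m) (n + 1)"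
proof -
  interpret symmetric_part n N \<tau> by (rule \<tau>)
  have nz: "y m + k / 2 \<noteq> 0"
  proof
    assume "y m + k / 2 = 0"
    hence "y m + k = - y m" by (simp add: field_simps)
    thus False using admissible_neq[OF y in_centers(1)[OF m] in_centers(2)[OF m]] by simp
  qed
  have t: "t \<noteq> y m" "t \<noteq> - y m" if "t \<notin> centers y" for t using that in_centers[OF m, of y] by auto
  have temp: "tempered (centers y) (ga k m (n + 1) y m)" "tempered (centers y) (gb n k m (n + 1) y m)"
    using tempered_state[OF m m, of "n + 1" "y m" y] by simp_all
  have y_id: "y(m := y m) = y" by simp
  note K = K_op_slots[where x = "\<lambda>_. 1" and \<beta> = "k / 2", OF m refl nz]
  show ?thesis
    unfolding state_def y_id K
  proof (rule slots_cong)
    fix i assume i: "i \<in> {1..n}"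
    have a: "(y m * (1 * (E * J y (gb n k m (n + 1) y m))) + k / 2 * (E * J y (ga k m (n + 1) y m))) / (y m + k / 2)
        = E * J y (ga k m (n + 1) (y(m := - y m)) m)"
      unfolding mult_1_left by (rule J_combine[OF y temp(2,1)]) (rule reflect_ga_gb(3)[where y = y and m = m, OF m m t nz])
    have b: "(y m * (inverse 1 * (E * J y (ga k m (n + 1) y m))) + k / 2 * (E * J y (gb n k m (n + 1) y m))) / (y m + k / 2)
        = E * J y (gb n k m (n + 1) (y(m := - y m)) m)"
      unfolding inverse_1 mult_1_left by (rule J_combine[OF y temp]) (rule reflect_ga_gb(4)[where y = y and m = m, OF m m t nz])
    have "E * J y (ga k m (n + 1) y i) = E * J y (ga k m (n + 1) (y(m := - y m)) i)" if "i \<noteq> m"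
      using J_cong[OF y reflect_ga_gb(1)[where y = y and m = m, OF m i t nz that]] by simp
    thus "((\<lambda>i. E * J y (ga k m (n + 1) y i))(m := (y m * (1 * (E * J y (gb n k m (n + 1) y m))) + k / 2 * (E * J y (ga k m (n + 1) y m))) / (y m + k / 2))) i
        = E * J y (ga k m (n + 1) (y(m := - y m)) i)" unfolding a by simp
    have "E * J y (gb n k m (n + 1) y i) = E * J y (gb n k m (n + 1) (y(m := - y m)) i)" if "i \<noteq> m"
      using J_cong[OF y reflect_ga_gb(2)[where y = y and m = m, OF m i t nz that]] by simp
    thus "((\<lambda>i. E * J y (gb n k m (n + 1) y i))(m := (y m * (inverse 1 * (E * J y (ga k m (n + 1) y m))) + k / 2 * (E * J y (gb n k m (n + 1) y m))) / (y m + k / 2))) i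
        = E * J y (gb n k m (n + 1) (y(m := - y m)) i)" unfolding b by simp
  qed
qed

text \<open>The operators skip j = m. Standing before \<open>m\<close> or before m + 1 is the same
  place for \<open>m\<close>, which joins the steps above \<open>m\<close> to those below.\<close>

lemma state_natural:
  assumes "m \<in> {1..n}"
  shows "state \<tau> E m y \<zeta> (m + 1) = state \<tau> E m y \<zeta> m"
  using assms unfolding state_def ga_def [abs_def] gb_def [abs_def] by (simp only: before_natural atLeastAtMost_iff)

end

context shift_data
begin

lemma shift_step:
  assumes \<tau>: "symmetric_part N \<tau>"
  shows "K_op N m (y m - c / 2) (xpt lam) (k / 2) (state \<tau> E m y (- y m) 1) = state \<tau> E m y2 (y2 m) 1"
proof -
  interpret symmetric_part n N \<tau> by (rule \<tau>)
  have x1: "\<And>p. 2 \<le> p \<Longrightarrow> xpt lam p = 1" by (simp add: xpt_def)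
  have K: "K_op N m (y m - c / 2) (xpt lam) (k / 2) (slots n \<tau> a b) =
      slots n \<tau> (a(m := ((y m - c / 2) * (xpt lam 1 * b m) + k / 2 * a m) / (y m - c / 2 + k / 2)))
         (b(m := ((y m - c / 2) * (inverse (xpt lam 1) * a m) + k / 2 * b m) / (y m - c / 2 + k / 2)))" for a b
    by (rule K_op_slots[where x = "xpt lam" and \<beta> = "k / 2", OF m _ shift_denominator]) (rule x1)
  have x: "inverse (xpt lam 1) = exp (- (2 * pi * \<i> * lam))" "xpt lam 1 * exp (- (2 * pi * \<i> * lam)) = 1"
    by (simp_all add: xpt_def exp_minus)
  have y2_id: "y2(m := y2 m) = y2" by simp
  let ?z = "y m - c / 2" and ?x = "xpt lam 1"
  let ?a = "\<lambda>i. E * J y (ga k m 1 (y(m := - ym)) i)" and ?b = "\<lambda>i. E * J y (gb n k m 1 (y(m := - ym)) i)"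
  show ?thesis
    unfolding state_def y2_id K
  proof (rule slots_cong)
    fix i assume i: "i \<in> {1..n}"
    \<comment> \<open>In the first row x_1 cancels the multiplier exp (- 2 pi i lam) of the
      translated integral; in the second row the inverse of x_1 supplies it to the integral that was
      not translated.\<close>
    have "?x * ?b m = (?x * exp (- (2 * pi * \<i> * lam))) * (E * Jy S1)" unfolding J_first by (simp only: mult_ac)
    hence xb: "?x * ?b m = E * Jy S1" unfolding x by simp
    have "(?z * (?x * ?b m) + k / 2 * ?a m) / (?z + k / 2) = E * ((k / 2 * Iy fA + ?z * Jy S1) / (?z + k / 2))"
      unfolding xb unfolding J_first by (simp add: algebra_simps)
    also have "\<dots> = E * J y2 (ga k m 1 y2 m)"
      unfolding shift_first(1)[symmetric] J_first using shift_denominator by simp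
    finally have a: "(?z * (?x * ?b m) + k / 2 * ?a m) / (?z + k / 2) = E * J y2 (ga k m 1 y2 m)" .
    have "(?z * (inverse ?x * ?a m) + k / 2 * ?b m) / (?z + k / 2)
        = E * (exp (- (2 * pi * \<i> * lam)) * ((?z * Iy fA + k / 2 * Jy S1) / (?z + k / 2)))"
      unfolding x J_first by (simp add: algebra_simps)
    also have "\<dots> = E * J y2 (gb n k m 1 y2 m)"
      unfolding shift_first(2)[symmetric] J_first using shift_denominator by simp
    finally have b: "(?z * (inverse ?x * ?a m) + k / 2 * ?b m) / (?z + k / 2) = E * J y2 (gb n k m 1 y2 m)" .
    have "ga k m 1 (y(m := \<zeta>)) i = (\<lambda>t. fct k \<zeta> t * ra i t)" "gb n k m 1 (y(m := \<zeta>)) i = (\<lambda>t. fct k \<zeta> t * rb i t)" if "i \<noteq> m" for \<zeta>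
      using ga_other[OF i that] by blast+
    hence o: "?a i = E * J y2 (ga k m 1 y2 i)" "?b i = E * J y2 (gb n k m 1 y2 i)" if "i \<noteq> m"
      using that J_other[OF tempered_others(1)[OF i that]] J_other[OF tempered_others(2)[OF i that]] by simp_all
    show "(?a(m := (?z * (?x * ?b m) + k / 2 * ?a m) / (?z + k / 2))) i = E * J y2 (ga k m 1 y2 i)"
      unfolding a using o(1) by simp
    show "(?b(m := (?z * (inverse ?x * ?a m) + k / 2 * ?b m) / (?z + k / 2))) i = E * J y2 (gb n k m 1 y2 i)"
      unfolding b using o(2) by simp
  qed
qed

lemma Q_op_state:
  assumes \<tau>: "symmetric_part N \<tau>"
  shows "Q_op n N c k (k / 2) (k / 2) m (xpt lam) y (state \<tau> E m y (y m) m) = state \<tau> E m y2 (y2 m) m"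
proof -
  let ?S = "state \<tau> E m y (y m)" and ?S' = "state \<tau> E m y (- y m)" and ?S2 = "state \<tau> E m y2 (y2 m)"
  have mn: "1 \<le> m" "m + 1 \<le> n + 1" using m by auto
  have 1: "op_prod (map (\<lambda>j. R_op k m j (y m - y j)) (rev [m + 1..<n + 1])) (?S (m + 1)) = ?S (n + 1)"
    by (rule op_prod_downto[OF mn(2)], rule R_step(1)[OF y m]) auto
  have 2: "op_prod (map (\<lambda>j. R_op k m j (y m + y j)) [m + 1..<n + 1]) (?S' (n + 1)) = ?S' (m + 1)"
  proof (rule op_prod_upto[OF mn(2)])
    fix j assume "m + 1 \<le> j" "j < n + 1"
    hence "R_op k m j (y j - - y m) (?S' (j + 1)) = ?S' j" by (intro R_step(2)[OF y m]) auto
    thus "R_op k m j (y m + y j) (?S' (j + 1)) = ?S' j" by (simp add: add.commute)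
  qed
  have 3: "op_prod (map (\<lambda>j. R_op k j m (y j + y m)) [1..<m]) (?S' m) = ?S' 1"
  proof (rule op_prod_upto[OF mn(1)])
    fix j assume j: "1 \<le> j" "j < m"
    hence "R_op k m j (y j - - y m) (?S' (j + 1)) = ?S' j" using m by (intro R_step(2)[OF y m]) auto
    \<comment> \<open>These factors of Q_m carry their indices in the other order; a transposition
      does not depend on it.\<close>
    moreover have "R_op k j m (y j - - y m) (?S' (j + 1)) = R_op k m j (y j - - y m) (?S' (j + 1))"
      unfolding state_def by (rule R_op_slots_commute) (use j m in auto)
    ultimately show "R_op k j m (y j + y m) (?S' (j + 1)) = ?S' j" by simp
  qed
  have 4: "op_prod (map (\<lambda>j. R_op k m j (y m - y j - c)) (rev [1..<m])) (?S2 1) = ?S2 m"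
  proof (rule op_prod_downto[OF mn(1)])
    fix j assume j: "1 \<le> j" "j < m"
    hence "R_op k m j (y2 m - y2 j) (?S2 j) = ?S2 (j + 1)" using m by (intro R_step(1)[OF y' m]) auto
    moreover have "y2 m - y2 j = y m - y j - c" using j by simp
    ultimately show "R_op k m j (y m - y j - c) (?S2 j) = ?S2 (j + 1)" by (simp only:)
  qed
  have nat: "?S m = ?S (m + 1)" "?S' (m + 1) = ?S' m" by (simp_all only: state_natural[OF m])
  show ?thesis
    unfolding Q_op_def op_prod_simps by (simp only: nat 1 K_step[OF \<tau> y m] 2 3 shift_step[OF \<tau>] 4)
qed

end

section \<open>The differential equation\<close>

lemma telescope_ga:
  assumes m: "1 \<le> m" and t: "\<And>p. p \<in> {1..<i} \<Longrightarrow> t \<noteq> y p"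
  shows "(\<Prod>p\<in>{1..<i}. fct k (y p) t) = 1 - k * (\<Sum>j=1..<i. ga k m m y j t)"
  using t
proof (induction i)
  case (Suc i)
  show ?case
  proof (cases "1 \<le> i")
    case True
    hence e: "{1..<Suc i} = insert i {1..<i}" by auto
    have "t - y i \<noteq> 0" using Suc.prems[of i] True by simp
    hence f: "fct k (y i) t = 1 - k * (1 / (t - y i))" by (simp add: fct_def field_simps)
    have IH: "(\<Prod>p\<in>{1..<i}. fct k (y p) t) = 1 - k * (\<Sum>j=1..<i. ga k m m y j t)" using Suc by simp
    have "(\<Prod>p\<in>{1..<Suc i}. fct k (y p) t) = (\<Prod>p\<in>{1..<i}. fct k (y p) t) - k * ga k m m y i t"
      unfolding e ga_def before_natural(1)[OF m] by (simp add: f algebra_simps)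
    thus ?thesis unfolding e IH by (simp add: algebra_simps)
  qed simp
qed simp

text \<open>Downward induction, because \<open>gb\<close> collects the factors at the later
  positions; it starts from the empty product at i = n + 1.\<close>

lemma telescope_gb:
  assumes m: "1 \<le> m" and i: "1 \<le> i" "i \<le> n + 1" and t: "\<And>p. p \<in> {1..n} \<Longrightarrow> t \<noteq> - y p"
  shows "(\<Prod>p\<in>{i..n}. fct k (- y p) t) * (\<Prod>p=1..n. fct k (y p) t)
    = (\<Prod>p=1..n. fct k (y p) t) - k * (\<Sum>j=i..n. gb n k m m y j t)"
  using i(2,1)
proof (induction i rule: inc_induct)
  case (step i)
  let ?F = "\<Prod>p=1..n. fct k (y p) t"
  have i: "i \<in> {1..n}" using step by simp
  have e: "{i..n} = insert i {Suc i..n}" using i by auto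
  have "t + y i \<noteq> 0" using t[OF i] by (simp add: add_eq_0_iff2)
  hence f: "fct k (- y i) t = 1 - k * (1 / (t + y i))" by (simp add: fct_def field_simps)
  have "{1..n} - {1..<i} - {i} = {Suc i..n}" using i by auto
  hence g: "gb n k m m y i t = 1 / (t + y i) * ((\<Prod>p\<in>{Suc i..n}. fct k (- y p) t) * ?F)"
    unfolding gb_def before_natural(1)[OF m] by (simp only: mult.assoc)
  have "(\<Prod>p\<in>{i..n}. fct k (- y p) t) = fct k (- y i) t * (\<Prod>p\<in>{Suc i..n}. fct k (- y p) t)"
    unfolding e by simp
  hence "(\<Prod>p\<in>{i..n}. fct k (- y p) t) * ?F = (\<Prod>p\<in>{Suc i..n}. fct k (- y p) t) * ?F - k * gb n k m m y i t"
    unfolding f g by (simp only:) (simp add: algebra_simps)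
  also have "\<dots> = ?F - k * (\<Sum>j=Suc i..n. gb n k m m y j t) - k * gb n k m m y i t" using step by simp
  also have "(\<Sum>j=i..n. gb n k m m y j t) = gb n k m m y i t + (\<Sum>j=Suc i..n. gb n k m m y j t)" unfolding e by simp
  ultimately show ?case by (simp add: algebra_simps)
qed simp

context solution_data
begin

lemma J_sum:
  assumes y: "admissible n c k y" and h: "\<And>i. i \<in> I \<Longrightarrow> tempered (centers y) (h i)" and I: "finite I"
  shows "J y (\<lambda>t. \<Sum>i\<in>I. h i t) = (\<Sum>i\<in>I. J y (h i))"
  using I h
proof (induction I rule: finite_induct)
  case empty
  thus ?case by (simp add: J_def line_integrand_def [abs_def])
next
  case (insert i I)
  have "J y (\<lambda>t. 1 * h i t + 1 * (\<Sum>j\<in>I. h j t)) = 1 * J y (h i) + 1 * J y (\<lambda>t. \<Sum>j\<in>I. h j t)"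
    by (rule J_linear[OF y]) (use insert in \<open>auto intro: tempered_sum\<close>)
  thus ?case using insert by simp
qed

lemma tempered_natural:
  assumes "i \<in> {1..n}"
  shows "tempered (centers y) (ga k 1 1 y i)" "tempered (centers y) (gb n k 1 1 y i)"
  using tempered_state[where m = 1 and y = y and \<zeta> = "y 1", of i 1] n assms by auto

text \<open>All 2n factors together move every centre by \<open>c\<close>, which a translation
  undoes. Without a function g_j the integrand has no poles at the centres themselves, so the
  contour and its translate separate the same poles and no residue appears.\<close>

lemma J_full:
  assumes y: "admissible n c k y"
  shows "J y (\<lambda>t. \<Prod>p=1..n. fct k (y p) t * fct k (- y p) t) = exp (- (2 * pi * \<i> * lam)) * J y (\<lambda>_. 1)"
proof -
  let ?f = "psiP y y (\<lambda>p. - y p)" and ?g = "psiP y (\<lambda>p. y p + c) (\<lambda>p. c - y p)"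
  let ?U = "up_set c k (centers y)" and ?L = "low_set c (centers y)"
  have "J y (\<lambda>t. \<Prod>p=1..n. fct k (y p) t * fct k (- y p) t) = integral UNIV (line_integrand (C y) ?g)"
    unfolding J_def
  proof (rule line_integral_cong_range, rule psi_mult)
    fix t p assume "t \<in> range (C y)" and p: "p \<in> {1..n}"
    note t = range_contour[OF y this(1)]
    show "Theta c k (t - y p) * fct k (y p) t = Theta c k (t - (y p + c))"
      by (rule fct_transfer[OF t in_centers(1)[OF p] refl])
    show "Theta c k (t - - y p) * fct k (- y p) t = Theta c k (t - (c - y p))"
      by (rule fct_transfer[OF t in_centers(2)[OF p]]) simp
  qed
  also have "integral UNIV (line_integrand (C y) ?g) = integral UNIV (line_integrand (\<lambda>s. C y s - c) (\<lambda>t. ?g (t + c)))"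
    by (simp only: line_integrand_shift[of "C y" c ?g])
  also have "\<dots> = integral UNIV (line_integrand (\<lambda>s. C y s - c) (\<lambda>t. exp (- (2 * pi * \<i> * lam)) * ?f t))"
    by (rule line_integral_cong_range, rule psi_translate[OF c0]) simp_all
  also have "\<dots> = exp (- (2 * pi * \<i> * lam)) * integral UNIV (line_integrand (\<lambda>s. C y s - c) ?f)"
    by (rule line_integral_cmult)
  also have "integral UNIV (line_integrand (\<lambda>s. C y s - c) ?f) = integral UNIV (line_integrand (C y) ?f)"
  proof (rule two_contours[OF w0 line_ended_shift[OF contour(1)[OF y]] contour(1)[OF y]])
    have Z: "y ` {1..n} \<union> (\<lambda>p. - y p) ` {1..n} \<subseteq> centers y" by (simp add: centers_def)
    note ph = psi_tempered[OF Z finite_centers finite.emptyI tempered_const[of "{}" 1]]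
    show "strip_finite w (?U \<union> ?L)" using ph(2) by simp
    show "?f holomorphic_on - (?U \<union> ?L)" using ph(1)[of y] by simp
    show "decays_strip w ?f" using ph(4)[of y] by simp
    show "?U \<inter> ?L = {}" using y low_set_lows unfolding admissible_iff by blast
    show "above w (\<lambda>s. C y s - c) p \<and> above w (C y) p" if "p \<in> ?U" for p
      by (intro conjI above_shift[OF contour(1)[OF y]] contour(2)[OF y] that up_set_add_c[OF that]) blast
    show "below w (\<lambda>s. C y s - c) p \<and> below w (C y) p" if "p \<in> ?L" for p
      using that low_set_lows
      by (intro conjI below_shift[OF contour(1)[OF y]] contour(3)[OF y] low_set_add_c[OF that]) blast+
  qed
  finally show ?thesis by (simp add: J_def)
qed

lemma moments:
  assumes y: "admissible n c k y" and i: "i \<in> {1..n}"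
  defines "A \<equiv> \<lambda>j. J y (ga k 1 1 y j)" and "B \<equiv> \<lambda>j. J y (gb n k 1 1 y j)"
  shows "J y (\<lambda>t. t * ga k 1 1 y i t) = y i * A i + J y (\<lambda>_. 1) - k * (\<Sum>j=1..<i. A j)"
    and "J y (\<lambda>t. t * gb n k 1 1 y i t) = - y i * B i + J y (\<lambda>_. 1) - k * (\<Sum>j=1..n. A j) - k * (\<Sum>j=i+1..n. B j)"
    and "exp (2 * pi * \<i> * lam) \<noteq> 1 \<Longrightarrow>
      J y (\<lambda>_. 1) = k * (exp (2 * pi * \<i> * lam) / (exp (2 * pi * \<i> * lam) - 1)) * ((\<Sum>j=1..n. A j) + (\<Sum>j=1..n. B j))"
proof -
  let ?a = "\<lambda>j. ga k 1 1 y j" and ?b = "\<lambda>j. gb n k 1 1 y j" and ?T = "tempered (centers y)"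
  have t1: "t \<noteq> y p" "t \<noteq> - y p" if "t \<notin> centers y" "p \<in> {1..n}" for t p
    using that in_centers[OF that(2), of y] by auto
  have all: "(\<Prod>p=1..n. fct k (y p) t) = 1 - k * (\<Sum>j=1..n. ?a j t)" if "t \<notin> centers y" for t
  proof -
    have "{1..<n + 1} = {1..n}" by auto
    moreover have "(\<Prod>p\<in>{1..<n + 1}. fct k (y p) t) = 1 - k * (\<Sum>j=1..<n + 1. ?a j t)"
      by (rule telescope_ga[OF order_refl], rule t1(1)[OF that]) auto
    ultimately show ?thesis by (simp only:)
  qed
  have T: "?T (?a j)" "?T (?b j)" if "j \<in> {1..n}" for j by (rule tempered_natural[OF that])+
  have Ts: "?T (\<lambda>t. \<Sum>j\<in>I. ?a j t)" "?T (\<lambda>t. \<Sum>j\<in>I. ?b j t)" if "I \<subseteq> {1..n}" for I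
    using that T by (auto intro!: tempered_sum)
  have Js: "J y (\<lambda>t. \<Sum>j\<in>I. ?a j t) = (\<Sum>j\<in>I. A j)" "J y (\<lambda>t. \<Sum>j\<in>I. ?b j t) = (\<Sum>j\<in>I. B j)" if "I \<subseteq> {1..n}" for I
    unfolding A_def B_def using that T finite_subset[OF that]
    by (auto intro!: J_sum[OF y])
  have sub: "{1..<i} \<subseteq> {1..n}" "{i+1..n} \<subseteq> {1..n}" "{1..n} \<subseteq> {1..n}" using i by auto
  have "J y (\<lambda>t. t * ?a i t) = J y (\<lambda>t. 1 * (y i * ?a i t + 1 * 1) + (- k) * (\<Sum>j=1..<i. ?a j t))"
  proof (rule J_cong[OF y])
    fix t assume t: "t \<notin> centers y"
    have "t - y i \<noteq> 0" using t1(1)[OF t i] by simp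
    hence "(t - y i) * ?a i t = (\<Prod>p\<in>{1..<i}. fct k (y p) t)" unfolding ga_def before_natural(1)[OF order_refl] by simp
    also have "\<dots> = 1 - k * (\<Sum>j=1..<i. ?a j t)"
      by (rule telescope_ga[OF order_refl], rule t1(1)[OF t]) (use i in auto)
    finally show "t * ?a i t = 1 * (y i * ?a i t + 1 * 1) + (- k) * (\<Sum>j=1..<i. ?a j t)" by (simp add: algebra_simps)
  qed
  also have "\<dots> = 1 * J y (\<lambda>t. y i * ?a i t + 1 * 1) + (- k) * J y (\<lambda>t. \<Sum>j=1..<i. ?a j t)"
    by (intro J_linear[OF y] Ts sub tempered_add tempered_mult tempered_const T i)
  also have "J y (\<lambda>t. y i * ?a i t + 1 * 1) = y i * J y (?a i) + 1 * J y (\<lambda>_. 1)"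
    by (intro J_linear[OF y] tempered_const T i)
  finally show "J y (\<lambda>t. t * ?a i t) = y i * A i + J y (\<lambda>_. 1) - k * (\<Sum>j=1..<i. A j)"
    unfolding Js[OF sub(1)] by (simp add: A_def)
  have "J y (\<lambda>t. t * ?b i t) = J y (\<lambda>t. 1 * ((- y i) * ?b i t + 1 * 1) + (- k) * ((1 * (\<Sum>j=1..n. ?a j t)) + 1 * (\<Sum>j=i+1..n. ?b j t)))"
  proof (rule J_cong[OF y])
    fix t assume t: "t \<notin> centers y"
    have "t + y i \<noteq> 0" using t1(2)[OF t i] by (simp add: add_eq_0_iff2)
    moreover have "{1..n} - {1..<i} - {i} = {i+1..n}" using i by auto
    ultimately have "(t + y i) * ?b i t = (\<Prod>p\<in>{i+1..n}. fct k (- y p) t) * (\<Prod>p=1..n. fct k (y p) t)"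
      unfolding gb_def before_natural(1)[OF order_refl] by simp
    also have "\<dots> = (\<Prod>p=1..n. fct k (y p) t) - k * (\<Sum>j=i+1..n. ?b j t)"
      by (rule telescope_gb[OF order_refl _ _ t1(2)[OF t]]) (use i in auto)
    finally show "t * ?b i t = 1 * ((- y i) * ?b i t + 1 * 1) + (- k) * ((1 * (\<Sum>j=1..n. ?a j t)) + 1 * (\<Sum>j=i+1..n. ?b j t))"
      unfolding all[OF t] by (simp add: algebra_simps)
  qed
  also have "\<dots> = 1 * J y (\<lambda>t. (- y i) * ?b i t + 1 * 1) + (- k) * J y (\<lambda>t. (1 * (\<Sum>j=1..n. ?a j t)) + 1 * (\<Sum>j=i+1..n. ?b j t))"
    by (intro J_linear[OF y] Ts sub tempered_add tempered_mult tempered_const T i)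
  also have "J y (\<lambda>t. (- y i) * ?b i t + 1 * 1) = (- y i) * J y (?b i) + 1 * J y (\<lambda>_. 1)"
    by (intro J_linear[OF y] tempered_const T i)
  also have "J y (\<lambda>t. (1 * (\<Sum>j=1..n. ?a j t)) + 1 * (\<Sum>j=i+1..n. ?b j t))
      = 1 * J y (\<lambda>t. \<Sum>j=1..n. ?a j t) + 1 * J y (\<lambda>t. \<Sum>j=i+1..n. ?b j t)"
    by (intro J_linear[OF y] Ts sub)
  finally show "J y (\<lambda>t. t * ?b i t) = - y i * B i + J y (\<lambda>_. 1) - k * (\<Sum>j=1..n. A j) - k * (\<Sum>j=i+1..n. B j)"
    unfolding Js[OF sub(2)] Js[OF sub(3)] by (simp add: B_def algebra_simps)
  assume x: "exp (2 * pi * \<i> * lam) \<noteq> 1"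
  let ?x = "exp (2 * pi * \<i> * lam)"
  \<comment> \<open>Two evaluations of the full product: by telescoping it is 1 minus k times the
    sum of all 2n functions, and by \<open>J_full\<close> it multiplies the integral of 1 by the
    inverse of x_1.\<close>
  have "J y (\<lambda>t. \<Prod>p=1..n. fct k (y p) t * fct k (- y p) t) = J y (\<lambda>t. 1 * 1 + (- k) * ((1 * (\<Sum>j=1..n. ?a j t)) + 1 * (\<Sum>j=1..n. ?b j t)))"
  proof (rule J_cong[OF y])
    fix t assume t: "t \<notin> centers y"
    have "(\<Prod>p=1..n. fct k (y p) t * fct k (- y p) t) = (\<Prod>p=1..n. fct k (- y p) t) * (\<Prod>p=1..n. fct k (y p) t)"
      by (simp add: prod.distrib mult.commute)
    also have "\<dots> = (\<Prod>p=1..n. fct k (y p) t) - k * (\<Sum>j=1..n. ?b j t)"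
      by (rule telescope_gb[OF order_refl _ _ t1(2)[OF t]]) auto
    finally show "(\<Prod>p=1..n. fct k (y p) t * fct k (- y p) t) = 1 * 1 + (- k) * ((1 * (\<Sum>j=1..n. ?a j t)) + 1 * (\<Sum>j=1..n. ?b j t))"
      unfolding all[OF t] by (simp add: algebra_simps)
  qed
  also have "\<dots> = 1 * J y (\<lambda>_. 1) + (- k) * J y (\<lambda>t. (1 * (\<Sum>j=1..n. ?a j t)) + 1 * (\<Sum>j=1..n. ?b j t))"
    by (intro J_linear[OF y] Ts sub tempered_add tempered_mult tempered_const)
  also have "J y (\<lambda>t. (1 * (\<Sum>j=1..n. ?a j t)) + 1 * (\<Sum>j=1..n. ?b j t))
      = 1 * J y (\<lambda>t. \<Sum>j=1..n. ?a j t) + 1 * J y (\<lambda>t. \<Sum>j=1..n. ?b j t)"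
    by (intro J_linear[OF y] Ts sub)
  finally have "exp (- (2 * pi * \<i> * lam)) * J y (\<lambda>_. 1) = J y (\<lambda>_. 1) - k * ((\<Sum>j=1..n. A j) + (\<Sum>j=1..n. B j))"
    unfolding J_full[OF y] Js[OF sub(3)] by simp
  hence "?x * (exp (- (2 * pi * \<i> * lam)) * J y (\<lambda>_. 1)) = ?x * (J y (\<lambda>_. 1) - k * ((\<Sum>j=1..n. A j) + (\<Sum>j=1..n. B j)))" by simp
  moreover have "?x * exp (- (2 * pi * \<i> * lam)) = 1" by (simp add: exp_minus)
  ultimately have "(?x - 1) * J y (\<lambda>_. 1) = k * ?x * ((\<Sum>j=1..n. A j) + (\<Sum>j=1..n. B j))"
    by (simp only: mult.assoc[symmetric]) (simp add: algebra_simps)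
  moreover have "?x - 1 \<noteq> 0" using x by simp
  ultimately show "J y (\<lambda>_. 1) = k * (?x / (?x - 1)) * ((\<Sum>j=1..n. A j) + (\<Sum>j=1..n. B j))"
    by (simp add: nonzero_eq_divide_eq mult_ac)
qed

text \<open>For every l the integral runs over the same contour and differs from that for
  \<open>lam\<close> by a factor exponential in t, by \<open>psi_shift_lam\<close>; so the
  derivative is taken in l - lam at 0.\<close>

lemma pairing_has_derivative:
  assumes y: "admissible n c k y" and g: "tempered (centers y) (g_fun n k y j)"
  shows "((\<lambda>l. pairing n c k C P j l y) has_field_derivative - (2 * pi * \<i> / c) * J y (\<lambda>t. t * g_fun n k y j t)) (at lam)"
proof -
  let ?F = "\<lambda>t. psiP y y (\<lambda>p. - y p) t * g_fun n k y j t" and ?q = "- (2 * pi * \<i> / c)"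
  let ?I = "\<lambda>\<eta>. integral UNIV (line_integrand (C y) (\<lambda>t. ?F t * exp (?q * \<eta> * t)))"
  obtain \<delta> where \<delta>: "\<delta> > 0" "decays_rate w \<delta> ?F" using J_sets(3)[OF g] by blast
  have "(?I has_field_derivative integral UNIV (line_integrand (C y) (\<lambda>t. ?F t * (?q * t)))) (at 0)"
    by (rule line_integral_exp_derivative[OF contour(1)[OF y] J_sets(2)[OF g] range_sets[OF y] J_sets(1)[OF g] \<delta>(2,1) refl])
  moreover have "integral UNIV (line_integrand (C y) (\<lambda>t. ?F t * (?q * t))) = ?q * J y (\<lambda>t. t * g_fun n k y j t)"
    unfolding J_def line_integral_cmult[symmetric] by (rule line_integral_cong_range) (simp only: mult_ac)
  ultimately have "(?I has_field_derivative ?q * J y (\<lambda>t. t * g_fun n k y j t)) (at (lam + - lam))" by simp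
  hence "((\<lambda>l. ?I (l + - lam)) has_field_derivative ?q * J y (\<lambda>t. t * g_fun n k y j t)) (at lam)"
    unfolding DERIV_shift .
  moreover have "pairing n c k C P j l y = ?I (l + - lam)" for l
    unfolding pairing_psi(1)[OF y]
  proof (rule line_integral_cong_range)
    fix t
    have "psi n c k (lam + (l + - lam)) (exponents P) (coeff (P y)) y (\<lambda>p. - y p) t
        = psiP y y (\<lambda>p. - y p) t * exp (?q * (l + - lam) * t)" by (rule psi_shift_lam)
    thus "psi n c k l (exponents P) (coeff (P y)) y (\<lambda>p. - y p) t * g_fun n k y j t = ?F t * exp (?q * (l + - lam) * t)"
      by (simp add: mult_ac)
  qed
  ultimately show ?thesis by (simp only:)
qed

lemma f_tilde_slots:
  assumes len: "\<forall>xs. vt xs \<noteq> 0 \<longrightarrow> length xs = n - 1" and \<tau>: "\<And>xs. vt xs = \<tau> (mset xs)"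
  shows "f_tilde n c k C P vt L l y = slots n \<tau> (\<lambda>i. exp (k / c * L l) * pairing n c k C P i l y)
     (\<lambda>i. exp (k / c * L l) * pairing n c k C P (2 * n + 1 - i) l y)"
proof
  fix ws
  have "f_tilde n c k C P vt L l y ws = (\<Sum>j=1..2*n. (exp (k / c * L l) * pairing n c k C P j l y) * u_vec n vt j ws)"
    unfolding f_tilde_def f_sol_def by (simp only: sum_distrib_left mult.assoc)
  also have "\<dots> = slots n \<tau> (\<lambda>i. exp (k / c * L l) * pairing n c k C P i l y)
     (\<lambda>i. exp (k / c * L l) * pairing n c k C P (2 * n + 1 - i) l y) ws"
    by (rule sum_u_vec[where \<tau> = \<tau>, OF n _ \<tau>]) (use len in blast)
  finally show "f_tilde n c k C P vt L l y ws = slots n \<tau> (\<lambda>i. exp (k / c * L l) * pairing n c k C P i l y)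
     (\<lambda>i. exp (k / c * L l) * pairing n c k C P (2 * n + 1 - i) l y) ws" .
qed

lemma f_tilde_state:
  assumes y: "admissible n c k y" and m: "m \<in> {1..n}"
    and len: "\<forall>xs. vt xs \<noteq> 0 \<longrightarrow> length xs = n - 1" and \<tau>: "\<And>xs. vt xs = \<tau> (mset xs)"
  shows "f_tilde n c k C P vt L lam y = state \<tau> (exp (k / c * L lam)) m y (y m) m"
proof -
  have y_id: "y(m := y m) = y" by simp
  show ?thesis
    unfolding f_tilde_slots[where \<tau> = \<tau> and vt = vt, OF len \<tau>] state_def y_id
    by (rule slots_cong) (simp_all only: pairing_eq_J[OF y m])
qed

lemma f_tilde_has_derivative:
  assumes y: "admissible n c k y" and L: "(L has_field_derivative L') (at lam)"
    and len: "\<forall>xs. vt xs \<noteq> 0 \<longrightarrow> length xs = n - 1" and \<tau>: "\<And>xs. vt xs = \<tau> (mset xs)"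
  defines "D \<equiv> \<lambda>j. exp (k / c * L lam) * (k / c * L' * pairing n c k C P j lam y
     + - (2 * pi * \<i> / c) * J y (\<lambda>t. t * g_fun n k y j t))"
  shows "((\<lambda>l. f_tilde n c k C P vt L l y ws) has_field_derivative slots n \<tau> D (\<lambda>i. D (2 * n + 1 - i)) ws) (at lam)"
proof -
  have temp: "tempered (centers y) (g_fun n k y j)" if "j \<in> {1..2*n}" for j
  proof (cases "j \<le> n")
    case True
    hence j: "j \<in> {1..n}" using that by simp
    have "g_fun n k y j = ga k 1 1 y j" using g_fun_eq(1)[OF j, of 1] n by auto
    thus ?thesis using tempered_natural(1)[OF j] by simp
  next
    case False
    hence j: "2 * n + 1 - j \<in> {1..n}" "2 * n + 1 - (2 * n + 1 - j) = j" using that by auto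
    have "g_fun n k y j = gb n k 1 1 y (2 * n + 1 - j)" using g_fun_eq(2)[OF j(1), of 1] n unfolding j(2) by auto
    thus ?thesis using tempered_natural(2)[OF j(1)] by simp
  qed
  have E: "((\<lambda>l. exp (k / c * L l)) has_field_derivative exp (k / c * L lam) * (k / c * L')) (at lam)"
    by (intro DERIV_chain2[OF DERIV_exp] DERIV_cmult L)
  have "((\<lambda>l. exp (k / c * L l) * pairing n c k C P j l y) has_field_derivative D j) (at lam)" if "j \<in> {1..2*n}" for j
    by (rule DERIV_cong[OF DERIV_mult[OF E pairing_has_derivative[OF y temp[OF that]]]])
      (simp add: D_def algebra_simps)
  hence "((\<lambda>l. \<Sum>j=1..2*n. (exp (k / c * L l) * pairing n c k C P j l y) * u_vec n vt j ws)
      has_field_derivative (\<Sum>j=1..2*n. D j * u_vec n vt j ws)) (at lam)"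
    by (intro DERIV_sum DERIV_cmult_right)
  moreover have "(\<Sum>j=1..2*n. D j * u_vec n vt j ws) = slots n \<tau> D (\<lambda>i. D (2 * n + 1 - i)) ws"
    by (rule sum_u_vec[where \<tau> = \<tau>, OF n _ \<tau>]) (use len in blast)
  moreover have "f_tilde n c k C P vt L l y ws = (\<Sum>j=1..2*n. (exp (k / c * L l) * pairing n c k C P j l y) * u_vec n vt j ws)" for l
    unfolding f_tilde_def f_sol_def by (simp only: sum_distrib_left mult.assoc)
  ultimately show ?thesis by (simp only:)
qed

text \<open>The prefactor contributes k x / (x - 1) = k + r times each coefficient. Here r cancels
  the term subtracted from the full sum in \<open>D1_slots\<close>, and k supplies the summand i
  missing from the partial sums in \<open>moments\<close> and \<open>D1_slots\<close>. This is what
  fixes the exponent k / c.\<close>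

lemma D1_f_tilde:
  assumes \<tau>': "symmetric_part N \<tau>" and y: "admissible n c k y"
    and L: "(L has_field_derivative L') (at lam)" "(xpt lam 1 - 1) * L' = 2 * pi * \<i> * xpt lam 1"
    and x: "xpt lam 1 \<noteq> 1" "xpt lam 1 \<noteq> - 1"
    and len: "\<forall>xs. vt xs \<noteq> 0 \<longrightarrow> length xs = n - 1" and \<tau>: "\<And>xs. vt xs = \<tau> (mset xs)"
  shows "D1 n N c k (k / 2) (k / 2) (f_tilde n c k C P vt L) lam y = (\<lambda>_. 0)"
proof -
  interpret symmetric_part n N \<tau> by (rule \<tau>')
  define E x A B where "E = exp (k / c * L lam)" and "x = xpt lam 1"
    and "A = (\<lambda>j. J y (ga k 1 1 y j))" and "B = (\<lambda>j. J y (gb n k 1 1 y j))"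
  define S where "S = (\<Sum>j=1..n. A j) + (\<Sum>j=1..n. B j)"
  define r where "r = k / (x - 1)"
  define D where "D j = E * (k / c * L' * pairing n c k C P j lam y + - (2 * pi * \<i> / c) * J y (\<lambda>t. t * g_fun n k y j t))" for j
  have n1: "1 \<in> {1..n}" using n by simp
  have x1: "x - 1 \<noteq> 0" using x(1) by (simp add: x_def)
  have kx: "k * (x / (x - 1)) = k + r" using x1 by (simp add: r_def field_simps)
  have "exp (2 * pi * \<i> * lam) \<noteq> 1" "exp (2 * pi * \<i> * lam) = x" using x(1) by (simp_all add: x_def xpt_def)
  hence J1: "J y (\<lambda>_. 1) = (k + r) * S" if "i \<in> {1..n}" for i
    using moments(3)[OF y that] unfolding S_def A_def B_def kx[symmetric] by simp
  have L': "L' = 2 * pi * \<i> * (x / (x - 1))" using L(2) x1 unfolding x_def[symmetric] by (simp add: nonzero_eq_divide_eq mult_ac)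
  have cancel: "c * (1 / p) * (k / c * (p * q)) = k * q" if "p \<noteq> 0" for p q :: complex using that c0 by simp
  have ci: "c * (1 / (2 * pi * \<i>)) * (k / c * L') = k + r" "c * (1 / (2 * pi * \<i>)) * - (2 * pi * \<i> / c) = -1"
    unfolding L' kx[symmetric] by (rule cancel, simp) (use c0 in simp)
  have cD: "c * (1 / (2 * pi * \<i>)) * D j = E * ((k + r) * pairing n c k C P j lam y - J y (\<lambda>t. t * g_fun n k y j t))" for j
  proof -
    have "c * (1 / (2 * pi * \<i>)) * D j = E * ((c * (1 / (2 * pi * \<i>)) * (k / c * L')) * pairing n c k C P j lam y
        + (c * (1 / (2 * pi * \<i>)) * - (2 * pi * \<i> / c)) * J y (\<lambda>t. t * g_fun n k y j t))"
      unfolding D_def by (simp only: distrib_left mult_ac)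
    thus ?thesis unfolding ci by simp
  qed
  have F: "f_tilde n c k C P vt L lam y = slots n \<tau> (\<lambda>i. E * A i) (\<lambda>i. E * B i)"
    unfolding f_tilde_slots[where \<tau> = \<tau> and vt = vt, OF len \<tau>] E_def A_def B_def
    by (rule slots_cong) (simp_all only: pairing_eq_J[OF y n1])
  have dF: "deriv (\<lambda>l. f_tilde n c k C P vt L l y ws) lam = slots n \<tau> D (\<lambda>i. D (2 * n + 1 - i)) ws" for ws
    unfolding D_def E_def by (rule DERIV_imp_deriv, rule f_tilde_has_derivative[where \<tau> = \<tau> and vt = vt, OF y L(1) len \<tau>])
  have zero: "slots n \<tau> (\<lambda>_. 0) (\<lambda>_. 0) = (\<lambda>_. 0)" by (simp add: slots_def coef_def fun_eq_iff)
  show ?thesis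
    unfolding D1_slots[where F = "f_tilde n c k C P vt L", OF F dF x_def x[folded x_def]] zero[symmetric]
  proof (rule slots_cong)
    fix i assume i: "i \<in> {1..n}"
    have split: "(\<Sum>j=1..n. f j) = (\<Sum>j=1..<i. f j) + f i + (\<Sum>j=i+1..n. f j)" for f :: "nat \<Rightarrow> complex"
    proof -
      have "{1..n} = insert i ({1..<i} \<union> {i+1..n})" using i by auto
      hence "(\<Sum>j=1..n. f j) = f i + sum f ({1..<i} \<union> {i+1..n})" by simp
      also have "sum f ({1..<i} \<union> {i+1..n}) = (\<Sum>j=1..<i. f j) + (\<Sum>j=i+1..n. f j)" by (rule sum.union_disjoint) auto
      finally show ?thesis by simp
    qed
    have g: "g_fun n k y i = ga k 1 1 y i" "g_fun n k y (2 * n + 1 - i) = gb n k 1 1 y i"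
      using g_fun_eq[OF i n1] by auto
    have ES: "(\<Sum>j=1..n. E * A j + E * B j) = E * S" by (simp only: S_def sum.distrib sum_distrib_left distrib_left)
    have a: "c * (1 / (2 * pi * \<i>)) * D i = E * ((k + r) * A i - (y i * A i + (k + r) * S - k * (\<Sum>j=1..<i. A j)))"
      unfolding cD g pairing_eq_J(1)[OF y n1 i] using moments(1)[OF y i] J1[OF i] by (simp add: A_def)
    have b: "c * (1 / (2 * pi * \<i>)) * D (2 * n + 1 - i) =
        E * ((k + r) * B i - (- y i * B i + (k + r) * S - k * (\<Sum>j=1..n. A j) - k * (\<Sum>j=i+1..n. B j)))"
      unfolding cD g pairing_eq_J(2)[OF y n1 i] using moments(2)[OF y i] J1[OF i] by (simp add: A_def B_def)
    show "c * (1 / (2 * pi * \<i>)) * D i + y i * (E * A i) + k * ((\<Sum>j=i+1..n. E * A j) + (\<Sum>j=1..n. E * B j))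
        + k / (x - 1) * ((\<Sum>j=1..n. E * A j + E * B j) - E * A i) = 0"
      unfolding a ES r_def[symmetric] sum_distrib_left[symmetric] S_def split[of A] by (simp add: algebra_simps)
    show "c * (1 / (2 * pi * \<i>)) * D (2 * n + 1 - i) - y i * (E * B i) + k * (\<Sum>j=1..<i. E * B j)
        + k / (x - 1) * ((\<Sum>j=1..n. E * A j + E * B j) - E * B i) = 0"
      unfolding b ES r_def[symmetric] sum_distrib_left[symmetric] S_def split[of B] by (simp add: algebra_simps)
  qed
qed

end

text \<open>Differentiating exp (L l) = exp (2 pi i l) - 1 determines the derivative, whichever
  branch is taken; and exp is never 0, so x_1 \<noteq> 1.\<close>

lemma log_branch_derivative:
  assumes "log_branch U L" "lam \<in> U"
  obtains L' where "(L has_field_derivative L') (at lam)"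
    "(xpt lam 1 - 1) * L' = 2 * pi * \<i> * xpt lam 1" "xpt lam 1 \<noteq> 1"
proof -
  have U: "open U" "L holomorphic_on U" and e: "\<And>l. l \<in> U \<Longrightarrow> exp (L l) = exp (2 * pi * \<i> * l) - 1"
    using assms(1) by (auto simp: log_branch_def)
  let ?e = "\<lambda>l. exp (2 * pi * \<i> * l) - 1"
  have L: "(L has_field_derivative deriv L lam) (at lam)" by (rule holomorphic_derivI[OF U(2,1) assms(2)])
  have 1: "((\<lambda>l. exp (L l)) has_field_derivative exp (L lam) * deriv L lam) (at lam)"
    by (rule DERIV_chain2[OF DERIV_exp L])
  have "(?e has_field_derivative 2 * pi * \<i> * exp (2 * pi * \<i> * lam)) (at lam)"
    by (auto intro!: derivative_eq_intros)
  moreover have "(?e has_field_derivative exp (L lam) * deriv L lam) (at lam)"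
    by (rule has_field_derivative_transform_within_open[OF 1 U(1) assms(2) e])
  ultimately have "exp (L lam) * deriv L lam = 2 * pi * \<i> * exp (2 * pi * \<i> * lam)" by (rule DERIV_unique[symmetric])
  moreover have "exp (2 * pi * \<i> * lam) \<noteq> 1"
  proof
    assume "exp (2 * pi * \<i> * lam) = 1"
    thus False using e[OF assms(2)] exp_not_eq_zero[of "L lam"] by simp
  qed
  ultimately show thesis using that[OF L] e[OF assms(2)] by (simp add: xpt_def)
qed

theorem theorem5p3:
  fixes n N :: nat and c k lam w :: complex
    and vt :: tensor
    and P :: "(nat \<Rightarrow> complex) \<Rightarrow> complex poly"
    and C :: "(nat \<Rightarrow> complex) \<Rightarrow> real \<Rightarrow> complex"
    and U :: "complex set" and L :: "complex \<Rightarrow> complex"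
  assumes "1 \<le> n" and "1 \<le> N"
    and "Im c > 0" and "Im k > 0"
    and "vt \<in> tensor_power (labels {2..N}) (n - 1)" and "vt \<noteq> (\<lambda>_. 0)"
    and "\<And>i. 1 \<le> i \<Longrightarrow> i + 2 \<le> n \<Longrightarrow> Pi_op i (i + 1) vt = vt"
    and "2 \<le> n \<Longrightarrow> site N (T_mat (\<lambda>_. 1)) (n - 1) vt = vt"
    and "P \<in> numerators n c"
    and "degree_condition n lam P"
    and "decay_direction n c lam P w"
    and "\<And>y. admissible n c k y \<Longrightarrow> separating_contour n c k w y (C y)"
    and "log_branch U L" and "lam \<in> U"
  shows
    "\<forall>y. admissible n c k y \<longrightarrow>
       (\<forall>j\<in>{1..2*n}. line_integrand (C y) (pairing_integrand n c k P j lam y) integrable_on UNIV) \<and>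
       (\<forall>m\<in>{1..n}. admissible n c k (shift c m y) \<longrightarrow>
          Delta c m (f_tilde n c k C P vt L) lam y =
          Q_op n N c k (k / 2) (k / 2) m (xpt lam) y (f_tilde n c k C P vt L lam y)) \<and>
       (xpt lam 1 \<noteq> - 1 \<longrightarrow>
          (\<forall>ws. (\<lambda>l. f_tilde n c k C P vt L l y ws) field_differentiable (at lam)) \<and>
          D1 n N c k (k / 2) (k / 2) (f_tilde n c k C P vt L) lam y = (\<lambda>_. 0))"
proof -
  interpret solution_data n c k lam w P C
    by unfold_locales (use assms in auto)
  obtain \<tau> where \<tau>': "symmetric_part N \<tau>" and \<tau>: "\<And>xs. vt xs = \<tau> (mset xs)"
    using symmetric_tensor[OF assms(1,2,5,7,8)] by blast
  have len: "\<forall>xs. vt xs \<noteq> 0 \<longrightarrow> length xs = n - 1" using assms(5) by (simp add: tensor_power_def)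
  obtain L' where L: "(L has_field_derivative L') (at lam)"
    "(xpt lam 1 - 1) * L' = 2 * pi * \<i> * xpt lam 1" "xpt lam 1 \<noteq> 1"
    using log_branch_derivative[OF assms(13,14)] .
  show ?thesis
  proof (intro allI impI conjI ballI)
    fix y assume y: "admissible n c k y"
    show "line_integrand (C y) (pairing_integrand n c k P j lam y) integrable_on UNIV" if j: "j \<in> {1..2*n}" for j
    proof (cases "j \<le> n")
      case True
      hence j': "j \<in> {1..n}" using j by simp
      show ?thesis by (rule pairing_eq_J(3)[OF y j' j'])
    next
      case False
      hence j': "2 * n + 1 - j \<in> {1..n}" "2 * n + 1 - (2 * n + 1 - j) = j" using j by auto
      show ?thesis using pairing_eq_J(4)[OF y j'(1) j'(1)] unfolding j'(2) .
    qed
    show "Delta c m (f_tilde n c k C P vt L) lam y =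
        Q_op n N c k (k / 2) (k / 2) m (xpt lam) y (f_tilde n c k C P vt L lam y)"
      if m: "m \<in> {1..n}" and y': "admissible n c k (shift c m y)" for m
    proof -
      interpret shift_data n c k lam w P C y m
        by unfold_locales (use m y y' in \<open>simp_all add: shift_def\<close>)
      show ?thesis
        unfolding Delta_def shift_def f_tilde_state[where \<tau> = \<tau> and vt = vt, OF y m len \<tau>]
          f_tilde_state[where \<tau> = \<tau> and vt = vt, OF y'[unfolded shift_def] m len \<tau>] by (rule Q_op_state[OF \<tau>', symmetric])
    qed
    show "(\<lambda>l. f_tilde n c k C P vt L l y ws) field_differentiable (at lam)" for ws
      using f_tilde_has_derivative[where \<tau> = \<tau> and vt = vt, OF y L(1) len \<tau>] unfolding field_differentiable_def by blast
    show "D1 n N c k (k / 2) (k / 2) (f_tilde n c k C P vt L) lam y = (\<lambda>_. 0)" if "xpt lam 1 \<noteq> - 1"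
      by (rule D1_f_tilde[where \<tau> = \<tau> and vt = vt, OF \<tau>' y L that len \<tau>])
  qed
qed

end
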